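(* Let $k$ be a number field and let $C: F(X,Y,Z)=0$, with $F\in k[X,Y,Z]$ homogeneous of degree $4$, be a smooth plane quartic curve over $k$. Then any quadratic geometric (resp. arithmetic) progression sequence on $C$ is of finite length; that is, no quadratic geometric progression sequence on $C$ is infinite, and no quadratic arithmetic progression sequence on $C$ is infinite.
   Context: $k$ is a number field with fixed algebraic closure $\overline{k}$. A smooth plane quartic curve $C: F(X,Y,Z)=0$ over $k$ is the zero locus in $\mathbb{P}^2$ of a homogeneous polynomial $F\in k[X,Y,Z]$ of degree $4$ with no singularities over $\overline{k}$. The set of quadratic points is $\Gamma_2(C,k)=\bigcup_{[\ell:k]=2}C(\ell)$, the union being over all quadratic extensions $\ell/k$ inside $\overline{k}$ (in particular it contains $C(k)$). A quadratic geometric progression sequence on $C$ is a sequence of points $P_i=(x_i:1:z_i)\in \Gamma_2(C,k)$, $i=1,2,\ldots$ (finite or infinite in length), with $x_i\in k$, such that there exist $t,t'\in k^*$ with $x_i=t't^i$ for all $i$. A quadratic arithmetic progression sequence on $C$ is a sequence of points $P_i=(x_i:1:z_i)\in\Gamma_2(C,k)$, $i=1,2,\ldots$, with $x_i\in k$, such that there exist $t,t'\in k^*$ with $x_i=t'+it$ for all $i$. Progressions are regarded as sets of points: such a sequence is called infinite if it is indexed by all positive integers and contains infinitely many distinct points $P_i$, and of finite length otherwise. *)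

theory Defs
  imports
    "HOL-Library.Poly_Mapping"
    "HOL-Library.Product_Plus"
    "HOL-Library.Extended_Nat"
    "HOL-Algebra.Algebraic_Closure_Type"
begin

text \<open>
  A number field \<open>k\<close> is a type of characteristic \<open>0\<close> fields that is finite-dimensional over the
  rationals; the fixed algebraic closure of \<open>k\<close> is the type \<open>'k alg_closure\<close>, with the embedding
  \<^const>\<open>to_ac\<close>.
\<close>

definition number_field :: "'k::field_char_0 itself \<Rightarrow> bool" where
  "number_field _ \<longleftrightarrow>
     (\<exists>B. finite_dimensional_vector_space (\<lambda>q (x::'k). of_rat q * x) B)"

text \<open>The algebraic closure as a vector space over \<open>k\<close>.\<close>

definition ac_scale :: "'k::field \<Rightarrow> 'k alg_closure \<Rightarrow> 'k alg_closure" where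
  "ac_scale c x = to_ac c * x"

lemma vector_space_ac_scale: "vector_space ac_scale"
  by unfold_locales (simp_all add: ac_scale_def algebra_simps)

definition quadratic_extension :: "'k::field alg_closure set \<Rightarrow> bool" where
  "quadratic_extension L \<longleftrightarrow>
     subfield L ring_of_type_algebra \<and> range to_ac \<subseteq> L \<and> vector_space.dim ac_scale L = 2"

text \<open>
  The polynomial ring \<open>k[X,Y,Z]\<close> is the monoid algebra of exponent triples: the coefficient of
  \<open>X\<^sup>a Y\<^sup>b Z\<^sup>c\<close> in \<open>F\<close> is \<open>Poly_Mapping.lookup F (a, b, c)\<close>.
\<close>

type_synonym 'k poly3 = "(nat \<times> nat \<times> nat) \<Rightarrow>\<^sub>0 'k"

definition homogeneous :: "nat \<Rightarrow> 'k::zero poly3 \<Rightarrow> bool" where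
  "homogeneous d F \<longleftrightarrow> (\<forall>(a, b, c) \<in> Poly_Mapping.keys F. a + b + c = d)"

definition eval_ac ::
  "'k::field poly3 \<Rightarrow> 'k alg_closure \<times> 'k alg_closure \<times> 'k alg_closure \<Rightarrow> 'k alg_closure" where
  "eval_ac F = (\<lambda>(x, y, z).
     \<Sum>(a, b, c) \<in> Poly_Mapping.keys F. to_ac (Poly_Mapping.lookup F (a, b, c)) * x ^ a * y ^ b * z ^ c)"

text \<open>
  Formal partial derivatives. A truncated exponent \<open>0 - 1\<close> only occurs with coefficient \<open>0\<close>.
\<close>

definition pderivX :: "'k::field poly3 \<Rightarrow> 'k poly3" where
  "pderivX F = (\<Sum>(a, b, c) \<in> Poly_Mapping.keys F.
     Poly_Mapping.single (a - 1, b, c) (of_nat a * Poly_Mapping.lookup F (a, b, c)))"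

definition pderivY :: "'k::field poly3 \<Rightarrow> 'k poly3" where
  "pderivY F = (\<Sum>(a, b, c) \<in> Poly_Mapping.keys F.
     Poly_Mapping.single (a, b - 1, c) (of_nat b * Poly_Mapping.lookup F (a, b, c)))"

definition pderivZ :: "'k::field poly3 \<Rightarrow> 'k poly3" where
  "pderivZ F = (\<Sum>(a, b, c) \<in> Poly_Mapping.keys F.
     Poly_Mapping.single (a, b, c - 1) (of_nat c * Poly_Mapping.lookup F (a, b, c)))"

text \<open>
  Points of the projective plane over a field are classes of nonzero triples up to scaling.
\<close>

type_synonym 'a proj_point = "('a \<times> 'a \<times> 'a) set"

definition proportional :: "(('a::field \<times> 'a \<times> 'a) \<times> ('a \<times> 'a \<times> 'a)) set" where
  "proportional = {((x, y, z), (x', y', z')).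
     (x, y, z) \<noteq> (0, 0, 0) \<and> (\<exists>c. c \<noteq> 0 \<and> (x', y', z') = (c * x, c * y, c * z))}"

definition proj_plane :: "'a::field proj_point set" where
  "proj_plane = (- {(0, 0, 0)}) // proportional"

definition hpoint :: "'a::field \<Rightarrow> 'a \<Rightarrow> 'a \<Rightarrow> 'a proj_point" ("'(_ : _ : _')\<^sub>P") where
  "(x : y : z)\<^sub>P = proportional `` {(x, y, z)}"

lemma equiv_proportional: "equiv (- {(0, 0, 0)}) (proportional :: (('a::field \<times> 'a \<times> 'a) \<times> _) set)"
proof (rule equivI)
  show "proportional \<subseteq> (- {(0, 0, 0)}) \<times> (- {(0::'a, 0::'a, 0::'a)})"
    by (auto simp: proportional_def)
  show "refl_on (- {(0, 0, 0)}) (proportional :: (('a \<times> 'a \<times> 'a) \<times> _) set)"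
    by (auto simp: refl_on_def proportional_def intro: exI[of _ 1])
  show "sym (proportional :: (('a \<times> 'a \<times> 'a) \<times> _) set)"
  proof (rule symI)
    fix u v :: "'a \<times> 'a \<times> 'a"
    assume "(u, v) \<in> proportional"
    then obtain x y z c where "u = (x, y, z)" "v = (c * x, c * y, c * z)" "c \<noteq> 0"
      "(x, y, z) \<noteq> (0, 0, 0)"
      by (auto simp: proportional_def)
    then show "(v, u) \<in> proportional"
      by (auto simp: proportional_def intro!: exI[of _ "inverse c"])
  qed
  show "trans (proportional :: (('a \<times> 'a \<times> 'a) \<times> _) set)"
  proof (rule transI)
    fix u v w :: "'a \<times> 'a \<times> 'a"
    assume "(u, v) \<in> proportional" "(v, w) \<in> proportional"
    then obtain x y z c d where "u = (x, y, z)" "c \<noteq> 0" "d \<noteq> 0"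
      "w = (d * (c * x), d * (c * y), d * (c * z))" "(x, y, z) \<noteq> (0, 0, 0)"
      by (auto simp: proportional_def)
    then show "(u, w) \<in> proportional"
      by (auto simp: proportional_def mult.assoc intro!: exI[of _ "d * c"])
  qed
qed

definition curve :: "'k::field poly3 \<Rightarrow> 'k alg_closure proj_point set" where
  "curve F = {p \<in> proj_plane. \<exists>v \<in> p. eval_ac F v = 0}"

text \<open>
  For homogeneous \<open>F\<close> the choice of the representative \<open>v\<close> in \<^const>\<open>curve\<close> is immaterial.
\<close>

lemma eval_ac_scale:
  assumes "homogeneous d F"
  shows "eval_ac F (t * x, t * y, t * z) = t ^ d * eval_ac F (x, y, z)"
proof -
  have "to_ac (Poly_Mapping.lookup F (a, b, c)) * (t * x) ^ a * (t * y) ^ b * (t * z) ^ c =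
        t ^ d * (to_ac (Poly_Mapping.lookup F (a, b, c)) * x ^ a * y ^ b * z ^ c)"
    if "(a, b, c) \<in> Poly_Mapping.keys F" for a b c
  proof -
    have "d = a + b + c"
      using assms that by (auto simp: homogeneous_def)
    then show ?thesis
      by (simp add: power_mult_distrib power_add ac_simps)
  qed
  then show ?thesis
    by (auto simp: eval_ac_def sum_distrib_left intro!: sum.cong)
qed

definition smooth_curve :: "'k::field poly3 \<Rightarrow> bool" where
  "smooth_curve F \<longleftrightarrow> \<not> (\<exists>p \<in> curve F. \<exists>v \<in> p.
     eval_ac (pderivX F) v = 0 \<and> eval_ac (pderivY F) v = 0 \<and> eval_ac (pderivZ F) v = 0)"

text \<open>\<open>C(L)\<close>: points of the curve that have homogeneous coordinates in \<open>L\<close>.\<close>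

definition rational_points ::
  "'k::field poly3 \<Rightarrow> 'k alg_closure set \<Rightarrow> 'k alg_closure proj_point set" where
  "rational_points F L = {p \<in> curve F. \<exists>v \<in> p. v \<in> L \<times> L \<times> L}"

definition quadratic_points :: "'k::field poly3 \<Rightarrow> 'k alg_closure proj_point set" where
  "quadratic_points F = (\<Union>L \<in> {L. quadratic_extension L}. rational_points F L)"

text \<open>
  A sequence of length \<open>N\<close> consists of the points \<open>P i\<close> with \<open>1 \<le> i \<le> N\<close>, where \<open>N = \<infinity>\<close> is
  allowed; other values of \<open>P\<close> are irrelevant.
\<close>

definition seq_indices :: "enat \<Rightarrow> nat set" where
  "seq_indices N = {i. 1 \<le> i \<and> enat i \<le> N}"

definition quadratic_geometric_progression ::
  "'k::field poly3 \<Rightarrow> enat \<Rightarrow> (nat \<Rightarrow> 'k alg_closure proj_point) \<Rightarrow> bool" where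
  "quadratic_geometric_progression F N P \<longleftrightarrow>
     (\<exists>(x :: nat \<Rightarrow> 'k) (z :: nat \<Rightarrow> 'k alg_closure).
        (\<forall>i \<in> seq_indices N. P i = (to_ac (x i) : 1 : z i)\<^sub>P \<and> P i \<in> quadratic_points F) \<and>
        (\<exists>t t'. t \<noteq> 0 \<and> t' \<noteq> 0 \<and> (\<forall>i \<in> seq_indices N. x i = t' * t ^ i)))"

definition quadratic_arithmetic_progression ::
  "'k::field poly3 \<Rightarrow> enat \<Rightarrow> (nat \<Rightarrow> 'k alg_closure proj_point) \<Rightarrow> bool" where
  "quadratic_arithmetic_progression F N P \<longleftrightarrow>
     (\<exists>(x :: nat \<Rightarrow> 'k) (z :: nat \<Rightarrow> 'k alg_closure).
        (\<forall>i \<in> seq_indices N. P i = (to_ac (x i) : 1 : z i)\<^sub>P \<and> P i \<in> quadratic_points F) \<and>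
        (\<exists>t t'. t \<noteq> 0 \<and> t' \<noteq> 0 \<and> (\<forall>i \<in> seq_indices N. x i = t' + of_nat i * t)))"

text \<open>
  Progressions are regarded as sets of points, so an infinitely indexed sequence taking only
  finitely many values (e.g. when \<open>t\<close> is a root of unity) does not count as infinite.
\<close>

definition infinite_progression :: "enat \<Rightarrow> (nat \<Rightarrow> 'a proj_point) \<Rightarrow> bool" where
  "infinite_progression N P \<longleftrightarrow> N = \<infinity> \<and> infinite (P ` seq_indices N)"

abbreviation finite_length :: "enat \<Rightarrow> (nat \<Rightarrow> 'a proj_point) \<Rightarrow> bool" where
  "finite_length N P \<equiv> \<not> infinite_progression N P"

end

theory Submission
  imports Defs "HOL-Computational_Algebra.Computational_Algebra" "HOL-Computational_Algebra.Field_as_Ring"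
begin

text \<open>
  The abscissas of either kind of progression contain a sequence \<open>c + t' t\<^sup>i\<close>; for an arithmetic
  progression take the indices \<open>2\<^sup>n\<close>. If \<open>t\<close> is a root of unity, there are finitely many abscissas,
  and each carries finitely many points. Otherwise some absolute value \<open>f\<close> of the algebraic closure has
  \<open>f t < 1\<close>, by Kronecker's theorem. Near \<open>X = c\<close> the branches of the curve are Puiseux series,
  so the trace and the norm over \<open>k\<close> of the ordinates are approximated at \<open>f\<close> by the sum and the product
  of two branches. A fixed \<open>k\<close>-linear combination of shifted sequences annihilates many initial terms of
  these series; its values are elements of \<open>k\<close> of controlled height that are smaller at \<open>f\<close> than
  Liouville's inequality allows for nonzero numbers. Hence they vanish, which forces the sum and the
  product of the two branches to be polynomials. So after the substitution \<open>X = c + Y\<^sup>e\<close> the equation of the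
  curve has a factor of degree one or two in \<open>Z\<close>.

  A linear factor is a nonconstant rational parametrization of a smooth quartic, which is excluded by
  comparing the degrees of position, velocity and gradient. A quadratic factor descends to \<open>e = 2\<close>
  by the action of the roots of unity on \<open>Y\<close>, and the action of \<open>Y \<mapsto> - Y\<close> then exhibits \<open>F\<close>
  as \<open>Q\<^sup>2 - \<kappa> R\<^sup>2\<close>, which is singular at the common zeros of \<open>Q\<close> and \<open>R\<close>.
\<close>

section \<open>Ring homomorphisms\<close>

text \<open>Two exponentials in the index \<open>i\<close> are compared. Heights grow like
  \<open>A ^ i\<close>, so nonzero values in \<open>k\<close> are at least a constant times an
  exponential; a combination killing \<open>M0\<close> terms has size about
  \<open>f t ^ (M0 * i)\<close>. Hence one \<open>M0\<close> serves every truncation order. Branches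
  are evaluated only after truncation, so their convergence at \<open>f\<close> is never an issue.

  The obstacle to using the ordinates themselves is circular: they lie in varying quadratic
  extensions, so the degree of a combination depends on the number of shifts, which depends on
  \<open>M0\<close>, which depends through Liouville's inequality on the degree. Traces and norms
  stay in \<open>k\<close>, where one degree bound holds for all combinations.

  The constant \<open>c\<close> is the limit of the abscissas at \<open>f\<close>, so it is the
  centre of the expansions. For an arithmetic progression it is the offset of the progression, and
  the ratio 2 is small at a place above the prime 2.

  Geometrically, a factor of degree one or two in \<open>Z\<close> would mean that the quartic is
  dominated by the line or by a double cover of the line, whereas smooth plane quartics are neither
  rational nor hyperelliptic. The last steps are elementary forms of these two facts.\<close>

definition is_hom :: "('a::comm_ring_1 \<Rightarrow> 'b::comm_ring_1) \<Rightarrow> bool" where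
  "is_hom h \<longleftrightarrow> h 1 = 1 \<and> (\<forall>x y. h (x + y) = h x + h y) \<and> (\<forall>x y. h (x * y) = h x * h y)"

lemma is_hom_simps:
  assumes "is_hom h"
  shows "h 1 = 1" "h (x + y) = h x + h y" "h (x * y) = h x * h y" "h 0 = 0" "h (- x) = - h x"
    "h (x - y) = h x - h y" "h (of_nat n) = of_nat n" "h (x ^ n) = h x ^ n" "h (of_int m) = of_int m"
proof -
  show 1: "h 1 = 1" and add: "\<And>x y. h (x + y) = h x + h y" and mult: "\<And>x y. h (x * y) = h x * h y"
    using assms by (auto simp: is_hom_def)
  show 0: "h 0 = 0" using add[of 0 0] by (metis add_cancel_left_right add_0)
  show uminus: "\<And>x. h (- x) = - h x" using add 0
    by (metis add.right_inverse minus_unique)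
  show "\<And>x y. h (x - y) = h x - h y" using add[of _ "- y" for y] uminus by simp
  show of_nat: "\<And>n. h (of_nat n) = of_nat n" by (induct_tac n) (auto simp: 0 1 add)
  show "h (x ^ n) = h x ^ n" by (induction n) (auto simp: 1 mult)
  show "h (of_int m) = of_int m" by (cases m rule: int_cases2) (simp_all add: uminus of_nat)
qed

lemma is_hom_field_simps:
  fixes h :: "'a::field \<Rightarrow> 'b::field"
  assumes "is_hom h"
  shows "h x = 0 \<longleftrightarrow> x = 0" "h (inverse x) = inverse (h x)" "h (x / y) = h x / h y"
proof -
  note h = is_hom_simps[OF assms]
  show eq0: "\<And>x. h x = 0 \<longleftrightarrow> x = 0"
  proof
    fix x assume "h x = 0"
    then show "x = 0" using h(3)[of x "inverse x"] h(1)
      by (metis mult_zero_left right_inverse zero_neq_one)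
  qed (simp add: h)
  show inv: "\<And>x. h (inverse x) = inverse (h x)"
  proof -
    fix x show "h (inverse x) = inverse (h x)"
      using h(3)[of x "inverse x"] h(1,4)
      by (metis inverse_unique inverse_zero right_inverse)
  qed
  show "h (x / y) = h x / h y" by (simp add: field_class.field_divide_inverse h inv)
qed

lemma is_hom_sum:
  assumes "is_hom h"
  shows "h (sum f A) = (\<Sum>x\<in>A. h (f x))"
  by (induction A rule: infinite_finite_induct) (simp_all add: is_hom_simps[OF assms])

lemma is_hom_comp: "is_hom g \<Longrightarrow> is_hom h \<Longrightarrow> is_hom (\<lambda>x. g (h x))"
  by (simp add: is_hom_def)

lemma is_hom_map_poly:
  assumes "is_hom h"
  shows "is_hom (map_poly h)"
  unfolding is_hom_def
  by (auto simp: poly_eq_iff coeff_map_poly is_hom_simps[OF assms] coeff_mult is_hom_sum[OF assms])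

lemma poly_map_poly_hom:
  assumes "is_hom h"
  shows "poly (map_poly h p) (h x) = h (poly p x)"
  by (induction p) (simp_all add: map_poly_pCons is_hom_simps[OF assms])

lemma map_poly_linear:
  assumes "is_hom h"
  shows "map_poly h [:a, b:] = [:h a, h b:]"
  by (simp add: map_poly_pCons is_hom_simps[OF assms])

lemma is_hom_prod_list:
  assumes "is_hom h"
  shows "h (prod_list xs) = prod_list (map h xs)"
  by (induction xs) (simp_all add: is_hom_simps[OF assms])

lemma monic_map_poly:
  assumes "is_hom h" "lead_coeff p = 1"
  shows "degree (map_poly h p) = degree p" "lead_coeff (map_poly h p) = 1"
proof -
  show "degree (map_poly h p) = degree p"
    by (intro map_poly_degree_eq) (simp add: is_hom_simps assms)
  then show "lead_coeff (map_poly h p) = 1"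
    by (simp add: coeff_map_poly is_hom_simps assms)
qed

section \<open>Linear relations and extension of homomorphisms\<close>

text \<open>There are more unknowns \<open>c i\<close> than equations, and each induction step
  eliminates one equation with a pivot. The later relations between powers and between shifts of a
  sequence all come from here.\<close>

lemma nontrivial_linear_relation:
  fixes v :: "'i \<Rightarrow> 'j \<Rightarrow> 'a::field"
  assumes "finite J" "finite I" "card J < card I"
  shows "\<exists>c. (\<forall>i. i \<notin> I \<longrightarrow> c i = 0) \<and> (\<exists>i\<in>I. c i \<noteq> 0) \<and> (\<forall>j\<in>J. (\<Sum>i\<in>I. c i * v i j) = 0)"
  using assms
proof (induction J arbitrary: I v rule: finite_induct)
  case empty
  then obtain i where "i \<in> I" by fastforce
  then show ?case
    by (intro exI[of _ "\<lambda>k. if k = i then 1 else 0"]) auto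
next
  case (insert j J)
  show ?case
  proof (cases "\<forall>i\<in>I. v i j = 0")
    case True
    have "card J < card I" using insert by simp
    with insert.IH[OF insert.prems(1) this, of v] obtain c where
      "\<forall>i. i \<notin> I \<longrightarrow> c i = 0" "\<exists>i\<in>I. c i \<noteq> 0" "\<forall>j\<in>J. (\<Sum>i\<in>I. c i * v i j) = 0" by blast
    then show ?thesis using True by (intro exI[of _ c]) simp
  next
    case False
    then obtain k where k: "k \<in> I" "v k j \<noteq> 0" by blast
    \<comment> \<open>Subtracting a multiple of row \<open>k\<close> makes every row vanish at
      \<open>j\<close>; the coefficient belonging to \<open>k\<close> is recovered afterwards in
      \<open>d\<close>.\<close>
    define w where "w = (\<lambda>i l. v i l - v i j / v k j * v k l)"
    have "card J < card (I - {k})"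
      using insert k by simp
    with insert.IH[of "I - {k}" w] insert.prems obtain c where
      c: "\<forall>i. i \<notin> I - {k} \<longrightarrow> c i = 0" "\<exists>i\<in>I - {k}. c i \<noteq> 0"
         "\<forall>l\<in>J. (\<Sum>i\<in>I - {k}. c i * w i l) = 0"
      by auto
    define d where "d = c(k := - (\<Sum>i\<in>I - {k}. c i * v i j) / v k j)"
    have split: "(\<Sum>i\<in>I. d i * v i l) = d k * v k l + (\<Sum>i\<in>I - {k}. c i * v i l)" for l
    proof -
      have "(\<Sum>i\<in>I. d i * v i l) = d k * v k l + (\<Sum>i\<in>I - {k}. d i * v i l)"
        using k insert.prems(1) by (simp add: sum.remove)
      also have "(\<Sum>i\<in>I - {k}. d i * v i l) = (\<Sum>i\<in>I - {k}. c i * v i l)"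
        by (intro sum.cong) (auto simp: d_def)
      finally show ?thesis .
    qed
    have "(\<Sum>i\<in>I. d i * v i l) = 0" if "l \<in> insert j J" for l
    proof (cases "l = j")
      case True
      have "d k * v k j = - (\<Sum>i\<in>I - {k}. c i * v i j)" using k by (simp add: d_def)
      then show ?thesis unfolding True split by simp
    next
      case False
      then have "0 = (\<Sum>i\<in>I - {k}. c i * w i l)" using c(3) that by auto
      also have "\<dots> = (\<Sum>i\<in>I - {k}. c i * v i l) - (\<Sum>i\<in>I - {k}. c i * v i j) / v k j * v k l"
        unfolding w_def sum_divide_distrib sum_distrib_right sum_subtractf[symmetric]
        by (intro sum.cong) (simp_all add: algebra_simps)
      finally have "(\<Sum>i\<in>I - {k}. c i * v i l) = (\<Sum>i\<in>I - {k}. c i * v i j) / v k j * v k l"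
        by simp
      moreover have "d k = - (\<Sum>i\<in>I - {k}. c i * v i j) / v k j" by (simp add: d_def)
      ultimately show ?thesis unfolding split by simp
    qed
    moreover have "\<exists>i\<in>I. d i \<noteq> 0"
      using c(2) by (auto simp: d_def)
    moreover have "\<forall>i. i \<notin> I \<longrightarrow> d i = 0"
      using c(1) k by (auto simp: d_def)
    ultimately show ?thesis by blast
  qed
qed

text \<open>Graphs of injective ring homomorphisms from a subring of \<open>'a\<close> to \<open>'b\<close>.\<close>

definition partial_hom :: "('a::field \<times> 'b::field) set \<Rightarrow> bool" where
  "partial_hom R \<longleftrightarrow> (1, 1) \<in> R \<and>
     (\<forall>a b c d. (a, b) \<in> R \<longrightarrow> (c, d) \<in> R \<longrightarrow> (a - c, b - d) \<in> R \<and> (a * c, b * d) \<in> R) \<and>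
     (\<forall>a b. (a, b) \<in> R \<longrightarrow> (a = 0 \<longleftrightarrow> b = 0))"

lemma partial_homD:
  assumes "partial_hom R"
  shows "(1, 1) \<in> R" "(0, 0) \<in> R"
    "(a, b) \<in> R \<Longrightarrow> (c, d) \<in> R \<Longrightarrow> (a - c, b - d) \<in> R"
    "(a, b) \<in> R \<Longrightarrow> (c, d) \<in> R \<Longrightarrow> (a + c, b + d) \<in> R"
    "(a, b) \<in> R \<Longrightarrow> (c, d) \<in> R \<Longrightarrow> (a * c, b * d) \<in> R"
    "(a, b) \<in> R \<Longrightarrow> a = 0 \<longleftrightarrow> b = 0"
proof -
  note R = assms[unfolded partial_hom_def]
  show "(1, 1) \<in> R" using R by blast
  show 0: "(0, 0) \<in> R" using R by (metis diff_self)
  show D: "\<And>a b c d. (a, b) \<in> R \<Longrightarrow> (c, d) \<in> R \<Longrightarrow> (a - c, b - d) \<in> R" using R by blast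
  show "(a, b) \<in> R \<Longrightarrow> (c, d) \<in> R \<Longrightarrow> (a + c, b + d) \<in> R"
    using D[OF _ D[OF 0, of c d], of a b] by simp
  show "(a, b) \<in> R \<Longrightarrow> (c, d) \<in> R \<Longrightarrow> (a * c, b * d) \<in> R" using R by blast
  show "(a, b) \<in> R \<Longrightarrow> a = 0 \<longleftrightarrow> b = 0" using R by blast
qed

lemma partial_hom_sum:
  assumes "partial_hom R" "\<And>i. i \<in> I \<Longrightarrow> (f i, g i) \<in> R"
  shows "(sum f I, sum g I) \<in> R"
  using assms(2)
proof (induction I rule: infinite_finite_induct)
  case (insert i I)
  then show ?case using partial_homD(4)[OF assms(1), of "f i" "g i" "sum f I" "sum g I"] by simp
qed (use partial_homD(2)[OF assms(1)] in simp_all)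

definition poly_rel :: "('a::field \<times> 'b::field) set \<Rightarrow> 'a poly \<Rightarrow> 'b poly \<Rightarrow> bool" where
  "poly_rel R f g \<longleftrightarrow> (\<forall>i. (coeff f i, coeff g i) \<in> R)"

lemma poly_rel_ops:
  assumes "partial_hom R"
  shows "poly_rel R f g \<Longrightarrow> poly_rel R f' g' \<Longrightarrow> poly_rel R (f - f') (g - g')"
    "poly_rel R f g \<Longrightarrow> poly_rel R f' g' \<Longrightarrow> poly_rel R (f + f') (g + g')"
    "poly_rel R f g \<Longrightarrow> poly_rel R f' g' \<Longrightarrow> poly_rel R (f * f') (g * g')"
    "(a, b) \<in> R \<Longrightarrow> poly_rel R (monom a n) (monom b n)"
    "poly_rel R 1 1" "poly_rel R 0 0"
    "poly_rel R f g \<Longrightarrow> f = 0 \<longleftrightarrow> g = 0"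
    "poly_rel R f g \<Longrightarrow> degree f = degree g"
proof -
  note R = partial_homD[OF assms]
  show "poly_rel R f g \<Longrightarrow> poly_rel R f' g' \<Longrightarrow> poly_rel R (f - f') (g - g')"
    using R(3) by (auto simp: poly_rel_def)
  show "poly_rel R f g \<Longrightarrow> poly_rel R f' g' \<Longrightarrow> poly_rel R (f + f') (g + g')"
    using R(4) by (auto simp: poly_rel_def)
  show "poly_rel R f g \<Longrightarrow> poly_rel R f' g' \<Longrightarrow> poly_rel R (f * f') (g * g')"
    using R(5) by (auto simp: poly_rel_def coeff_mult intro!: partial_hom_sum[OF assms])
  show "(a, b) \<in> R \<Longrightarrow> poly_rel R (monom a n) (monom b n)"
    using R(2) by (auto simp: poly_rel_def)
  show "poly_rel R 1 1" "poly_rel R 0 0"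
    using R(1,2) by (auto simp: poly_rel_def coeff_1)
  show *: "poly_rel R f g \<Longrightarrow> f = 0 \<longleftrightarrow> g = 0"
    using R(6) by (auto simp: poly_rel_def poly_eq_iff)
  assume rel: "poly_rel R f g"
  then have "coeff f i = 0 \<longleftrightarrow> coeff g i = 0" for i
    using R(6) by (auto simp: poly_rel_def)
  then show "degree f = degree g" by (simp add: degree_def)
qed

text \<open>The divisor is monic, so division uses ring operations only. Carrying out the same steps
  on both sides keeps quotients and remainders related.\<close>

lemma poly_rel_division:
  assumes R: "partial_hom R" and pq: "poly_rel R p q" "lead_coeff p = 1"
  shows "poly_rel R f g \<Longrightarrow> \<exists>s s' r r'. poly_rel R s s' \<and> poly_rel R r r' \<and> f = p * s + r \<and>
     g = q * s' + r' \<and> (r = 0 \<or> degree r < degree p)"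
proof (induction "degree f" arbitrary: f g rule: less_induct)
  case (less f g)
  show ?case
  proof (cases "f = 0 \<or> degree f < degree p")
    case True
    then show ?thesis using less.prems poly_rel_ops(6)[OF R]
      by (intro exI[of _ 0] exI[of _ f] exI[of _ g]) auto
  next
    case False
    define n where "n = degree f - degree p"
    define m m' where "m = monom (lead_coeff f) n" and "m' = monom (lead_coeff g) n"
    have deg: "degree g = degree f" using poly_rel_ops(8)[OF R less.prems] by simp
    have mm: "poly_rel R m m'" unfolding m_def m'_def
      using less.prems deg by (intro poly_rel_ops(4)[OF R]) (auto simp: poly_rel_def)
    have f': "poly_rel R (f - p * m) (g - q * m')"
      by (intro poly_rel_ops[OF R] less.prems mm pq(1))
    have "p \<noteq> 0" using pq(2) by auto
    have "f \<noteq> 0" using False by simp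
    then have "m \<noteq> 0" "degree m = n" "lead_coeff m = lead_coeff f"
      by (auto simp: m_def degree_monom_eq)
    have dm: "degree (p * m) = degree f"
      using False \<open>p \<noteq> 0\<close> \<open>m \<noteq> 0\<close> \<open>degree m = n\<close> by (simp add: degree_mult_eq n_def)
    have lm: "lead_coeff (p * m) = lead_coeff f"
      using pq(2) \<open>lead_coeff m = lead_coeff f\<close> by (simp add: lead_coeff_mult)
    have "coeff (f - p * m) (degree f) = 0" using dm lm by simp
    moreover have "degree (f - p * m) \<le> degree f" using dm by (intro degree_diff_le) auto
    ultimately have "f - p * m = 0 \<or> degree (f - p * m) < degree f"
      by (metis le_neq_implies_less leading_coeff_0_iff)
    then show ?thesis
    proof
      assume "f - p * m = 0"
      moreover from this have "g - q * m' = 0" using poly_rel_ops(7)[OF R f'] by simp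
      ultimately show ?thesis using mm poly_rel_ops(6)[OF R]
        by (intro exI[of _ m] exI[of _ m'] exI[of _ 0]) auto
    next
      assume "degree (f - p * m) < degree f"
      from less.hyps[OF this f'] obtain s s' r r' where
        *: "poly_rel R s s'" "poly_rel R r r'" "f - p * m = p * s + r" "g - q * m' = q * s' + r'"
           "r = 0 \<or> degree r < degree p" by blast
      then show ?thesis
        by (intro exI[of _ "m + s"] exI[of _ "m' + s'"] exI[of _ r] exI[of _ r'])
          (auto simp: algebra_simps intro!: poly_rel_ops[OF R] mm)
    qed
  qed
qed

text \<open>The condition \<open>eq\<close> is what makes the assignment of \<open>poly g y\<close>
  to \<open>poly f x\<close> single-valued and injective, so that \<open>x\<close> can be adjoined
  to the domain with image \<open>y\<close>.\<close>

lemma partial_hom_image: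
  assumes R: "partial_hom R" and eq: "\<And>f g. poly_rel R f g \<Longrightarrow> poly f x = 0 \<longleftrightarrow> poly g y = 0"
  shows "partial_hom {(poly f x, poly g y) | f g. poly_rel R f g}" (is "partial_hom ?R")
    and "R \<subseteq> {(poly f x, poly g y) | f g. poly_rel R f g}"
    and "(x, y) \<in> {(poly f x, poly g y) | f g. poly_rel R f g}"
proof -
  show "partial_hom ?R"
    unfolding partial_hom_def
  proof (intro conjI allI impI)
    show "(1, 1) \<in> ?R" using poly_rel_ops(5)[OF R] by (force intro!: exI[of _ 1])
  next
    fix a b c d assume "(a, b) \<in> ?R" "(c, d) \<in> ?R"
    then obtain f g f' g' where *: "poly_rel R f g" "poly_rel R f' g'"
      "a = poly f x" "b = poly g y" "c = poly f' x" "d = poly g' y" by auto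
    show "(a - c, b - d) \<in> ?R"
      using poly_rel_ops(1)[OF R *(1,2)] * by (force intro!: exI[of _ "f - f'"] exI[of _ "g - g'"])
    show "(a * c, b * d) \<in> ?R"
      using poly_rel_ops(3)[OF R *(1,2)] * by (force intro!: exI[of _ "f * f'"] exI[of _ "g * g'"])
  next
    fix a b assume "(a, b) \<in> ?R"
    then show "a = 0 \<longleftrightarrow> b = 0" using eq by auto
  qed
  show "R \<subseteq> ?R"
  proof
    fix ab assume "ab \<in> R"
    then show "ab \<in> ?R"
      using poly_rel_ops(4)[OF R, of "fst ab" "snd ab" 0]
      by (auto intro!: exI[of _ "monom (fst ab) 0"] exI[of _ "monom (snd ab) 0"] simp: poly_monom prod_eq_iff)
  qed
  show "(x, y) \<in> ?R"
    using poly_rel_ops(4)[OF R partial_homD(1)[OF R], of 1]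
    by (auto intro!: exI[of _ "monom 1 1"] exI[of _ "monom 1 1"] simp: poly_monom)
qed

text \<open>Passage to fractions; a maximal partial homomorphism therefore has a field as its
  domain.\<close>

lemma partial_hom_inverses:
  assumes R: "partial_hom R"
  shows "partial_hom {(c / a, d / b) | a b c d. (c, d) \<in> R \<and> (a, b) \<in> R \<and> a \<noteq> 0}"
    (is "partial_hom ?R")
proof -
  note RD = partial_homD[OF R]
  show ?thesis
    unfolding partial_hom_def
  proof (intro conjI allI impI)
    show "(1, 1) \<in> ?R" using RD(1) by (force intro!: exI[of _ 1])
  next
    fix x y u v assume "(x, y) \<in> ?R" "(u, v) \<in> ?R"
    then obtain a b c d a' b' c' d' where *: "(c, d) \<in> R" "(a, b) \<in> R" "a \<noteq> 0" "x = c / a" "y = d / b"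
      "(c', d') \<in> R" "(a', b') \<in> R" "a' \<noteq> 0" "u = c' / a'" "v = d' / b'" by auto
    then have nz: "b \<noteq> 0" "b' \<noteq> 0" using RD(6) by blast+
    have "x - u = (c * a' - c' * a) / (a * a')" "y - v = (d * b' - d' * b) / (b * b')"
      "x * u = (c * c') / (a * a')" "y * v = (d * d') / (b * b')" "a * a' \<noteq> 0"
      using * nz by (auto simp: field_simps)
    moreover have "(c * a' - c' * a, d * b' - d' * b) \<in> R" "(c * c', d * d') \<in> R" "(a * a', b * b') \<in> R"
      by (intro RD *)+
    ultimately show "(x - u, y - v) \<in> ?R" "(x * u, y * v) \<in> ?R" by blast+
  next
    fix x y assume "(x, y) \<in> ?R"
    then show "x = 0 \<longleftrightarrow> y = 0" using RD(6) by auto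
  qed
qed

text \<open>By maximality the domain is a field. Let \<open>p\<close> be the minimal polynomial of
  \<open>x\<close> over it and \<open>y\<close> a root of the related polynomial \<open>q\<close>.
  For related \<open>f\<close> and \<open>g\<close>, vanishing at \<open>x\<close> and vanishing at
  \<open>y\<close> both amount to \<open>p\<close> dividing \<open>f\<close>, so \<open>x\<close>
  may be sent to \<open>y\<close> and already lies in the domain.\<close>

lemma maximal_partial_hom_domain:
  fixes R :: "('a::field \<times> 'b::alg_closed_field) set"
  assumes R: "partial_hom R" and max: "\<And>S. partial_hom S \<Longrightarrow> R \<subseteq> S \<Longrightarrow> S = R"
    and x: "p0 \<noteq> 0" "poly p0 x = 0" "\<And>i. coeff p0 i \<in> fst ` R"
  shows "x \<in> fst ` R"
proof -
  note RD = partial_homD[OF R]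
  have inv: "(inverse a, inverse b) \<in> R" if ab: "(a, b) \<in> R" "a \<noteq> 0" for a b
  proof -
    let ?S = "{(c / a, d / b) | a b c d. (c, d) \<in> R \<and> (a, b) \<in> R \<and> a \<noteq> 0}"
    have "R \<subseteq> ?S"
    proof
      fix cd assume "cd \<in> R"
      moreover obtain c d where cd: "cd = (c / 1, d / 1)" by (cases cd) simp
      ultimately have "(c, d) \<in> R" by simp
      then show "cd \<in> ?S" unfolding cd using RD(1) one_neq_zero by blast
    qed
    then have "?S = R" by (intro max partial_hom_inverses R)
    moreover have "(inverse a, inverse b) \<in> ?S"
      unfolding inverse_eq_divide using ab RD(1) by blast
    ultimately show ?thesis by simp
  qed
  define Z where "Z = (\<lambda>p. p \<noteq> 0 \<and> poly p x = 0 \<and> (\<exists>q. poly_rel R p q))"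
  have "\<exists>q0. poly_rel R p0 q0"
  proof -
    have "\<forall>i. \<exists>b. (coeff p0 i, b) \<in> R" using x(3) by force
    then obtain h where h: "\<And>i. (coeff p0 i, h i) \<in> R" by metis
    have "coeff (\<Sum>i\<le>degree p0. monom (h i) i) k = h k" for k
      using RD(6)[OF h[of k]] by (auto simp: coeff_sum coeff_eq_0)
    then have "poly_rel R p0 (\<Sum>i\<le>degree p0. monom (h i) i)"
      using h by (simp add: poly_rel_def)
    then show ?thesis ..
  qed
  then have "Z p0" using x by (auto simp: Z_def)
  define p1 where "p1 = arg_min degree Z"
  have p1: "Z p1" and p1_min: "\<And>f. Z f \<Longrightarrow> degree p1 \<le> degree f"
    unfolding p1_def using arg_min_natI[of Z p0 degree, OF \<open>Z p0\<close>] arg_min_nat_le[of Z _ degree] by auto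
  then obtain q1 where q1: "poly_rel R p1 q1" by (auto simp: Z_def)
  define p q where "p = monom (inverse (lead_coeff p1)) 0 * p1"
    and "q = monom (inverse (lead_coeff q1)) 0 * q1"
  have p1nz: "p1 \<noteq> 0" using p1 by (simp add: Z_def)
  have "degree q1 = degree p1" using poly_rel_ops(8)[OF R q1] by simp
  then have "(lead_coeff p1, lead_coeff q1) \<in> R" using q1 by (auto simp: poly_rel_def)
  then have pq: "poly_rel R p q"
    unfolding p_def q_def using p1nz by (intro poly_rel_ops(3,4)[OF R] q1 inv) auto
  have deg_p: "degree p = degree p1" "lead_coeff p = 1" "poly p x = 0" "p \<noteq> 0"
    using p1 by (auto simp: p_def Z_def monom_0)
  have "degree p > 0"
  proof (rule ccontr)
    assume "\<not> degree p > 0"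
    then obtain c where "p = [:c:]" by (metis degree_eq_zeroE gr0I)
    then show False using deg_p by simp
  qed
  moreover have "degree q = degree p" using poly_rel_ops(8)[OF R pq] by simp
  ultimately obtain y where y: "poly q y = 0" using alg_closed_imp_poly_has_root[of q] by auto
  define Y where "Y = (\<lambda>f. f \<noteq> 0 \<and> (\<exists>g. poly_rel R f g \<and> poly g y = 0))"
  have "Y p" using deg_p pq y by (auto simp: Y_def)
  \<comment> \<open>A normalized element \<open>p2\<close> of least degree on the side of
    \<open>y\<close> divides \<open>p\<close>, say \<open>p = p2 * s\<close> with \<open>s\<close>
    of smaller degree. Minimality of \<open>p\<close> at \<open>x\<close> excludes that
    \<open>s\<close> vanishes there, so \<open>p2\<close> does and cannot have smaller degree than
    \<open>p\<close>.\<close>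
  have Y_min: "degree p \<le> degree f" if "Y f" for f
  proof -
    define p2' where "p2' = arg_min degree Y"
    have p2': "Y p2'" and p2_min: "\<And>f. Y f \<Longrightarrow> degree p2' \<le> degree f"
      unfolding p2'_def using arg_min_natI[of Y p degree, OF \<open>Y p\<close>] arg_min_nat_le[of Y _ degree] by auto
    then obtain q2' where q2': "poly_rel R p2' q2'" "poly q2' y = 0" by (auto simp: Y_def)
    define p2 q2 where "p2 = monom (inverse (lead_coeff p2')) 0 * p2'"
      and "q2 = monom (inverse (lead_coeff q2')) 0 * q2'"
    have nz: "p2' \<noteq> 0" using p2' by (simp add: Y_def)
    have "degree q2' = degree p2'" using poly_rel_ops(8)[OF R q2'(1)] by simp
    then have "(lead_coeff p2', lead_coeff q2') \<in> R" using q2' by (auto simp: poly_rel_def)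
    then have pq2: "poly_rel R p2 q2"
      unfolding p2_def q2_def using nz by (intro poly_rel_ops(3,4)[OF R] q2' inv) auto
    have deg_p2: "degree p2 = degree p2'" "lead_coeff p2 = 1" "poly q2 y = 0" "p2 \<noteq> 0"
      using nz q2' by (auto simp: p2_def q2_def monom_0)
    obtain s s' r r' where d: "poly_rel R s s'" "poly_rel R r r'" "p = p2 * s + r" "q = q2 * s' + r'"
       "r = 0 \<or> degree r < degree p2"
      using poly_rel_division[OF R pq2 deg_p2(2) pq] by blast
    have "poly r' y = 0" using y d deg_p2 by simp
    then have "r \<noteq> 0 \<Longrightarrow> degree p2' \<le> degree r" using d(2) by (intro p2_min) (auto simp: Y_def)
    then have "r = 0" using d(5) deg_p2(1) by linarith
    then have p_eq: "p = p2 * s" using d by simp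
    have "degree p2 > 0"
    proof (rule ccontr)
      assume "\<not> degree p2 > 0"
      then have "degree q2 = 0" using poly_rel_ops(8)[OF R pq2] by simp
      then obtain c where "q2 = [:c:]" by (metis degree_eq_zeroE)
      then have "q2 = 0" using deg_p2 by simp
      then show False using poly_rel_ops(7)[OF R pq2] deg_p2 by simp
    qed
    moreover have "s \<noteq> 0" using p_eq deg_p by auto
    ultimately have "degree s < degree p" using deg_p2 p_eq by (simp add: degree_mult_eq)
    have "poly p2 x = 0"
    proof (rule ccontr)
      assume "poly p2 x \<noteq> 0"
      then have "Z s" using p_eq deg_p d \<open>s \<noteq> 0\<close> by (auto simp: Z_def)
      then show False using p1_min \<open>degree s < degree p\<close> deg_p by fastforce
    qed
    then have "Z p2" using pq2 deg_p2 by (auto simp: Z_def)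
    then show ?thesis using p1_min p2_min[OF that] deg_p deg_p2 by fastforce
  qed
  have eq: "poly f x = 0 \<longleftrightarrow> poly g y = 0" if "poly_rel R f g" for f g
  proof -
    obtain s s' r r' where d: "poly_rel R s s'" "poly_rel R r r'" "f = p * s + r" "g = q * s' + r'"
       "r = 0 \<or> degree r < degree p"
      using poly_rel_division[OF R pq deg_p(2) \<open>poly_rel R f g\<close>] by blast
    have "poly f x = poly r x" "poly g y = poly r' y" using d deg_p y by simp_all
    moreover have "r = 0" if "poly r x = 0"
      using that d(2,5) p1_min[of r] deg_p(1) unfolding Z_def by (metis leD)
    moreover have "r = 0" if "poly r' y = 0"
      using that d(2,5) Y_min[of r] unfolding Y_def by (metis leD)
    moreover have "r = 0 \<longleftrightarrow> r' = 0" using poly_rel_ops(7)[OF R d(2)] .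
    ultimately show ?thesis by auto
  qed
  have "{(poly f x, poly g y) | f g. poly_rel R f g} = R"
    by (rule max[OF partial_hom_image(1)[OF R eq] partial_hom_image(2)[OF R eq]])
  then have "(x, y) \<in> R" using partial_hom_image(3)[OF R eq] by simp
  then show ?thesis by force
qed

text \<open>Zorn's lemma gives a maximal extension, and algebraicity over the domain of
  \<open>R\<close> makes it total. This provides embeddings into the complex numbers and
  endomorphisms moving an element to a given conjugate.\<close>

lemma partial_hom_extends:
  fixes R :: "('a::field \<times> 'b::alg_closed_field) set"
  assumes R: "partial_hom R"
    and alg: "\<And>x. \<exists>p. p \<noteq> 0 \<and> poly p x = 0 \<and> (\<forall>i. coeff p i \<in> fst ` R)"
  obtains h where "is_hom h" "\<And>a b. (a, b) \<in> R \<Longrightarrow> h a = b"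
proof -
  define A where "A = {S. partial_hom S \<and> R \<subseteq> S}"
  have "\<exists>M\<in>A. \<forall>M'\<in>A. M \<subseteq> M' \<longrightarrow> M' = M"
  proof (rule subset_Zorn_nonempty)
    show "A \<noteq> {}" using R by (auto simp: A_def)
  next
    fix C assume C: "C \<noteq> {}" "subset.chain A C"
    have sub: "\<And>S. S \<in> C \<Longrightarrow> partial_hom S \<and> R \<subseteq> S" and
      ch: "\<And>S T. S \<in> C \<Longrightarrow> T \<in> C \<Longrightarrow> S \<subseteq> T \<or> T \<subseteq> S"
      using C(2) unfolding subset.chain_def A_def by blast+
    have "partial_hom (\<Union>C)"
      unfolding partial_hom_def
    proof (intro conjI allI impI)
      show "(1, 1) \<in> \<Union>C" using C(1) sub partial_homD(1) by blast
    next
      fix a b c d assume "(a, b) \<in> \<Union>C" "(c, d) \<in> \<Union>C"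
      then obtain S where "S \<in> C" "(a, b) \<in> S" "(c, d) \<in> S" using ch by blast
      then show "(a - c, b - d) \<in> \<Union>C" "(a * c, b * d) \<in> \<Union>C"
        using sub partial_homD(3,5) by blast+
    next
      fix a b assume "(a, b) \<in> \<Union>C"
      then show "a = 0 \<longleftrightarrow> b = 0" using sub partial_homD(6) by blast
    qed
    then show "\<Union>C \<in> A" using C(1) sub by (auto simp: A_def)
  qed
  then obtain M where MA: "M \<in> A" "\<And>S. S \<in> A \<Longrightarrow> M \<subseteq> S \<Longrightarrow> S = M" by blast
  then have M: "partial_hom M" "R \<subseteq> M" by (simp_all add: A_def)
  have max: "S = M" if "partial_hom S" "M \<subseteq> S" for S
    using MA(2)[of S] that M(2) by (simp add: A_def)
  note MD = partial_homD[OF M(1)]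
  have "\<exists>y. (x, y) \<in> M" for x
  proof -
    obtain p where p: "p \<noteq> 0" "poly p x = 0" "\<forall>i. coeff p i \<in> fst ` R" using alg by blast
    have "\<And>i. coeff p i \<in> fst ` M" using p(3) M(2) by (meson image_mono subsetD)
    then have "x \<in> fst ` M" using maximal_partial_hom_domain[OF M(1) max p(1,2)] by blast
    then show ?thesis by auto
  qed
  then obtain h where h: "\<And>x. (x, h x) \<in> M" by metis
  have uniq: "y = h x" if "(x, y) \<in> M" for x y
    using MD(3)[OF that h[of x]] MD(6)[of "x - x" "y - h x"] by simp
  show ?thesis
  proof
    show "is_hom h"
      unfolding is_hom_def
      using uniq[OF MD(1)] uniq[OF MD(4)[OF h h]] uniq[OF MD(5)[OF h h]] by simp
    show "h a = b" if "(a, b) \<in> R" for a b using that M(2) uniq by blast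
  qed
qed

section \<open>Puiseux series\<close>

text \<open>A polynomial over power series is read as a power series with polynomial coefficients;
  this is its coefficient of index \<open>n\<close>.\<close>

definition reduction :: "nat \<Rightarrow> 'a::zero fps poly \<Rightarrow> 'a poly" where
  "reduction n p = map_poly (\<lambda>f. fps_nth f n) p"

lemma coeff_reduction [simp]: "coeff (reduction n p) i = fps_nth (coeff p i) n"
  by (simp add: reduction_def coeff_map_poly)

text \<open>Solves the linearized factorization equation of Hensel's lemma. Reducing the Bezout
  coefficient modulo \<open>g\<close> bounds \<open>u\<close>, and the degree of \<open>c\<close>
  then bounds \<open>v\<close>; without these bounds the lifted factors would not stay
  monic.\<close>

lemma bezout_degree:
  fixes g h c :: "'a::field_gcd poly"
  assumes cop: "coprime g h" and dg: "degree g > 0" and dh: "degree h > 0"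
    and dc: "degree c < degree g + degree h"
  shows "\<exists>u v. u * h + v * g = c \<and> degree u < degree g \<and> degree v < degree h"
proof -
  have "g \<noteq> 0" "h \<noteq> 0" using dg dh by auto
  obtain r s where rs: "r * g + s * h = 1"
    using bezout_coefficients_fst_snd[of g h] cop by (metis coprime_imp_gcd_eq_1)
  define u q where "u = (c * s) mod g" and "q = (c * s) div g"
  define v where "v = c * r + q * h"
  have cs: "c * s = q * g + u" by (simp add: u_def q_def)
  have "u * h + v * g = (c * s - q * g) * h + (c * r + q * h) * g" by (simp add: cs v_def)
  also have "\<dots> = c * (r * g + s * h)" by (simp add: algebra_simps)
  finally have eq: "u * h + v * g = c" by (simp add: rs)
  have du: "degree u < degree g" using degree_mod_less[OF \<open>g \<noteq> 0\<close>, of "c * s"] dg by (auto simp: u_def)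
  have "degree v < degree h"
  proof (cases "v = 0")
    case False
    have "degree (u * h) < degree g + degree h"
      using degree_mult_le[of u h] du by linarith
    then have "degree (c - u * h) < degree g + degree h" using dc by (meson degree_diff_less)
    moreover have "v * g = c - u * h" using eq by (simp add: algebra_simps)
    ultimately show ?thesis using False \<open>g \<noteq> 0\<close> degree_mult_eq[of v g] by simp
  qed (use dh in simp)
  with eq du show ?thesis by blast
qed

theorem hensel_fps:
  fixes p :: "'a::field_gcd fps poly"
  assumes p: "lead_coeff p = 1" and red: "reduction 0 p = g0 * h0"
    and monic: "lead_coeff g0 = 1" "lead_coeff h0 = 1" and cop: "coprime g0 h0"
    and pos: "degree g0 > 0" "degree h0 > 0"
  shows "\<exists>g h. p = g * h \<and> lead_coeff g = 1 \<and> degree g = degree g0 \<and> lead_coeff h = 1 \<and> degree h = degree h0"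
proof -
  \<comment> \<open>The pair \<open>r\<close> holds the coefficients of index \<open>n\<close> of
    both factors. Comparing coefficients in \<open>p = g * h\<close> leaves a linear equation in
    this pair, the earlier pairs forming the right-hand side; for positive \<open>n\<close> the
    strict degree bounds preserve the leading coefficient 1.\<close>
  define P where "P = (\<lambda>(F :: nat \<Rightarrow> 'a poly \<times> 'a poly) n r.
     if n = 0 then r = (g0, h0) else
     degree (fst r) < degree g0 \<and> degree (snd r) < degree h0 \<and>
     fst r * h0 + snd r * g0 = reduction n p - (\<Sum>i\<in>{1..<n}. fst (F i) * snd (F (n - i))))"
  have nz: "g0 \<noteq> 0" "h0 \<noteq> 0" "p \<noteq> 0" using monic p by auto
  have deg_p: "degree p = degree g0 + degree h0"
  proof (rule antisym)
    have "coeff (reduction 0 p) (degree p) = 1" using p by simp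
    then have "degree p \<le> degree (reduction 0 p)" by (intro le_degree) simp
    then show "degree p \<le> degree g0 + degree h0" using red nz by (simp add: degree_mult_eq)
    have "degree (g0 * h0) \<le> degree p"
      unfolding red[symmetric] by (intro degree_le) (simp add: coeff_eq_0)
    then show "degree g0 + degree h0 \<le> degree p" using nz by (simp add: degree_mult_eq)
  qed
  have "\<exists>F. \<forall>n. P F n (F n)"
  proof (rule dependent_wellorder_choice)
    fix r :: "'a poly \<times> 'a poly" and F F' :: "nat \<Rightarrow> 'a poly \<times> 'a poly" and n :: nat
    assume "\<And>y. y < n \<Longrightarrow> F y = F' y"
    then have "(\<Sum>i\<in>{1..<n}. fst (F i) * snd (F (n - i))) = (\<Sum>i\<in>{1..<n}. fst (F' i) * snd (F' (n - i)))"
      by (intro sum.cong) auto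
    then show "P F n r = P F' n r" by (simp add: P_def)
  next
    fix n :: nat and F :: "nat \<Rightarrow> 'a poly \<times> 'a poly"
    assume prev: "\<And>y. y < n \<Longrightarrow> P F y (F y)"
    show "\<exists>r. P F n r"
    proof (cases "n = 0")
      case True
      then show ?thesis by (auto simp: P_def)
    next
      case False
      define c where "c = reduction n p - (\<Sum>i\<in>{1..<n}. fst (F i) * snd (F (n - i)))"
      have "degree (reduction n p) < degree g0 + degree h0"
      proof -
        have "coeff (reduction n p) i = 0" if "i \<ge> degree p" for i
          using that p False by (cases "i = degree p") (auto simp: coeff_eq_0)
        then show ?thesis using pos deg_p by (metis degree_0 add_pos_pos leading_coeff_0_iff not_le)
      qed
      moreover have "degree (\<Sum>i\<in>{1..<n}. fst (F i) * snd (F (n - i))) < degree g0 + degree h0"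
      proof (rule degree_sum_less)
        fix i assume "i \<in> {1..<n}"
        then have "degree (fst (F i)) < degree g0" "degree (snd (F (n - i))) < degree h0"
          using prev[of i] prev[of "n - i"] by (auto simp: P_def)
        then show "degree (fst (F i) * snd (F (n - i))) < degree g0 + degree h0"
          using degree_mult_le[of "fst (F i)" "snd (F (n - i))"] by linarith
      qed (use pos in simp)
      ultimately have "degree c < degree g0 + degree h0"
        unfolding c_def by (rule degree_diff_less)
      from bezout_degree[OF cop pos this] obtain u v where
        "u * h0 + v * g0 = c" "degree u < degree g0" "degree v < degree h0" by blast
      then show ?thesis using False by (intro exI[of _ "(u, v)"]) (simp add: P_def c_def)
    qed
  qed
  then obtain F where F: "\<And>n. P F n (F n)" by blast
  define G H where "G = (\<lambda>n. fst (F n))" and "H = (\<lambda>n. snd (F n))"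
  have GH0: "G 0 = g0" "H 0 = h0" using F[of 0] by (auto simp: P_def G_def H_def)
  have degs: "degree (G n) < degree g0" "degree (H n) < degree h0" if "n > 0" for n
    using F[of n] that by (auto simp: P_def G_def H_def)
  have conv: "reduction n p = (\<Sum>i\<le>n. G i * H (n - i))" for n
  proof (cases "n = 0")
    case True
    then show ?thesis using red GH0 by simp
  next
    case False
    have "{..n} = insert 0 (insert n {1..<n})" using False by auto
    then have "(\<Sum>i\<le>n. G i * H (n - i)) = G 0 * H n + (G n * H 0 + (\<Sum>i\<in>{1..<n}. G i * H (n - i)))"
      using False by simp
    also have "\<dots> = reduction n p"
      using F[of n] False GH0 by (simp add: P_def G_def H_def algebra_simps)
    finally show ?thesis ..
  qed
  \<comment> \<open>Transposes a sequence of polynomials into one polynomial over power series. The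
    cut-off \<open>d\<close> loses nothing, since the polynomials \<open>G n\<close> and
    \<open>H n\<close> do not exceed it.\<close>
  define lift where "lift = (\<lambda>(K :: nat \<Rightarrow> 'a poly) d. \<Sum>k\<le>d. monom (Abs_fps (\<lambda>n. coeff (K n) k)) k)"
  have coeff_lift: "fps_nth (coeff (lift K d) k) n = (if k \<le> d then coeff (K n) k else 0)" for K d k n
    by (simp add: lift_def coeff_sum if_distrib[of "\<lambda>f. fps_nth f n"] cong: if_cong)
  define g h where "g = lift G (degree g0)" and "h = lift H (degree h0)"
  have cg: "fps_nth (coeff g k) n = coeff (G n) k" for k n
  proof -
    have "coeff (G n) k = 0" if "k > degree g0"
      using that degs(1)[of n] GH0 by (cases "n = 0") (auto intro!: coeff_eq_0)
    then show ?thesis by (auto simp: g_def coeff_lift)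
  qed
  have ch: "fps_nth (coeff h k) n = coeff (H n) k" for k n
  proof -
    have "coeff (H n) k = 0" if "k > degree h0"
      using that degs(2)[of n] GH0 by (cases "n = 0") (auto intro!: coeff_eq_0)
    then show ?thesis by (auto simp: h_def coeff_lift)
  qed
  have lg: "coeff g (degree g0) = 1"
  proof (rule fps_ext)
    fix n show "fps_nth (coeff g (degree g0)) n = fps_nth 1 n"
      using degs(1)[of n] GH0 monic by (cases "n = 0") (auto simp: cg coeff_eq_0)
  qed
  have lh: "coeff h (degree h0) = 1"
  proof (rule fps_ext)
    fix n show "fps_nth (coeff h (degree h0)) n = fps_nth 1 n"
      using degs(2)[of n] GH0 monic by (cases "n = 0") (auto simp: ch coeff_eq_0)
  qed
  have dg: "degree g = degree g0"
    using lg by (intro antisym le_degree degree_le) (auto simp: g_def lift_def coeff_sum)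
  have dh: "degree h = degree h0"
    using lh by (intro antisym le_degree degree_le) (auto simp: h_def lift_def coeff_sum)
  have "p = g * h"
  proof (rule poly_eqI, rule fps_ext)
    fix k n
    have "fps_nth (coeff (g * h) k) n = (\<Sum>j\<le>k. \<Sum>i=0..n. coeff (G i) j * coeff (H (n - i)) (k - j))"
      by (simp add: coeff_mult fps_sum_nth fps_mult_nth cg ch)
    also have "\<dots> = (\<Sum>i\<le>n. \<Sum>j\<le>k. coeff (G i) j * coeff (H (n - i)) (k - j))"
      by (subst sum.swap) (simp add: atLeast0AtMost)
    also have "\<dots> = coeff (\<Sum>i\<le>n. G i * H (n - i)) k"
      by (simp add: coeff_sum coeff_mult)
    also have "\<dots> = fps_nth (coeff p k) n" by (simp flip: conv)
    finally show "fps_nth (coeff p k) n = fps_nth (coeff (g * h) k) n" ..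
  qed
  then show ?thesis using lg lh dg dh by (intro exI[of _ g] exI[of _ h]) simp
qed

section \<open>Ramification and Puiseux's theorem\<close>

definition ramify :: "nat \<Rightarrow> 'a::comm_ring_1 fps \<Rightarrow> 'a fps" where
  "ramify e f = fps_compose f (fps_X ^ e)"

lemma ramify_nth [simp]: "fps_nth (ramify e f) n = (if e dvd n then fps_nth f (n div e) else 0)"
  by (simp add: ramify_def fps_nth_compose_X_power)

lemma ramify_one [simp]: "ramify (Suc 0) f = f"
  by (rule fps_ext) simp

lemma ramify_ramify: "a > 0 \<Longrightarrow> b > 0 \<Longrightarrow> ramify a (ramify b f) = ramify (a * b) f"
proof (rule fps_ext)
  fix n assume "a > 0" "b > 0"
  then show "fps_nth (ramify a (ramify b f)) n = fps_nth (ramify (a * b) f) n"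
  proof (cases "a dvd n")
    case True
    then obtain m where "n = a * m" by (elim dvdE)
    then show ?thesis using \<open>a > 0\<close> by simp
  next
    case False
    then have "\<not> a * b dvd n" using dvd_mult_left by blast
    then show ?thesis using False by simp
  qed
qed

lemma is_hom_ramify:
  assumes "e > 0"
  shows "is_hom (ramify e :: 'a::idom fps \<Rightarrow> 'a fps)"
  using assms by (simp add: is_hom_def ramify_def fps_compose_add_distrib fps_compose_mult_distrib)

text \<open>The two top coefficients are all that the Tschirnhaus translation needs: for monic
  \<open>p\<close>, a suitable \<open>c\<close> cancels the subleading one.\<close>

lemma coeff_pcompose_shift:
  fixes p :: "'a::comm_ring_1 poly"
  assumes "degree p \<le> n"
  shows "coeff (pcompose p [:c, 1:]) n = coeff p n \<and>
    (n > 0 \<longrightarrow> coeff (pcompose p [:c, 1:]) (n - 1) = coeff p (n - 1) + of_nat n * c * coeff p n)"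
  using assms
proof (induction p arbitrary: n)
  case (pCons a p)
  define q where "q = pcompose p [:c, 1:]"
  have eq: "pcompose (pCons a p) [:c, 1:] = [:a:] + (smult c q + pCons 0 q)"
    by (simp add: pcompose_pCons q_def)
  show ?case
  proof (cases n)
    case 0
    then have "p = 0" using pCons by (cases "p = 0") auto
    then show ?thesis using 0 by (simp add: pcompose_pCons)
  next
    case (Suc m)
    then have "degree p \<le> m" using pCons by (cases "p = 0") auto
    then have IH: "coeff q m = coeff p m" "m > 0 \<Longrightarrow> coeff q (m - 1) = coeff p (m - 1) + of_nat m * c * coeff p m"
      and "coeff q (Suc m) = coeff p (Suc m)"
      using pCons.IH[of m] pCons.IH[of "Suc m"] by (auto simp: q_def)
    moreover have "coeff p (Suc m) = 0" using \<open>degree p \<le> m\<close> by (simp add: coeff_eq_0)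
    ultimately show ?thesis unfolding eq Suc by (cases m) (simp_all add: algebra_simps)
  qed
qed simp

text \<open>With a single root \<open>x\<close> the polynomial would be the \<open>n\<close>-th
  power of a linear one, with subleading coefficient \<open>- n * x\<close>. In characteristic 0
  this forces \<open>x = 0\<close>, hence a pure monomial, against the nonzero coefficient at
  \<open>k\<close>.\<close>

lemma monic_two_roots:
  fixes p :: "'a::{alg_closed_field, field_char_0} poly"
  assumes p: "lead_coeff p = 1" "coeff p (degree p - 1) = 0" and k: "k < degree p" "coeff p k \<noteq> 0"
  shows "\<exists>x y. poly p x = 0 \<and> poly p y = 0 \<and> x \<noteq> y"
proof (rule ccontr)
  assume neg: "\<not> ?thesis"
  define n where "n = degree p"
  have "p \<noteq> 0" using p by auto
  obtain x where x: "poly p x = 0" using alg_closed_imp_poly_has_root[of p] k by auto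
  obtain A where A: "size A = n" "p = (\<Prod>y\<in>#A. [:- y, 1:])"
    using alg_closed_imp_factorization[OF \<open>p \<noteq> 0\<close>] p n_def by auto
  have "y = x" if "y \<in># A" for y
  proof -
    have "[:- y, 1:] dvd p" unfolding A(2) using that by (intro dvd_prod_mset) auto
    then have "poly p y = 0" by (simp add: poly_eq_0_iff_dvd)
    then show ?thesis using neg x by blast
  qed
  then have "A = replicate_mset n x" using A(1)
    by (metis set_mset_subset_singletonD subsetI singletonI singleton_iff)
  then have "p = [:- x, 1:] ^ n" using A(2) by simp
  have "n > 0" using k n_def by simp
  then have "coeff p (n - 1) = of_nat n * (- x)"
    unfolding \<open>p = [:- x, 1:] ^ n\<close> using binomial_symmetric[of 1 n]
    by (subst coeff_linear_poly_power) simp_all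
  then have "x = 0" using p(2) \<open>n > 0\<close> by (simp add: n_def)
  then have "p = monom 1 n" using \<open>p = [:- x, 1:] ^ n\<close> by (simp add: monom_altdef)
  then have "coeff p k = 0" using k n_def by (metis coeff_monom less_irrefl)
  then show False using k by simp
qed

text \<open>
  Once the subleading coefficient is removed by a translation, scaling \<open>Z\<close> by the smallest Newton slope
  leaves a reduction that is not a power of a linear polynomial, so that Hensel's lemma applies.
\<close>

theorem puiseux_root:
  fixes p :: "'a::{alg_closed_field, field_char_0, field_gcd} fps poly"
  assumes "lead_coeff p = 1" "degree p > 0"
  shows "\<exists>e \<psi>. e > 0 \<and> poly (map_poly (ramify e) p) \<psi> = 0"
  using assms
proof (induction "degree p" arbitrary: p rule: less_induct)
  case (less p0)
  define n where "n = degree p0"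
  define t where "t = fps_const (1 / of_nat n) * coeff p0 (n - 1)"
  define p where "p = pcompose p0 [:- t, 1:]"
  have n: "n > 0" using less.prems by (simp add: n_def)
  have deg_p: "degree p = n" by (simp add: p_def degree_pcompose n_def)
  have top: "coeff p n = 1" "coeff p (n - 1) = 0"
  proof -
    have "of_nat n * t = coeff p0 (n - 1)"
      using n unfolding t_def fps_of_nat[symmetric] mult.assoc[symmetric] fps_const_mult by simp
    then show "coeff p n = 1" "coeff p (n - 1) = 0"
      using coeff_pcompose_shift[of p0 n "- t"] less.prems n by (auto simp: p_def n_def)
  qed
  have goalI: "?case" if "e > 0" "poly (map_poly (ramify e) p) \<psi> = 0" for e \<psi>
  proof -
    have hom: "is_hom (ramify e :: 'a fps \<Rightarrow> _)" by (rule is_hom_ramify[OF that(1)])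
    have "map_poly (ramify e) p = pcompose (map_poly (ramify e) p0) [:- ramify e t, 1:]"
      unfolding p_def
    proof (induction p0)
      case (pCons a q)
      have "map_poly (ramify e) ([:- t, 1:] * pcompose q [:- t, 1:]) =
        [:- ramify e t, 1:] * map_poly (ramify e) (pcompose q [:- t, 1:])"
        by (subst is_hom_simps(3)[OF is_hom_map_poly[OF hom]])
          (simp add: map_poly_linear[OF hom] is_hom_simps[OF hom])
      then show ?case
        using pCons by (simp add: pcompose_pCons map_poly_pCons is_hom_simps[OF hom]
          is_hom_simps(2)[OF is_hom_map_poly[OF hom]])
    qed simp
    then have "poly (map_poly (ramify e) p0) (- ramify e t + \<psi>) = 0"
      using that(2) by (simp add: poly_pcompose)
    then show ?thesis using that(1) by blast
  qed
  show ?case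
  proof (cases "\<forall>k<n. coeff p k = 0")
    case True
    then have "coeff p 0 = 0" using n by blast
    then have "poly (map_poly (ramify 1) p) 0 = 0" by (simp add: poly_0_coeff_0 coeff_map_poly)
    then show ?thesis by (intro goalI[of 1 0]) simp_all
  next
    case False
    define Z where "Z = {k. k < n \<and> coeff p k \<noteq> 0}"
    have Z: "finite Z" "Z \<noteq> {}" using False by (auto simp: Z_def)
    \<comment> \<open>The least of these quotients is the Newton slope \<open>a / j\<close>.
      Ramifying by \<open>j\<close> makes it an integer, so that \<open>Z\<close> can be rescaled by
      the \<open>a\<close>-th power of the variable.\<close>
    define slope where "slope = (\<lambda>k. real (subdegree (coeff p k)) / real (n - k))"
    define m where "m = arg_min_on slope Z"
    have m: "m \<in> Z" "\<And>k. k \<in> Z \<Longrightarrow> slope m \<le> slope k"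
      unfolding m_def using arg_min_if_finite[OF Z, of slope] arg_min_least[OF Z, of _ slope] by auto
    define a j where "a = subdegree (coeff p m)" and "j = n - m"
    have j: "j > 0" using m(1) by (simp add: Z_def j_def)
    have slope_le: "a * (n - k) \<le> j * subdegree (coeff p k)" if "k \<in> Z" for k
    proof -
      have "real a / real j \<le> real (subdegree (coeff p k)) / real (n - k)"
        using m(2)[OF that] by (simp add: slope_def a_def j_def)
      then have "real a * real (n - k) \<le> real j * real (subdegree (coeff p k))"
        using that j by (simp add: Z_def field_simps)
      then show ?thesis unfolding of_nat_mult[symmetric] of_nat_le_iff .
    qed
    have hom: "is_hom (ramify j :: 'a fps \<Rightarrow> _)" by (rule is_hom_ramify[OF j])
    \<comment> \<open>The coefficient of \<open>Z ^ k\<close> in \<open>p\<close> after substituting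
      \<open>X ^ j\<close> for \<open>X\<close> and \<open>X ^ a * Z\<close> for \<open>Z\<close>
      and dividing by \<open>X ^ (a * n)\<close>.\<close>
    define d where "d = (\<lambda>k. fps_shift (a * (n - k)) (ramify j (coeff p k)))"
    have d: "ramify j (coeff p k) = fps_X ^ (a * (n - k)) * d k" if "k \<le> n" for k
    proof -
      have "coeff p k = 0 \<or> k = n \<or> k \<in> Z" using that by (auto simp: Z_def)
      then consider "coeff p k = 0" | "k = n" | "k \<in> Z" by blast
      then show ?thesis
      proof cases
        case 3
        have "fps_nth (ramify j (coeff p k)) i = 0" if "i < a * (n - k)" for i
        proof (cases "j dvd i")
          case True
          then obtain l where "i = j * l" by (elim dvdE)
          then have "l < subdegree (coeff p k)" using that slope_le[OF 3] j
            by (metis less_le_trans mult_less_cancel1)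
          then have "fps_nth (coeff p k) l = 0" by (rule nth_less_subdegree_zero)
          then show ?thesis using j unfolding \<open>i = j * l\<close> by simp
        qed simp
        then have "ramify j (coeff p k) = 0 \<or> a * (n - k) \<le> subdegree (ramify j (coeff p k))"
          using subdegree_geI by blast
        then show ?thesis unfolding d_def by (rule fps_conv_fps_X_power_mult_fps_shift)
      qed (simp_all add: d_def is_hom_simps[OF hom])
    qed
    define q where "q = (\<Sum>k\<le>n. monom (d k) k)"
    have cq: "coeff q k = (if k \<le> n then d k else 0)" for k by (simp add: q_def coeff_sum)
    have "d n = 1" by (simp add: d_def top is_hom_simps[OF hom])
    have deg_q: "degree q = n" "lead_coeff q = 1"
    proof -
      show "degree q = n" using \<open>d n = 1\<close> by (intro antisym le_degree degree_le) (auto simp: cq)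
      then show "lead_coeff q = 1" using \<open>d n = 1\<close> by (simp add: cq)
    qed
    define q0 where "q0 = reduction 0 q"
    have q0: "degree q0 = n" "lead_coeff q0 = 1"
    proof -
      show "degree q0 = n"
        using \<open>d n = 1\<close> by (intro antisym le_degree degree_le) (auto simp: cq q0_def)
      then show "lead_coeff q0 = 1" using \<open>d n = 1\<close> by (simp add: cq q0_def)
    qed
    have "coeff q0 (n - 1) = 0" using top by (simp add: q0_def cq d_def is_hom_simps[OF hom])
    \<comment> \<open>The minimal slope is attained at \<open>m\<close>, so the lowest coefficient
      of this term survives the reduction.\<close>
    have "coeff q0 m \<noteq> 0"
    proof -
      have "coeff p m \<noteq> 0" "m < n" using m(1) by (auto simp: Z_def)
      then have "fps_nth (coeff p m) a \<noteq> 0" unfolding a_def by (rule_tac nth_subdegree_nonzero)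
      moreover have "coeff q0 m = fps_nth (coeff p m) a"
        using \<open>m < n\<close> j by (simp add: q0_def cq d_def j_def)
      ultimately show ?thesis by simp
    qed
    have "m < n" using m(1) by (simp add: Z_def)
    then obtain x y where xy: "poly q0 x = 0" "poly q0 y = 0" "x \<noteq> y"
      using monic_two_roots[of q0 m] q0 \<open>coeff q0 (n - 1) = 0\<close> \<open>coeff q0 m \<noteq> 0\<close> by auto
    have "m \<noteq> n - 1" using \<open>coeff q0 (n - 1) = 0\<close> \<open>coeff q0 m \<noteq> 0\<close> by auto
    then have "degree q0 > 1" using \<open>m < n\<close> q0 by simp
    from alg_closed_imp_poly_splits_coprime[OF this xy] obtain r s where
      rs: "degree r > 0" "degree s > 0" "coprime r s" "q0 = r * s" .
    \<comment> \<open>The leading coefficients of \<open>r\<close> and \<open>s\<close> have product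
      1, so exchanging them makes both factors monic without changing the product.\<close>
    define g0 h0 where "g0 = smult (lead_coeff s) r" and "h0 = smult (lead_coeff r) s"
    have lrs: "lead_coeff r * lead_coeff s = 1" using q0(2) rs(4) by (simp add: lead_coeff_mult)
    then have nz: "lead_coeff r \<noteq> 0" "lead_coeff s \<noteq> 0" by auto
    have gh: "reduction 0 q = g0 * h0" "lead_coeff g0 = 1" "lead_coeff h0 = 1" "degree g0 > 0" "degree h0 > 0"
      using rs lrs nz by (simp_all add: g0_def h0_def ac_simps flip: q0_def)
    have "coprime g0 h0"
    proof (rule coprimeI)
      fix c assume "c dvd g0" "c dvd h0"
      then have "c dvd r" "c dvd s" using nz by (simp_all add: g0_def h0_def dvd_smult_iff)
      then show "is_unit c" using rs(3) by (rule_tac coprime_common_divisor)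
    qed
    from hensel_fps[OF deg_q(2) gh(1-3) \<open>coprime g0 h0\<close> gh(4,5)] obtain g h where
      g: "q = g * h" "lead_coeff g = 1" "degree g = degree g0" "lead_coeff h = 1" "degree h = degree h0" by blast
    have "degree g + degree h = n"
    proof -
      have "g \<noteq> 0" "h \<noteq> 0" using g by auto
      then show ?thesis using deg_q(1) g(1) by (simp add: degree_mult_eq)
    qed
    then have "degree g < degree p0" using g gh n_def by simp
    from less.hyps[OF this g(2)] g(3) gh(4) obtain e \<psi> where
      e: "e > 0" "poly (map_poly (ramify e) g) \<psi> = 0" by auto
    have home: "is_hom (ramify e :: 'a fps \<Rightarrow> _)" by (rule is_hom_ramify[OF e(1)])
    have "poly (map_poly (ramify e) q) \<psi> = 0"
      using e(2) by (simp add: g(1) is_hom_simps(3)[OF is_hom_map_poly[OF home]])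
    define Y where "Y = ramify e (fps_X ^ a :: 'a fps)"
    have deg_map: "degree (map_poly (ramify (e * j)) p) = n" "degree (map_poly (ramify e) q) = n"
      using monic_map_poly(1)[OF is_hom_ramify[of "e * j"], of p] monic_map_poly(1)[OF home deg_q(2)]
        top e j by (simp_all add: deg_p deg_q)
    have "poly (map_poly (ramify (e * j)) p) (Y * \<psi>) = (\<Sum>k\<le>n. ramify e (ramify j (coeff p k)) * (Y * \<psi>) ^ k)"
      using e j by (simp add: poly_altdef deg_map coeff_map_poly is_hom_simps[OF is_hom_ramify] ramify_ramify)
    also have "\<dots> = (\<Sum>k\<le>n. Y ^ n * (ramify e (d k) * \<psi> ^ k))"
    proof (intro sum.cong refl)
      fix k assume "k \<in> {..n}"
      then have "n - k + k = n" by simp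
      then have "Y ^ n = Y ^ (n - k) * Y ^ k" by (simp flip: power_add)
      moreover have "ramify e (ramify j (coeff p k)) = Y ^ (n - k) * ramify e (d k)"
        using d[of k] \<open>k \<in> {..n}\<close> by (simp add: is_hom_simps[OF home] power_mult Y_def)
      ultimately show "ramify e (ramify j (coeff p k)) * (Y * \<psi>) ^ k = Y ^ n * (ramify e (d k) * \<psi> ^ k)"
        by (simp add: power_mult_distrib ac_simps)
    qed
    also have "\<dots> = Y ^ n * poly (map_poly (ramify e) q) \<psi>"
      by (simp add: poly_altdef deg_map cq coeff_map_poly is_hom_simps[OF home] sum_distrib_left)
    finally have "poly (map_poly (ramify (e * j)) p) (Y * \<psi>) = 0"
      using \<open>poly (map_poly (ramify e) q) \<psi> = 0\<close> by simp
    then show ?thesis using goalI[of "e * j"] e j by simp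
  qed
qed

text \<open>Roots are split off one at a time. Each later ramification must also be applied to the
  roots found before, which are series in the old parameter.\<close>

theorem puiseux_splitting:
  fixes p :: "'a::{alg_closed_field, field_char_0, field_gcd} fps poly"
  assumes "lead_coeff p = 1"
  shows "\<exists>e \<psi>s. e > 0 \<and> map_poly (ramify e) p = (\<Prod>\<psi>\<leftarrow>\<psi>s. [:- \<psi>, 1:])"
  using assms
proof (induction "degree p" arbitrary: p)
  case 0
  then have "p = 1" by (metis degree_eq_zeroE lead_coeff_pCons(2) one_pCons degree_pCons_0 coeff_pCons_0)
  then show ?case by (intro exI[of _ 1] exI[of _ "[]"]) simp
next
  case (Suc n)
  obtain e \<psi> where e: "e > 0" "poly (map_poly (ramify e) p) \<psi> = 0"
    using puiseux_root[of p] Suc by auto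
  define p1 where "p1 = map_poly (ramify e) p"
  have p1: "degree p1 = Suc n" "lead_coeff p1 = 1"
    using monic_map_poly[OF is_hom_ramify[OF e(1)] Suc.prems] Suc.hyps(2) by (auto simp: p1_def)
  obtain q where q: "p1 = [:- \<psi>, 1:] * q"
    using e(2) by (auto simp: p1_def poly_eq_0_iff_dvd elim: dvdE)
  then have "lead_coeff p1 = lead_coeff [:- \<psi>, 1:] * lead_coeff q" by (simp only: lead_coeff_mult)
  then have "lead_coeff q = 1" using p1 by simp
  then have "q \<noteq> 0" by auto
  then have "degree p1 = Suc (degree q)" unfolding q using degree_mult_eq[of "[:- \<psi>, 1:]" q] by simp
  with Suc.hyps(1)[of q] p1 \<open>lead_coeff q = 1\<close> obtain f \<psi>s where
    f: "f > 0" "map_poly (ramify f) q = (\<Prod>\<psi>\<leftarrow>\<psi>s. [:- \<psi>, 1:])" by auto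
  have hom: "is_hom (ramify f :: 'a fps \<Rightarrow> _)" by (rule is_hom_ramify[OF f(1)])
  have "map_poly (ramify (f * e)) p = map_poly (ramify f) p1"
    unfolding p1_def using e f
    by (simp add: poly_eq_iff coeff_map_poly ramify_ramify is_hom_simps[OF is_hom_ramify])
  also have "\<dots> = [:- ramify f \<psi>, 1:] * (\<Prod>\<psi>\<leftarrow>\<psi>s. [:- \<psi>, 1:])"
    unfolding q is_hom_simps(3)[OF is_hom_map_poly[OF hom]] f(2)
    by (simp add: map_poly_linear[OF hom] is_hom_simps[OF hom])
  finally show ?case using e f
    by (intro exI[of _ "f * e"] exI[of _ "ramify f \<psi> # \<psi>s"]) simp
qed

section \<open>Archimedean and ultrametric places\<close>

definition is_subring :: "'a::field set \<Rightarrow> bool" where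
  "is_subring V \<longleftrightarrow> 1 \<in> V \<and> (\<forall>x\<in>V. \<forall>y\<in>V. x - y \<in> V \<and> x * y \<in> V)"

lemma is_subringD:
  assumes "is_subring V"
  shows "1 \<in> V" "0 \<in> V" "x \<in> V \<Longrightarrow> y \<in> V \<Longrightarrow> x - y \<in> V" "x \<in> V \<Longrightarrow> y \<in> V \<Longrightarrow> x * y \<in> V"
    "x \<in> V \<Longrightarrow> - x \<in> V" "x \<in> V \<Longrightarrow> y \<in> V \<Longrightarrow> x + y \<in> V" "of_int m \<in> V" "x \<in> V \<Longrightarrow> x ^ n \<in> V"
proof -
  show 1: "1 \<in> V" and diff: "\<And>x y. x \<in> V \<Longrightarrow> y \<in> V \<Longrightarrow> x - y \<in> V"
    and mult: "\<And>x y. x \<in> V \<Longrightarrow> y \<in> V \<Longrightarrow> x * y \<in> V"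
    using assms by (auto simp: is_subring_def)
  show 0: "0 \<in> V" using diff[OF 1 1] by simp
  show minus: "\<And>x. x \<in> V \<Longrightarrow> - x \<in> V" using diff[OF 0] by simp
  show add: "\<And>x y. x \<in> V \<Longrightarrow> y \<in> V \<Longrightarrow> x + y \<in> V" using diff[OF _ minus] by fastforce
  have "of_nat n \<in> V" for n by (induction n) (simp_all add: 0 1 add)
  then show "of_int m \<in> V" by (cases m rule: int_cases2) (simp_all add: minus)
  show "x \<in> V \<Longrightarrow> x ^ n \<in> V" by (induction n) (simp_all add: 1 mult)
qed

lemma is_subring_sum:
  assumes "is_subring V" "\<And>i. i \<in> I \<Longrightarrow> f i \<in> V"
  shows "sum f I \<in> V"
  using assms(2)
proof (induction I rule: infinite_finite_induct)
  case (insert i I)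
  then show ?case using is_subringD(6)[OF assms(1), of "f i" "sum f I"] by simp
qed (use is_subringD(2)[OF assms(1)] in simp_all)

lemma is_subring_adjoin:
  assumes V: "is_subring V"
  shows "is_subring {poly f x | f. \<forall>i. coeff f i \<in> V}" (is "is_subring ?W")
    and "V \<subseteq> {poly f x | f. \<forall>i. coeff f i \<in> V}"
    and "x \<in> {poly f x | f. \<forall>i. coeff f i \<in> V}"
proof -
  note D = is_subringD[OF V]
  show "is_subring ?W"
    unfolding is_subring_def
  proof (intro conjI ballI)
    have "\<forall>i. coeff 1 i \<in> V" by (simp add: coeff_1 D)
    then show "1 \<in> ?W" by (intro CollectI exI[of _ 1]) simp
  next
    fix a b assume "a \<in> ?W" "b \<in> ?W"
    then obtain f g where fg: "a = poly f x" "b = poly g x" "\<forall>i. coeff f i \<in> V" "\<forall>i. coeff g i \<in> V" by auto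
    have "\<forall>i. coeff (f - g) i \<in> V" using fg D by simp
    then show "a - b \<in> ?W" using fg by (intro CollectI exI[of _ "f - g"]) simp
    have "\<forall>i. coeff (f * g) i \<in> V" using fg D by (auto simp: coeff_mult intro!: is_subring_sum[OF V])
    then show "a * b \<in> ?W" using fg by (intro CollectI exI[of _ "f * g"]) simp
  qed
  show "V \<subseteq> ?W"
  proof
    fix a assume "a \<in> V"
    then have "\<forall>i. coeff [:a:] i \<in> V" by (simp add: coeff_pCons D split: nat.split)
    then show "a \<in> ?W" by (intro CollectI exI[of _ "[:a:]"]) simp
  qed
  have "\<forall>i. coeff (monom 1 1) i \<in> V" by (simp add: D)
  then show "x \<in> ?W" by (intro CollectI exI[of _ "monom 1 1"]) (simp add: poly_monom)
qed

definition abs_value :: "('a::field \<Rightarrow> real) \<Rightarrow> bool" where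
  "abs_value f \<longleftrightarrow> f 0 = 0 \<and> (\<forall>x. x \<noteq> 0 \<longrightarrow> f x > 0) \<and> (\<forall>x y. f (x * y) = f x * f y) \<and>
     (\<forall>x y. f (x + y) \<le> f x + f y)"

text \<open>Places live on the large field, not on \<open>k\<close>, so that they can be composed
  with its endomorphisms and evaluated at ordinates and roots.\<close>

definition arch_places :: "('a::field_char_0 \<Rightarrow> real) set" where
  "arch_places = {\<lambda>x. cmod (\<sigma> x) | \<sigma>. is_hom \<sigma>}"

text \<open>The last condition fixes the scale: a high power of a p-adic absolute value is again
  ultrametric, but would make integers too small for a uniform Liouville estimate.\<close>

definition ultra_places :: "('a::field_char_0 \<Rightarrow> real) set" where
  "ultra_places = {f. abs_value f \<and> (\<forall>x y. f (x + y) \<le> max (f x) (f y)) \<and>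
     (\<forall>m. m \<noteq> 0 \<longrightarrow> f (of_int m) \<ge> 1 / \<bar>of_int m\<bar>)}"

text \<open>
  A subring that is maximal among those not containing \<open>1 / p\<close> is a valuation ring. On algebraic elements
  its value group is a subgroup of the rationals: some power of \<open>x\<close> is a unit times a power of \<open>p\<close>.
\<close>

locale maximal_subring =
  fixes V :: "'a::field_char_0 set" and p :: nat
  assumes subring: "is_subring V" and prime_p: "prime p" and not_in: "inverse (of_nat p) \<notin> V"
    and maximal: "\<And>W. is_subring W \<Longrightarrow> V \<subseteq> W \<Longrightarrow> inverse (of_nat p) \<notin> W \<Longrightarrow> W = V"
begin

abbreviation P :: 'a where "P \<equiv> of_nat p"

lemmas V = is_subringD[OF subring]

lemma P_nonzero: "P \<noteq> 0"
  using prime_p not_prime_0 by (metis of_nat_eq_0_iff)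

lemma P_mem: "P \<in> V"
  using V(7)[of "int p"] by (metis of_int_of_nat_eq)

text \<open>\<open>P\<close> lies in the Jacobson radical of \<open>V\<close>: inverting all
  elements \<open>1 + P * b\<close> gives a ring that still omits the inverse of \<open>P\<close>,
  so by maximality these inverses are in \<open>V\<close> already.\<close>

lemma one_plus_unit:
  assumes b: "b \<in> V"
  shows "1 + P * b \<noteq> 0" "inverse (1 + P * b) \<in> V"
proof -
  have nz: "1 + P * b \<noteq> 0" if "b \<in> V" for b
  proof
    assume "1 + P * b = 0"
    then have "P * (- b) = 1" by (simp add: add_eq_0_iff)
    then have "inverse P = - b" by (simp add: inverse_unique)
    then show False using not_in V that by metis
  qed
  show "1 + P * b \<noteq> 0" by (rule nz[OF b])
  define W where "W = {c / (1 + P * b) | b c. b \<in> V \<and> c \<in> V}"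
  have "is_subring W"
    unfolding is_subring_def
  proof (intro conjI ballI)
    have "1 = 1 / (1 + P * 0)" by simp
    then show "1 \<in> W" unfolding W_def using V(1,2) by blast
  next
    fix x y assume "x \<in> W" "y \<in> W"
    then obtain a b c d where *: "a \<in> V" "b \<in> V" "c \<in> V" "d \<in> V" "x = c / (1 + P * a)" "y = d / (1 + P * b)"
      by (auto simp: W_def)
    define e where "e = a + b + P * (a * b)"
    have e: "e \<in> V" "(1 + P * a) * (1 + P * b) = 1 + P * e"
      unfolding e_def using * P_mem V(4,6) by (auto simp: algebra_simps)
    have "x - y = (c * (1 + P * b) - d * (1 + P * a)) / (1 + P * e)"
      unfolding *(5,6) e(2)[symmetric] using nz[OF *(1)] nz[OF *(2)] by (simp add: diff_frac_eq)
    moreover have "c * (1 + P * b) - d * (1 + P * a) \<in> V"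
      by (intro V(1,3,4,6) P_mem *(1-4))
    ultimately show "x - y \<in> W" using e unfolding W_def by blast
    have "x * y = c * d / (1 + P * e)" using * by (simp add: e(2)[symmetric])
    then show "x * y \<in> W" using e * V(4) unfolding W_def by blast
  qed
  moreover have "V \<subseteq> W"
  proof
    fix x assume "x \<in> V"
    moreover have "x = x / (1 + P * 0)" by simp
    ultimately show "x \<in> W" unfolding W_def using V(2) by blast
  qed
  moreover have "inverse P \<notin> W"
  proof
    assume "inverse P \<in> W"
    then obtain b c where *: "b \<in> V" "c \<in> V" "inverse P = c / (1 + P * b)" by (auto simp: W_def)
    then have "1 + P * b = P * c" using nz[of b] P_nonzero by (simp add: field_simps)
    then have "P * (c - b) = 1" by (simp add: algebra_simps)
    then have "inverse P = c - b" by (simp add: inverse_unique)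
    then show False using not_in V * by metis
  qed
  ultimately have "W = V" using maximal by blast
  moreover have "inverse (1 + P * b) = 1 / (1 + P * b)" by (simp add: inverse_eq_divide)
  ultimately show "inverse (1 + P * b) \<in> V" using b V(1) unfolding W_def by blast
qed

lemma adjoin_outside:
  assumes "x \<notin> V"
  shows "\<exists>f. (\<forall>i. coeff f i \<in> V) \<and> poly f x = inverse P"
proof (rule ccontr)
  assume "\<not> ?thesis"
  then have "inverse P \<notin> {poly f x | f. \<forall>i. coeff f i \<in> V}" by fastforce
  then have "{poly f x | f. \<forall>i. coeff f i \<in> V} = V"
    using is_subring_adjoin[OF subring] by (intro maximal) blast+
  then show False using assms is_subring_adjoin(3)[OF subring, of x] by blast
qed

text \<open>In the relation for \<open>inverse x\<close> the constant term can be absorbed, because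
  \<open>1 - P * coeff g 0\<close> is a unit. After multiplication by \<open>x ^ n\<close> this
  writes \<open>x ^ n\<close> through lower powers, which replaces the top term of
  \<open>f\<close>.\<close>

lemma reduce_degree:
  assumes x: "x \<noteq> 0" and f: "\<forall>i. coeff f i \<in> V" "poly f x = inverse P" "degree f > 0"
    and g: "\<forall>i. coeff g i \<in> V" "poly g (inverse x) = inverse P" "degree g \<le> degree f"
  shows "\<exists>f'. (\<forall>i. coeff f' i \<in> V) \<and> poly f' x = inverse P \<and> degree f' < degree f"
proof -
  define n m where "n = degree f" and "m = degree g"
  define u where "u = inverse (1 + P * (- coeff g 0))"
  have u: "u \<in> V" "u * (1 - P * coeff g 0) = 1"
    using one_plus_unit[of "- coeff g 0"] g(1) V(5) unfolding u_def by (auto simp: field_simps)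
  define h where "h = (\<Sum>j\<in>{1..m}. monom (coeff g j) (n - j))"
  define f' where "f' = f - monom (lead_coeff f) n + smult (lead_coeff f * P * u) h"
  have "1 = P * poly g (inverse x)" using P_nonzero by (simp add: g(2))
  also have "poly g (inverse x) = coeff g 0 + (\<Sum>j\<in>{1..m}. coeff g j * inverse x ^ j)"
    by (simp add: poly_altdef m_def atMost_atLeast0 sum.atLeast_Suc_atMost)
  finally have "1 - P * coeff g 0 = P * (\<Sum>j\<in>{1..m}. coeff g j * inverse x ^ j)"
    by (simp add: algebra_simps)
  then have "1 = P * u * (\<Sum>j\<in>{1..m}. coeff g j * inverse x ^ j)"
    using u(2) by (simp add: ac_simps)
  then have "x ^ n = P * u * ((\<Sum>j\<in>{1..m}. coeff g j * inverse x ^ j) * x ^ n)"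
    using arg_cong[of _ _ "\<lambda>z. z * x ^ n"] by (fastforce simp: mult.assoc)
  also have "(\<Sum>j\<in>{1..m}. coeff g j * inverse x ^ j) * x ^ n = poly h x"
    unfolding h_def poly_sum poly_monom sum_distrib_right
  proof (intro sum.cong refl)
    fix j assume "j \<in> {1..m}"
    then have "j \<le> n" using g(3) by (simp add: n_def m_def)
    then show "coeff g j * inverse x ^ j * x ^ n = coeff g j * x ^ (n - j)"
      using x by (simp add: power_diff field_simps)
  qed
  finally have xn: "x ^ n = P * u * poly h x" .
  have "poly f' x = poly f x"
    by (simp add: f'_def poly_monom xn)
  moreover have "coeff f' i \<in> V" for i
  proof -
    have "coeff h i \<in> V"
      unfolding h_def coeff_sum using g(1) V(2) by (intro is_subring_sum[OF subring]) simp
    moreover have "coeff (monom (lead_coeff f) n) i \<in> V" using f(1) V(2) by simp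
    moreover have "lead_coeff f * P * u \<in> V" using f(1) u(1) P_mem V(4) by blast
    ultimately show ?thesis
      unfolding f'_def coeff_add coeff_diff coeff_smult using f(1) V(3,4,6) by blast
  qed
  moreover have "degree f' < n"
  proof -
    have "coeff f' i = 0" if "i \<ge> n" for i
    proof -
      have "coeff h i = 0" unfolding h_def coeff_sum using that f(3) g(3)
        by (intro sum.neutral) (auto simp: n_def m_def)
      then show ?thesis using that by (cases "i = n") (auto simp: f'_def n_def coeff_eq_0)
    qed
    then show ?thesis using f(3) unfolding n_def
      by (metis degree_0 leading_coeff_0_iff not_le)
  qed
  ultimately show ?thesis using f(2) n_def by auto
qed

text \<open>If neither element is in \<open>V\<close>, adjoining either produces the inverse of
  \<open>P\<close>. Of two such relations of least degree, the one of larger or equal degree can be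
  shortened with the other.\<close>

lemma valuation_ring:
  assumes "x \<noteq> 0"
  shows "x \<in> V \<or> inverse x \<in> V"
proof (rule ccontr)
  assume neg: "\<not> ?thesis"
  define A where "A = (\<lambda>x f. (\<forall>i. coeff f i \<in> V) \<and> poly f x = inverse P)"
  have deg: "degree f > 0" if "A x f" for f x
  proof (rule ccontr)
    assume "\<not> degree f > 0"
    then obtain c where "f = [:c:]" by (metis degree_eq_zeroE gr0I)
    then show False using that not_in unfolding A_def by (metis coeff_pCons_0 poly_pCons mult_zero_right add_0_right poly_0)
  qed
  have "\<exists>f. A x f \<and> (\<forall>f'. A x f' \<longrightarrow> degree f \<le> degree f')" if x: "x \<notin> V" for x
  proof -
    obtain f where "A x f" using adjoin_outside[OF x] unfolding A_def by blast
    then show ?thesis by (rule ex_has_least_nat)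
  qed
  from this[of x] this[of "inverse x"] neg obtain f g where
    f: "A x f" "\<And>f'. A x f' \<Longrightarrow> degree f \<le> degree f'" and
    g: "A (inverse x) g" "\<And>f'. A (inverse x) f' \<Longrightarrow> degree g \<le> degree f'" by blast
  show False
  proof (cases "degree g \<le> degree f")
    case True
    from reduce_degree[of x f g, OF assms] f(1) g(1) deg[OF f(1)] True
    obtain f' where "A x f'" "degree f' < degree f" unfolding A_def by blast
    then show False using f(2) by fastforce
  next
    case False
    from reduce_degree[of "inverse x" g f] assms f(1) g(1) deg[OF g(1)] False
    obtain f' where "A (inverse x) f'" "degree f' < degree g" unfolding A_def by auto
    then show False using g(2) by fastforce
  qed
qed

definition U :: "'a set" where
  "U = {x. x \<noteq> 0 \<and> x \<in> V \<and> inverse x \<in> V}"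

lemma U_ops:
  shows "1 \<in> U" "x \<in> U \<Longrightarrow> y \<in> U \<Longrightarrow> x * y \<in> U" "x \<in> U \<Longrightarrow> inverse x \<in> U"
    "x \<in> U \<Longrightarrow> x ^ n \<in> U" "x \<in> U \<Longrightarrow> - x \<in> U" "x \<in> U \<Longrightarrow> x powi m \<in> U"
proof -
  show 1: "1 \<in> U" by (simp add: U_def V)
  show mult: "\<And>x y. x \<in> U \<Longrightarrow> y \<in> U \<Longrightarrow> x * y \<in> U" by (auto simp: U_def intro!: V)
  show inv: "\<And>x. x \<in> U \<Longrightarrow> inverse x \<in> U" by (auto simp: U_def)
  show power: "x \<in> U \<Longrightarrow> x ^ n \<in> U" for n by (induction n) (auto intro: 1 mult)
  show "x \<in> U \<Longrightarrow> - x \<in> U" by (auto simp: U_def intro!: V)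
  show "x \<in> U \<Longrightarrow> x powi m \<in> U"
    using power[of "nat m"] inv[OF power[of "nat (- m)"]] by (simp add: power_int_def power_inverse)
qed

lemma P_powi_U:
  assumes "P powi m \<in> U"
  shows "m = 0"
proof -
  have "\<not> P powi k \<in> U" if "k > 0" for k
  proof
    assume k: "P powi k \<in> U"
    have "P powi (k - 1) = P ^ nat (k - 1)" using that by (simp add: power_int_def)
    then have "P powi (k - 1) \<in> V" using V(8)[OF P_mem] by simp
    moreover have "inverse (P powi k) \<in> V" using k by (simp add: U_def)
    ultimately have "P powi (k - 1) * inverse (P powi k) \<in> V" by (rule V(4))
    moreover have "P powi (k - 1) * inverse (P powi k) = inverse P"
      using P_nonzero that by (simp add: power_int_diff field_simps)
    ultimately show False using not_in by simp
  qed
  moreover have "P powi (- m) \<in> U" using U_ops(3)[OF assms] by (simp add: power_int_minus)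
  ultimately show ?thesis using assms by (metis linorder_neqE neg_0_less_iff_less)
qed

text \<open>\<open>V\<close> is local: one of two nonzero nonunits divides the other, so a unit sum
  would make the divisor a unit.\<close>

lemma nonunit_add:
  assumes x: "x \<in> V" "x \<notin> U" and y: "y \<in> V" "y \<notin> U"
  shows "x + y \<notin> U"
proof -
  have aux: "x + y \<notin> U" if x: "x \<in> V" "x \<notin> U" and y: "y \<in> V" "y \<notin> U" "y \<noteq> 0" "x / y \<in> V" for x y
  proof
    assume xy: "x + y \<in> U"
    have "x + y = y * (1 + x / y)" using y(3) by (simp add: algebra_simps)
    then have "inverse y = (1 + x / y) * inverse (x + y)"
      using y(3) xy by (auto simp: U_def field_simps)
    moreover have "(1 + x / y) * inverse (x + y) \<in> V"
      using xy y by (auto simp: U_def intro!: V)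
    ultimately show False using y by (simp add: U_def)
  qed
  show ?thesis
  proof (cases "x = 0 \<or> y = 0")
    case False
    then have "x / y \<noteq> 0" by simp
    then have "x / y \<in> V \<or> y / x \<in> V" using valuation_ring[of "x / y"] by simp
    then show ?thesis using aux[of x y] aux[of y x] False assms by (auto simp: add.commute)
  qed (use assms in auto)
qed

lemma nonunit_sum:
  assumes "finite I" "\<And>i. i \<in> I \<Longrightarrow> f i \<in> V \<and> f i \<notin> U"
  shows "sum f I \<in> V \<and> sum f I \<notin> U"
  using assms
proof (induction I rule: finite_induct)
  case empty
  then show ?case using V(2) by (simp add: U_def)
next
  case (insert i I)
  then show ?case using nonunit_add[of "f i" "sum f I"] V(6)[of "f i" "sum f I"] by simp
qed

lemma max_term:
  assumes "finite I" "I \<noteq> {}" "\<And>i. i \<in> I \<Longrightarrow> f i \<noteq> 0"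
  shows "\<exists>k\<in>I. \<forall>i\<in>I. f i / f k \<in> V"
  using assms
proof (induction I rule: finite_ne_induct)
  case (singleton i)
  then show ?case using V(1) by simp
next
  case (insert i I)
  then obtain k where k: "k \<in> I" "\<forall>i\<in>I. f i / f k \<in> V" by auto
  have nz: "f i \<noteq> 0" "f k \<noteq> 0" using insert.prems k by auto
  then have "f i / f k \<in> V \<or> f k / f i \<in> V" using valuation_ring[of "f i / f k"] by simp
  then show ?case
  proof
    assume "f i / f k \<in> V"
    then show ?thesis using k by auto
  next
    assume ki: "f k / f i \<in> V"
    have "f j / f i \<in> V" if "j \<in> I" for j
    proof -
      have "f j / f i = (f j / f k) * (f k / f i)" using nz by simp
      then show ?thesis using V(4) ki k(2) that by metis
    qed
    then show ?thesis using nz V(1) by auto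
  qed
qed

text \<open>Divide by a dominating term. If no two terms were associated, the remaining quotients
  would be nonunits with sum \<open>- 1\<close>.\<close>

lemma zero_sum_two_associated:
  assumes I: "finite I" "I \<noteq> {}" "\<And>i. i \<in> I \<Longrightarrow> f i \<noteq> 0" and sum: "sum f I = 0"
  shows "\<exists>i\<in>I. \<exists>k\<in>I. i \<noteq> k \<and> f i / f k \<in> U"
proof (rule ccontr)
  assume neg: "\<not> ?thesis"
  obtain k where k: "k \<in> I" "\<forall>i\<in>I. f i / f k \<in> V" using max_term[OF I(1,2), of f] I(3) by blast
  then have "(\<Sum>i\<in>I - {k}. f i / f k) \<in> V \<and> (\<Sum>i\<in>I - {k}. f i / f k) \<notin> U"
    using neg I(1) by (intro nonunit_sum) auto
  moreover have "(\<Sum>i\<in>I - {k}. f i / f k) = - 1"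
  proof -
    have "0 = sum f I / f k" using sum by simp
    also have "\<dots> = f k / f k + (\<Sum>i\<in>I - {k}. f i / f k)"
      unfolding sum_divide_distrib using I(1) k(1) by (simp add: sum.remove[of I k])
    finally show ?thesis using I(3)[OF k(1)] by (simp add: add_eq_0_iff)
  qed
  ultimately show False using U_ops(1,5) by metis
qed

text \<open>An integer \<open>b\<close> prime to \<open>p\<close> is a unit of \<open>V\<close>:
  Bezout gives a multiple of \<open>b\<close> of the form \<open>1 + P * s\<close>, which is
  invertible.\<close>

lemma int_valuation:
  assumes "a \<noteq> 0"
  shows "\<exists>k. of_int a / P ^ k \<in> U \<and> int p ^ k dvd a"
proof -
  have p: "prime (int p)" using prime_p by simp
  have "\<not> is_unit (int p)" using p not_prime_unit by blast
  with assms obtain b where "a = int p ^ multiplicity (int p) a * b" "\<not> int p dvd b"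
    by (rule multiplicity_decompose'[of a "int p"])
  then obtain k where kb: "a = int p ^ k * b" "\<not> int p dvd b" by blast
  then have "coprime b (int p)" using p prime_imp_coprime coprime_commute by metis
  then obtain r s where "r * b + s * int p = 1"
    using bezout_int[of b "int p"] by (auto simp: coprime_iff_gcd_eq_1)
  then have rs: "b * r + int p * s = 1" by (simp add: mult.commute)
  have "(1 :: 'a) + P * (- of_int s) = of_int b * of_int r"
    using arg_cong[OF rs, of "of_int :: int \<Rightarrow> 'a"] by (simp add: algebra_simps)
  then have unit: "of_int b * (of_int r :: 'a) \<noteq> 0" "inverse (of_int b * of_int r) \<in> V"
    using one_plus_unit[of "- of_int s"] V(5,7) by metis+
  have "inverse (of_int b) = of_int r * inverse (of_int b * of_int r :: 'a)"
    using unit(1) by (simp add: field_simps)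
  then have "inverse (of_int b) \<in> V" using V(4)[OF V(7)[of r] unit(2)] by metis
  then have "of_int b \<in> U" using unit(1) V(7) by (auto simp: U_def)
  moreover have "of_int a / P ^ k = of_int b" using P_nonzero by (simp add: kb(1))
  ultimately show ?thesis using kb(1) by (metis dvd_triv_left)
qed

text \<open>Two terms of an integral equation for \<open>x\<close> have equal value. Their quotient
  compares a power of \<open>x\<close> with a quotient of two integers, whose value is a power of
  \<open>P\<close>.\<close>

lemma algebraic_valuation:
  assumes "algebraic x" "x \<noteq> 0"
  shows "\<exists>n m. n > (0::nat) \<and> x ^ n / P powi m \<in> U"
proof -
  obtain f where f: "\<And>i. coeff f i \<in> \<int>" "f \<noteq> 0" "poly f x = 0"
    using assms(1) unfolding algebraic_def by blast
  define I where "I = {i. i \<le> degree f \<and> coeff f i \<noteq> 0}"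
  have I: "finite I" "I \<noteq> {}" using f(2) by (auto simp: I_def intro: exI[of _ "degree f"])
  have "(\<Sum>i\<in>I. coeff f i * x ^ i) = poly f x"
    unfolding poly_altdef by (intro sum.mono_neutral_left) (auto simp: I_def)
  then have "(\<Sum>i\<in>I. coeff f i * x ^ i) = 0" using f(3) by simp
  then obtain i k where ik: "i \<in> I" "k \<in> I" "i \<noteq> k" "(coeff f i * x ^ i) / (coeff f k * x ^ k) \<in> U"
    using zero_sum_two_associated[of I "\<lambda>i. coeff f i * x ^ i"] I assms(2) by (auto simp: I_def)
  have val: "\<exists>j. coeff f i / P ^ j \<in> U" if "i \<in> I" for i
    using f(1)[of i] int_valuation that by (auto simp: I_def elim!: Ints_cases) metis
  obtain r s where rs: "coeff f i / P ^ r \<in> U" "coeff f k / P ^ s \<in> U"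
    using val[OF ik(1)] val[OF ik(2)] by blast
  have nz: "coeff f i \<noteq> 0" "coeff f k \<noteq> 0" using ik by (auto simp: I_def)
  define u where "u = (coeff f i * x ^ i) / (coeff f k * x ^ k) * (coeff f k / P ^ s) * inverse (coeff f i / P ^ r)"
  have u: "u \<in> U" unfolding u_def by (intro U_ops ik(4) rs)
  have u_eq: "u = x powi (int i - int k) * P powi (int r - int s)"
    using nz assms(2) P_nonzero by (simp add: u_def power_int_diff field_simps)
  show ?thesis
  proof (cases "i > k")
    case True
    then have "x powi (int i - int k) = x ^ (i - k)" by (simp add: power_int_def nat_diff_distrib)
    moreover have "P powi (int r - int s) = inverse (P powi (int s - int r))"
      by (metis minus_diff_eq power_int_minus)
    ultimately have "x ^ (i - k) / P powi (int s - int r) \<in> U"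
      using u by (simp add: u_eq field_class.field_divide_inverse)
    then show ?thesis using True zero_less_diff by blast
  next
    case False
    then have "i < k" using ik(3) by simp
    then have "x powi (int k - int i) = x ^ (k - i)" by (simp add: power_int_def nat_diff_distrib)
    moreover have "inverse u = x powi (int k - int i) * inverse (P powi (int r - int s))"
      unfolding u_eq inverse_mult_distrib by (metis minus_diff_eq power_int_minus)
    ultimately have "x ^ (k - i) / P powi (int r - int s) \<in> U"
      using U_ops(3)[OF u] by (simp add: field_class.field_divide_inverse)
    then show ?thesis using \<open>i < k\<close> zero_less_diff by blast
  qed
qed

text \<open>The additive valuation normalized by giving \<open>P\<close> the value 1. It is a
  relation because \<open>n\<close> and \<open>m\<close> are not unique; only their quotient
  is.\<close>

definition has_ord :: "'a \<Rightarrow> real \<Rightarrow> bool" where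
  "has_ord x r \<longleftrightarrow> x \<noteq> 0 \<and> (\<exists>n m. n > (0::nat) \<and> x ^ n / P powi m \<in> U \<and> r = of_int m / of_nat n)"

lemma has_ord_unique:
  assumes "has_ord x r" "has_ord x s"
  shows "r = s"
proof -
  obtain n m k l where *: "x \<noteq> 0" "n > 0" "x ^ n / P powi m \<in> U" "r = of_int m / of_nat n"
    "k > 0" "x ^ k / P powi l \<in> U" "s = of_int l / of_nat k"
    using assms by (auto simp: has_ord_def)
  define a where "a = x ^ n / P powi m"
  define b where "b = x ^ k / P powi l"
  have "a ^ k * inverse (b ^ n) \<in> U"
    unfolding a_def b_def by (intro U_ops *)
  moreover have "a ^ k = x ^ (n * k) / P powi (m * int k)"
    by (simp add: a_def power_divide power_mult power_int_mult)
  moreover have "b ^ n = x ^ (n * k) / P powi (l * int n)"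
    by (simp add: b_def power_divide power_mult power_int_mult mult.commute[of n])
  ultimately have "P powi (l * int n) / P powi (m * int k) \<in> U"
    using *(1) P_nonzero by (simp add: field_simps)
  then have "P powi (l * int n - m * int k) \<in> U" using P_nonzero by (simp add: power_int_diff)
  then have "l * int n = m * int k" using P_powi_U by fastforce
  then have "of_int l * of_nat n = (of_int m * of_nat k :: real)"
    by (metis of_int_mult of_int_of_nat_eq)
  then show ?thesis unfolding *(4,7) using *(2,5) by (simp add: frac_eq_eq)
qed

lemma has_ord_mult:
  assumes "has_ord x r" "has_ord y s"
  shows "has_ord (x * y) (r + s)"
proof -
  obtain n m k l where *: "x \<noteq> 0" "n > 0" "x ^ n / P powi m \<in> U" "r = of_int m / of_nat n"
    "y \<noteq> 0" "k > 0" "y ^ k / P powi l \<in> U" "s = of_int l / of_nat k"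
    using assms by (auto simp: has_ord_def)
  have "(x ^ n / P powi m) ^ k * (y ^ k / P powi l) ^ n \<in> U" by (intro U_ops *)
  moreover have "(x ^ n) ^ k = x ^ (n * k)" "(y ^ k) ^ n = y ^ (n * k)"
    by (simp_all add: mult.commute flip: power_mult)
  then have "(x ^ n / P powi m) ^ k * (y ^ k / P powi l) ^ n = (x * y) ^ (n * k) / P powi (m * int k + l * int n)"
    using P_nonzero by (simp add: power_divide power_int_mult power_int_add power_mult_distrib)
  ultimately have "(x * y) ^ (n * k) / P powi (m * int k + l * int n) \<in> U" by simp
  moreover have "r + s = of_int (m * int k + l * int n) / of_nat (n * k)"
    using * by (simp add: field_simps)
  ultimately show ?thesis unfolding has_ord_def using * by (metis mult_eq_0_iff nat_0_less_mult_iff)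
qed

text \<open>A negative value would put the inverse of \<open>P\<close> into \<open>V\<close>. For
  the converse, \<open>x ^ n\<close> is in \<open>V\<close>, and if \<open>inverse x\<close> is too,
  then \<open>x\<close> is the product of \<open>x ^ n\<close> and
  \<open>inverse x ^ (n - 1)\<close>.\<close>

lemma has_ord_mem:
  assumes "has_ord x r"
  shows "x \<in> V \<longleftrightarrow> r \<ge> 0"
proof -
  obtain n m where *: "x \<noteq> 0" "n > 0" "x ^ n / P powi m \<in> U" "r = of_int m / of_nat n"
    using assms by (auto simp: has_ord_def)
  have r: "r \<ge> 0 \<longleftrightarrow> m \<ge> 0" using * by (simp add: zero_le_divide_iff)
  show ?thesis
  proof
    assume "x \<in> V"
    show "r \<ge> 0"
    proof (rule ccontr)
      assume "\<not> r \<ge> 0"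
      then have m: "m < 0" using r by simp
      have "inverse (x ^ n / P powi m) * x ^ n * P ^ nat (- m - 1) \<in> V"
        using *(3) \<open>x \<in> V\<close> P_mem by (intro V) (auto simp: U_def)
      moreover have "inverse (x ^ n / P powi m) * x ^ n * P ^ nat (- m - 1) = P powi m * P powi (- m - 1)"
        using * m by (simp add: power_int_def)
      moreover have "\<dots> = inverse P"
        using P_nonzero by (simp flip: power_int_add add: power_int_minus)
      ultimately show False using not_in by simp
    qed
  next
    assume "r \<ge> 0"
    then have "m \<ge> 0" using r by simp
    then have "P powi m \<in> V" using V(8)[OF P_mem] by (simp add: power_int_def)
    then have "(x ^ n / P powi m) * P powi m \<in> V" using *(3) by (intro V) (simp_all add: U_def)
    then have xn: "x ^ n \<in> V" using P_nonzero by simp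
    show "x \<in> V"
    proof (rule ccontr)
      assume "x \<notin> V"
      then have "inverse x \<in> V" using valuation_ring[OF *(1)] by blast
      then have "x ^ n * inverse x ^ (n - 1) \<in> V" using V(4)[OF xn V(8)] by blast
      moreover have "x ^ n * inverse x ^ (n - 1) = x"
      proof -
        have "x ^ (n - 1) * inverse x ^ (n - 1) = 1" using *(1) by (simp flip: power_mult_distrib)
        then show ?thesis using *(2) by (metis mult.assoc mult.right_neutral power_minus_mult mult.commute)
      qed
      ultimately show False using \<open>x \<notin> V\<close> by simp
    qed
  qed
qed

lemma valuation_place:
  assumes alg: "\<And>x :: 'a. algebraic x"
  shows "\<exists>f\<in>ultra_places. f P < 1"
proof -
  have "\<exists>r. has_ord x r" if "x \<noteq> 0" for x
    using algebraic_valuation[OF alg that] that unfolding has_ord_def by blast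
  then obtain v where v: "\<And>x. x \<noteq> 0 \<Longrightarrow> has_ord x (v x)" by metis
  \<comment> \<open>Any base above 1 gives an absolute value. The base 2 is at most
    \<open>p\<close>, so an integer exactly divisible by \<open>p ^ k\<close> receives
    \<open>1 / 2 ^ k\<close>, which respects the lower bound on integers in
    \<open>ultra_places\<close>.\<close>
  define f where "f = (\<lambda>x. if x = 0 then 0 else 2 powr (- v x))"
  have mult: "f (x * y) = f x * f y" for x y
  proof (cases "x = 0 \<or> y = 0")
    case False
    then have "v (x * y) = v x + v y" using has_ord_mult[OF v v, of x y] v[of "x * y"] has_ord_unique by auto
    then show ?thesis using False by (simp add: f_def flip: powr_add)
  qed (auto simp: f_def)
  have mem: "x \<in> V \<longleftrightarrow> f x \<le> 1" for x
  proof (cases "x = 0")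
    case False
    have "(2 powr (- v x) \<le> (1::real)) \<longleftrightarrow> - v x \<le> 0" using powr_le_cancel_iff[of 2 "- v x" 0] by simp
    then show ?thesis using has_ord_mem[OF v[OF False]] False by (simp add: f_def)
  qed (simp add: f_def V)
  have nonneg: "f x \<ge> 0" and pos: "x \<noteq> 0 \<Longrightarrow> f x > 0" and zero: "f 0 = 0" for x
    by (auto simp: f_def)
  have ultra: "f (x + y) \<le> max (f x) (f y)" for x y
  proof -
    have aux: "f (x + y) \<le> f y" if "f x \<le> f y" for x y
    proof (cases "y = 0")
      case True
      then have "x = 0" using that pos[of x] zero by (metis not_le)
      then show ?thesis using True by simp
    next
      case False
      have "f (x / y) * f y = f x" using mult[of "x / y" y] False by simp
      then have "f (x / y) = f x / f y" using pos[OF False] by (simp add: field_simps)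
      then have "f (x / y) \<le> 1" using that pos[OF False] by simp
      then have "1 + x / y \<in> V" using mem[of "x / y"] V(6)[OF V(1)] by blast
      then have "f (1 + x / y) * f y \<le> 1 * f y" using mem nonneg by (intro mult_right_mono) auto
      moreover have "f (1 + x / y) * f y = f (x + y)"
      proof -
        have "(1 + x / y) * y = x + y" using False by (simp add: distrib_right)
        then show ?thesis by (simp only: mult[symmetric])
      qed
      ultimately show ?thesis by simp
    qed
    show ?thesis using aux[of x y] aux[of y x] by (auto simp: max_def add.commute)
  qed
  have int: "f (of_int a) \<ge> 1 / \<bar>of_int a\<bar>" if a: "a \<noteq> 0" for a
  proof -
    obtain k where k: "of_int a / P ^ k \<in> U" "int p ^ k dvd a" using int_valuation[OF a] by blast
    have "of_int a ^ 1 / P powi (int k) \<in> U" using k by simp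
    then have "has_ord (of_int a) (of_int (int k) / of_nat 1)"
      unfolding has_ord_def using that by (intro conjI exI[of _ 1] exI[of _ "int k"]) auto
    then have "v (of_int a) = real k" using has_ord_unique[OF v[of "of_int a"]] that by simp
    then have "f (of_int a) = 1 / 2 ^ k" using that
      by (simp add: f_def powr_minus powr_realpow divide_inverse)
    moreover have "2 ^ k \<le> \<bar>of_int a :: real\<bar>"
    proof -
      have "2 ^ k \<le> int p ^ k" using prime_ge_2_nat[OF prime_p] by (intro power_mono) auto
      also have "\<dots> \<le> \<bar>a\<bar>" using k(2) that by (intro zdvd_imp_le) auto
      finally have "of_int (2 ^ k) \<le> (of_int \<bar>a\<bar> :: real)" unfolding of_int_le_iff .
      then show ?thesis by simp
    qed
    ultimately show ?thesis by (simp add: frac_le)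
  qed
  have "f P < 1"
  proof -
    have "f P * f (inverse P) = f 1" using mult[of P "inverse P"] P_nonzero by simp
    moreover have "f 1 = 1" using mult[of 1 1] pos[of 1] by simp
    moreover have "f (inverse P) > 1" using mem[of "inverse P"] not_in by auto
    ultimately show ?thesis using pos[OF P_nonzero]
      by (metis mult_less_cancel_left_pos mult.right_neutral)
  qed
  moreover have "f (x + y) \<le> f x + f y" for x y
    using ultra[of x y] nonneg[of x] nonneg[of y] by linarith
  ultimately show ?thesis
    using ultra int mult pos zero
    by (intro bexI[of _ f]) (auto simp: ultra_places_def abs_value_def)
qed

end

text \<open>Zorn's lemma applies to the subrings that omit the inverse of \<open>p\<close>, of which
  the ring of integers is one.\<close>

lemma exists_place_above_prime:
  assumes alg: "\<And>x :: 'a::field_char_0. algebraic x" and p: "prime p"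
  shows "\<exists>f\<in>ultra_places. f (of_nat p :: 'a) < 1"
proof -
  define A where "A = {W :: 'a set. is_subring W \<and> inverse (of_nat p) \<notin> W}"
  have "\<exists>M\<in>A. \<forall>M'\<in>A. M \<subseteq> M' \<longrightarrow> M' = M"
  proof (rule subset_Zorn_nonempty)
    have "is_subring (\<int> :: 'a set)" by (auto simp: is_subring_def)
    moreover have "inverse (of_nat p :: 'a) \<notin> \<int>"
    proof
      assume "inverse (of_nat p :: 'a) \<in> \<int>"
      then obtain m where "inverse (of_nat p :: 'a) = of_int m" by (elim Ints_cases)
      then have "of_int (m * int p) = (1 :: 'a)" using p by (simp add: field_simps)
      then have "m * int p = 1" by (metis of_int_eq_1_iff)
      then have "int p dvd 1" by (metis dvd_triv_right)
      then show False using p by (simp add: prime_nat_iff)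
    qed
    ultimately show "A \<noteq> {}" by (auto simp: A_def)
  next
    fix C assume C: "C \<noteq> {}" "subset.chain A C"
    have sub: "\<And>S. S \<in> C \<Longrightarrow> is_subring S \<and> inverse (of_nat p) \<notin> S" and
      ch: "\<And>S T. S \<in> C \<Longrightarrow> T \<in> C \<Longrightarrow> S \<subseteq> T \<or> T \<subseteq> S"
      using C(2) unfolding subset.chain_def A_def by blast+
    have "is_subring (\<Union>C)"
      unfolding is_subring_def
    proof (intro conjI ballI)
      show "1 \<in> \<Union>C" using C(1) sub is_subringD(1) by blast
    next
      fix a b assume "a \<in> \<Union>C" "b \<in> \<Union>C"
      then obtain S where "S \<in> C" "a \<in> S" "b \<in> S" using ch by blast
      then show "a - b \<in> \<Union>C" "a * b \<in> \<Union>C" using sub is_subringD(3,4) by blast+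
    qed
    then show "\<Union>C \<in> A" using sub by (auto simp: A_def)
  qed
  then obtain M where M: "M \<in> A" "\<And>M'. M' \<in> A \<Longrightarrow> M \<subseteq> M' \<Longrightarrow> M' = M" by blast
  interpret maximal_subring M p
  proof
    show "is_subring M" "prime p" "inverse (of_nat p) \<notin> M" using M(1) p by (simp_all add: A_def)
    show "W = M" if "is_subring W" "M \<subseteq> W" "inverse (of_nat p) \<notin> W" for W
      using M(2)[of W] that by (simp add: A_def)
  qed
  show ?thesis by (rule valuation_place[OF alg])
qed

section \<open>Liouville's inequality\<close>

lemma abs_valueD:
  assumes "abs_value f"
  shows "f 0 = 0" "x \<noteq> 0 \<Longrightarrow> f x > 0" "f (x * y) = f x * f y" "f (x + y) \<le> f x + f y"
    "f x \<ge> 0" "f 1 = 1" "f (- x) = f x" "f (x ^ n) = f x ^ n" "f (inverse x) = inverse (f x)"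
    "f (x - y) \<le> f x + f y" "f (x / y) = f x / f y"
proof -
  show 0: "f 0 = 0" and pos: "\<And>x. x \<noteq> 0 \<Longrightarrow> f x > 0" and mult: "\<And>x y. f (x * y) = f x * f y"
    and add: "\<And>x y. f (x + y) \<le> f x + f y"
    using assms by (auto simp: abs_value_def)
  show nonneg: "\<And>x. f x \<ge> 0" using 0 pos by (metis less_eq_real_def)
  show 1: "f 1 = 1" using mult[of 1 1] pos[of 1] by simp
  show minus: "\<And>x. f (- x) = f x"
  proof -
    fix x
    have "f (- 1) * f (- 1) = 1" using mult[of "- 1" "- 1"] 1 by simp
    then have "f (- 1) = 1" using nonneg[of "- 1"]
      by (metis abs_of_nonneg abs_square_eq_1 power2_eq_square)
    then show "f (- x) = f x" using mult[of "- 1" x] by simp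
  qed
  show "f (x ^ n) = f x ^ n" by (induction n) (simp_all add: 1 mult)
  show inv: "\<And>x. f (inverse x) = inverse (f x)"
  proof -
    fix x show "f (inverse x) = inverse (f x)"
    proof (cases "x = 0")
      case False
      then have "f x * f (inverse x) = 1" using mult[of x "inverse x"] 1 by simp
      then show ?thesis by (metis inverse_unique)
    qed (simp add: 0)
  qed
  show "f (x - y) \<le> f x + f y" using add[of x "- y"] minus by simp
  show "f (x / y) = f x / f y" by (simp add: field_class.field_divide_inverse mult inv)
qed

lemma abs_value_sum:
  assumes "abs_value f"
  shows "f (sum g A) \<le> (\<Sum>x\<in>A. f (g x))"
proof (induction A rule: infinite_finite_induct)
  case (insert x A)
  then show ?case using abs_valueD(4)[OF assms, of "g x" "sum g A"] by simp
qed (simp_all add: abs_valueD[OF assms])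

lemma is_hom_of_rat: "is_hom (of_rat :: rat \<Rightarrow> 'a::field_char_0)"
  by (simp add: is_hom_def of_rat_add of_rat_mult)

lemma is_hom_rat:
  fixes h :: "'a::field_char_0 \<Rightarrow> 'b::field_char_0"
  assumes "is_hom h"
  shows "h (of_rat r) = of_rat r"
proof (cases r)
  case (Fract a b)
  then show ?thesis
    by (simp add: of_rat_rat is_hom_field_simps[OF assms] is_hom_simps[OF assms])
qed

lemma arch_place:
  assumes "f \<in> arch_places"
  shows "abs_value f" "f (of_rat r) = \<bar>of_rat r\<bar>" "f (of_int m) = \<bar>of_int m\<bar>"
proof -
  obtain \<sigma> :: "'a \<Rightarrow> complex" where \<sigma>: "is_hom \<sigma>" "f = (\<lambda>x. cmod (\<sigma> x))"
    using assms by (auto simp: arch_places_def)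
  show "abs_value f"
    by (auto simp: abs_value_def \<sigma>(2) is_hom_simps[OF \<sigma>(1)] is_hom_field_simps[OF \<sigma>(1)] norm_mult norm_triangle_ineq)
  have "of_rat r = (of_real (of_rat r) :: complex)"
    by (cases r) (simp add: of_rat_rat)
  then show "f (of_rat r) = \<bar>of_rat r\<bar>"
    by (simp add: \<sigma>(2) is_hom_rat[OF \<sigma>(1)])
  show "f (of_int m) = \<bar>of_int m\<bar>"
    by (simp add: \<sigma>(2) is_hom_simps[OF \<sigma>(1)])
qed

lemma ultra_place:
  assumes "f \<in> ultra_places"
  shows "abs_value f" "f (x + y) \<le> max (f x) (f y)" "m \<noteq> 0 \<Longrightarrow> f (of_int m) \<ge> 1 / \<bar>of_int m\<bar>" "f (of_int m) \<le> 1"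
proof -
  show f: "abs_value f" and ultra: "\<And>x y. f (x + y) \<le> max (f x) (f y)"
    and "m \<noteq> 0 \<Longrightarrow> f (of_int m) \<ge> 1 / \<bar>of_int m\<bar>"
    using assms by (auto simp: ultra_places_def)
  have nat: "f (of_nat n) \<le> 1" for n
  proof (induction n)
    case (Suc n)
    then show ?case using ultra[of 1 "of_nat n"] abs_valueD(6)[OF f] by simp
  qed (simp add: abs_valueD[OF f])
  show "f (of_int m) \<le> 1"
    by (cases m rule: int_cases2) (simp_all add: nat abs_valueD(7)[OF f])
qed

lemma ultra_sum:
  assumes "f \<in> ultra_places" "B \<ge> 0" "\<And>x. x \<in> A \<Longrightarrow> f (g x) \<le> B"
  shows "f (sum g A) \<le> B"
  using assms(3)
proof (induction A rule: infinite_finite_induct)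
  case (insert x A)
  then have "max (f (g x)) (f (sum g A)) \<le> B" by simp
  then show ?case
    using insert.hyps order.trans[OF ultra_place(2)[OF assms(1), of "g x" "sum g A"]] by simp
qed (use assms(2) abs_valueD(1)[OF ultra_place(1)[OF assms(1)]] in simp_all)

definition places :: "('a::field_char_0 \<Rightarrow> real) set" where
  "places = arch_places \<union> ultra_places"

lemma place:
  assumes "f \<in> places"
  shows "abs_value f" "m \<noteq> 0 \<Longrightarrow> f (of_int m) \<ge> 1 / \<bar>of_int m\<bar>" "f (of_int m) \<le> \<bar>of_int m\<bar>"
proof -
  show "abs_value f" using assms arch_place(1) ultra_place(1) by (auto simp: places_def)
  have "1 / \<bar>of_int m\<bar> \<le> \<bar>of_int m :: real\<bar>" if "m \<noteq> 0" for m
  proof -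
    have "1 \<le> \<bar>of_int m :: real\<bar>" using that by linarith
    then have "1 / \<bar>of_int m :: real\<bar> \<le> 1" by simp
    then show ?thesis using \<open>1 \<le> \<bar>of_int m :: real\<bar>\<close> by linarith
  qed
  then show "m \<noteq> 0 \<Longrightarrow> f (of_int m) \<ge> 1 / \<bar>of_int m\<bar>"
    using assms arch_place(3)[of f m] ultra_place(3)[of f m] by (auto simp: places_def)
  show "f (of_int m) \<le> \<bar>of_int m\<bar>"
  proof (cases "m = 0")
    case True
    then show ?thesis using abs_valueD(1)[OF \<open>abs_value f\<close>] by simp
  next
    case False
    then have "1 \<le> \<bar>of_int m :: real\<bar>" by linarith
    then show ?thesis
      using assms arch_place(3)[of f m] ultra_place(4)[of f m] by (auto simp: places_def)
  qed
qed

lemma arch_place_comp: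
  assumes "f \<in> arch_places" "is_hom \<tau>"
  shows "(\<lambda>x. f (\<tau> x)) \<in> arch_places"
proof -
  obtain \<sigma> where "is_hom \<sigma>" "f = (\<lambda>x. cmod (\<sigma> x))"
    using assms(1) unfolding arch_places_def by blast
  then show ?thesis
    using is_hom_comp[of \<sigma> \<tau>] assms(2) unfolding arch_places_def
    by (intro CollectI exI[of _ "\<lambda>x. \<sigma> (\<tau> x)"]) simp
qed

lemma ultra_place_comp:
  assumes "f \<in> ultra_places" "is_hom \<tau>"
  shows "(\<lambda>x. f (\<tau> x)) \<in> ultra_places"
  using assms unfolding ultra_places_def abs_value_def
  by (simp add: is_hom_simps[OF assms(2)] is_hom_field_simps[OF assms(2)])

section \<open>Conjugates and integral minimal polynomials\<close>

lemma partial_hom_rat: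
  "partial_hom {(of_rat r :: 'a::field_char_0, of_rat r :: 'b::field_char_0) | r. True}"
  unfolding partial_hom_def
proof (intro conjI allI impI)
  have "(1, 1) = (of_rat 1 :: 'a, of_rat 1 :: 'b)" by simp
  then show "(1, 1) \<in> {(of_rat r :: 'a, of_rat r :: 'b) | r. True}" by blast
  fix a c :: 'a and b d :: 'b
  assume "(a, b) \<in> {(of_rat r, of_rat r) | r. True}"
  then obtain r where r: "a = of_rat r" "b = of_rat r" by blast
  then show "a = 0 \<longleftrightarrow> b = 0" by simp
  assume "(c, d) \<in> {(of_rat r, of_rat r) | r. True}"
  then obtain s where "c = of_rat s" "d = of_rat s" by blast
  then have "a - c = of_rat (r - s)" "b - d = of_rat (r - s)" "a * c = of_rat (r * s)" "b * d = of_rat (r * s)"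
    using r by (simp_all add: of_rat_diff of_rat_mult)
  then show "(a - c, b - d) \<in> {(of_rat r, of_rat r) | r. True}" "(a * c, b * d) \<in> {(of_rat r, of_rat r) | r. True}"
    by blast+
qed

lemma rat_coeff_rel:
  assumes alg: "algebraic (x :: 'a::field_char_0)" and sub: "{(of_rat r, of_rat r) | r. True} \<subseteq> R"
  shows "\<exists>p. p \<noteq> 0 \<and> poly p x = 0 \<and> (\<forall>i. coeff p i \<in> fst ` R)"
proof -
  obtain p where p: "p \<noteq> 0" "poly p x = 0" "\<And>i. coeff p i \<in> \<rat>"
    using alg unfolding algebraic_altdef by blast
  have "coeff p i \<in> fst ` R" for i
  proof -
    obtain r where "coeff p i = of_rat r" using p(3)[of i] by (elim Rats_cases)
    then show ?thesis using sub by force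
  qed
  then show ?thesis using p by blast
qed

text \<open>For irreducible \<open>q\<close>, vanishing at \<open>w\<close> and vanishing at
  \<open>\<rho>\<close> both mean divisibility by \<open>q\<close>. So sending \<open>w\<close> to
  \<open>\<rho>\<close> is well defined on polynomials in \<open>w\<close>, and it extends because
  everything is algebraic.\<close>

lemma hom_to_conjugate:
  fixes w :: "'a::field_char_0" and \<rho> :: "'b::{alg_closed_field, field_char_0}"
  assumes alg: "\<And>x :: 'a. algebraic x" and q: "irreducible q"
    and roots: "poly (map_poly of_rat q) w = 0" "poly (map_poly of_rat q) \<rho> = 0"
  obtains h where "is_hom h" "h w = \<rho>"
proof -
  define R where "R = {(of_rat r :: 'a, of_rat r :: 'b) | r. True}"
  have R: "partial_hom R" unfolding R_def by (rule partial_hom_rat)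
  note hom = is_hom_simps[OF is_hom_map_poly[OF is_hom_of_rat]]
  have dvd: "poly (map_poly of_rat g) x = 0 \<longleftrightarrow> q dvd g"
    if x: "poly (map_poly of_rat q) x = 0" for g and x :: "'c::field_char_0"
  proof
    assume "q dvd g"
    then show "poly (map_poly of_rat g) x = 0" using x by (auto simp: hom elim!: dvdE)
  next
    assume g: "poly (map_poly of_rat g) x = 0"
    show "q dvd g"
    proof (rule ccontr)
      assume "\<not> q dvd g"
      then have "coprime q g"
        using q by (metis coprimeI coprime_common_divisor irreducibleD' dvd_trans)
      then obtain r s where "r * q + s * g = 1"
        using bezout_coefficients_fst_snd[of q g] by (metis coprime_imp_gcd_eq_1)
      then have "poly (map_poly of_rat (r * q + s * g)) x = 1" by (simp add: hom)
      then show False using x g by (simp add: hom)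
    qed
  qed
  have rel: "poly f w = 0 \<longleftrightarrow> poly g \<rho> = 0" if "poly_rel R f g" for f g
  proof -
    have "\<forall>i. \<exists>r. coeff f i = of_rat r \<and> coeff g i = of_rat r"
      using that by (auto simp: poly_rel_def R_def)
    then obtain r where r: "\<And>i. coeff f i = of_rat (r i)" "\<And>i. coeff g i = of_rat (r i)" by metis
    define h where "h = (\<Sum>i\<le>degree f. monom (r i) i)"
    have "coeff h i = r i" for i
      using r(1)[of i] by (auto simp: h_def coeff_sum coeff_eq_0)
    then have "f = map_poly of_rat h" "g = map_poly of_rat h"
      by (simp_all add: poly_eq_iff coeff_map_poly r)
    then show ?thesis using dvd[OF roots(1), of h] dvd[OF roots(2), of h] by simp
  qed
  define S where "S = {(poly f w, poly g \<rho>) | f g. poly_rel R f g}"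
  have S: "partial_hom S" "R \<subseteq> S" "(w, \<rho>) \<in> S"
    unfolding S_def using partial_hom_image[OF R rel] by blast+
  show ?thesis
    by (rule partial_hom_extends[OF S(1) rat_coeff_rel[OF alg S(2)[unfolded R_def]]])
      (use S(3) that in blast)
qed

lemma exists_arch_place:
  assumes alg: "\<And>x :: 'a::field_char_0. algebraic x"
  shows "\<exists>f. f \<in> (arch_places :: ('a \<Rightarrow> real) set)"
proof -
  obtain h :: "'a \<Rightarrow> complex" where "is_hom h"
    by (rule partial_hom_extends[OF partial_hom_rat rat_coeff_rel[OF alg subset_refl]])
  then show ?thesis unfolding arch_places_def by blast
qed

text \<open>At a place above a prime dividing the denominator the numerator is a unit by Bezout, so
  the value of \<open>r\<close> exceeds 1.\<close>

lemma ultra_integral_rat: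
  fixes r :: rat
  assumes alg: "\<And>x :: 'a::field_char_0. algebraic x"
    and r: "\<And>f :: 'a \<Rightarrow> real. f \<in> ultra_places \<Longrightarrow> f (of_rat r) \<le> 1"
  shows "r \<in> \<int>"
proof (rule ccontr)
  assume "r \<notin> \<int>"
  obtain a b where ab: "quotient_of r = (a, b)" by force
  have b: "b > 0" "coprime a b" "r = of_int a / of_int b"
    using quotient_of_denom_pos[OF ab] quotient_of_coprime[OF ab] quotient_of_div[OF ab] by auto
  have "b \<noteq> 1" using b(3) \<open>r \<notin> \<int>\<close> by auto
  then have "nat b \<noteq> 1" using b(1) by simp
  then obtain p where p: "prime p" "p dvd nat b" using prime_factor_nat by blast
  obtain f :: "'a \<Rightarrow> real" where f: "f \<in> ultra_places" "f (of_nat p) < 1"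
    using exists_place_above_prime[OF alg p(1)] by blast
  note fv = abs_valueD[OF ultra_place(1)[OF f(1)]]
  obtain c where c: "b = int p * c" using p(2) b(1)
    by (metis dvd_def int_dvd_int_iff int_nat_eq order_less_imp_le)
  have "f (of_int b) = f (of_nat p) * f (of_int c)" by (simp add: c fv)
  also have "\<dots> \<le> f (of_nat p) * 1"
    using ultra_place(4)[OF f(1)] fv(5) by (intro mult_left_mono)
  finally have fb: "f (of_int b) < 1" using f(2) by simp
  obtain s t where st: "s * a + t * b = 1" using b(2) bezout_int[of a b] by (auto simp: coprime_iff_gcd_eq_1)
  have "1 = f (of_int (s * a + t * b))" by (simp add: st fv)
  also have "\<dots> \<le> max (f (of_int s * of_int a)) (f (of_int t * of_int b))"
    using ultra_place(2)[OF f(1)] by simp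
  finally have "1 \<le> f (of_int s * of_int a) \<or> 1 \<le> f (of_int t * of_int b)" by (simp add: le_max_iff_disj)
  moreover have "f (of_int t * of_int b) < 1"
  proof -
    have "f (of_int t) * f (of_int b) \<le> 1 * f (of_int b)"
      using ultra_place(4)[OF f(1)] fv(5) by (intro mult_right_mono)
    then show ?thesis using fb by (simp add: fv)
  qed
  ultimately have "1 \<le> f (of_int s) * f (of_int a)" by (simp add: fv)
  also have "\<dots> \<le> 1 * f (of_int a)" using ultra_place(4)[OF f(1)] fv(5) by (intro mult_right_mono)
  finally have fa: "1 \<le> f (of_int a)" by simp
  have "f (of_rat r) = f (of_int a) / f (of_int b)"
    by (simp add: b(3) of_rat_divide fv)
  moreover have "f (of_int b) > 0" using b(1) by (intro fv(2)) simp
  ultimately have "f (of_rat r) > 1" using fa fb by (simp add: less_divide_eq)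
  then show False using r[OF f(1)] by simp
qed

lemma coeff_prod_roots_ultra:
  assumes f: "f \<in> ultra_places" and A: "\<And>y. y \<in># A \<Longrightarrow> f y \<le> 1"
  shows "f (coeff (\<Prod>y\<in>#A. [:- y, 1:]) i) \<le> 1"
  using A
proof (induction A arbitrary: i)
  case empty
  then show ?case using abs_valueD[OF ultra_place(1)[OF f]] by (simp add: coeff_1)
next
  case (add x A)
  note fv = abs_valueD[OF ultra_place(1)[OF f]]
  define q where "q = (\<Prod>y\<in>#A. [:- y, 1:])"
  have IH: "f (coeff q j) \<le> 1" for j using add by (simp add: q_def)
  have "f (- x * coeff q i) \<le> 1"
    using mult_mono[OF add.prems[of x] IH[of i]] fv(5) by (simp add: fv)
  moreover have "f (coeff (pCons 0 q) i) \<le> 1" using IH by (cases i) (simp_all add: fv)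
  moreover have "coeff (\<Prod>y\<in>#add_mset x A. [:- y, 1:]) i = - x * coeff q i + coeff (pCons 0 q) i"
    by (simp add: q_def)
  ultimately show ?case using order.trans[OF ultra_place(2)[OF f]] by (metis max.bounded_iff)
qed

lemma coeff_prod_roots_bound:
  assumes f: "abs_value f" and A: "\<And>y. y \<in># A \<Longrightarrow> f y \<le> H" and H: "H \<ge> 0"
  shows "f (coeff (\<Prod>y\<in>#A. [:- y, 1:]) i) \<le> (1 + H) ^ size A"
  using A
proof (induction A arbitrary: i)
  case empty
  then show ?case using abs_valueD[OF f] by (simp add: coeff_1)
next
  case (add x A)
  note fv = abs_valueD[OF f]
  define q where "q = (\<Prod>y\<in>#A. [:- y, 1:])"
  have IH: "f (coeff q j) \<le> (1 + H) ^ size A" for j using add by (simp add: q_def)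
  have "f (- x * coeff q i) \<le> H * (1 + H) ^ size A"
    using mult_mono[OF add.prems[of x] IH[of i]] fv(5) H by (simp add: fv)
  moreover have "f (coeff (pCons 0 q) i) \<le> (1 + H) ^ size A"
    using IH H by (cases i) (simp_all add: fv)
  moreover have "coeff (\<Prod>y\<in>#add_mset x A. [:- y, 1:]) i = - x * coeff q i + coeff (pCons 0 q) i"
    by (simp add: q_def)
  ultimately have "f (coeff (\<Prod>y\<in>#add_mset x A. [:- y, 1:]) i) \<le> H * (1 + H) ^ size A + (1 + H) ^ size A"
    using order.trans[OF fv(4)] by (metis add_mono)
  then show ?case by (simp add: algebra_simps)
qed

lemma minimal_rat_poly:
  fixes w :: "'a::field_char_0"
  assumes q0: "q0 \<noteq> 0" "poly (map_poly of_rat q0) w = 0"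
  obtains m :: "rat poly" where "irreducible m" "lead_coeff m = 1" "degree m \<le> degree q0"
    "poly (map_poly of_rat m) w = 0"
proof -
  define Z where "Z = (\<lambda>q :: rat poly. q \<noteq> 0 \<and> poly (map_poly of_rat q) w = 0)"
  have "Z q0" using q0 by (simp add: Z_def)
  then obtain m0 where m0: "Z m0" "\<And>q. Z q \<Longrightarrow> degree m0 \<le> degree q"
    using ex_has_least_nat[of Z q0 degree] by blast
  define m where "m = smult (inverse (lead_coeff m0)) m0"
  note hom = is_hom_simps[OF is_hom_map_poly[OF is_hom_of_rat[where ?'a = 'a]]]
  have m: "m \<noteq> 0" "degree m = degree m0" "lead_coeff m = 1"
    using m0 by (auto simp: m_def Z_def)
  have "map_poly of_rat m = smult (of_rat (inverse (lead_coeff m0))) (map_poly of_rat m0 :: 'a poly)"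
    by (simp add: m_def poly_eq_iff coeff_map_poly of_rat_mult)
  then have root: "poly (map_poly of_rat m) w = 0" using m0 by (simp add: Z_def)
  have "irreducible m"
  proof (rule irreducibleI)
    show "m \<noteq> 0" by (rule m)
    show "\<not> is_unit m"
    proof
      assume "is_unit m"
      then obtain c where c: "m = [:c:]" "c \<noteq> 0" using m(1) by (auto simp: is_unit_poly_iff)
      then show False using root by (simp add: map_poly_pCons)
    qed
    fix a b assume ab: "m = a * b"
    then have nz: "a \<noteq> 0" "b \<noteq> 0" using m by auto
    then have deg: "degree m0 = degree a + degree b" using m(2) ab by (simp add: degree_mult_eq)
    have "poly (map_poly of_rat a) w = 0 \<or> poly (map_poly of_rat b) w = 0"
      using root by (simp add: ab hom)
    then have "Z a \<or> Z b" using nz by (auto simp: Z_def)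
    then have "degree b = 0 \<or> degree a = 0" using m0(2) deg by fastforce
    then show "is_unit a \<or> is_unit b" using nz by (auto simp: is_unit_iff_degree)
  qed
  then show ?thesis using that m root m0(2)[OF \<open>Z q0\<close>] by simp
qed

text \<open>The coefficients of the minimal polynomial are symmetric functions of the conjugates of
  \<open>w\<close>; composing places with the endomorphisms of the ambient field bounds them.\<close>

lemma integral_bounded_poly:
  fixes w :: "'a::{alg_closed_field, field_char_0}"
  assumes alg: "\<And>x :: 'a. algebraic x"
    and q0: "q0 \<noteq> 0" "degree q0 \<le> n" "poly (map_poly of_rat q0) w = 0"
    and ultra: "\<And>f. f \<in> ultra_places \<Longrightarrow> f w \<le> 1"
    and arch: "\<And>f. f \<in> arch_places \<Longrightarrow> f w \<le> H" and H: "H \<ge> 0"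
  obtains q :: "int poly" where "lead_coeff q = 1" "degree q \<le> n" "poly (map_poly of_int q) w = 0"
    "\<And>i. \<bar>of_int (coeff q i)\<bar> \<le> (1 + H) ^ n"
proof -
  obtain m :: "rat poly" where m: "irreducible m" "lead_coeff m = 1" "degree m \<le> degree q0"
    "poly (map_poly of_rat m) w = 0" using minimal_rat_poly[OF q0(1,3)] by blast
  define M :: "'a poly" where "M = map_poly of_rat m"
  have M: "degree M = degree m" "lead_coeff M = 1"
    unfolding M_def using monic_map_poly[OF is_hom_of_rat m(2)] by auto
  then have "M \<noteq> 0" by auto
  then obtain A where "size A = degree M" "M = smult (lead_coeff M) (\<Prod>y\<in>#A. [:- y, 1:])"
    using alg_closed_imp_factorization by blast
  then have A: "size A = degree M" "M = (\<Prod>y\<in>#A. [:- y, 1:])" unfolding M(2) by simp_all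
  have conj: "\<exists>h. is_hom h \<and> h w = y" if "y \<in># A" for y
  proof -
    have "[:- y, 1:] dvd M" unfolding A(2) using that by (intro dvd_prod_mset) auto
    then have "poly M y = 0" by (simp add: poly_eq_0_iff_dvd)
    then show ?thesis using hom_to_conjugate[OF alg m(1,4), of y] unfolding M_def by blast
  qed
  have cM: "coeff M i = of_rat (coeff m i)" for i by (simp add: M_def coeff_map_poly)
  have int: "coeff m i \<in> \<int>" for i
  proof (rule ultra_integral_rat[OF alg])
    fix f :: "'a \<Rightarrow> real" assume f: "f \<in> ultra_places"
    have "f y \<le> 1" if "y \<in># A" for y
      using conj[OF that] ultra[OF ultra_place_comp[OF f]] by auto
    then show "f (of_rat (coeff m i)) \<le> 1"
      using coeff_prod_roots_ultra[OF f, of A i] unfolding A(2)[symmetric] cM by blast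
  qed
  define q where "q = map_poly floor m"
  have cq: "of_int (coeff q i) = coeff m i" for i
    using int[of i] by (auto simp: q_def coeff_map_poly elim!: Ints_cases)
  then have cq': "of_int (coeff q i) = (of_rat (coeff m i) :: 'b::field_char_0)" for i
    by (metis of_rat_of_int_eq)
  have "degree q = degree m"
  proof -
    have "coeff q i = 0 \<longleftrightarrow> coeff m i = 0" for i using cq[of i] by (metis of_int_eq_0_iff)
    then show ?thesis by (simp add: degree_def)
  qed
  then have lq: "lead_coeff q = 1" using cq[of "degree m"] m(2) by simp
  have "map_poly of_int q = M" by (simp add: poly_eq_iff coeff_map_poly cq' cM)
  then have root: "poly (map_poly of_int q) w = 0" using m(4) by (simp add: M_def)
  \<comment> \<open>The coefficients are integers, whose ordinary absolute value can be read off at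
    any single archimedean place.\<close>
  obtain f :: "'a \<Rightarrow> real" where f: "f \<in> arch_places" using exists_arch_place[OF alg] by blast
  have "\<bar>of_int (coeff q i)\<bar> \<le> (1 + H) ^ n" for i
  proof -
    have "f y \<le> H" if "y \<in># A" for y
      using conj[OF that] arch[OF arch_place_comp[OF f]] by auto
    then have "f (of_int (coeff q i)) \<le> (1 + H) ^ size A"
      using coeff_prod_roots_bound[OF arch_place(1)[OF f], of A H i] H
      unfolding A(2)[symmetric] cM cq' by blast
    also have "\<dots> \<le> (1 + H) ^ n" using A(1) M m(3) q0(2) H by (intro power_increasing) auto
    finally show ?thesis using arch_place(3)[OF f] by simp
  qed
  moreover have "degree q \<le> n" using \<open>degree q = degree m\<close> m(3) q0(2) by simp
  ultimately show ?thesis using that[of q] lq root by blast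
qed

text \<open>After division by a power of \<open>w\<close>, the lowest nonzero coefficient equals a
  combination of positive powers of \<open>w\<close>. For \<open>f w < 1\<close> each term is at
  most \<open>M * f w\<close>, while a nonzero integer of size at most \<open>M\<close> is at least
  \<open>1 / M\<close> at every place; this accounts for the square of \<open>M\<close>.\<close>

lemma liouville:
  fixes w :: "'a::field_char_0"
  assumes w: "w \<noteq> 0" and q: "q \<noteq> 0" "degree q \<le> n" "poly (map_poly of_int q) w = 0"
    and coeffs: "\<And>i. \<bar>of_int (coeff q i)\<bar> \<le> M" and f: "f \<in> places"
  shows "f w \<ge> 1 / ((real n + 1) * M ^ 2)"
proof -
  note fv = abs_valueD[OF place(1)[OF f]]
  have "lead_coeff q \<noteq> 0" using q(1) by simp
  then have "1 \<le> \<bar>lead_coeff q\<bar>" by linarith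
  then have "real_of_int 1 \<le> real_of_int \<bar>lead_coeff q\<bar>" unfolding of_int_le_iff .
  then have "\<bar>of_int (lead_coeff q) :: real\<bar> \<ge> 1" by simp
  then have M: "M \<ge> 1" using coeffs[of "degree q"] by linarith
  then have M2: "M ^ 2 \<ge> 1" by simp
  show ?thesis
  proof (cases "f w \<ge> 1")
    case True
    have "(real n + 1) * M ^ 2 \<ge> 1 * 1" using M2 by (intro mult_mono) auto
    then have "1 / ((real n + 1) * M ^ 2) \<le> 1" by simp
    then show ?thesis using True by simp
  next
    case False
    define r where "r = (LEAST i. coeff q i \<noteq> 0)"
    have r: "coeff q r \<noteq> 0" "\<And>i. i < r \<Longrightarrow> coeff q i = 0"
      unfolding r_def using LeastI[of "\<lambda>i. coeff q i \<noteq> 0" "degree q"] q(1) not_less_Least by auto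
    have deg: "degree (map_poly of_int q :: 'a poly) = degree q"
      by (intro map_poly_degree_eq) (use q(1) in simp)
    have "r \<le> degree q" using r(1) by (rule le_degree)
    have "0 = (\<Sum>i\<le>degree q. of_int (coeff q i) * w ^ i)"
      using q(3) by (simp add: poly_altdef deg coeff_map_poly)
    also have "\<dots> = (\<Sum>i=r..degree q. of_int (coeff q i) * w ^ i)"
      using r(2) by (intro sum.mono_neutral_right) (auto simp: not_le)
    also have "\<dots> = of_int (coeff q r) * w ^ r + (\<Sum>i=Suc r..degree q. of_int (coeff q i) * w ^ i)"
      using \<open>r \<le> degree q\<close> by (simp add: sum.atLeast_Suc_atMost)
    also have "(\<Sum>i=Suc r..degree q. of_int (coeff q i) * w ^ i) =
        w ^ r * (\<Sum>i=Suc r..degree q. of_int (coeff q i) * w ^ (i - r))"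
      unfolding sum_distrib_left
      by (intro sum.cong) (auto simp: ac_simps simp flip: power_add)
    finally have "w ^ r * (of_int (coeff q r) + (\<Sum>i=Suc r..degree q. of_int (coeff q i) * w ^ (i - r))) = 0"
      by (simp add: algebra_simps)
    then have "of_int (coeff q r) = - (\<Sum>i=Suc r..degree q. of_int (coeff q i) * w ^ (i - r))"
      using w by (simp add: eq_neg_iff_add_eq_0)
    then have "f (of_int (coeff q r)) = f (\<Sum>i=Suc r..degree q. of_int (coeff q i) * w ^ (i - r))"
      by (simp only: fv(7))
    also have "\<dots> \<le> (\<Sum>i=Suc r..degree q. f (of_int (coeff q i) * w ^ (i - r)))"
      by (rule abs_value_sum[OF place(1)[OF f]])
    also have "\<dots> \<le> (\<Sum>i=Suc r..degree q. M * f w)"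
    proof (intro sum_mono)
      fix i assume i: "i \<in> {Suc r..degree q}"
      have "f w ^ (i - r) \<le> f w ^ 1" using False fv(5) i by (intro power_decreasing) auto
      moreover have "f (of_int (coeff q i)) \<le> M" using place(3)[OF f] coeffs order.trans by blast
      ultimately show "f (of_int (coeff q i) * w ^ (i - r)) \<le> M * f w"
        using M fv(5) by (simp add: fv mult_mono)
    qed
    also have "\<dots> = real (degree q - r) * (M * f w)" by simp
    also have "\<dots> \<le> (real n + 1) * (M * f w)" using M fv(5) q(2) by (intro mult_right_mono) auto
    finally have 1: "f (of_int (coeff q r)) \<le> (real n + 1) * (M * f w)" .
    have pos: "\<bar>of_int (coeff q r) :: real\<bar> > 0" using r(1) by simp
    have "1 / M \<le> 1 / \<bar>of_int (coeff q r)\<bar>" using coeffs[of r] pos M by (intro divide_left_mono) auto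
    also have "\<dots> \<le> f (of_int (coeff q r))" using place(2)[OF f r(1)] .
    finally have "1 / M \<le> (real n + 1) * (M * f w)" using 1 by simp
    then have "1 \<le> f w * ((real n + 1) * M ^ 2)" using M by (simp add: field_simps power2_eq_square)
    then show ?thesis using M by (simp add: divide_le_eq)
  qed
qed

section \<open>Heights and growth\<close>

text \<open>The consequence of finite dimension over the rationals that the estimates use: one
  degree bound, uniform in \<open>w\<close>.\<close>

definition degree_bounded :: "nat \<Rightarrow> 'a::field_char_0 set \<Rightarrow> bool" where
  "degree_bounded n K \<longleftrightarrow> is_subring K \<and>
     (\<forall>w\<in>K. \<exists>q :: rat poly. q \<noteq> 0 \<and> degree q \<le> n \<and> poly (map_poly of_rat q) w = 0)"

text \<open>A substitute for the height: one integer serves as bound at all archimedean places and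
  as common denominator at all ultrametric ones. Hence bounds are enlarged along divisibility and
  not merely along the order.\<close>

definition height_bound :: "nat \<Rightarrow> 'a::field_char_0 \<Rightarrow> bool" where
  "height_bound N w \<longleftrightarrow> N > 0 \<and> (\<forall>f\<in>arch_places. f w \<le> real N) \<and>
     (\<forall>f\<in>ultra_places. f (of_nat N * w) \<le> 1)"

lemma place_of_nat:
  "f \<in> arch_places \<Longrightarrow> f (of_nat k) = real k"
  "f \<in> ultra_places \<Longrightarrow> f (of_nat k) \<le> 1"
  using arch_place(3)[of f "int k"] ultra_place(4)[of f "int k"] by simp_all

lemma height_bound_mono:
  assumes "height_bound N w" "N dvd N'" "N' > 0"
  shows "height_bound N' w"
proof -
  obtain k where k: "N' = N * k" using assms(2) by (elim dvdE)
  have "N \<le> N'" using assms(2,3) by (rule dvd_imp_le)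
  have "f (of_nat N' * w) \<le> 1" if f: "f \<in> ultra_places" for f
  proof -
    note fv = abs_valueD[OF ultra_place(1)[OF f]]
    have "f (of_nat N' * w) = f (of_nat k) * f (of_nat N * w)" by (simp add: k fv)
    also have "\<dots> \<le> 1 * 1"
      using assms(1) f place_of_nat(2)[OF f] fv(5) by (intro mult_mono) (auto simp: height_bound_def)
    finally show ?thesis by simp
  qed
  moreover have "f w \<le> real N'" if "f \<in> arch_places" for f
    using assms(1) that \<open>N \<le> N'\<close> unfolding height_bound_def by (meson of_nat_mono order.trans)
  ultimately show ?thesis using assms(3) by (simp add: height_bound_def)
qed

lemma height_bound_add:
  assumes "height_bound N x" "height_bound N y"
  shows "height_bound (2 * N) (x + y)"
proof -
  have "f (of_nat (2 * N) * (x + y)) \<le> 1" if f: "f \<in> ultra_places" for f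
  proof -
    note fv = abs_valueD[OF ultra_place(1)[OF f]]
    have "f (of_nat N * x + of_nat N * y) \<le> max (f (of_nat N * x)) (f (of_nat N * y))"
      by (rule ultra_place(2)[OF f])
    also have "\<dots> \<le> 1" using assms f by (simp add: height_bound_def)
    finally have "f (of_nat 2) * f (of_nat N * x + of_nat N * y) \<le> 1 * 1"
      using place_of_nat(2)[OF f, of 2] fv(5) by (intro mult_mono) auto
    then show ?thesis by (simp add: algebra_simps flip: fv(3))
  qed
  moreover have "f (x + y) \<le> real (2 * N)" if f: "f \<in> arch_places" for f
  proof -
    have "f x \<le> real N" "f y \<le> real N" using assms f by (auto simp: height_bound_def)
    then show ?thesis using abs_valueD(4)[OF arch_place(1)[OF f], of x y] by simp
  qed
  ultimately show ?thesis using assms by (simp add: height_bound_def)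
qed

lemma height_bound_mult:
  assumes "height_bound N x" "height_bound M y"
  shows "height_bound (N * M) (x * y)"
proof -
  have "f (of_nat (N * M) * (x * y)) \<le> 1" if f: "f \<in> ultra_places" for f
  proof -
    note fv = abs_valueD[OF ultra_place(1)[OF f]]
    have "f (of_nat N * x) * f (of_nat M * y) \<le> 1 * 1"
      using assms f fv(5) by (intro mult_mono) (auto simp: height_bound_def)
    then show ?thesis by (simp add: fv ac_simps)
  qed
  moreover have "f (x * y) \<le> real (N * M)" if f: "f \<in> arch_places" for f
  proof -
    note fv = abs_valueD[OF arch_place(1)[OF f]]
    have "f x \<le> real N" "f y \<le> real M" using assms f by (auto simp: height_bound_def)
    then show ?thesis using mult_mono[of "f x" "real N" "f y" "real M"] by (simp add: fv)
  qed
  ultimately show ?thesis using assms by (simp add: height_bound_def)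
qed

lemma height_bound_one: "height_bound 1 (1 :: 'a::field_char_0)"
proof -
  have "f (1 :: 'a) \<le> 1" "f (of_nat 1 * 1 :: 'a) \<le> 1" if "f \<in> arch_places \<union> ultra_places" for f
  proof -
    have "abs_value f" using that arch_place(1) ultra_place(1) by blast
    then show "f (1 :: 'a) \<le> 1" "f (of_nat 1 * 1 :: 'a) \<le> 1" by (simp_all add: abs_valueD)
  qed
  then show ?thesis unfolding height_bound_def by auto
qed

lemma height_bound_power:
  "height_bound N (x :: 'a::field_char_0) \<Longrightarrow> height_bound (N ^ i) (x ^ i)"
  by (induction i) (simp_all add: height_bound_one[simplified] height_bound_mult)

text \<open>At an ultrametric place \<open>N * z\<close> satisfies a monic equation with
  coefficients of size at most 1; were its value \<open>r\<close> larger than 1, then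
  \<open>r ^ m \<le> r ^ (m - 1)\<close>. At an archimedean place it is Cauchy's bound on roots, and
  the factor \<open>m\<close> is the number of terms.\<close>

lemma height_bound_root:
  assumes m: "m > 0" and eq: "z ^ m = - (\<Sum>j<m. c j * z ^ j)"
    and c: "\<And>j. j < m \<Longrightarrow> height_bound N (c j)"
  shows "height_bound (m * N) z"
proof -
  have N: "N > 0" using c[OF m] by (simp add: height_bound_def)
  have "f (of_nat N * z) \<le> 1" if f: "f \<in> ultra_places" for f
  proof (rule ccontr)
    note fv = abs_valueD[OF ultra_place(1)[OF f]]
    define r where "r = f (of_nat N * z)"
    assume "\<not> f (of_nat N * z) \<le> 1"
    then have r: "r > 1" by (simp add: r_def)
    have "(of_nat N * z) ^ m = - (\<Sum>j<m. of_nat N ^ m * (c j * z ^ j))"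
      by (simp add: power_mult_distrib eq sum_distrib_left)
    also have "(\<Sum>j<m. of_nat N ^ m * (c j * z ^ j)) =
      (\<Sum>j<m. of_nat N ^ (m - 1 - j) * (of_nat N * c j) * (of_nat N * z) ^ j)"
    proof (intro sum.cong refl)
      fix j assume "j \<in> {..<m}"
      then have "m = (m - 1 - j) + 1 + j" by simp
      then have "of_nat N ^ m = of_nat N ^ (m - 1 - j) * of_nat N * (of_nat N ^ j :: 'a)"
        by (metis power_add power_one_right)
      then show "of_nat N ^ m * (c j * z ^ j) = of_nat N ^ (m - 1 - j) * (of_nat N * c j) * (of_nat N * z) ^ j"
        by (simp add: power_mult_distrib ac_simps)
    qed
    finally have "r ^ m = f (\<Sum>j<m. of_nat N ^ (m - 1 - j) * (of_nat N * c j) * (of_nat N * z) ^ j)"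
      unfolding r_def by (metis fv(7,8))
    also have "\<dots> \<le> r ^ (m - 1)"
    proof (rule ultra_sum[OF f])
      fix j assume "j \<in> {..<m}"
      then have j: "j < m" by simp
      have "f (of_nat N) ^ (m - 1 - j) \<le> 1" using place_of_nat(2)[OF f, of N] fv(5) by (intro power_le_one)
      moreover have "f (of_nat N * c j) \<le> 1" using c[OF j] f by (simp add: height_bound_def)
      moreover have "r ^ j \<le> r ^ (m - 1)" using r j by (intro power_increasing) auto
      ultimately have "f (of_nat N) ^ (m - 1 - j) * f (of_nat N * c j) * r ^ j \<le> 1 * 1 * r ^ (m - 1)"
        using fv(5) r by (intro mult_mono) auto
      then show "f (of_nat N ^ (m - 1 - j) * (of_nat N * c j) * (of_nat N * z) ^ j) \<le> r ^ (m - 1)"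
        unfolding r_def fv(3)[of _ "_ ^ _"] fv(3)[of _ "of_nat N * c j"] fv(8) by simp
    qed (use r in simp)
    finally have "r ^ m \<le> r ^ (m - 1)" .
    moreover have "r ^ (m - 1) < r ^ m" using r m by (intro power_strict_increasing) auto
    ultimately show False by simp
  qed
  then have "f (of_nat (m * N) * z) \<le> 1" if f: "f \<in> ultra_places" for f
  proof -
    note fv = abs_valueD[OF ultra_place(1)[OF f]]
    have "f (of_nat m) * f (of_nat N * z) \<le> 1 * 1"
      using \<open>\<And>f. f \<in> ultra_places \<Longrightarrow> f (of_nat N * z) \<le> 1\<close>[OF f] place_of_nat(2)[OF f] fv(5)
      by (intro mult_mono) auto
    then show ?thesis by (simp add: fv ac_simps)
  qed
  moreover have "f z \<le> real (m * N)" if f: "f \<in> arch_places" for f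
  proof (cases "f z \<le> 1")
    case True
    have "1 \<le> m * N" using m N by (metis One_nat_def Suc_leI nat_0_less_mult_iff)
    then have "1 \<le> real (m * N)" by linarith
    then show ?thesis using True by simp
  next
    case False
    note fv = abs_valueD[OF arch_place(1)[OF f]]
    have "f z ^ m = f (\<Sum>j<m. c j * z ^ j)" using eq by (metis fv(7,8))
    also have "\<dots> \<le> (\<Sum>j<m. f (c j * z ^ j))" by (rule abs_value_sum[OF arch_place(1)[OF f]])
    also have "\<dots> \<le> (\<Sum>j<m. real N * f z ^ (m - 1))"
    proof (intro sum_mono)
      fix j assume "j \<in> {..<m}"
      then have "f (c j) \<le> real N" "f z ^ j \<le> f z ^ (m - 1)"
        using c f False by (auto simp: height_bound_def intro!: power_increasing)
      then show "f (c j * z ^ j) \<le> real N * f z ^ (m - 1)"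
        by (simp add: fv mult_mono)
    qed
    also have "\<dots> = real (m * N) * f z ^ (m - 1)" by simp
    finally have "f z * f z ^ (m - 1) \<le> real (m * N) * f z ^ (m - 1)"
      using m by (simp add: power_eq_if)
    then show ?thesis using False by (simp add: mult_le_cancel_right)
  qed
  ultimately show ?thesis using m N by (simp add: height_bound_def)
qed

lemma height_bound_common:
  assumes "finite J" "\<And>j. j \<in> J \<Longrightarrow> \<exists>N. height_bound N (c j)"
  shows "\<exists>N>0. \<forall>j\<in>J. height_bound N (c j)"
proof -
  obtain N where N: "\<And>j. j \<in> J \<Longrightarrow> height_bound (N j) (c j)" using assms(2) by metis
  have "prod N J > 0" using N by (intro prod_pos) (auto simp: height_bound_def)
  moreover have "height_bound (prod N J) (c j)" if "j \<in> J" for j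
    using height_bound_mono[OF N[OF that]] dvd_prodI[OF assms(1) that] \<open>prod N J > 0\<close> by blast
  ultimately show ?thesis by blast
qed

text \<open>The factor containing \<open>b\<close> clears the denominator; the summand 1 keeps the
  bound positive when \<open>a = 0\<close>.\<close>

lemma height_bound_rational:
  assumes "b \<noteq> 0"
  shows "height_bound (nat (\<bar>a\<bar> + 1) * nat \<bar>b\<bar>) (of_int a / of_int b :: 'a::field_char_0)"
proof -
  define N where "N = nat (\<bar>a\<bar> + 1) * nat \<bar>b\<bar>"
  have N: "int N = (\<bar>a\<bar> + 1) * \<bar>b\<bar>" by (simp add: N_def)
  have "f (of_int a / of_int b) \<le> real N" if f: "f \<in> arch_places" for f :: "'a \<Rightarrow> real"
  proof -
    have b1: "\<bar>of_int b :: real\<bar> \<ge> 1" using assms by linarith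
    have "f (of_int a / of_int b) = \<bar>of_int a\<bar> / \<bar>of_int b\<bar>"
      by (simp add: abs_valueD[OF arch_place(1)[OF f]] arch_place(3)[OF f])
    also have "\<dots> \<le> (\<bar>of_int a\<bar> + 1) * \<bar>of_int b\<bar>"
    proof -
      have "\<bar>of_int a :: real\<bar> \<le> (\<bar>of_int a\<bar> + 1) * (\<bar>of_int b\<bar> * \<bar>of_int b\<bar>)"
        using mult_mono[of "\<bar>of_int a :: real\<bar>" "\<bar>of_int a\<bar> + 1" 1 "\<bar>of_int b\<bar> * \<bar>of_int b\<bar>"]
          mult_mono[OF b1 b1] by simp
      moreover have "0 < \<bar>of_int b :: real\<bar>" using b1 by linarith
      ultimately show ?thesis by (simp only: pos_divide_le_eq mult.assoc)
    qed
    also have "\<dots> = real N" using arg_cong[OF N, of real_of_int] by simp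
    finally show ?thesis .
  qed
  moreover have "f (of_nat N * (of_int a / of_int b)) \<le> 1" if f: "f \<in> ultra_places" for f :: "'a \<Rightarrow> real"
  proof -
    obtain c where "int N = c * b" using N by (metis dvd_abs_iff dvd_def dvd_triv_right mult.commute abs_dvd_iff)
    then have "(of_nat N :: 'a) = of_int c * of_int b" by (metis of_int_mult of_int_of_nat_eq)
    then have "of_nat N * (of_int a / of_int b) = (of_int (c * a) :: 'a)" using assms by simp
    then show ?thesis using ultra_place(4)[OF f] by metis
  qed
  moreover have "N > 0" using assms by (simp add: N_def)
  ultimately show ?thesis unfolding N_def[symmetric] height_bound_def by blast
qed

lemma height_bound_algebraic:
  assumes "algebraic c"
  shows "\<exists>N. height_bound N c"
proof -
  obtain p where p: "\<And>i. coeff p i \<in> \<int>" "p \<noteq> 0" "poly p c = 0"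
    using assms unfolding algebraic_def by blast
  define d where "d = degree p"
  have "d > 0"
  proof (rule ccontr)
    assume "\<not> d > 0"
    then obtain a where "p = [:a:]" unfolding d_def by (metis degree_eq_zeroE gr0I)
    then show False using p by simp
  qed
  have lc: "coeff p d \<noteq> 0" using p(2) by (simp add: d_def)
  have "\<exists>N>0. \<forall>j\<in>{..<d}. height_bound N (coeff p j / coeff p d)"
  proof (rule height_bound_common)
    fix j
    obtain a b where "coeff p j = of_int a" "coeff p d = of_int b" using p(1) by (metis Ints_cases)
    moreover from this lc have "b \<noteq> 0" by auto
    ultimately show "\<exists>N. height_bound N (coeff p j / coeff p d)" using height_bound_rational by metis
  qed simp
  then obtain N where N: "\<And>j. j < d \<Longrightarrow> height_bound N (coeff p j / coeff p d)" by auto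
  have "{..d} = insert d {..<d}" by auto
  then have "coeff p d * c ^ d + (\<Sum>j<d. coeff p j * c ^ j) = 0"
    using p(3) by (simp add: poly_altdef d_def)
  then have "c ^ d = - (\<Sum>j<d. coeff p j * c ^ j) / coeff p d"
    using lc by (simp add: field_simps add_eq_0_iff)
  then have "c ^ d = - (\<Sum>j<d. coeff p j / coeff p d * c ^ j)"
    by (simp add: sum_divide_distrib)
  from height_bound_root[OF \<open>d > 0\<close> this N] show ?thesis by blast
qed

text \<open>Only the rate \<open>A\<close> matters in the end. It is an integer, as is the constant,
  so that bounds for different sequences can be merged by divisibility.\<close>

definition growth_bound :: "nat \<Rightarrow> (nat \<Rightarrow> 'a::field_char_0) \<Rightarrow> bool" where
  "growth_bound A s \<longleftrightarrow> A > 0 \<and> (\<exists>C>0. \<forall>i. height_bound (C * A ^ i) (s i))"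

lemma growth_bound_add:
  assumes "growth_bound A s" "growth_bound A t"
  shows "growth_bound A (\<lambda>i. s i + t i)"
proof -
  obtain C D where CD: "C > 0" "D > 0" "\<And>i. height_bound (C * A ^ i) (s i)" "\<And>i. height_bound (D * A ^ i) (t i)" "A > 0"
    using assms by (auto simp: growth_bound_def)
  have "height_bound (2 * (C * D * A ^ i)) (s i + t i)" for i
    by (intro height_bound_add height_bound_mono[OF CD(3)] height_bound_mono[OF CD(4)])
      (use CD in \<open>auto intro: mult_dvd_mono\<close>)
  then show ?thesis using CD unfolding growth_bound_def by (intro conjI exI[of _ "2 * (C * D)"]) (simp_all add: mult.assoc)
qed

lemma growth_bound_mult:
  assumes "growth_bound A s" "growth_bound B t"
  shows "growth_bound (A * B) (\<lambda>i. s i * t i)"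
proof -
  obtain C D where CD: "C > 0" "D > 0" "\<And>i. height_bound (C * A ^ i) (s i)" "\<And>i. height_bound (D * B ^ i) (t i)" "A > 0" "B > 0"
    using assms by (auto simp: growth_bound_def)
  have "height_bound (C * D * (A * B) ^ i) (s i * t i)" for i
    using height_bound_mult[OF CD(3,4), of i i] by (simp add: power_mult_distrib ac_simps)
  then show ?thesis using CD unfolding growth_bound_def by (intro conjI exI[of _ "C * D"]) simp_all
qed

lemma growth_bound_mono:
  assumes "growth_bound A s" "A dvd B" "B > 0"
  shows "growth_bound B s"
proof -
  obtain C where C: "C > 0" "\<And>i. height_bound (C * A ^ i) (s i)" using assms by (auto simp: growth_bound_def)
  have "height_bound (C * B ^ i) (s i)" for i
    by (rule height_bound_mono[OF C(2)]) (use assms C in \<open>auto intro: mult_dvd_mono dvd_power_same\<close>)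
  then show ?thesis using C assms(3) by (auto simp: growth_bound_def)
qed

lemma growth_bound_const:
  assumes "algebraic c"
  shows "growth_bound 1 (\<lambda>_. c)"
proof -
  obtain N where "height_bound N c" using height_bound_algebraic[OF assms] by blast
  then show ?thesis by (auto simp: growth_bound_def height_bound_def)
qed

lemma growth_bound_shift:
  assumes "growth_bound A s"
  shows "growth_bound A (\<lambda>i. s (i + a))"
proof -
  obtain C where C: "C > 0" "\<And>i. height_bound (C * A ^ i) (s i)" "A > 0" using assms by (auto simp: growth_bound_def)
  have "height_bound (C * A ^ a * A ^ i) (s (i + a))" for i
    using C(2)[of "i + a"] by (simp add: power_add ac_simps)
  then show ?thesis using C unfolding growth_bound_def by (intro conjI exI[of _ "C * A ^ a"]) simp_all
qed

lemma growth_bound_sum: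
  assumes "finite I" "A > 0" "algebraic 0" "\<And>a. a \<in> I \<Longrightarrow> growth_bound A (s a)"
  shows "growth_bound A (\<lambda>i. \<Sum>a\<in>I. s a i)"
  using assms(1,4)
proof (induction I rule: finite_induct)
  case empty
  then show ?case using growth_bound_mono[OF growth_bound_const[of 0]] assms(2) by simp
next
  case (insert a I)
  then show ?case using growth_bound_add[of A "s a" "\<lambda>i. \<Sum>a\<in>I. s a i"] by simp
qed

lemma growth_bound_geometric:
  assumes "algebraic t"
  shows "\<exists>A. growth_bound A (\<lambda>i. t ^ i)"
proof -
  obtain N where N: "height_bound N t" using height_bound_algebraic[OF assms] by blast
  have "\<forall>i. height_bound (1 * N ^ i) (t ^ i)" using height_bound_power[OF N] by simp
  then show ?thesis using N unfolding growth_bound_def height_bound_def by blast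
qed

lemma growth_bound_poly:
  fixes s :: "nat \<Rightarrow> 'a::field_char_0"
  assumes alg: "\<And>x :: 'a. algebraic x" and s: "growth_bound A s"
  shows "\<exists>B. growth_bound B (\<lambda>i. poly p (s i))"
proof (induction p)
  case 0
  then show ?case using growth_bound_const[of 0] by auto
next
  case (pCons a p)
  then obtain B where B: "growth_bound B (\<lambda>i. poly p (s i))" by blast
  then have "A * B > 0" using s by (simp add: growth_bound_def)
  then have "growth_bound (A * B) (\<lambda>i. a + s i * poly p (s i))"
    by (intro growth_bound_add growth_bound_mult[OF s B] growth_bound_mono[OF growth_bound_const[OF alg]]) simp_all
  then show ?case by (auto simp: algebra_simps)
qed

lemma growth_bound_root:
  assumes m: "m > 0" and eq: "\<And>i. z i ^ m = - (\<Sum>j<m. c j i * z i ^ j)"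
    and c: "\<And>j. j < m \<Longrightarrow> \<exists>A. growth_bound A (c j)"
  shows "\<exists>A. growth_bound A z"
proof -
  have "\<forall>j\<in>{..<m}. \<exists>A C. A > 0 \<and> C > 0 \<and> (\<forall>i. height_bound (C * A ^ i) (c j i))"
    using c unfolding growth_bound_def by blast
  then obtain A C where AC: "\<And>j. j < m \<Longrightarrow> A j > 0 \<and> C j > 0 \<and> (\<forall>i. height_bound (C j * A j ^ i) (c j i))"
    by (metis lessThan_iff)
  define A' C' where "A' = prod A {..<m}" and "C' = prod C {..<m}"
  have pos: "A' > 0" "C' > 0" unfolding A'_def C'_def using AC by (auto intro!: prod_pos)
  have "height_bound (C' * A' ^ i) (c j i)" if "j < m" for i j
  proof (rule height_bound_mono)
    show "height_bound (C j * A j ^ i) (c j i)" using AC that by blast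
    show "C j * A j ^ i dvd C' * A' ^ i"
      unfolding A'_def C'_def using that by (intro mult_dvd_mono dvd_power_same dvd_prodI) auto
  qed (use pos in simp)
  then have "height_bound (m * (C' * A' ^ i)) (z i)" for i
    by (intro height_bound_root[OF m eq])
  then have "height_bound (m * C' * A' ^ i) (z i)" for i by (simp add: mult.assoc)
  then show ?thesis using pos m unfolding growth_bound_def by (intro exI[of _ A'] conjI exI[of _ "m * C'"]) simp_all
qed

text \<open>\<open>N * w\<close> is integral with archimedean size at most \<open>N ^ 2\<close>, so
  its integer polynomial has coefficients at most \<open>(1 + N ^ 2) ^ n\<close>, hence at most
  \<open>(2 * N ^ 2) ^ n\<close>. Liouville squares this, giving \<open>4 ^ n * N ^ (4 * n)\<close>,
  and returning from \<open>N * w\<close> to \<open>w\<close> costs one more factor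
  \<open>N\<close>.\<close>

lemma place_lower_bound:
  fixes w :: "'a::{alg_closed_field, field_char_0}"
  assumes alg: "\<And>x :: 'a. algebraic x" and K: "degree_bounded n K" and w: "w \<in> K" "w \<noteq> 0"
    and hb: "height_bound N w" and f: "f \<in> places"
  shows "f w \<ge> 1 / ((real n + 1) * 4 ^ n * real N ^ (4 * n + 1))"
proof -
  have N: "N > 0" using hb by (simp add: height_bound_def)
  then have N1: "real N \<ge> 1" by linarith
  have subring: "is_subring K" using K by (simp add: degree_bounded_def)
  have NK: "of_nat N * w \<in> K"
    using is_subringD(4,7)[OF subring] w(1) by (metis of_int_of_nat_eq)
  obtain q0 :: "rat poly" where q0: "q0 \<noteq> 0" "degree q0 \<le> n" "poly (map_poly of_rat q0) (of_nat N * w) = 0"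
    using K NK unfolding degree_bounded_def by blast
  have "g (of_nat N * w) \<le> real N ^ 2" if g: "g \<in> arch_places" for g
  proof -
    have "g (of_nat N * w) = real N * g w"
      by (simp add: abs_valueD(3)[OF arch_place(1)[OF g]] place_of_nat(1)[OF g])
    also have "\<dots> \<le> real N * real N" using hb g N by (intro mult_left_mono) (auto simp: height_bound_def)
    finally show ?thesis by (simp add: power2_eq_square)
  qed
  moreover have "g (of_nat N * w) \<le> 1" if "g \<in> ultra_places" for g
    using hb that by (simp add: height_bound_def)
  ultimately obtain q where q: "lead_coeff q = 1" "degree q \<le> n" "poly (map_poly of_int q) (of_nat N * w) = 0"
    "\<And>i. \<bar>of_int (coeff q i)\<bar> \<le> (1 + real N ^ 2) ^ n"
    using integral_bounded_poly[OF alg q0, of "real N ^ 2"] by (metis zero_le_power2)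
  have "q \<noteq> 0" using q(1) by auto
  have "of_nat N * w \<noteq> 0" using N w(2) by simp
  from liouville[OF this \<open>q \<noteq> 0\<close> q(2,3,4) f]
  have 1: "1 / ((real n + 1) * ((1 + real N ^ 2) ^ n) ^ 2) \<le> f (of_nat N * w)" .
  have "1 \<le> real N ^ 2" using N1 by simp
  then have "(1 + real N ^ 2) ^ n \<le> (2 * real N ^ 2) ^ n" by (intro power_mono) auto
  then have "((1 + real N ^ 2) ^ n) ^ 2 \<le> ((2 * real N ^ 2) ^ n) ^ 2" by (rule power_mono) simp
  also have "\<dots> = ((2 * real N ^ 2) ^ 2) ^ n" by (metis power_mult mult.commute)
  also have "(2 * real N ^ 2) ^ 2 = 4 * real N ^ 4" by (simp add: power_mult_distrib flip: power_mult)
  also have "\<dots> ^ n = 4 ^ n * real N ^ (4 * n)" by (simp add: power_mult_distrib power_mult)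
  finally have 2: "(real n + 1) * ((1 + real N ^ 2) ^ n) ^ 2 \<le> (real n + 1) * (4 ^ n * real N ^ (4 * n))"
    by (intro mult_left_mono) auto
  have "1 / ((real n + 1) * (4 ^ n * real N ^ (4 * n))) \<le> 1 / ((real n + 1) * ((1 + real N ^ 2) ^ n) ^ 2)"
    using 2 by (intro divide_left_mono mult_pos_pos zero_less_power) (auto simp: add_pos_nonneg N)
  also note 1
  also have "f (of_nat N * w) \<le> real N * f w"
    using place(3)[OF f, of "int N"] abs_valueD(5)[OF place(1)[OF f], of w]
    by (simp add: abs_valueD(3)[OF place(1)[OF f]] mult_right_mono)
  finally have "1 / ((real n + 1) * (4 ^ n * real N ^ (4 * n))) / real N \<le> f w"
    using N by (simp only: pos_divide_le_eq of_nat_0_less_iff mult.commute)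
  moreover have "(real n + 1) * 4 ^ n * real N ^ (4 * n + 1) = (real n + 1) * (4 ^ n * real N ^ (4 * n)) * real N"
    by simp
  ultimately show ?thesis by (simp only: divide_divide_eq_left)
qed

lemma growth_lower_bound:
  fixes s :: "nat \<Rightarrow> 'a::{alg_closed_field, field_char_0}"
  assumes alg: "\<And>x :: 'a. algebraic x" and K: "degree_bounded n K" and s: "growth_bound A s"
    and f: "f \<in> places"
  shows "\<exists>c>0. \<forall>i. s i \<in> K \<longrightarrow> s i \<noteq> 0 \<longrightarrow> f (s i) \<ge> c / (real A ^ (4 * n + 1)) ^ i"
proof -
  obtain C where C: "C > 0" "\<And>i. height_bound (C * A ^ i) (s i)" "A > 0" using s by (auto simp: growth_bound_def)
  define c where "c = 1 / ((real n + 1) * 4 ^ n * real C ^ (4 * n + 1))"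
  have "f (s i) \<ge> c / (real A ^ (4 * n + 1)) ^ i" if "s i \<in> K" "s i \<noteq> 0" for i
  proof -
    have "real (C * A ^ i) ^ (4 * n + 1) = real C ^ (4 * n + 1) * (real A ^ (4 * n + 1)) ^ i"
      by (simp only: of_nat_mult of_nat_power power_mult_distrib power_mult[symmetric] mult.commute)
    then show ?thesis
      using place_lower_bound[OF alg K that C(2) f] unfolding c_def by (simp only: divide_divide_eq_left mult.assoc)
  qed
  moreover have "c > 0" using C by (simp add: c_def)
  ultimately show ?thesis by blast
qed

lemma finite_bounded_int_polys:
  "finite {q :: int poly. degree q \<le> n \<and> (\<forall>i. \<bar>coeff q i\<bar> \<le> M)}"
proof (rule finite_subset)
  show "finite (Poly ` {xs. set xs \<subseteq> {-M..M} \<and> length xs \<le> Suc n})"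
    by (intro finite_imageI finite_lists_length_le) simp
  show "{q. degree q \<le> n \<and> (\<forall>i. \<bar>coeff q i\<bar> \<le> M)} \<subseteq> Poly ` {xs. set xs \<subseteq> {-M..M} \<and> length xs \<le> Suc n}"
  proof
    fix q :: "int poly" assume "q \<in> {q. degree q \<le> n \<and> (\<forall>i. \<bar>coeff q i\<bar> \<le> M)}"
    then have q: "degree q \<le> n" "\<And>i. \<bar>coeff q i\<bar> \<le> M" by auto
    have "set (coeffs q) \<subseteq> {-M..M}"
      using q(2) by (auto simp: coeffs_def abs_le_iff minus_le_iff)
    moreover have "length (coeffs q) \<le> Suc n" using q(1) by (simp add: coeffs_def)
    ultimately show "q \<in> Poly ` {xs. set xs \<subseteq> {-M..M} \<and> length xs \<le> Suc n}"
      by (intro image_eqI[of _ _ "coeffs q"]) simp_all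
  qed
qed

text \<open>Kronecker's theorem on roots of unity, applied to the inverse of \<open>t\<close>.\<close>

lemma exists_small_place:
  fixes t :: "'a::{alg_closed_field, field_char_0}"
  assumes alg: "\<And>x :: 'a. algebraic x" and K: "degree_bounded n K"
    and t: "inverse t \<in> K" "t \<noteq> 0" "inj (\<lambda>i::nat. t ^ i)"
  shows "\<exists>f\<in>places. f t < 1"
proof (rule ccontr)
  assume "\<not> ?thesis"
  then have ge: "f t \<ge> 1" if "f \<in> places" for f using that by force
  \<comment> \<open>If \<open>t\<close> is nowhere smaller than 1, all powers of its inverse have
    size at most 1 at every place. With \<open>H = 1\<close> the bound on integer coefficients is
    \<open>(1 + 1) ^ n\<close>, so finitely many polynomials annihilate all these powers.\<close>
  define Q where "Q = {q :: int poly. degree q \<le> n \<and> (\<forall>i. \<bar>coeff q i\<bar> \<le> 2 ^ n)}"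
  have "\<exists>q\<in>Q. q \<noteq> 0 \<and> poly (map_poly of_int q) (inverse t ^ i) = 0" for i
  proof -
    have le: "f (inverse t ^ i) \<le> 1" if "f \<in> places" for f
    proof -
      have "inverse (f t) \<le> 1" using ge[OF that] by (simp add: inverse_le_1_iff)
      then show ?thesis using ge[OF that]
        by (simp add: abs_valueD[OF place(1)[OF that]] power_le_one)
    qed
    have "inverse t ^ i \<in> K" using K t(1) is_subringD(8) unfolding degree_bounded_def by blast
    then obtain q0 :: "rat poly" where q0: "q0 \<noteq> 0" "degree q0 \<le> n" "poly (map_poly of_rat q0) (inverse t ^ i) = 0"
      using K unfolding degree_bounded_def by blast
    obtain q where q: "lead_coeff q = 1" "degree q \<le> n" "poly (map_poly of_int q) (inverse t ^ i) = 0"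
      "\<And>j. \<bar>real_of_int (coeff q j)\<bar> \<le> (1 + 1) ^ n"
      using integral_bounded_poly[OF alg q0, of 1] le by (auto simp: places_def)
    have "\<bar>coeff q j\<bar> \<le> 2 ^ n" for j
    proof -
      have "real_of_int \<bar>coeff q j\<bar> \<le> real_of_int (2 ^ n)" using q(4)[of j] by simp
      then show ?thesis unfolding of_int_le_iff .
    qed
    then have "q \<in> Q" using q(2) by (simp add: Q_def)
    moreover have "q \<noteq> 0" using q(1) by auto
    ultimately show ?thesis using q(3) by blast
  qed
  then have "range (\<lambda>i. inverse t ^ i) \<subseteq> (\<Union>q\<in>Q - {0}. {x. poly (map_poly of_int q) x = 0})" by blast
  moreover have "finite (\<Union>q\<in>Q - {0}. {x :: 'a. poly (map_poly of_int q) x = 0})"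
  proof (rule finite_UN_I)
    show "finite (Q - {0})" unfolding Q_def by (intro finite_Diff finite_bounded_int_polys)
    fix q assume "q \<in> Q - {0}"
    then have "map_poly of_int q \<noteq> (0 :: 'a poly)" by (simp add: map_poly_eq_0_iff)
    then show "finite {x :: 'a. poly (map_poly of_int q) x = 0}" by (rule poly_roots_finite)
  qed
  ultimately have "finite (range (\<lambda>i. inverse t ^ i))" by (rule finite_subset)
  moreover have "inj (\<lambda>i. inverse t ^ i)"
    using t(3) by (simp add: inj_def power_inverse)
  ultimately show False using finite_imageD by blast
qed

section \<open>Sequences approximated by power series\<close>

lemma poly_truncate_fps: "poly (truncate_fps M g) y = (\<Sum>l<M. fps_nth g l * y ^ l)"
  for y :: "'a::comm_ring_1"
proof -
  have "truncate_fps M g = (\<Sum>l<M. monom (fps_nth g l) l)"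
    by (rule poly_eqI) (simp add: coeff_truncate_fps coeff_sum)
  then show ?thesis by (simp add: poly_sum poly_monom)
qed

lemma abs_value_poly_bound:
  assumes f: "abs_value f" and B: "B \<ge> 0"
  shows "\<exists>C\<ge>0. \<forall>x. f x \<le> B \<longrightarrow> f (poly p x) \<le> C"
proof (intro exI[of _ "\<Sum>i\<le>degree p. f (coeff p i) * B ^ i"] conjI allI impI)
  note fv = abs_valueD[OF f]
  show "0 \<le> (\<Sum>i\<le>degree p. f (coeff p i) * B ^ i)"
    using B fv(5) by (intro sum_nonneg mult_nonneg_nonneg) auto
  fix x assume x: "f x \<le> B"
  have "f (poly p x) \<le> (\<Sum>i\<le>degree p. f (coeff p i * x ^ i))"
    unfolding poly_altdef by (rule abs_value_sum[OF f])
  also have "\<dots> \<le> (\<Sum>i\<le>degree p. f (coeff p i) * B ^ i)"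
    using x fv(5) by (intro sum_mono) (auto simp: fv intro!: mult_left_mono power_mono)
  finally show "f (poly p x) \<le> (\<Sum>i\<le>degree p. f (coeff p i) * B ^ i)" .
qed

lemma frequently_finite_pigeonhole:
  assumes "finite \<Omega>" "eventually (\<lambda>i. \<exists>x\<in>\<Omega>. P x i) sequentially"
  shows "\<exists>x\<in>\<Omega>. \<exists>\<^sub>F i in sequentially. P x i"
proof (rule ccontr)
  assume "\<not> ?thesis"
  then have "\<forall>x\<in>\<Omega>. eventually (\<lambda>i. \<not> P x i) sequentially"
    by (simp add: frequently_def)
  then have "eventually (\<lambda>i. \<forall>x\<in>\<Omega>. \<not> P x i) sequentially"
    by (intro eventually_ball_finite assms(1))
  with assms(2) have "eventually (\<lambda>i. False) sequentially"
    by eventually_elim blast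
  then show False by simp
qed

lemma geometric_place_tendsto_zero:
  assumes f: "abs_value f" and t: "f t < 1"
  shows "(\<lambda>i. f (\<tau> * t ^ i)) \<longlonglongrightarrow> 0"
proof -
  note fv = abs_valueD[OF f]
  have "(\<lambda>i. f \<tau> * f t ^ i) \<longlonglongrightarrow> f \<tau> * 0"
    using fv(5) t by (intro tendsto_mult tendsto_const LIMSEQ_realpow_zero)
  then show ?thesis by (simp add: fv)
qed

text \<open>As \<open>\<tau> * t ^ i\<close> tends to zero at \<open>f\<close>, the lowest nonzero
  term dominates \<open>p\<close>. Its exponent is below \<open>M\<close>, so it cannot be bounded
  by the \<open>M\<close>-th power infinitely often.\<close>

lemma poly_zero_of_small_values:
  assumes f: "abs_value f" and t: "f t < 1" "t \<noteq> 0" and \<tau>: "\<tau> \<noteq> 0"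
    and p: "degree p < M \<or> p = 0"
    and small: "\<exists>\<^sub>F i in sequentially. f (poly p (\<tau> * t ^ i)) \<le> D * f (\<tau> * t ^ i) ^ M"
  shows "p = 0"
proof (rule ccontr)
  assume nz: "p \<noteq> 0"
  note fv = abs_valueD[OF f]
  define r where "r = (LEAST i. coeff p i \<noteq> 0)"
  have r: "coeff p r \<noteq> 0" "\<And>i. i < r \<Longrightarrow> coeff p i = 0"
    unfolding r_def using LeastI[of "\<lambda>i. coeff p i \<noteq> 0" "degree p"] nz not_less_Least by auto
  have "r < M" using le_degree[OF r(1)] p nz by simp
  define h where "h = (\<Sum>i\<in>{Suc r..degree p}. monom (coeff p i) (i - Suc r))"
  have p_eq: "p = monom 1 r * ([:coeff p r:] + [:0, 1:] * h)"
  proof -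
    have "p = (\<Sum>i\<le>degree p. monom (coeff p i) i)" by (simp add: poly_as_sum_of_monoms)
    also have "\<dots> = (\<Sum>i\<in>{r..degree p}. monom (coeff p i) i)"
      using r(2) by (intro sum.mono_neutral_right) (auto simp: not_le)
    also have "\<dots> = monom (coeff p r) r + (\<Sum>i\<in>{Suc r..degree p}. monom (coeff p i) i)"
      using le_degree[OF r(1)] by (simp add: sum.atLeast_Suc_atMost)
    also have "(\<Sum>i\<in>{Suc r..degree p}. monom (coeff p i) i) = monom 1 (Suc r) * h"
      unfolding h_def sum_distrib_left by (intro sum.cong) (auto simp: mult_monom)
    also have "monom 1 (Suc r) = monom 1 r * ([:0, 1:] :: 'a poly)"
      by (simp add: monom_Suc)
    also have "monom (coeff p r) r = monom 1 r * [:coeff p r:]"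
      by (simp add: smult_monom)
    finally show ?thesis by (simp add: algebra_simps)
  qed
  obtain H where H: "H \<ge> 0" "\<And>x. f x \<le> 1 \<Longrightarrow> f (poly h x) \<le> H"
    using abs_value_poly_bound[OF f, of 1 h] by auto
  \<comment> \<open>Chosen so that for \<open>f y < \<epsilon>\<close> the higher terms and the
    assumed bound together stay below the size of the lowest coefficient.\<close>
  define \<epsilon> where "\<epsilon> = f (coeff p r) / (H + \<bar>D\<bar> + 1)"
  have \<epsilon>: "\<epsilon> > 0" using H(1) fv(2)[OF r(1)] by (simp add: \<epsilon>_def)
  have "eventually (\<lambda>i. f (\<tau> * t ^ i) < min 1 \<epsilon>) sequentially"
    using geometric_place_tendsto_zero[OF f t(1), of \<tau>] \<epsilon> by (intro order_tendstoD) auto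
  from frequently_eventually_frequently[OF small this]
  obtain i where i: "f (poly p (\<tau> * t ^ i)) \<le> D * f (\<tau> * t ^ i) ^ M" "f (\<tau> * t ^ i) < min 1 \<epsilon>"
    using frequently_ex by blast
  define y where "y = \<tau> * t ^ i"
  have "y \<noteq> 0" using t \<tau> by (simp add: y_def)
  then have y: "f y > 0" "f y < 1" "f y < \<epsilon>" using i(2) fv(2) by (auto simp: y_def)
  have "poly p y = y ^ r * (coeff p r + y * poly h y)"
    by (subst p_eq) (simp add: poly_monom algebra_simps)
  then have "f y ^ r * f (coeff p r + y * poly h y) \<le> D * f y ^ M"
    using i(1) by (simp add: y_def fv)
  also have "\<dots> \<le> \<bar>D\<bar> * f y ^ M" using y by (intro mult_right_mono) auto
  also have "\<dots> \<le> \<bar>D\<bar> * f y ^ Suc r"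
    using y \<open>r < M\<close> by (intro mult_left_mono power_decreasing) auto
  also have "\<dots> = f y ^ r * (\<bar>D\<bar> * f y)" by simp
  finally have "f y ^ r * f (coeff p r + y * poly h y) \<le> f y ^ r * (\<bar>D\<bar> * f y)" .
  then have "f (coeff p r + y * poly h y) \<le> \<bar>D\<bar> * f y"
    using y(1) by simp
  moreover have "f (coeff p r) \<le> f (coeff p r + y * poly h y) + f (y * poly h y)"
    using fv(10)[of "coeff p r + y * poly h y" "y * poly h y"] by simp
  moreover have "f (y * poly h y) \<le> f y * H"
    using H(2)[of y] y by (simp add: fv)
  ultimately have "f (coeff p r) \<le> f y * (H + \<bar>D\<bar>)" by (simp add: algebra_simps)
  also have "\<dots> < f y * (H + \<bar>D\<bar> + 1)" using y by simp
  also have "\<dots> < \<epsilon> * (H + \<bar>D\<bar> + 1)" using y H(1) by (intro mult_strict_right_mono) auto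
  also have "\<dots> = f (coeff p r)" using H(1) by (simp add: \<epsilon>_def)
  finally show False by simp
qed

lemma pigeonhole_class:
  assumes "finite R" "\<And>a. a \<le> W \<Longrightarrow> c a \<in> R" "W = card R * M"
  shows "\<exists>\<rho>\<in>R. card {a. a \<le> W \<and> c a = \<rho>} > M"
proof (rule ccontr)
  assume neg: "\<not> ?thesis"
  have "{..W} = (\<Union>\<rho>\<in>R. {a. a \<le> W \<and> c a = \<rho>})" using assms(2) by auto
  then have "card {..W} \<le> (\<Sum>\<rho>\<in>R. card {a. a \<le> W \<and> c a = \<rho>})"
    using card_UN_le[OF assms(1), of "\<lambda>\<rho>. {a. a \<le> W \<and> c a = \<rho>}"] by simp
  also have "\<dots> \<le> (\<Sum>\<rho>\<in>R. M)" using neg by (intro sum_mono) (auto simp: not_less)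
  finally show False using assms(3) by simp
qed

text \<open>The sum is a fixed nonzero polynomial evaluated at the distinct points
  \<open>t ^ l\<close>.\<close>

lemma finite_zeros_geometric:
  fixes t :: "'a::field"
  assumes inj: "inj (\<lambda>l::nat. t ^ l)" and S: "finite S" "\<exists>a\<in>S. \<mu> a \<noteq> 0"
  shows "finite {l. (\<Sum>a\<in>S. \<mu> a * t ^ (a * l)) = 0}"
proof -
  define p where "p = (\<Sum>a\<in>S. monom (\<mu> a) a)"
  have "coeff p a = (if a \<in> S then \<mu> a else 0)" for a
    using S(1) by (simp add: p_def coeff_sum)
  then have "p \<noteq> 0" using S(2) by (metis coeff_0)
  have "(\<Sum>a\<in>S. \<mu> a * t ^ (a * l)) = poly p (t ^ l)" for l
    by (simp add: p_def poly_sum poly_monom mult.commute flip: power_mult)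
  then have "{l. (\<Sum>a\<in>S. \<mu> a * t ^ (a * l)) = 0} = (\<lambda>l. t ^ l) -` {x. poly p x = 0}" by auto
  then show ?thesis using finite_vimageI[OF poly_roots_finite[OF \<open>p \<noteq> 0\<close>] inj] by simp
qed

text \<open>
  The relation \<open>\<mu>\<close> annihilates the first \<open>M0\<close> terms of the expansion of \<open>s j\<close>, so the corresponding
  combination of values is too small at \<open>f\<close> to be nonzero. Indices are grouped by branch \<open>\<rho>\<close> since
  the branch approximating \<open>s j i\<close> may change with \<open>i\<close>.
\<close>

theorem expansion_is_polynomial:
  fixes \<iota> :: "'k::field_char_0 \<Rightarrow> 'a::{alg_closed_field, field_char_0}" and s :: "'j \<Rightarrow> nat \<Rightarrow> 'a"
    and Q :: "'r \<Rightarrow> 'j \<Rightarrow> 'a fps"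
  assumes alg: "\<And>x :: 'a. algebraic x" and \<iota>: "is_hom \<iota>" and K: "degree_bounded n (range \<iota>)"
    and f: "f \<in> places" and t: "f (\<iota> t) < 1" "t \<noteq> 0" and \<tau>: "\<tau> \<noteq> 0"
    and fin: "finite J" "finite R"
    and growth: "\<And>j. j \<in> J \<Longrightarrow> \<exists>A. growth_bound A (s j)"
    and rational: "\<And>j i. j \<in> J \<Longrightarrow> s j i \<in> range \<iota>"
    and approx: "\<And>M. \<exists>C. \<forall>i. \<exists>\<rho>\<in>R. \<forall>j\<in>J.
      f (s j i - poly (truncate_fps M (Q \<rho> j)) (\<tau> * \<iota> t ^ i)) \<le> C * f (\<tau> * \<iota> t ^ i) ^ M"
  shows "\<exists>\<rho>\<in>R. \<exists>L. \<forall>j\<in>J. \<forall>l\<ge>L. fps_nth (Q \<rho> j) l = 0"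
proof -
  have fa: "abs_value f" by (rule place(1)[OF f])
  note fv = abs_valueD[OF fa]
  note \<iota>s = is_hom_simps[OF \<iota>] is_hom_field_simps[OF \<iota>]
  define \<eta> where "\<eta> = (\<lambda>i. \<tau> * \<iota> t ^ i)"
  have \<iota>t: "\<iota> t \<noteq> 0" "f (\<iota> t) > 0" using t(2) \<iota>s fv(2) by auto
  have inj: "inj (\<lambda>l::nat. \<iota> t ^ l)"
  proof (rule injI)
    fix k l :: nat assume "\<iota> t ^ k = \<iota> t ^ l"
    then have "f (\<iota> t) ^ k = f (\<iota> t) ^ l" by (metis fv(8))
    then show "k = l" using \<iota>t(2) t(1) by (simp add: power_inject_exp')
  qed
  obtain A where A: "\<And>j. j \<in> J \<Longrightarrow> growth_bound (A j) (s j)" using growth by metis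
  define B where "B = prod A J"
  have "B > 0" unfolding B_def using A by (intro prod_pos) (auto simp: growth_bound_def)
  have B: "growth_bound B (s j)" if "j \<in> J" for j
    using growth_bound_mono[OF A[OF that] _ \<open>B > 0\<close>] dvd_prodI[OF fin(1) that, of A] unfolding B_def by blast
  \<comment> \<open>By Liouville, nonzero combinations are at least a constant times
    \<open>1 / \<beta> ^ i\<close>. The choice of \<open>M0\<close> makes
    \<open>f (\<iota> t) ^ M0 * \<beta>\<close> less than 1, so that \<open>M0\<close> killed terms
    beat this bound.\<close>
  define \<beta> where "\<beta> = real B ^ (4 * n + 1)"
  have \<beta>: "\<beta> > 0" using \<open>B > 0\<close> by (simp add: \<beta>_def)
  obtain M0 where M0: "f (\<iota> t) ^ M0 < 1 / \<beta>"
    using real_arch_pow_inv[of "1 / \<beta>" "f (\<iota> t)"] \<beta> t(1) by auto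
  \<comment> \<open>Among \<open>W + 1\<close> consecutive indices more than \<open>M0\<close> share
    a branch, which leaves enough unknowns to kill \<open>M0\<close> terms.\<close>
  define W where "W = card R * M0"
  define \<Omega> where "\<Omega> = {S. S \<subseteq> {..W} \<and> card S > M0}"
  have finS: "finite S" if "S \<in> \<Omega>" for S using that finite_subset[of S "{..W}"] by (auto simp: \<Omega>_def)
  have "\<forall>S\<in>\<Omega>. \<exists>\<mu>. (\<exists>a\<in>S. \<mu> a \<noteq> 0) \<and> (\<forall>l<M0. (\<Sum>a\<in>S. \<mu> a * t ^ (a * l)) = 0)"
  proof
    fix S assume S: "S \<in> \<Omega>"
    show "\<exists>\<mu>. (\<exists>a\<in>S. \<mu> a \<noteq> 0) \<and> (\<forall>l<M0. (\<Sum>a\<in>S. \<mu> a * t ^ (a * l)) = 0)"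
      using nontrivial_linear_relation[of "{..<M0}" S "\<lambda>a l. t ^ (a * l)"] finS[OF S] S
      by (auto simp: \<Omega>_def)
  qed
  then obtain \<mu> where \<mu>: "\<And>S. S \<in> \<Omega> \<Longrightarrow> \<exists>a\<in>S. \<mu> S a \<noteq> 0"
    "\<And>S l. S \<in> \<Omega> \<Longrightarrow> l < M0 \<Longrightarrow> (\<Sum>a\<in>S. \<mu> S a * t ^ (a * l)) = 0" by metis
  \<comment> \<open>The factor by which the relation for \<open>S\<close> multiplies the term of
    order \<open>l\<close>, shifting by \<open>a\<close> being multiplication by
    \<open>\<iota> t ^ (a * l)\<close>. It does not depend on \<open>i\<close>, on the branch or on
    the truncation order.\<close>
  define \<kappa> where "\<kappa> = (\<lambda>S l. \<Sum>a\<in>S. \<iota> (\<mu> S a) * \<iota> t ^ (a * l))"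
  define u where "u = (\<lambda>S j i. \<Sum>a\<in>S. \<iota> (\<mu> S a) * s j (i + a))"
  define P where "P = (\<lambda>M S \<rho> j. \<Sum>l<M. monom (fps_nth (Q \<rho> j) l * \<kappa> S l) l)"
  have cP: "coeff (P M S \<rho> j) l = (if l < M then fps_nth (Q \<rho> j) l * \<kappa> S l else 0)" for M S \<rho> j l
    by (simp add: P_def coeff_sum)
  have \<kappa>0: "\<kappa> S l = 0" if "S \<in> \<Omega>" "l < M0" for S l
  proof -
    have "\<kappa> S l = \<iota> (\<Sum>a\<in>S. \<mu> S a * t ^ (a * l))" by (simp add: \<kappa>_def is_hom_sum[OF \<iota>] \<iota>s)
    then show ?thesis using \<mu>(2)[OF that] by (simp add: \<iota>s)
  qed
  have fin\<Omega>: "finite (\<Omega> \<times> R)" using fin(2) by (auto simp: \<Omega>_def)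
  define E where "E = (\<Sum>S\<in>\<Omega>. \<Sum>a\<in>S. f (\<iota> (\<mu> S a)))"
  have E: "(\<Sum>a\<in>S. f (\<iota> (\<mu> S a))) \<le> E" if "S \<in> \<Omega>" for S
    unfolding E_def using that fin fv(5) by (intro member_le_sum sum_nonneg) (auto simp: \<Omega>_def)
  have u_K: "u S j i \<in> range \<iota>" if j: "j \<in> J" for S j i
  proof -
    have "\<forall>i. \<exists>v. s j i = \<iota> v" using rational[OF j] by blast
    then obtain v where v: "\<And>i. s j i = \<iota> (v i)" by metis
    have "u S j i = \<iota> (\<Sum>a\<in>S. \<mu> S a * v (i + a))" by (simp add: u_def v is_hom_sum[OF \<iota>] \<iota>s)
    then show ?thesis by simp
  qed
  have u_lower: "\<exists>c>0. \<forall>i. u S j i \<noteq> 0 \<longrightarrow> f (u S j i) \<ge> c / \<beta> ^ i" if "S \<in> \<Omega>" "j \<in> J" for S j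
  proof -
    have "growth_bound B (\<lambda>i. \<iota> (\<mu> S a) * s j (i + a))" for a
      using growth_bound_mult[OF growth_bound_const[OF alg, of "\<iota> (\<mu> S a)"] growth_bound_shift[OF B[OF that(2)], of a]] by simp
    then have "growth_bound B (u S j)" unfolding u_def
      using finS[OF that(1)] \<open>B > 0\<close> alg by (intro growth_bound_sum) auto
    from growth_lower_bound[OF alg K this f] show ?thesis
      using u_K[OF that(2)] unfolding \<beta>_def by blast
  qed
  have key: "\<exists>\<sigma>\<in>\<Omega> \<times> R. \<forall>j\<in>J. P M (fst \<sigma>) (snd \<sigma>) j = 0" if "M \<ge> M0" for M
  proof -
    obtain C where C: "\<And>i. \<exists>\<rho>\<in>R. \<forall>j\<in>J. f (s j i - poly (truncate_fps M (Q \<rho> j)) (\<eta> i)) \<le> C * f (\<eta> i) ^ M"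
      using approx[of M] unfolding \<eta>_def by blast
    then obtain \<rho> where \<rho>: "\<And>i. \<rho> i \<in> R" "\<And>i j. j \<in> J \<Longrightarrow> f (s j i - poly (truncate_fps M (Q (\<rho> i) j)) (\<eta> i)) \<le> C * f (\<eta> i) ^ M"
      by metis
    define D where "D = E * \<bar>C\<bar>"
    have E0: "E \<ge> 0" unfolding E_def using fv(5) by (intro sum_nonneg) auto
    define good where "good = (\<lambda>\<sigma> i. \<forall>j\<in>J. f (u (fst \<sigma>) j i - poly (P M (fst \<sigma>) (snd \<sigma>) j) (\<eta> i)) \<le> D * f (\<eta> i) ^ M)"
    have ex_good: "\<exists>\<sigma>\<in>\<Omega> \<times> R. good \<sigma> i" for i
    proof -
      obtain r where r: "r \<in> R" "card {a. a \<le> W \<and> \<rho> (i + a) = r} > M0"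
        using pigeonhole_class[OF fin(2), of W "\<lambda>a. \<rho> (i + a)" M0] \<rho>(1) W_def by blast
      define S where "S = {a. a \<le> W \<and> \<rho> (i + a) = r}"
      have S: "S \<in> \<Omega>" using r(2) by (auto simp: \<Omega>_def S_def)
      have "f (u S j i - poly (P M S r j) (\<eta> i)) \<le> D * f (\<eta> i) ^ M" if j: "j \<in> J" for j
      proof -
        have \<eta>_add: "\<eta> (i + a) ^ l = \<eta> i ^ l * \<iota> t ^ (a * l)" for a l
          by (simp add: \<eta>_def power_add power_mult_distrib power_mult)
        have "poly (P M S r j) (\<eta> i) = (\<Sum>l<M. \<Sum>a\<in>S. \<iota> (\<mu> S a) * (fps_nth (Q r j) l * \<eta> (i + a) ^ l))"
          unfolding \<eta>_add
          by (simp add: P_def poly_sum poly_monom \<kappa>_def sum_distrib_left sum_distrib_right ac_simps)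
        also have "\<dots> = (\<Sum>a\<in>S. \<iota> (\<mu> S a) * poly (truncate_fps M (Q r j)) (\<eta> (i + a)))"
          by (subst sum.swap) (simp add: poly_truncate_fps sum_distrib_left)
        finally have "u S j i - poly (P M S r j) (\<eta> i) =
            (\<Sum>a\<in>S. \<iota> (\<mu> S a) * (s j (i + a) - poly (truncate_fps M (Q r j)) (\<eta> (i + a))))"
          by (simp add: u_def sum_subtractf algebra_simps)
        then have "f (u S j i - poly (P M S r j) (\<eta> i)) \<le>
            (\<Sum>a\<in>S. f (\<iota> (\<mu> S a)) * f (s j (i + a) - poly (truncate_fps M (Q r j)) (\<eta> (i + a))))"
          using abs_value_sum[OF fa] by (simp flip: fv(3))
        also have "\<dots> \<le> (\<Sum>a\<in>S. f (\<iota> (\<mu> S a)) * (\<bar>C\<bar> * f (\<eta> i) ^ M))"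
        proof (intro sum_mono mult_left_mono fv(5))
          fix a assume a: "a \<in> S"
          have "f (s j (i + a) - poly (truncate_fps M (Q r j)) (\<eta> (i + a))) \<le> C * f (\<eta> (i + a)) ^ M"
            using \<rho>(2)[OF j, of "i + a"] a by (simp add: S_def)
          also have "\<dots> \<le> \<bar>C\<bar> * f (\<eta> (i + a)) ^ M" using fv(5) by (intro mult_right_mono) auto
          also have "\<dots> \<le> \<bar>C\<bar> * f (\<eta> i) ^ M"
          proof (intro mult_left_mono power_mono fv(5))
            have "f (\<iota> t) ^ a \<le> 1" using \<iota>t t(1) by (intro power_le_one) auto
            then have "f (\<eta> i) * f (\<iota> t) ^ a \<le> f (\<eta> i) * 1" using fv(5) by (intro mult_left_mono)
            then show "f (\<eta> (i + a)) \<le> f (\<eta> i)" by (simp add: \<eta>_def power_add fv mult.assoc)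
          qed simp
          finally show "f (s j (i + a) - poly (truncate_fps M (Q r j)) (\<eta> (i + a))) \<le> \<bar>C\<bar> * f (\<eta> i) ^ M" .
        qed
        also have "\<dots> = (\<Sum>a\<in>S. f (\<iota> (\<mu> S a))) * (\<bar>C\<bar> * f (\<eta> i) ^ M)" by (simp add: sum_distrib_right)
        also have "\<dots> \<le> E * (\<bar>C\<bar> * f (\<eta> i) ^ M)" using E[OF S] fv(5) by (intro mult_right_mono) auto
        finally show ?thesis by (simp add: D_def mult.assoc)
      qed
      then show ?thesis using S r(1) by (intro bexI[of _ "(S, r)"]) (auto simp: good_def)
    qed
    have vanish: "eventually (\<lambda>i. good \<sigma> i \<longrightarrow> u (fst \<sigma>) j i = 0) sequentially" if \<sigma>: "\<sigma> \<in> \<Omega> \<times> R" and j: "j \<in> J" for \<sigma> j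
    proof -
      obtain S r where Sr: "\<sigma> = (S, r)" "S \<in> \<Omega>" "r \<in> R" using \<sigma> by auto
      obtain c where c: "c > 0" "\<And>i. u S j i \<noteq> 0 \<Longrightarrow> f (u S j i) \<ge> c / \<beta> ^ i"
        using u_lower[OF Sr(2) j] by blast
      \<comment> \<open>All factors \<open>\<kappa> S l\<close> with \<open>l < M0\<close> vanish,
        so \<open>y ^ M0\<close> splits off; it provides the upper bound that decays faster than the
        Liouville bound.\<close>
      define h where "h = (\<Sum>l\<in>{M0..<M}. monom (fps_nth (Q r j) l * \<kappa> S l) (l - M0))"
      have P_eq: "poly (P M S r j) y = y ^ M0 * poly h y" for y
      proof -
        have "poly (P M S r j) y = (\<Sum>l<M. fps_nth (Q r j) l * \<kappa> S l * y ^ l)"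
          by (simp add: P_def poly_sum poly_monom)
        also have "\<dots> = (\<Sum>l\<in>{M0..<M}. fps_nth (Q r j) l * \<kappa> S l * y ^ l)"
          using \<kappa>0[OF Sr(2)] by (intro sum.mono_neutral_right) (auto simp: not_le)
        also have "\<dots> = y ^ M0 * poly h y"
          unfolding h_def poly_sum poly_monom sum_distrib_left
          by (intro sum.cong) (auto simp: ac_simps simp flip: power_add)
        finally show ?thesis .
      qed
      obtain H where H: "H \<ge> 0" "\<And>x. f x \<le> 1 \<Longrightarrow> f (poly h x) \<le> H"
        using abs_value_poly_bound[OF fa, of 1 h] by auto
      define G where "G = (H + \<bar>D\<bar>) * f \<tau> ^ M0"
      have "(\<lambda>i. G * (f (\<iota> t) ^ M0 * \<beta>) ^ i) \<longlonglongrightarrow> G * 0"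
        using M0 \<beta> \<iota>t by (intro tendsto_mult tendsto_const LIMSEQ_realpow_zero) (auto simp: field_simps)
      then have ev1: "eventually (\<lambda>i. G * (f (\<iota> t) ^ M0 * \<beta>) ^ i < c) sequentially"
        using c(1) by (intro order_tendstoD) auto
      have ev2: "eventually (\<lambda>i. f (\<eta> i) < 1) sequentially"
        using geometric_place_tendsto_zero[OF fa t(1), of \<tau>] unfolding \<eta>_def by (intro order_tendstoD) auto
      from ev1 ev2 show ?thesis
      proof eventually_elim
        case (elim i)
        show ?case
        proof (intro impI, rule ccontr)
          assume g: "good \<sigma> i" and nz: "u (fst \<sigma>) j i \<noteq> 0"
          have "f (u S j i) \<le> f (poly (P M S r j) (\<eta> i)) + f (u S j i - poly (P M S r j) (\<eta> i))"
            using fv(4)[of "poly (P M S r j) (\<eta> i)" "u S j i - poly (P M S r j) (\<eta> i)"] by simp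
          moreover have "f (u S j i - poly (P M S r j) (\<eta> i)) \<le> D * f (\<eta> i) ^ M"
            using g j by (simp add: good_def Sr)
          moreover have "D * f (\<eta> i) ^ M \<le> \<bar>D\<bar> * f (\<eta> i) ^ M0"
            using elim(2) fv(5) \<open>M \<ge> M0\<close> by (intro mult_mono power_decreasing) auto
          moreover have "f (poly (P M S r j) (\<eta> i)) \<le> H * f (\<eta> i) ^ M0"
            using mult_left_mono[OF H(2)[of "\<eta> i"], of "f (\<eta> i) ^ M0"] elim(2) fv(5)[of "\<eta> i"]
            by (simp add: P_eq fv mult.commute)
          ultimately have "f (u S j i) \<le> (H + \<bar>D\<bar>) * f (\<eta> i) ^ M0" by (simp add: algebra_simps)
          also have "\<dots> = G * (f (\<iota> t) ^ M0) ^ i"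
            by (simp add: G_def \<eta>_def fv power_mult_distrib mult.commute flip: power_mult)
          finally have "c / \<beta> ^ i \<le> G * (f (\<iota> t) ^ M0) ^ i" using c(2)[of i] nz by (simp add: Sr)
          then have "c \<le> G * (f (\<iota> t) ^ M0 * \<beta>) ^ i"
            using \<beta> by (simp add: divide_le_eq power_mult_distrib mult.assoc)
          then show False using elim(1) by simp
        qed
      qed
    qed
    have "eventually (\<lambda>i. \<forall>\<sigma>\<in>\<Omega> \<times> R. \<forall>j\<in>J. good \<sigma> i \<longrightarrow> u (fst \<sigma>) j i = 0) sequentially"
      using vanish by (intro eventually_ball_finite fin\<Omega> fin(1) ballI)
    then have "eventually (\<lambda>i. \<exists>\<sigma>\<in>\<Omega> \<times> R. good \<sigma> i \<and> (\<forall>j\<in>J. u (fst \<sigma>) j i = 0)) sequentially"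
      by eventually_elim (use ex_good in blast)
    \<comment> \<open>One pair is good, with vanishing combinations, for infinitely many
      \<open>i\<close>. There the polynomials \<open>P\<close> are as small as the truncation error,
      which forces them to be zero.\<close>
    from frequently_finite_pigeonhole[OF fin\<Omega> this] obtain \<sigma> where
      \<sigma>: "\<sigma> \<in> \<Omega> \<times> R" "\<exists>\<^sub>F i in sequentially. good \<sigma> i \<and> (\<forall>j\<in>J. u (fst \<sigma>) j i = 0)" by blast
    have "P M (fst \<sigma>) (snd \<sigma>) j = 0" if j: "j \<in> J" for j
    proof (rule poly_zero_of_small_values[OF fa t(1) \<iota>t(1) \<tau>])
      show "degree (P M (fst \<sigma>) (snd \<sigma>) j) < M \<or> P M (fst \<sigma>) (snd \<sigma>) j = 0"
        using cP[of M "fst \<sigma>" "snd \<sigma>" j] by (metis leading_coeff_0_iff)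
      show "\<exists>\<^sub>F i in sequentially. f (poly (P M (fst \<sigma>) (snd \<sigma>) j) (\<tau> * \<iota> t ^ i)) \<le> D * f (\<tau> * \<iota> t ^ i) ^ M"
        using \<sigma>(2)
      proof (rule frequently_elim1)
        fix i assume "good \<sigma> i \<and> (\<forall>j\<in>J. u (fst \<sigma>) j i = 0)"
        then have "f (0 - poly (P M (fst \<sigma>) (snd \<sigma>) j) (\<eta> i)) \<le> D * f (\<eta> i) ^ M"
          using j unfolding good_def by metis
        then show "f (poly (P M (fst \<sigma>) (snd \<sigma>) j) (\<tau> * \<iota> t ^ i)) \<le> D * f (\<tau> * \<iota> t ^ i) ^ M"
          by (simp add: \<eta>_def fv)
      qed
    qed
    then show ?thesis using \<sigma>(1) by blast
  qed
  then have "eventually (\<lambda>M. \<exists>\<sigma>\<in>\<Omega> \<times> R. \<forall>j\<in>J. P M (fst \<sigma>) (snd \<sigma>) j = 0) sequentially"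
    unfolding eventually_sequentially by blast
  \<comment> \<open>The pair found for each \<open>M\<close> ranges over a finite set that does not
    depend on \<open>M\<close>, so one pair serves infinitely many \<open>M\<close> and thereby
    controls coefficients of every order.\<close>
  from frequently_finite_pigeonhole[OF fin\<Omega> this] obtain \<sigma> where
    "\<sigma> \<in> \<Omega> \<times> R" "\<exists>\<^sub>F M in sequentially. \<forall>j\<in>J. P M (fst \<sigma>) (snd \<sigma>) j = 0" by blast
  then obtain S r where Sr: "S \<in> \<Omega>" "r \<in> R" "\<exists>\<^sub>F M in sequentially. \<forall>j\<in>J. P M S r j = 0" by force
  have zero: "fps_nth (Q r j) l * \<kappa> S l = 0" if "j \<in> J" for j l
  proof -
    obtain M where "M > l" "\<forall>j\<in>J. P M S r j = 0"
      using frequently_eventually_frequently[OF Sr(3) eventually_gt_at_top[of l]] frequently_ex by blast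
    then show ?thesis using cP[of M S r j l] that by simp
  qed
  have "\<exists>a\<in>S. \<iota> (\<mu> S a) \<noteq> 0" using \<mu>(1)[OF Sr(1)] by (simp add: \<iota>s)
  from finite_zeros_geometric[OF inj finS[OF Sr(1)] this]
  have "finite {l. \<kappa> S l = 0}" by (simp add: \<kappa>_def)
  then obtain L where "\<And>l. \<kappa> S l = 0 \<Longrightarrow> l < L" by (auto simp: finite_nat_set_iff_bounded)
  then have "\<forall>j\<in>J. \<forall>l\<ge>L. fps_nth (Q r j) l = 0" using zero by (meson mult_eq_0_iff not_le)
  then show ?thesis using Sr(2) by blast
qed

section \<open>Algebraic factors\<close>

text \<open>The outer variable of \<open>'a poly poly\<close> is \<open>Z\<close>, the inner one \<open>Y\<close>; this is \<open>P(Y\<^sup>e, Z)\<close>.\<close>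

definition expand :: "nat \<Rightarrow> 'a::comm_ring_1 poly poly \<Rightarrow> 'a poly poly" where
  "expand e P = map_poly (\<lambda>c. pcompose c (monom 1 e)) P"

lemma is_hom_pcompose: "is_hom (\<lambda>c. pcompose c (q :: 'a::comm_ring_1 poly))"
  by (simp add: is_hom_def pcompose_add pcompose_mult pcompose_1)

lemma is_hom_fps_of_poly: "is_hom (fps_of_poly :: 'a::comm_ring_1 poly \<Rightarrow> _)"
  by (simp add: is_hom_def fps_of_poly_add fps_of_poly_mult)

lemma is_hom_expand: "is_hom (expand e)"
  unfolding expand_def by (rule is_hom_map_poly[OF is_hom_pcompose])

lemma coeff_expand: "coeff (expand e P) i = pcompose (coeff P i) (monom 1 e)"
  by (simp add: expand_def coeff_map_poly)

lemma monic_expand: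
  assumes "lead_coeff P = 1"
  shows "degree (expand e P) = degree P" "lead_coeff (expand e P) = 1"
  unfolding expand_def using monic_map_poly[OF is_hom_pcompose assms] by auto

lemma poly_expand: "poly (poly (expand e P) [:z:]) y = poly (poly P [:z:]) (y ^ e)"
proof -
  have "poly (expand e P) (pcompose [:z:] (monom 1 e)) = pcompose (poly P [:z:]) (monom 1 e)"
    unfolding expand_def by (rule poly_map_poly_hom[OF is_hom_pcompose])
  then show ?thesis by (simp add: poly_pcompose poly_monom)
qed

lemma fps_of_poly_expand:
  fixes c :: "'a::field poly"
  assumes "e > 0"
  shows "fps_of_poly (pcompose c (monom 1 e)) = ramify e (fps_of_poly c)"
  using assms by (simp add: fps_of_poly_pcompose fps_of_poly_monom' ramify_def)

lemma puiseux_splitting_poly: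
  fixes P :: "'a::{alg_closed_field, field_char_0, field_gcd} poly poly"
  assumes "lead_coeff P = 1"
  obtains e \<psi>s where "e > 0" "map_poly fps_of_poly (expand e P) = (\<Prod>\<psi>\<leftarrow>\<psi>s. [:- \<psi>, 1:])"
proof -
  have "lead_coeff (map_poly fps_of_poly P) = 1" by (rule monic_map_poly(2)[OF is_hom_fps_of_poly assms])
  then obtain e \<psi>s where e: "e > 0" "map_poly (ramify e) (map_poly fps_of_poly P) = (\<Prod>\<psi>\<leftarrow>\<psi>s. [:- \<psi>, 1:])"
    using puiseux_splitting by blast
  have "map_poly fps_of_poly (expand e P) = map_poly (ramify e) (map_poly fps_of_poly P)"
    using e(1) by (simp add: poly_eq_iff coeff_map_poly expand_def fps_of_poly_expand is_hom_simps[OF is_hom_ramify])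
  then show ?thesis using that e by simp
qed

section \<open>Approximation of ordinates by truncated branches\<close>

lemma linear_product_congruence:
  fixes \<psi>s :: "'a::field fps list"
  shows "\<exists>D. (\<Prod>\<psi>\<leftarrow>\<psi>s. [:- \<psi>, 1:]) - (\<Prod>\<psi>\<leftarrow>\<psi>s. [:- fps_of_poly (truncate_fps M \<psi>), 1:]) = smult (fps_X ^ M) D"
proof (induction \<psi>s)
  case Nil
  then show ?case by (intro exI[of _ 0]) simp
next
  case (Cons \<psi> \<psi>s)
  define A B where "A = (\<Prod>\<psi>\<leftarrow>\<psi>s. [:- \<psi>, 1:])" and "B = (\<Prod>\<psi>\<leftarrow>\<psi>s. [:- fps_of_poly (truncate_fps M \<psi>), 1:])"
  obtain D where D: "A - B = smult (fps_X ^ M) D" using Cons by (auto simp: A_def B_def)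
  define d where "d = fps_shift M \<psi>"
  have "\<psi> - fps_of_poly (truncate_fps M \<psi>) = fps_X ^ M * d"
    by (rule fps_ext) (simp add: coeff_truncate_fps d_def fps_X_power_mult_nth)
  then have "[:- \<psi>, 1:] = [:- fps_of_poly (truncate_fps M \<psi>), 1:] - smult (fps_X ^ M) [:d:]"
    by (simp add: algebra_simps)
  moreover have "(l - x) * A - l * B = l * (A - B) - x * A" for l x by (simp add: algebra_simps)
  ultimately have "[:- \<psi>, 1:] * A - [:- fps_of_poly (truncate_fps M \<psi>), 1:] * B =
    [:- fps_of_poly (truncate_fps M \<psi>), 1:] * (A - B) - smult (fps_X ^ M) [:d:] * A"
    by (simp only:)
  also have "\<dots> = smult (fps_X ^ M) ([:- fps_of_poly (truncate_fps M \<psi>), 1:] * D - [:d:] * A)"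
    unfolding D by (simp only: mult_smult_right mult_smult_left smult_diff_right)
  finally show ?case unfolding A_def B_def by auto
qed

text \<open>An identity between polynomials can be evaluated at points, which the factorization over
  power series cannot. Truncating the roots restores polynomials at the cost of a multiple of
  \<open>Y ^ M\<close>.\<close>

lemma truncated_factorization:
  fixes P :: "'a::field poly poly"
  assumes "map_poly fps_of_poly P = (\<Prod>\<psi>\<leftarrow>\<psi>s. [:- \<psi>, 1:])"
  shows "\<exists>D. P = (\<Prod>\<psi>\<leftarrow>\<psi>s. [:- truncate_fps M \<psi>, 1:]) + smult (monom 1 M) D"
proof -
  define T where "T = (\<Prod>\<psi>\<leftarrow>\<psi>s. [:- truncate_fps M \<psi>, 1:])"
  have "map_poly fps_of_poly T = (\<Prod>\<psi>\<leftarrow>\<psi>s. [:- fps_of_poly (truncate_fps M \<psi>), 1:])"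
    unfolding T_def by (simp add: is_hom_prod_list[OF is_hom_map_poly[OF is_hom_fps_of_poly]]
      o_def map_poly_linear[OF is_hom_fps_of_poly] fps_of_poly_uminus)
  then obtain D where D: "map_poly fps_of_poly P - map_poly fps_of_poly T = smult (fps_X ^ M) D"
    using linear_product_congruence[of \<psi>s M] assms by auto
  have low: "coeff (coeff (P - T) k) i = 0" if "i < M" for k i
  proof -
    have "fps_of_poly (coeff (P - T) k) = coeff (smult (fps_X ^ M) D) k"
      unfolding D[symmetric] by (simp add: coeff_map_poly fps_of_poly_diff)
    then have "fps_nth (fps_of_poly (coeff (P - T) k)) i = fps_nth (fps_X ^ M * coeff D k) i" by simp
    then show ?thesis using that by (simp add: fps_X_power_mult_nth)
  qed
  define E where "E = map_poly (poly_shift M) (P - T)"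
  have "P - T = smult (monom 1 M) E"
  proof (rule poly_eqI, rule poly_eqI)
    fix k i
    show "coeff (coeff (P - T) k) i = coeff (coeff (smult (monom 1 M) E) k) i"
      using low[of i k]
      by (simp add: E_def coeff_map_poly poly_shift_0 coeff_monom_mult coeff_poly_shift)
  qed
  then show ?thesis unfolding T_def by (intro exI[of _ E]) (simp add: algebra_simps)
qed

lemma abs_value_poly2_bound:
  assumes f: "abs_value f" and B: "A \<ge> 0" "B \<ge> 0"
  shows "\<exists>C\<ge>0. \<forall>y z. f y \<le> A \<longrightarrow> f z \<le> B \<longrightarrow> f (poly (poly D [:z:]) y) \<le> C"
proof (induction D)
  case 0
  then show ?case using abs_valueD(1)[OF f] by auto
next
  case (pCons a D)
  note fv = abs_valueD[OF f]
  obtain C where C: "C \<ge> 0" "\<And>y z. f y \<le> A \<Longrightarrow> f z \<le> B \<Longrightarrow> f (poly (poly D [:z:]) y) \<le> C"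
    using pCons by blast
  obtain C' where C': "C' \<ge> 0" "\<And>y. f y \<le> A \<Longrightarrow> f (poly a y) \<le> C'"
    using abs_value_poly_bound[OF f B(1), of a] by blast
  have "f (poly (poly (pCons a D) [:z:]) y) \<le> C' + B * C" if "f y \<le> A" "f z \<le> B" for y z
  proof -
    have "f (poly (poly (pCons a D) [:z:]) y) \<le> f (poly a y) + f z * f (poly (poly D [:z:]) y)"
      using fv(4)[of "poly a y" "z * poly (poly D [:z:]) y"] by (simp add: fv)
    also have "\<dots> \<le> C' + B * C" using C C' that B fv(5) by (intro add_mono mult_mono) auto
    finally show ?thesis .
  qed
  moreover have "C' + B * C \<ge> 0" using C C' B by simp
  ultimately show ?case by blast
qed

lemma poly2_root_power:
  fixes P :: "'a::comm_ring_1 poly poly"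
  assumes P: "lead_coeff P = 1" and root: "poly (poly P [:z:]) y = 0"
  shows "z ^ degree P = - (\<Sum>j<degree P. poly (coeff P j) y * z ^ j)"
proof -
  have "{..degree P} = insert (degree P) {..<degree P}" by auto
  then have "poly (poly P [:z:]) y = z ^ degree P + (\<Sum>j<degree P. poly (coeff P j) y * z ^ j)"
    using P by (simp add: poly_altdef[of P] poly_sum poly_power)
  then have "z ^ degree P + (\<Sum>j<degree P. poly (coeff P j) y * z ^ j) = 0" using root by simp
  then show ?thesis by (rule eq_neg_iff_add_eq_0[THEN iffD2])
qed

lemma abs_value_root_bound:
  assumes f: "abs_value f" and P: "lead_coeff P = 1" and A: "A \<ge> 0"
  shows "\<exists>B\<ge>0. \<forall>y z. f y \<le> A \<longrightarrow> poly (poly P [:z:]) y = 0 \<longrightarrow> f z \<le> B"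
proof -
  note fv = abs_valueD[OF f]
  define m where "m = degree P"
  have "\<forall>j. \<exists>C\<ge>0. \<forall>y. f y \<le> A \<longrightarrow> f (poly (coeff P j) y) \<le> C"
    using abs_value_poly_bound[OF f A] by blast
  then obtain C where C: "\<And>j. C j \<ge> 0" "\<And>j y. f y \<le> A \<Longrightarrow> f (poly (coeff P j) y) \<le> C j"
    by metis
  have "f z \<le> 1 + (\<Sum>j<m. C j)" if y: "f y \<le> A" and root: "poly (poly P [:z:]) y = 0" for y z
  proof (cases "f z \<le> 1")
    case True
    then show ?thesis using sum_nonneg[of "{..<m}" C] C(1) by auto
  next
    case False
    have "m > 0"
    proof (rule ccontr)
      assume "\<not> m > 0"
      then show False using poly2_root_power[OF P root] by (simp add: m_def)
    qed
    have "f z ^ m = f (\<Sum>j<m. poly (coeff P j) y * z ^ j)"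
      using poly2_root_power[OF P root] unfolding m_def by (metis fv(7,8))
    also have "\<dots> \<le> (\<Sum>j<m. f (poly (coeff P j) y * z ^ j))" by (rule abs_value_sum[OF f])
    also have "\<dots> \<le> (\<Sum>j<m. C j * f z ^ (m - 1))"
    proof (intro sum_mono)
      fix j assume "j \<in> {..<m}"
      then have "f z ^ j \<le> f z ^ (m - 1)" using False by (intro power_increasing) auto
      then show "f (poly (coeff P j) y * z ^ j) \<le> C j * f z ^ (m - 1)"
        using C(2)[OF y] C(1) fv(5) by (simp add: fv mult_mono)
    qed
    also have "\<dots> = (\<Sum>j<m. C j) * f z ^ (m - 1)" by (simp add: sum_distrib_right)
    finally have "f z * f z ^ (m - 1) \<le> (\<Sum>j<m. C j) * f z ^ (m - 1)"
      using \<open>m > 0\<close> by (simp add: power_eq_if)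
    then have "f z \<le> (\<Sum>j<m. C j)" using False by (simp add: mult_le_cancel_right)
    then show ?thesis by simp
  qed
  moreover have "1 + (\<Sum>j<m. C j) \<ge> 0" using sum_nonneg[of "{..<m}" C] C(1) by simp
  ultimately show ?thesis by blast
qed

lemma small_factor:
  fixes g :: "'b \<Rightarrow> real"
  assumes "(\<Prod>x\<leftarrow>xs. g x) \<le> b ^ length xs" "xs \<noteq> []" "b \<ge> 0"
  shows "\<exists>x\<in>set xs. g x \<le> b"
proof (rule ccontr)
  assume neg: "\<not> ?thesis"
  have weak: "(\<Prod>x\<leftarrow>ys. g x) \<ge> b ^ length ys \<and> (\<Prod>x\<leftarrow>ys. g x) > 0" if "\<forall>x\<in>set ys. g x > b" for ys
    using that
  proof (induction ys)
    case (Cons a ys)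
    then have "b ^ length ys \<le> (\<Prod>x\<leftarrow>ys. g x)" "(\<Prod>x\<leftarrow>ys. g x) > 0" "g a > b" by auto
    then show ?case using assms(3) by (auto intro!: mult_mono mult_pos_pos)
  qed simp
  obtain x ys where xs: "xs = x # ys" using assms(2) by (cases xs) auto
  have "g x > b" and ys: "b ^ length ys \<le> (\<Prod>x\<leftarrow>ys. g x)" "(\<Prod>x\<leftarrow>ys. g x) > 0"
    using weak[of ys] neg xs by (simp_all add: not_le)
  have "b * b ^ length ys \<le> b * (\<Prod>x\<leftarrow>ys. g x)" using ys assms(3) by (intro mult_left_mono)
  also have "\<dots> < g x * (\<Prod>x\<leftarrow>ys. g x)" using \<open>g x > b\<close> ys by (intro mult_strict_right_mono)
  finally show False using assms(1) xs by simp
qed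

text \<open>Truncate at order \<open>N = m * M\<close>, where \<open>m\<close> is the number of
  branches. At a root the product of \<open>m\<close> differences is of size
  \<open>f y ^ (m * M)\<close>, so some factor is of size \<open>f y ^ M\<close>; shortening that
  truncation from \<open>N\<close> to \<open>M\<close> costs an error of the same order.\<close>

lemma branch_approximation:
  fixes P :: "'a::field poly poly"
  assumes f: "abs_value f" and P: "lead_coeff P = 1"
    and split: "map_poly fps_of_poly P = (\<Prod>\<psi>\<leftarrow>\<psi>s. [:- \<psi>, 1:])" and A: "A \<ge> 0"
  shows "\<exists>C. \<forall>y z. f y \<le> A \<longrightarrow> poly (poly P [:z:]) y = 0 \<longrightarrow>
    (\<exists>\<psi>\<in>set \<psi>s. f (z - poly (truncate_fps M \<psi>) y) \<le> C * f y ^ M)"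
proof -
  note fv = abs_valueD[OF f]
  define m where "m = length \<psi>s"
  define N where "N = m * M"
  obtain D where D: "P = (\<Prod>\<psi>\<leftarrow>\<psi>s. [:- truncate_fps N \<psi>, 1:]) + smult (monom 1 N) D"
    using truncated_factorization[OF split] by blast
  obtain B where B: "B \<ge> 0" "\<And>y z. f y \<le> A \<Longrightarrow> poly (poly P [:z:]) y = 0 \<Longrightarrow> f z \<le> B"
    using abs_value_root_bound[OF f P A] by blast
  obtain C1 where C1: "C1 \<ge> 0" "\<And>y z. f y \<le> A \<Longrightarrow> f z \<le> B \<Longrightarrow> f (poly (poly D [:z:]) y) \<le> C1"
    using abs_value_poly2_bound[OF f A B(1), of D] by blast
  have "\<forall>\<psi>. \<exists>C\<ge>0. \<forall>y. f y \<le> A \<longrightarrow> f (poly (\<Sum>l\<in>{M..<N}. monom (fps_nth \<psi> l) (l - M)) y) \<le> C"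
    using abs_value_poly_bound[OF f A] by blast
  then obtain C2 where C2: "\<And>\<psi>. C2 \<psi> \<ge> 0"
    "\<And>\<psi> y. f y \<le> A \<Longrightarrow> f (poly (\<Sum>l\<in>{M..<N}. monom (fps_nth \<psi> l) (l - M)) y) \<le> C2 \<psi>" by metis
  define C where "C = (1 + C1) + (\<Sum>\<psi>\<in>set \<psi>s. C2 \<psi>)"
  have "\<exists>\<psi>\<in>set \<psi>s. f (z - poly (truncate_fps M \<psi>) y) \<le> C * f y ^ M"
    if y: "f y \<le> A" and root: "poly (poly P [:z:]) y = 0" for y z
  proof -
    have eval: "poly (poly (\<Prod>\<psi>\<leftarrow>xs. [:- truncate_fps N \<psi>, 1:]) [:z:]) y = (\<Prod>\<psi>\<leftarrow>xs. z - poly (truncate_fps N \<psi>) y)" for xs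
      by (induction xs) (simp_all add: left_diff_distrib)
    have "(\<Prod>\<psi>\<leftarrow>\<psi>s. z - poly (truncate_fps N \<psi>) y) = - (y ^ N * poly (poly D [:z:]) y)"
      using root by (subst (asm) D) (simp add: eval poly_monom add_eq_0_iff)
    then have "f (\<Prod>\<psi>\<leftarrow>\<psi>s. z - poly (truncate_fps N \<psi>) y) = f y ^ N * f (poly (poly D [:z:]) y)"
      by (simp add: fv)
    moreover have "f (\<Prod>\<psi>\<leftarrow>xs. z - poly (truncate_fps N \<psi>) y) = (\<Prod>\<psi>\<leftarrow>xs. f (z - poly (truncate_fps N \<psi>) y))" for xs
      by (induction xs) (simp_all add: fv)
    ultimately have "(\<Prod>\<psi>\<leftarrow>\<psi>s. f (z - poly (truncate_fps N \<psi>) y)) \<le> f y ^ N * C1"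
      using C1(2)[OF y B(2)[OF y root]] fv(5) by (simp add: mult_left_mono)
    have ne: "\<psi>s \<noteq> []"
    proof
      assume "\<psi>s = []"
      then have "degree (map_poly fps_of_poly P) = 0" using split by simp
      then have "degree P = 0" using monic_map_poly(1)[OF is_hom_fps_of_poly P] by simp
      then show False using poly2_root_power[OF P root] by simp
    qed
    have "f y ^ N * C1 \<le> f y ^ N * (1 + C1) ^ m"
    proof (intro mult_left_mono)
      have "C1 \<le> (1 + C1) ^ 1" by simp
      also have "\<dots> \<le> (1 + C1) ^ m" using C1(1) ne by (intro power_increasing) (auto simp: m_def Suc_le_eq)
      finally show "C1 \<le> (1 + C1) ^ m" .
    qed (use fv(5) in simp)
    also have "\<dots> = ((1 + C1) * f y ^ M) ^ length \<psi>s"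
      by (simp add: N_def m_def power_mult_distrib mult.commute flip: power_mult)
    finally have "(\<Prod>\<psi>\<leftarrow>\<psi>s. f (z - poly (truncate_fps N \<psi>) y)) \<le> ((1 + C1) * f y ^ M) ^ length \<psi>s"
      using \<open>(\<Prod>\<psi>\<leftarrow>\<psi>s. f (z - poly (truncate_fps N \<psi>) y)) \<le> f y ^ N * C1\<close> by linarith
    from small_factor[OF this ne] obtain \<psi> where \<psi>: "\<psi> \<in> set \<psi>s" "f (z - poly (truncate_fps N \<psi>) y) \<le> (1 + C1) * f y ^ M"
      using C1(1) fv(5) by auto
    have "M \<le> N" using ne by (cases \<psi>s) (simp_all add: N_def m_def)
    have "poly (truncate_fps N \<psi>) y - poly (truncate_fps M \<psi>) y = (\<Sum>l\<in>{M..<N}. fps_nth \<psi> l * y ^ l)"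
    proof -
      have "{..<N} = {..<M} \<union> {M..<N}" using \<open>M \<le> N\<close> by auto
      then have "(\<Sum>l<N. fps_nth \<psi> l * y ^ l) = (\<Sum>l<M. fps_nth \<psi> l * y ^ l) + (\<Sum>l\<in>{M..<N}. fps_nth \<psi> l * y ^ l)"
        using sum.union_disjoint[of "{..<M}" "{M..<N}" "\<lambda>l. fps_nth \<psi> l * y ^ l"] by fastforce
      then show ?thesis unfolding poly_truncate_fps by simp
    qed
    also have "\<dots> = y ^ M * poly (\<Sum>l\<in>{M..<N}. monom (fps_nth \<psi> l) (l - M)) y"
      unfolding poly_sum poly_monom sum_distrib_left by (intro sum.cong) (auto simp: ac_simps simp flip: power_add)
    finally have "f (poly (truncate_fps N \<psi>) y - poly (truncate_fps M \<psi>) y) \<le> f y ^ M * C2 \<psi>"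
      using C2(2)[OF y, of \<psi>] fv(5) by (simp add: fv mult_left_mono)
    moreover have "C2 \<psi> \<le> (\<Sum>\<psi>\<in>set \<psi>s. C2 \<psi>)" using \<psi>(1) C2(1) by (intro member_le_sum) auto
    then have "f y ^ M * C2 \<psi> \<le> f y ^ M * (\<Sum>\<psi>\<in>set \<psi>s. C2 \<psi>)" using fv(5) by (intro mult_left_mono) auto
    moreover have "f (z - poly (truncate_fps M \<psi>) y) \<le> f (z - poly (truncate_fps N \<psi>) y) + f (poly (truncate_fps N \<psi>) y - poly (truncate_fps M \<psi>) y)"
      using fv(4)[of "z - poly (truncate_fps N \<psi>) y" "poly (truncate_fps N \<psi>) y - poly (truncate_fps M \<psi>) y"] by simp
    ultimately have "f (z - poly (truncate_fps M \<psi>) y) \<le> C * f y ^ M"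
      using \<psi>(2) by (simp add: C_def algebra_simps)
    then show ?thesis using \<psi>(1) by blast
  qed
  then show ?thesis by blast
qed

lemma truncate_fps_mult:
  fixes \<psi> \<phi> :: "'a::comm_ring_1 fps"
  shows "\<exists>E. truncate_fps M \<psi> * truncate_fps M \<phi> - truncate_fps M (\<psi> * \<phi>) = monom 1 M * E"
proof (intro exI[of _ "poly_shift M (truncate_fps M \<psi> * truncate_fps M \<phi>)"] poly_eqI)
  fix n
  have "coeff (truncate_fps M \<psi> * truncate_fps M \<phi>) n = fps_nth (\<psi> * \<phi>) n" if "n < M"
    unfolding coeff_mult fps_mult_nth atMost_atLeast0
    by (intro sum.cong) (use that in \<open>auto simp: coeff_truncate_fps\<close>)
  then show "coeff (truncate_fps M \<psi> * truncate_fps M \<phi> - truncate_fps M (\<psi> * \<phi>)) n =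
      coeff (monom 1 M * poly_shift M (truncate_fps M \<psi> * truncate_fps M \<phi>)) n"
    by (simp add: coeff_truncate_fps coeff_monom_mult coeff_poly_shift)
qed

text \<open>For the product, write \<open>z * z' - a * b = (z - a) * z' + a * (z' - b)\<close> with
  the truncated values \<open>a\<close> and \<open>b\<close>; the product of the truncations differs
  from the truncated product by a multiple of \<open>y ^ M\<close>.\<close>

lemma sum_product_approximation:
  assumes f: "abs_value f" and A: "A \<ge> 0" and C: "C \<ge> 0"
  shows "\<exists>C'. \<forall>y z z'. f y \<le> A \<longrightarrow> f (z - poly (truncate_fps M \<psi>) y) \<le> C * f y ^ M \<longrightarrow>
     f (z' - poly (truncate_fps M \<phi>) y) \<le> C * f y ^ M \<longrightarrow>
     f (z + z' - poly (truncate_fps M (\<psi> + \<phi>)) y) \<le> C' * f y ^ M \<and>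
     f (z * z' - poly (truncate_fps M (\<psi> * \<phi>)) y) \<le> C' * f y ^ M"
proof -
  note fv = abs_valueD[OF f]
  obtain E where E: "truncate_fps M \<psi> * truncate_fps M \<phi> - truncate_fps M (\<psi> * \<phi>) = monom 1 M * E" using truncate_fps_mult by blast
  obtain c1 where c1: "c1 \<ge> 0" "\<And>y. f y \<le> A \<Longrightarrow> f (poly (truncate_fps M \<psi>) y) \<le> c1"
    using abs_value_poly_bound[OF f A] by blast
  obtain c2 where c2: "c2 \<ge> 0" "\<And>y. f y \<le> A \<Longrightarrow> f (poly (truncate_fps M \<phi>) y) \<le> c2"
    using abs_value_poly_bound[OF f A] by blast
  obtain c3 where c3: "c3 \<ge> 0" "\<And>y. f y \<le> A \<Longrightarrow> f (poly E y) \<le> c3"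
    using abs_value_poly_bound[OF f A] by blast
  define C' where "C' = 2 * C + C * (c2 + C * A ^ M) + c1 * C + c3"
  have main: "f (z + z' - poly (truncate_fps M (\<psi> + \<phi>)) y) \<le> C' * f y ^ M"
    "f (z * z' - poly (truncate_fps M (\<psi> * \<phi>)) y) \<le> C' * f y ^ M"
    if y: "f y \<le> A" and z: "f (z - poly (truncate_fps M \<psi>) y) \<le> C * f y ^ M"
      and z': "f (z' - poly (truncate_fps M \<phi>) y) \<le> C * f y ^ M" for y z z'
  proof -
    define a b where "a = poly (truncate_fps M \<psi>) y" and "b = poly (truncate_fps M \<phi>) y"
    define \<delta> where "\<delta> = f y ^ M"
    have \<delta>: "\<delta> \<ge> 0" "\<delta> \<le> A ^ M" using fv(5) y by (auto simp: \<delta>_def intro: power_mono)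
    have "truncate_fps M (\<psi> + \<phi>) = truncate_fps M \<psi> + truncate_fps M \<phi>"
      by (simp add: poly_eq_iff coeff_truncate_fps)
    then have "z + z' - poly (truncate_fps M (\<psi> + \<phi>)) y = (z - a) + (z' - b)" by (simp add: a_def b_def)
    then have "f (z + z' - poly (truncate_fps M (\<psi> + \<phi>)) y) \<le> f (z - a) + f (z' - b)"
      using fv(4)[of "z - a" "z' - b"] by (simp only:)
    also have "\<dots> \<le> C * \<delta> + C * \<delta>"
      using z z' by (intro add_mono) (simp_all add: a_def b_def \<delta>_def)
    also have "\<dots> = 2 * C * \<delta>" by simp
    also have "\<dots> \<le> C' * \<delta>" unfolding C'_def using C c1 c2 c3 A \<delta> by (intro mult_right_mono) auto
    finally show "f (z + z' - poly (truncate_fps M (\<psi> + \<phi>)) y) \<le> C' * f y ^ M" by (simp add: \<delta>_def)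
    have fz': "f z' \<le> c2 + C * A ^ M"
    proof -
      have "f z' \<le> f b + f (z' - b)" using fv(4)[of b "z' - b"] by simp
      moreover have "C * \<delta> \<le> C * A ^ M" using C \<delta> by (intro mult_left_mono)
      ultimately show ?thesis using z' c2(2)[OF y] by (simp add: b_def \<delta>_def)
    qed
    have "a * b - poly (truncate_fps M (\<psi> * \<phi>)) y = y ^ M * poly E y"
      using arg_cong[OF E, of "\<lambda>p. poly p y"] by (simp add: a_def b_def poly_monom)
    then have "z * z' - poly (truncate_fps M (\<psi> * \<phi>)) y = (z - a) * z' + (a * (z' - b) + y ^ M * poly E y)"
      by (simp add: algebra_simps)
    then have "f (z * z' - poly (truncate_fps M (\<psi> * \<phi>)) y) \<le> f (z - a) * f z' + (f a * f (z' - b) + \<delta> * f (poly E y))"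
      using fv(4)[of "(z - a) * z'" "a * (z' - b) + y ^ M * poly E y"]
        fv(4)[of "a * (z' - b)" "y ^ M * poly E y"] by (simp add: fv(3,8) \<delta>_def)
    moreover have "f (z - a) * f z' \<le> (C * \<delta>) * (c2 + C * A ^ M)"
      using z fz' fv(5) C \<delta> by (intro mult_mono) (auto simp: a_def \<delta>_def)
    moreover have "f a * f (z' - b) \<le> c1 * (C * \<delta>)"
      using z' c1 y fv(5) by (intro mult_mono) (auto simp: a_def b_def \<delta>_def)
    moreover have "\<delta> * f (poly E y) \<le> \<delta> * c3" using c3(2)[OF y] \<delta> by (intro mult_left_mono)
    ultimately have "f (z * z' - poly (truncate_fps M (\<psi> * \<phi>)) y) \<le> (C * \<delta>) * (c2 + C * A ^ M) + (c1 * (C * \<delta>) + \<delta> * c3)"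
      by linarith
    also have "\<dots> = (C * (c2 + C * A ^ M) + c1 * C + c3) * \<delta>" by (simp add: algebra_simps)
    also have "\<dots> \<le> C' * \<delta>" unfolding C'_def using C \<delta> by (intro mult_right_mono) auto
    finally show "f (z * z' - poly (truncate_fps M (\<psi> * \<phi>)) y) \<le> C' * f y ^ M" by (simp add: \<delta>_def)
  qed
  then show ?thesis by blast
qed

text \<open>Division by the monic quadratic leaves a remainder of degree at most one in
  \<open>Z\<close> with two distinct power series roots, hence zero.\<close>

lemma monic_quadratic_dvd:
  fixes P :: "'a::field poly poly"
  assumes roots: "poly (map_poly fps_of_poly P) \<psi> = 0" "poly (map_poly fps_of_poly P) \<phi> = 0" "\<psi> \<noteq> \<phi>"
    and ab: "\<psi> + \<phi> = fps_of_poly a" "\<psi> * \<phi> = fps_of_poly b"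
  shows "[:b, - a, 1:] dvd P"
proof -
  define G where "G = [:b, - a, 1:]"
  have G: "G \<noteq> 0" "degree G = 2" "lead_coeff G = 1" by (auto simp: G_def)
  obtain q r where qr: "pseudo_divmod P G = (q, r)" by force
  have "P = G * q + r" using pseudo_divmod(1)[OF G(1) qr] G by simp
  have dr: "r = 0 \<or> degree r < 2" using pseudo_divmod(2)[OF G(1) qr] G by simp
  note h = is_hom_simps[OF is_hom_map_poly[OF is_hom_fps_of_poly]]
  have "map_poly fps_of_poly G = [:\<psi> * \<phi>, - (\<psi> + \<phi>), 1:]"
    by (simp add: G_def map_poly_pCons ab fps_of_poly_uminus)
  then have "poly (map_poly fps_of_poly G) \<psi> = 0" "poly (map_poly fps_of_poly G) \<phi> = 0"
    by (simp_all add: algebra_simps)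
  then have r0: "poly (map_poly fps_of_poly r) \<psi> = 0" "poly (map_poly fps_of_poly r) \<phi> = 0"
    using roots(1,2) by (simp_all add: \<open>P = G * q + r\<close> h)
  have "r = [:coeff r 0, coeff r 1:]"
  proof (rule poly_eqI)
    fix n show "coeff r n = coeff [:coeff r 0, coeff r 1:] n"
    proof (cases "n < 2")
      case True
      then have "n = 0 \<or> n = 1" by auto
      then show ?thesis by auto
    next
      case False
      then obtain m where "n = Suc (Suc m)" by (metis add_2_eq_Suc le_Suc_ex not_less)
      moreover have "coeff r n = 0" using dr False by (auto intro: coeff_eq_0)
      ultimately show ?thesis by simp
    qed
  qed
  then have mr: "map_poly fps_of_poly r = [:fps_of_poly (coeff r 0), fps_of_poly (coeff r 1):]"
    by (metis map_poly_linear[OF is_hom_fps_of_poly])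
  moreover have "(\<psi> - \<phi>) * c = (d + \<psi> * c) - (d + \<phi> * c)" for c d by (simp add: algebra_simps)
  ultimately have "(\<psi> - \<phi>) * fps_of_poly (coeff r 1) =
      poly (map_poly fps_of_poly r) \<psi> - poly (map_poly fps_of_poly r) \<phi>"
    by (simp only: poly_pCons poly_0 mult_zero_right add_0_right)
  then have "(\<psi> - \<phi>) * fps_of_poly (coeff r 1) = 0" using r0 by simp
  then have "coeff r 1 = 0" using roots(3) by (simp add: fps_of_poly_eq_iff[of _ 0, simplified])
  moreover from this have "coeff r 0 = 0" using r0(1) mr by (simp add: fps_of_poly_eq_iff[of _ 0, simplified])
  ultimately have "r = 0" using \<open>r = [:coeff r 0, coeff r 1:]\<close> by simp
  then show ?thesis unfolding G_def[symmetric] using \<open>P = G * q + r\<close> by simp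
qed

theorem algebraic_factor:
  fixes \<iota> :: "'k::field_char_0 \<Rightarrow> 'a::{alg_closed_field, field_char_0, field_gcd}" and P :: "'a poly poly"
  assumes alg: "\<And>x :: 'a. algebraic x" and \<iota>: "is_hom \<iota>" and K: "degree_bounded n (range \<iota>)"
    and t: "inj (\<lambda>i::nat. t ^ i)" "t \<noteq> 0" and t': "t' \<noteq> 0"
    and P: "lead_coeff P = 1"
    and roots: "\<And>i::nat. poly (poly P [:z i:]) (\<iota> (t' * t ^ i)) = 0" "\<And>i. poly (poly P [:z' i:]) (\<iota> (t' * t ^ i)) = 0"
    and rational: "\<And>i. z i + z' i \<in> range \<iota>" "\<And>i. z i * z' i \<in> range \<iota>"
  shows "\<exists>e>0. (\<exists>a. [:a, 1:] dvd expand e P) \<or> (\<exists>a b. [:b, a, 1:] dvd expand e P)"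
proof -
  note \<iota>s = is_hom_simps[OF \<iota>] is_hom_field_simps[OF \<iota>]
  have "inj (\<lambda>i::nat. \<iota> t ^ i)"
  proof (rule injI)
    fix i j :: nat assume "\<iota> t ^ i = \<iota> t ^ j"
    then have "\<iota> (t ^ i) = \<iota> (t ^ j)" by (simp only: \<iota>s(8))
    then have "t ^ i = t ^ j" using \<iota>s(6)[of "t ^ i" "t ^ j"] \<iota>s(10)[of "t ^ i - t ^ j"] by simp
    then show "i = j" using t(1) by (auto dest: injD)
  qed
  moreover have "inverse (\<iota> t) \<in> range \<iota>" by (metis \<iota>s(11) rangeI)
  ultimately obtain f where f: "f \<in> places" "f (\<iota> t) < 1"
    using exists_small_place[OF alg K, of "\<iota> t"] t(2) \<iota>s by auto
  have fa: "abs_value f" by (rule place(1)[OF f(1)])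
  note fv = abs_valueD[OF fa]
  obtain e \<psi>s where e: "e > 0" and split: "map_poly fps_of_poly (expand e P) = (\<Prod>\<psi>\<leftarrow>\<psi>s. [:- \<psi>, 1:])"
    using puiseux_splitting_poly[OF P] by blast
  define Pe where "Pe = expand e P"
  have Pe: "lead_coeff Pe = 1" using monic_expand[OF P] by (simp add: Pe_def)
  \<comment> \<open>With \<open>\<tau> ^ e\<close> equal to the image of \<open>t'\<close>, the
    numbers \<open>\<eta> i = \<tau> * \<iota> t ^ i\<close> are \<open>e\<close>-th roots of the
    abscissas of index \<open>e * i\<close>. Restricting to these indices keeps the parameter of the
    branches geometric with ratio in \<open>k\<close>.\<close>
  obtain \<tau> where \<tau>: "\<tau> ^ e = \<iota> t'" using nth_root_exists[OF e] by blast
  then have "\<tau> \<noteq> 0" using t' e \<iota>s by (metis zero_power)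
  define \<eta> where "\<eta> = (\<lambda>i. \<tau> * \<iota> t ^ i)"
  have \<eta>e: "\<eta> i ^ e = \<iota> (t' * t ^ (e * i))" for i
    by (simp add: \<eta>_def power_mult_distrib \<tau> \<iota>s mult.commute flip: power_mult)
  have root: "poly (poly Pe [:z (e * i):]) (\<eta> i) = 0" "poly (poly Pe [:z' (e * i):]) (\<eta> i) = 0" for i
    unfolding Pe_def poly_expand \<eta>e by (rule roots)+
  define A where "A = f \<tau>"
  have A: "A \<ge> 0" "f (\<eta> i) \<le> A" for i
  proof -
    show "A \<ge> 0" using fv(5) by (simp add: A_def)
    have "f (\<iota> t) ^ i \<le> 1" using f(2) fv(5) by (intro power_le_one) auto
    then show "f (\<eta> i) \<le> A" using mult_left_mono[of "f (\<iota> t) ^ i" 1 "f \<tau>"] fv(5) by (simp add: \<eta>_def A_def fv)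
  qed
  \<comment> \<open>The Boolean index selects the product when true and the sum when false. Treating
    both in one family ensures that the same pair of branches serves both.\<close>
  define s where "s = (\<lambda>j i. if j then z (e * i) * z' (e * i) else z (e * i) + z' (e * i))"
  define Q where "Q = (\<lambda>(\<psi>, \<phi>) j. if j then \<psi> * \<phi> else \<psi> + \<phi> :: 'a fps)"
  define R where "R = set \<psi>s \<times> set \<psi>s"
  have deg: "degree Pe > 0"
  proof (rule ccontr)
    assume "\<not> degree Pe > 0"
    then show False using poly2_root_power[OF Pe root(1)] by simp
  qed
  have "\<exists>B. growth_bound B (\<lambda>i. \<tau> * \<iota> t ^ i)"
    using growth_bound_mult[OF growth_bound_const[OF alg]] growth_bound_geometric[OF alg] by blast
  then have "\<exists>B. growth_bound B (\<lambda>i. poly (coeff Pe j) (\<eta> i))" for j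
    using growth_bound_poly[OF alg] unfolding \<eta>_def by blast
  then have "\<exists>B. growth_bound B (\<lambda>i. w i)" if "\<And>i. poly (poly Pe [:w i:]) (\<eta> i) = 0" for w
    using growth_bound_root[OF deg, of w "\<lambda>j i. poly (coeff Pe j) (\<eta> i)"] poly2_root_power[OF Pe that] by blast
  from this[OF root(1)] this[OF root(2)] obtain B1 B2 where
    B: "growth_bound B1 (\<lambda>i. z (e * i))" "growth_bound B2 (\<lambda>i. z' (e * i))" by blast
  have "B1 * B2 > 0" using B by (simp add: growth_bound_def)
  then have "growth_bound (B1 * B2) (\<lambda>i. z (e * i) + z' (e * i))"
    by (intro growth_bound_add growth_bound_mono[OF B(1)] growth_bound_mono[OF B(2)]) simp_all
  moreover have "growth_bound (B1 * B2) (\<lambda>i. z (e * i) * z' (e * i))" by (rule growth_bound_mult[OF B])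
  ultimately have growth: "\<exists>B. growth_bound B (s j)" for j by (cases j) (auto simp: s_def)
  have rat: "s j i \<in> range \<iota>" for j i using rational by (simp add: s_def)
  have approx: "\<exists>C. \<forall>i. \<exists>\<rho>\<in>R. \<forall>j\<in>UNIV. f (s j i - poly (truncate_fps M (Q \<rho> j)) (\<tau> * \<iota> t ^ i)) \<le> C * f (\<tau> * \<iota> t ^ i) ^ M" for M
  proof -
    obtain C0 where C0: "\<And>y z. f y \<le> A \<Longrightarrow> poly (poly Pe [:z:]) y = 0 \<Longrightarrow>
        \<exists>\<psi>\<in>set \<psi>s. f (z - poly (truncate_fps M \<psi>) y) \<le> C0 * f y ^ M"
      using branch_approximation[OF fa Pe split[folded Pe_def] A(1), of M] by blast
    define C where "C = \<bar>C0\<bar>"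
    have C: "C \<ge> 0" "\<And>y z. f y \<le> A \<Longrightarrow> poly (poly Pe [:z:]) y = 0 \<Longrightarrow>
        \<exists>\<psi>\<in>set \<psi>s. f (z - poly (truncate_fps M \<psi>) y) \<le> C * f y ^ M"
    proof -
      fix y z assume "f y \<le> A" "poly (poly Pe [:z:]) y = 0"
      from C0[OF this] obtain \<psi> where "\<psi> \<in> set \<psi>s" "f (z - poly (truncate_fps M \<psi>) y) \<le> C0 * f y ^ M" by blast
      moreover have "C0 * f y ^ M \<le> C * f y ^ M" using fv(5) by (intro mult_right_mono) (auto simp: C_def)
      ultimately show "\<exists>\<psi>\<in>set \<psi>s. f (z - poly (truncate_fps M \<psi>) y) \<le> C * f y ^ M" by force
    qed (simp add: C_def)
    obtain C' where C': "\<And>\<psi> \<phi> y z z'. f y \<le> A \<Longrightarrow> f (z - poly (truncate_fps M \<psi>) y) \<le> C * f y ^ M \<Longrightarrow>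
       f (z' - poly (truncate_fps M \<phi>) y) \<le> C * f y ^ M \<Longrightarrow>
       f (z + z' - poly (truncate_fps M (\<psi> + \<phi>)) y) \<le> C' \<psi> \<phi> * f y ^ M \<and>
       f (z * z' - poly (truncate_fps M (\<psi> * \<phi>)) y) \<le> C' \<psi> \<phi> * f y ^ M"
      using sum_product_approximation[OF fa A(1) C(1), of M] by metis
    define C'' where "C'' = (\<Sum>\<rho>\<in>R. \<bar>C' (fst \<rho>) (snd \<rho>)\<bar>)"
    have "\<exists>\<rho>\<in>R. \<forall>j\<in>UNIV. f (s j i - poly (truncate_fps M (Q \<rho> j)) (\<eta> i)) \<le> C'' * f (\<eta> i) ^ M" for i
    proof -
      obtain \<psi> \<phi> where \<psi>: "\<psi> \<in> set \<psi>s" "\<phi> \<in> set \<psi>s"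
        "f (z (e * i) - poly (truncate_fps M \<psi>) (\<eta> i)) \<le> C * f (\<eta> i) ^ M"
        "f (z' (e * i) - poly (truncate_fps M \<phi>) (\<eta> i)) \<le> C * f (\<eta> i) ^ M"
        using C(2)[OF A(2) root(1)] C(2)[OF A(2) root(2)] by blast
      have "\<bar>C' \<psi> \<phi>\<bar> \<le> C''"
        unfolding C''_def using \<psi> member_le_sum[of "(\<psi>, \<phi>)" R "\<lambda>\<rho>. \<bar>C' (fst \<rho>) (snd \<rho>)\<bar>"] by (simp add: R_def)
      then have "C' \<psi> \<phi> * f (\<eta> i) ^ M \<le> C'' * f (\<eta> i) ^ M" using fv(5) by (intro mult_right_mono) auto
      then have "f (s j i - poly (truncate_fps M (Q (\<psi>, \<phi>) j)) (\<eta> i)) \<le> C'' * f (\<eta> i) ^ M" for j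
        using C'[OF A(2) \<psi>(3,4)] by (cases j) (auto simp: s_def Q_def)
      moreover have "(\<psi>, \<phi>) \<in> R" using \<psi> by (simp add: R_def)
      ultimately show ?thesis by blast
    qed
    then show ?thesis unfolding \<eta>_def by blast
  qed
  have "\<exists>\<rho>\<in>R. \<exists>L. \<forall>j\<in>UNIV. \<forall>l\<ge>L. fps_nth (Q \<rho> j) l = 0"
    by (rule expansion_is_polynomial[OF alg \<iota> K f t(2) \<open>\<tau> \<noteq> 0\<close>, of UNIV R s Q])
      (use growth rat approx in \<open>auto simp: R_def\<close>)
  then obtain \<psi> \<phi> L where \<psi>: "\<psi> \<in> set \<psi>s" "\<phi> \<in> set \<psi>s"
    and L: "\<And>j l. l \<ge> L \<Longrightarrow> fps_nth (Q (\<psi>, \<phi>) j) l = 0" by (auto simp: R_def)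
  \<comment> \<open>Both series vanish from index \<open>L\<close> on, so these truncations are
    exact.\<close>
  define a b where "a = truncate_fps L (\<psi> + \<phi>)" and "b = truncate_fps L (\<psi> * \<phi>)"
  have ab: "\<psi> + \<phi> = fps_of_poly a" "\<psi> * \<phi> = fps_of_poly b"
    using L[of _ False] L[of _ True] by (auto simp: fps_eq_iff a_def b_def coeff_truncate_fps Q_def)
  have roots': "poly (map_poly fps_of_poly Pe) x = 0" if "x \<in> set \<psi>s" for x
  proof -
    have "[:- x, 1:] dvd map_poly fps_of_poly Pe"
      unfolding Pe_def split using that by (intro prod_list_dvd) auto
    then show ?thesis by (simp add: poly_eq_0_iff_dvd)
  qed
  show ?thesis
  proof (cases "\<psi> = \<phi>")
    case False
    then have "[:b, - a, 1:] dvd Pe" using monic_quadratic_dvd[OF roots'[OF \<psi>(1)] roots'[OF \<psi>(2)] _ ab] by blast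
    then show ?thesis using e unfolding Pe_def by blast
  next
    \<comment> \<open>The two ordinates may follow the same branch. Then half of the polynomial
      \<open>a\<close> is the branch itself, which yields a linear factor.\<close>
    case True
    define c where "c = smult (1 / 2) a"
    have "\<psi> = fps_of_poly c"
    proof (rule fps_ext)
      fix n
      have "fps_nth \<psi> n + fps_nth \<phi> n = fps_nth (\<psi> + \<phi>) n" by (rule fps_add_nth[symmetric])
      also have "\<dots> = coeff a n" unfolding ab(1) by (rule fps_of_poly_nth)
      finally show "fps_nth \<psi> n = fps_nth (fps_of_poly c) n" unfolding True by (simp add: c_def mult.commute)
    qed
    then have "fps_of_poly (poly Pe c) = 0"
      using roots'[OF \<psi>(1)] by (simp add: poly_map_poly_hom[OF is_hom_fps_of_poly])
    then have "poly Pe c = 0" by (simp add: fps_of_poly_eq_iff[of _ 0, simplified])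
    then have "[:- c, 1:] dvd Pe" by (simp add: poly_eq_0_iff_dvd)
    then show ?thesis using e unfolding Pe_def by blast
  qed
qed

section \<open>Rational parametrizations of smooth quartics\<close>

text \<open>The target ring is arbitrary so that the same form can be evaluated at points and at
  triples of polynomials, that is, along parametrized curves.\<close>

definition eval3 :: "('k::zero \<Rightarrow> 'r::comm_ring_1) \<Rightarrow> 'k poly3 \<Rightarrow> 'r \<Rightarrow> 'r \<Rightarrow> 'r \<Rightarrow> 'r" where
  "eval3 h F x y z =
     (\<Sum>(a, b, c) \<in> Poly_Mapping.keys F. h (Poly_Mapping.lookup F (a, b, c)) * x ^ a * y ^ b * z ^ c)"

lemma eval_ac_eq_eval3: "eval_ac F (x, y, z) = eval3 to_ac F x y z"
  by (simp add: eval_ac_def eval3_def)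

lemma eval3_superset:
  assumes "finite A" "Poly_Mapping.keys F \<subseteq> A" "h 0 = 0"
  shows "eval3 h F x y z = (\<Sum>(a, b, c) \<in> A. h (Poly_Mapping.lookup F (a, b, c)) * x ^ a * y ^ b * z ^ c)"
  unfolding eval3_def using assms
  by (intro sum.mono_neutral_left) (auto simp: in_keys_iff)

lemma eval3_add:
  assumes "h 0 = 0" "\<And>u v. h (u + v) = h u + h v"
  shows "eval3 h (F + G) x y z = eval3 h F x y z + eval3 h G x y z"
proof -
  define A where "A = Poly_Mapping.keys F \<union> Poly_Mapping.keys G"
  have A: "finite A" "Poly_Mapping.keys F \<subseteq> A" "Poly_Mapping.keys G \<subseteq> A" "Poly_Mapping.keys (F + G) \<subseteq> A"
    using Poly_Mapping.keys_add[of F G] by (auto simp: A_def)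
  show ?thesis
    by (simp add: eval3_superset[OF A(1,2)] eval3_superset[OF A(1,3)] eval3_superset[OF A(1,4)] assms
        lookup_add sum.distrib[symmetric] case_prod_unfold algebra_simps)
qed

lemma eval3_single:
  assumes "h 0 = 0"
  shows "eval3 h (Poly_Mapping.single (a, b, c) u) x y z = h u * x ^ a * y ^ b * z ^ c"
  using assms by (subst eval3_superset[of "{(a, b, c)}"]) auto

lemma eval3_single':
  assumes "h 0 = 0"
  shows "eval3 h (Poly_Mapping.single v u) x y z = h u * x ^ fst v * y ^ fst (snd v) * z ^ snd (snd v)"
  by (cases v) (simp add: eval3_single[of h, OF assms])

lemma eval3_sum:
  assumes "h 0 = 0" "\<And>u v. h (u + v) = h u + h v"
  shows "eval3 h (\<Sum>i\<in>I. G i) x y z = (\<Sum>i\<in>I. eval3 h (G i) x y z)"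
proof (induction I rule: infinite_finite_induct)
  case (insert i I)
  then show ?case using eval3_add[of h] assms by simp
qed (simp_all add: eval3_def)

lemma eval3_hom:
  assumes "is_hom g"
  shows "g (eval3 h F x y z) = eval3 (\<lambda>c. g (h c)) F (g x) (g y) (g z)"
  by (simp add: eval3_def is_hom_sum[OF assms] is_hom_simps[OF assms] case_prod_unfold)

lemma eval3_pderiv:
  fixes h :: "'k::field \<Rightarrow> 'r::comm_ring_1"
  assumes h: "is_hom h"
  shows "eval3 h (pderivX F) x y z = (\<Sum>(a, b, c) \<in> Poly_Mapping.keys F. of_nat a * h (Poly_Mapping.lookup F (a, b, c)) * x ^ (a - 1) * y ^ b * z ^ c)"
    "eval3 h (pderivY F) x y z = (\<Sum>(a, b, c) \<in> Poly_Mapping.keys F. of_nat b * h (Poly_Mapping.lookup F (a, b, c)) * x ^ a * y ^ (b - 1) * z ^ c)"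
    "eval3 h (pderivZ F) x y z = (\<Sum>(a, b, c) \<in> Poly_Mapping.keys F. of_nat c * h (Poly_Mapping.lookup F (a, b, c)) * x ^ a * y ^ b * z ^ (c - 1))"
  unfolding pderivX_def pderivY_def pderivZ_def case_prod_unfold
  by (simp_all add: eval3_sum eval3_single' is_hom_simps[OF h])

lemma euler_identity:
  fixes h :: "'k::field \<Rightarrow> 'r::comm_ring_1"
  assumes h: "is_hom h" and F: "homogeneous d F"
  shows "x * eval3 h (pderivX F) x y z + y * eval3 h (pderivY F) x y z + z * eval3 h (pderivZ F) x y z =
    of_nat d * eval3 h F x y z"
proof -
  have pow: "of_nat n * w * (of_nat n * w ^ (n - 1)) = of_nat n * (of_nat n * w ^ n)" for n and w :: 'r
    by (cases n) (simp_all add: ac_simps)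
  have "x * eval3 h (pderivX F) x y z + y * eval3 h (pderivY F) x y z + z * eval3 h (pderivZ F) x y z =
    (\<Sum>(a, b, c) \<in> Poly_Mapping.keys F. h (Poly_Mapping.lookup F (a, b, c)) *
      ((of_nat a * (x * x ^ (a - 1))) * y ^ b * z ^ c + (of_nat b * (y * y ^ (b - 1))) * x ^ a * z ^ c
        + (of_nat c * (z * z ^ (c - 1))) * x ^ a * y ^ b))"
    unfolding eval3_pderiv[OF h] sum_distrib_left sum.distrib[symmetric] case_prod_unfold
    by (intro sum.cong) (simp_all add: algebra_simps)
  also have "\<dots> = (\<Sum>(a, b, c) \<in> Poly_Mapping.keys F. of_nat d * (h (Poly_Mapping.lookup F (a, b, c)) * x ^ a * y ^ b * z ^ c))"
  proof (intro sum.cong refl, clarify)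
    fix a b c assume "(a, b, c) \<in> Poly_Mapping.keys F"
    then have d: "of_nat d = (of_nat a + of_nat b + of_nat c :: 'r)"
      using F by (auto simp: homogeneous_def)
    have p: "of_nat n * (w * w ^ (n - 1)) = of_nat n * w ^ n" for n and w :: 'r
      by (cases n) simp_all
    show "h (Poly_Mapping.lookup F (a, b, c)) *
      ((of_nat a * (x * x ^ (a - 1))) * y ^ b * z ^ c + (of_nat b * (y * y ^ (b - 1))) * x ^ a * z ^ c
        + (of_nat c * (z * z ^ (c - 1))) * x ^ a * y ^ b) = of_nat d * (h (Poly_Mapping.lookup F (a, b, c)) * x ^ a * y ^ b * z ^ c)"
      unfolding p d by (simp add: algebra_simps)
  qed
  also have "\<dots> = of_nat d * eval3 h F x y z"
    by (simp add: eval3_def sum_distrib_left case_prod_unfold)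
  finally show ?thesis .
qed

abbreviation const_ac :: "'k::field \<Rightarrow> 'k alg_closure poly" where
  "const_ac \<equiv> \<lambda>c. [:to_ac c:]"

lemma is_hom_to_ac: "is_hom to_ac"
  by (simp add: is_hom_def)

lemma is_hom_const_ac: "is_hom const_ac"
  by (simp add: is_hom_def one_pCons)

lemma is_hom_poly: "is_hom (\<lambda>p. poly p (s :: 'a::comm_ring_1))"
  by (simp add: is_hom_def)

lemma poly_eval3: "poly (eval3 const_ac F p q r) s = eval_ac F (poly p s, poly q s, poly r s)"
  using eval3_hom[OF is_hom_poly[of s], of const_ac F p q r] by (simp add: eval_ac_eq_eval3)

lemma pderiv_sum: "pderiv (sum f A) = (\<Sum>x\<in>A. pderiv (f x))"
  by (induction A rule: infinite_finite_induct) (simp_all add: pderiv_add)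

lemma pderiv_eval3:
  fixes F :: "'k::field_char_0 poly3"
  shows "pderiv (eval3 const_ac F p q r) = eval3 const_ac (pderivX F) p q r * pderiv p +
    eval3 const_ac (pderivY F) p q r * pderiv q + eval3 const_ac (pderivZ F) p q r * pderiv r"
  unfolding eval3_pderiv[OF is_hom_const_ac] unfolding eval3_def
  unfolding sum_distrib_right sum.distrib[symmetric] case_prod_unfold pderiv_sum
  by (intro sum.cong) (simp_all add: pderiv_mult pderiv_power pderiv_smult algebra_simps of_nat_poly smult_add_right)

lemma coeff_mult_top:
  assumes "degree p \<le> m" "degree q \<le> n"
  shows "coeff (p * q) (m + n) = coeff p m * coeff (q :: 'a::comm_ring_1 poly) n"
proof -
  have "coeff (p * q) (m + n) = (\<Sum>i\<le>m + n. if i = m then coeff p m * coeff q n else 0)"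
    unfolding coeff_mult
  proof (intro sum.cong refl)
    fix i assume "i \<in> {..m + n}"
    show "coeff p i * coeff q (m + n - i) = (if i = m then coeff p m * coeff q n else 0)"
      using assms by (cases i m rule: linorder_cases) (auto intro: coeff_eq_0 simp: coeff_eq_0)
  qed
  then show ?thesis by simp
qed

lemma degree_power_le_mult: "degree p \<le> m \<Longrightarrow> degree (p ^ a) \<le> a * m"
  using order.trans[OF degree_power_le[of p a] mult_le_mono1[of "degree p" m a]] by (simp add: mult.commute)

lemma coeff_power_top:
  assumes "degree (p :: 'a::comm_ring_1 poly) \<le> m"
  shows "coeff (p ^ a) (a * m) = coeff p m ^ a"
proof (induction a)
  case (Suc a)
  then show ?case
    using coeff_mult_top[OF assms degree_power_le_mult[OF assms, of a]] by (simp add: add.commute)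
qed simp

lemma coeff_monomial_top:
  fixes p q r :: "'a::comm_ring_1 poly"
  assumes "degree p \<le> m" "degree q \<le> m" "degree r \<le> m"
  shows "coeff (p ^ a * q ^ b * r ^ c) ((a + b + c) * m) = coeff p m ^ a * coeff q m ^ b * coeff r m ^ c"
proof -
  have "degree (p ^ a * q ^ b) \<le> a * m + b * m"
    using degree_mult_le[of "p ^ a" "q ^ b"] degree_power_le_mult[OF assms(1), of a] degree_power_le_mult[OF assms(2), of b]
    by linarith
  from coeff_mult_top[OF this degree_power_le_mult[OF assms(3), of c]]
    coeff_mult_top[OF degree_power_le_mult[OF assms(1), of a] degree_power_le_mult[OF assms(2), of b]]
  show ?thesis by (simp add: coeff_power_top assms add_mult_distrib)
qed

lemma coeff_eval3_top:
  assumes F: "homogeneous d F" and deg: "degree p \<le> m" "degree q \<le> m" "degree r \<le> m"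
  shows "coeff (eval3 const_ac F p q r) (d * m) = eval_ac F (coeff p m, coeff q m, coeff r m)"
  unfolding eval_ac_eq_eval3 eval3_def coeff_sum case_prod_unfold
proof (intro sum.cong refl)
  fix v assume v: "v \<in> Poly_Mapping.keys F"
  obtain a b c where abc: "v = (a, b, c)" by (cases v)
  then have "d = a + b + c" using F v by (auto simp: homogeneous_def)
  then have "coeff (p ^ a * q ^ b * r ^ c) (d * m) = coeff p m ^ a * coeff q m ^ b * coeff r m ^ c"
    using coeff_monomial_top[OF deg] by simp
  then show "coeff ([:to_ac (Poly_Mapping.lookup F (fst v, fst (snd v), snd (snd v))):] * p ^ fst v * q ^ fst (snd v) * r ^ snd (snd v)) (d * m) =
      to_ac (Poly_Mapping.lookup F (fst v, fst (snd v), snd (snd v))) * coeff p m ^ fst v * coeff q m ^ fst (snd v) * coeff r m ^ snd (snd v)"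
    by (simp add: abc mult.assoc)
qed

lemma homogeneous_pderiv:
  assumes "homogeneous (Suc d) F"
  shows "homogeneous d (pderivX F)" "homogeneous d (pderivY F)" "homogeneous d (pderivZ F)"
proof -
  have keys: "v \<in> Poly_Mapping.keys (\<Sum>i\<in>I. Poly_Mapping.single (g i) (c i)) \<Longrightarrow> \<exists>i\<in>I. v = g i \<and> c i \<noteq> 0"
    for v :: "nat \<times> nat \<times> nat" and I and g and c :: "_ \<Rightarrow> 'a"
  proof -
    assume "v \<in> Poly_Mapping.keys (\<Sum>i\<in>I. Poly_Mapping.single (g i) (c i))"
    then have "v \<in> (\<Union>i\<in>I. Poly_Mapping.keys (Poly_Mapping.single (g i) (c i)))"
      using Poly_Mapping.keys_sum[of "\<lambda>i. Poly_Mapping.single (g i) (c i)" I] by blast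
    then show ?thesis by (auto split: if_splits)
  qed
  have F: "fst v + fst (snd v) + snd (snd v) = Suc d" if "v \<in> Poly_Mapping.keys F" for v
    using assms that by (cases v) (auto simp: homogeneous_def)
  show "homogeneous d (pderivX F)"
    unfolding homogeneous_def
  proof clarify
    fix a b c assume "(a, b, c) \<in> Poly_Mapping.keys (pderivX F)"
    from keys[OF this[unfolded pderivX_def case_prod_unfold]] obtain v where
      v: "v \<in> Poly_Mapping.keys F" "a = fst v - 1" "b = fst (snd v)" "c = snd (snd v)" "of_nat (fst v) \<noteq> (0 :: 'a)"
      by auto
    then show "a + b + c = d" using F[OF v(1)] by (cases "fst v") auto
  qed
  show "homogeneous d (pderivY F)"
    unfolding homogeneous_def
  proof clarify
    fix a b c assume "(a, b, c) \<in> Poly_Mapping.keys (pderivY F)"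
    from keys[OF this[unfolded pderivY_def case_prod_unfold]] obtain v where
      v: "v \<in> Poly_Mapping.keys F" "a = fst v" "b = fst (snd v) - 1" "c = snd (snd v)" "of_nat (fst (snd v)) \<noteq> (0 :: 'a)"
      by auto
    then show "a + b + c = d" using F[OF v(1)] by (cases "fst (snd v)") auto
  qed
  show "homogeneous d (pderivZ F)"
    unfolding homogeneous_def
  proof clarify
    fix a b c assume "(a, b, c) \<in> Poly_Mapping.keys (pderivZ F)"
    from keys[OF this[unfolded pderivZ_def case_prod_unfold]] obtain v where
      v: "v \<in> Poly_Mapping.keys F" "a = fst v" "b = fst (snd v)" "c = snd (snd v) - 1" "of_nat (snd (snd v)) \<noteq> (0 :: 'a)"
      by auto
    then show "a + b + c = d" using F[OF v(1)] by (cases "snd (snd v)") auto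
  qed
qed

lemma smooth_curveD:
  assumes "smooth_curve F" "v \<noteq> (0, 0, 0)" "eval_ac F v = 0"
  shows "\<not> (eval_ac (pderivX F) v = 0 \<and> eval_ac (pderivY F) v = 0 \<and> eval_ac (pderivZ F) v = 0)"
proof
  assume sing: "eval_ac (pderivX F) v = 0 \<and> eval_ac (pderivY F) v = 0 \<and> eval_ac (pderivZ F) v = 0"
  define p where "p = proportional `` {v}"
  have "v \<in> p" unfolding p_def using equiv_class_self[OF equiv_proportional, of v] assms(2) by simp
  moreover have "p \<in> proj_plane" unfolding p_def proj_plane_def using assms(2) by (intro quotientI) simp
  ultimately have "p \<in> curve F" using assms(3) by (auto simp: curve_def)
  then show False using assms(1) sing \<open>v \<in> p\<close> unfolding smooth_curve_def by blast
qed

text \<open>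
  The velocity of a coprime parametrization spans with its position a plane orthogonal to the gradient,
  so position \<open>\<times>\<close> velocity is a polynomial multiple of the gradient, which has degree \<open>3 m\<close> by
  smoothness.
\<close>

lemma no_coprime_parametrization:
  fixes F :: "'k::field_char_0 poly3"
  assumes F: "homogeneous 4 F" "smooth_curve F" and zero: "eval3 const_ac F p q r = 0"
    and cop: "\<And>s. (poly p s, poly q s, poly r s) \<noteq> (0, 0, 0)"
  shows "p * pderiv q = q * pderiv p" "q * pderiv r = r * pderiv q"
proof -
  define A B C where "A = eval3 const_ac (pderivX F) p q r" and "B = eval3 const_ac (pderivY F) p q r"
    and "C = eval3 const_ac (pderivZ F) p q r"
  have e1: "p * A + q * B + r * C = 0"
    using euler_identity[OF is_hom_const_ac F(1), of p q r] by (simp add: A_def B_def C_def zero)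
  have e2: "pderiv p * A + pderiv q * B + pderiv r * C = 0"
    using pderiv_eval3[of F p q r] by (simp add: A_def B_def C_def zero mult.commute)
  \<comment> \<open>The cross product of position and velocity. The gradient is orthogonal to both
    by \<open>e1\<close> and \<open>e2\<close>, which gives the three proportionality relations
    below.\<close>
  define u v w where "u = q * pderiv r - r * pderiv q" and "v = r * pderiv p - p * pderiv r"
    and "w = p * pderiv q - q * pderiv p"
  have uB: "u * B = v * A"
  proof -
    have "u * B - v * A = pderiv r * (p * A + q * B + r * C) - r * (pderiv p * A + pderiv q * B + pderiv r * C)"
      by (simp add: u_def v_def algebra_simps)
    then show ?thesis by (simp add: e1 e2)
  qed
  have uC: "u * C = w * A"
  proof -
    have "u * C - w * A = q * (pderiv p * A + pderiv q * B + pderiv r * C) - pderiv q * (p * A + q * B + r * C)"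
      by (simp add: u_def w_def algebra_simps)
    then show ?thesis by (simp add: e1 e2)
  qed
  have vC: "v * C = w * B"
  proof -
    have "v * C - w * B = pderiv p * (p * A + q * B + r * C) - p * (pderiv p * A + pderiv q * B + pderiv r * C)"
      by (simp add: v_def w_def algebra_simps)
    then show ?thesis by (simp add: e1 e2)
  qed
  have on_curve: "eval_ac F (poly p s, poly q s, poly r s) = 0" for s
    using poly_eval3[of F p q r s] by (simp add: zero)
  have nocommon: "\<not> (poly A s = 0 \<and> poly B s = 0 \<and> poly C s = 0)" for s
    using smooth_curveD[OF F(2) cop on_curve] by (simp add: A_def B_def C_def poly_eval3)
  \<comment> \<open>By smoothness the gradient has no zero along the parametrization, so its
    components generate the unit ideal. The resulting Bezout identity turns proportionality into a
    polynomial multiple \<open>h\<close> of the gradient.\<close>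
  define g where "g = gcd (gcd A B) C"
  have g_dvd: "g dvd A" "g dvd B" "g dvd C" by (auto simp: g_def intro: dvd_trans)
  have "g \<noteq> 0" using nocommon[of 0] g_dvd by (auto simp: g_def)
  have "degree g = 0"
  proof (rule ccontr)
    assume "degree g \<noteq> 0"
    then obtain s where "poly g s = 0" using alg_closed_imp_poly_has_root[of g] by auto
    then show False using nocommon[of s] g_dvd by (auto elim!: dvdE)
  qed
  then have "is_unit g" using \<open>g \<noteq> 0\<close> by (simp add: is_unit_iff_degree)
  obtain \<alpha> \<beta> where ab: "\<alpha> * A + \<beta> * B = gcd A B" using bezout_coefficients_fst_snd[of A B] by blast
  obtain \<mu> \<nu> where mn: "\<mu> * gcd A B + \<nu> * C = g" using bezout_coefficients_fst_snd[of "gcd A B" C] unfolding g_def by blast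
  obtain g' where g': "g' * g = 1" using \<open>is_unit g\<close> by (metis dvd_def mult.commute)
  define a b c where "a = g' * \<mu> * \<alpha>" and "b = g' * \<mu> * \<beta>" and "c = g' * \<nu>"
  have abc: "a * A + b * B + c * C = 1"
  proof -
    have "a * A + b * B + c * C = g' * (\<mu> * (\<alpha> * A + \<beta> * B) + \<nu> * C)" by (simp add: a_def b_def c_def algebra_simps)
    then show ?thesis by (simp add: ab mn g')
  qed
  define h where "h = a * u + b * v + c * w"
  have h: "u = A * h" "v = B * h" "w = C * h"
  proof -
    have "u = (a * A + b * B + c * C) * u" by (simp add: abc)
    also have "\<dots> = a * A * u + b * (u * B) + c * (u * C)" by (simp add: algebra_simps)
    finally show "u = A * h" unfolding uB uC by (simp add: h_def algebra_simps)
    have "v = (a * A + b * B + c * C) * v" by (simp add: abc)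
    also have "\<dots> = a * (v * A) + b * B * v + c * (v * C)" by (simp add: algebra_simps)
    finally show "v = B * h" unfolding uB[symmetric] vC by (simp add: h_def algebra_simps)
    have "w = (a * A + b * B + c * C) * w" by (simp add: abc)
    also have "\<dots> = a * (w * A) + b * (w * B) + c * C * w" by (simp add: algebra_simps)
    finally show "w = C * h" unfolding uC[symmetric] vC[symmetric] by (simp add: h_def algebra_simps)
  qed
  have "h = 0"
  proof (rule ccontr)
    assume "h \<noteq> 0"
    define m where "m = max (degree p) (max (degree q) (degree r))"
    have deg: "degree p \<le> m" "degree q \<le> m" "degree r \<le> m" by (auto simp: m_def)
    \<comment> \<open>The point of the parametrization at infinity. Smoothness there shows that some
      component of the gradient has a nonzero coefficient of order \<open>3 * m\<close>, whereas the
      leading terms leave the cross product with degree at most \<open>2 * m - 1\<close> for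
      positive \<open>m\<close>, and zero for \<open>m = 0\<close>.\<close>
    define x where "x = (coeff p m, coeff q m, coeff r m)"
    have "x \<noteq> (0, 0, 0)"
    proof
      assume x: "x = (0, 0, 0)"
      have "f = 0 \<or> degree f < m" if "degree f \<le> m" "coeff f m = 0" for f :: "'k alg_closure poly"
        using that by (metis le_neq_implies_less leading_coeff_0_iff)
      then have zero_or: "p = 0 \<or> degree p < m" "q = 0 \<or> degree q < m" "r = 0 \<or> degree r < m"
        using x deg by (simp_all add: x_def)
      show False
      proof (cases "m = 0")
        case True
        then show False using zero_or cop[of 0] by simp
      next
        case False
        then have "degree p < m" "degree q < m" "degree r < m" using zero_or by auto
        then show False unfolding m_def by linarith
      qed
    qed
    moreover have "eval_ac F x = 0"
      using coeff_eval3_top[OF F(1) deg] by (simp add: zero x_def)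
    ultimately have "eval_ac (pderivX F) x \<noteq> 0 \<or> eval_ac (pderivY F) x \<noteq> 0 \<or> eval_ac (pderivZ F) x \<noteq> 0"
      using smooth_curveD[OF F(2)] by blast
    moreover have "homogeneous (Suc 3) F" using F(1) by simp
    note hd = homogeneous_pderiv[OF this]
    moreover have "coeff A (3 * m) = eval_ac (pderivX F) x" "coeff B (3 * m) = eval_ac (pderivY F) x" "coeff C (3 * m) = eval_ac (pderivZ F) x"
      unfolding A_def B_def C_def x_def by (intro coeff_eval3_top hd deg)+
    ultimately have "coeff A (3 * m) \<noteq> 0 \<or> coeff B (3 * m) \<noteq> 0 \<or> coeff C (3 * m) \<noteq> 0" by simp
    moreover have small: "f = 0 \<or> degree (f * h) \<ge> 3 * m" if "coeff f (3 * m) \<noteq> 0" for f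
      using le_degree[OF that] \<open>h \<noteq> 0\<close> by (cases "f = 0") (auto simp: degree_mult_eq)
    moreover have cross: "degree (f * pderiv f' - f' * pderiv f) < 3 * m \<or> f * pderiv f' - f' * pderiv f = 0"
      if "degree f \<le> m" "degree f' \<le> m" for f f' :: "'k alg_closure poly"
    proof (cases "m = 0")
      case True
      then have "degree f = 0" "degree f' = 0" using that by auto
      then have "pderiv f = 0" "pderiv f' = 0" by (simp_all add: pderiv_eq_0_iff)
      then show ?thesis by simp
    next
      case False
      have "degree (f * pderiv f') \<le> m + (m - 1)" "degree (f' * pderiv f) \<le> m + (m - 1)"
        using that by (auto intro!: order.trans[OF degree_mult_le] add_mono simp: degree_pderiv)
      then have "degree (f * pderiv f' - f' * pderiv f) \<le> m + (m - 1)" by (rule degree_diff_le)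
      then show ?thesis using False by linarith
    qed
    have "u \<noteq> 0 \<and> degree u \<ge> 3 * m \<or> v \<noteq> 0 \<and> degree v \<ge> 3 * m \<or> w \<noteq> 0 \<and> degree w \<ge> 3 * m"
    proof -
      have "f * h \<noteq> 0 \<and> degree (f * h) \<ge> 3 * m" if "coeff f (3 * m) \<noteq> 0" for f
      proof -
        have "f \<noteq> 0" using that by auto
        then show ?thesis using small[OF that] \<open>h \<noteq> 0\<close> by simp
      qed
      then show ?thesis
        using \<open>coeff A (3 * m) \<noteq> 0 \<or> coeff B (3 * m) \<noteq> 0 \<or> coeff C (3 * m) \<noteq> 0\<close> unfolding h by blast
    qed
    then show False
      using cross[OF deg(2,3)] cross[OF deg(3,1)] cross[OF deg(1,2)] unfolding u_def v_def w_def by linarith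
  qed
  then show "p * pderiv q = q * pderiv p" "q * pderiv r = r * pderiv q"
    using h(1,3) by (simp_all add: u_def w_def)
qed

lemma eval3_scale:
  fixes h :: "'k::zero \<Rightarrow> 'r::comm_ring_1"
  assumes "homogeneous d F"
  shows "eval3 h F (t * x) (t * y) (t * z) = t ^ d * eval3 h F x y z"
  unfolding eval3_def sum_distrib_left
proof (intro sum.cong refl, clarify)
  fix a b c assume "(a, b, c) \<in> Poly_Mapping.keys F"
  then have "d = a + b + c" using assms by (auto simp: homogeneous_def)
  then show "h (Poly_Mapping.lookup F (a, b, c)) * (t * x) ^ a * (t * y) ^ b * (t * z) ^ c =
      t ^ d * (h (Poly_Mapping.lookup F (a, b, c)) * x ^ a * y ^ b * z ^ c)"
    by (simp add: power_mult_distrib power_add ac_simps)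
qed

text \<open>A common factor \<open>g\<close> multiplies the cross products by \<open>g * g\<close>,
  so it can be removed first. In characteristic 0 the conclusion says that \<open>p\<close> and
  \<open>r\<close> are constant multiples of \<open>q\<close> when \<open>q\<close> is
  nonzero.\<close>

theorem no_parametrization:
  fixes F :: "'k::field_char_0 poly3"
  assumes F: "homogeneous 4 F" "smooth_curve F" and zero: "eval3 const_ac F p q r = 0"
  shows "p * pderiv q = q * pderiv p" "q * pderiv r = r * pderiv q"
proof -
  have "p * pderiv q = q * pderiv p \<and> q * pderiv r = r * pderiv q" if "\<not> (p = 0 \<and> q = 0 \<and> r = 0)"
  proof -
  define g where "g = gcd p (gcd q r)"
  have "g \<noteq> 0" using that by (auto simp: g_def)
  have "g dvd p" "g dvd q" "g dvd r" by (auto simp: g_def intro: dvd_trans)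
  then obtain p1 q1 r1 where eq: "p = g * p1" "q = g * q1" "r = g * r1" by (auto elim!: dvdE)
  have "(poly p1 s, poly q1 s, poly r1 s) \<noteq> (0, 0, 0)" for s
  proof
    assume "(poly p1 s, poly q1 s, poly r1 s) = (0, 0, 0)"
    then have "[:- s, 1:] dvd p1" "[:- s, 1:] dvd q1" "[:- s, 1:] dvd r1" by (auto simp: poly_eq_0_iff_dvd)
    then have "g * [:- s, 1:] dvd p" "g * [:- s, 1:] dvd q" "g * [:- s, 1:] dvd r" by (simp_all add: eq mult_dvd_mono del: mult_pCons_right)
    then have "g * [:- s, 1:] dvd g * 1" unfolding g_def by simp
    then have "[:- s, 1:] dvd 1" using \<open>g \<noteq> 0\<close> by (simp only: dvd_mult_cancel_left) simp
    then show False by (simp add: is_unit_iff_degree)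
  qed
  moreover have "eval3 const_ac F p1 q1 r1 = 0"
    using zero eval3_scale[OF F(1), of const_ac g p1 q1 r1] \<open>g \<noteq> 0\<close> by (simp add: eq)
  ultimately have "p1 * pderiv q1 = q1 * pderiv p1" "q1 * pderiv r1 = r1 * pderiv q1"
    using no_coprime_parametrization[OF F] by blast+
  moreover have "p * pderiv q - q * pderiv p = g * g * (p1 * pderiv q1 - q1 * pderiv p1)"
    "q * pderiv r - r * pderiv q = g * g * (q1 * pderiv r1 - r1 * pderiv q1)"
    by (simp_all add: eq pderiv_mult algebra_simps)
  ultimately show ?thesis by simp
  qed
  then show "p * pderiv q = q * pderiv p" "q * pderiv r = r * pderiv q" by (cases "p = 0 \<and> q = 0 \<and> r = 0"; auto)+
qed

text \<open>The quotient of the first two coordinates is \<open>Y ^ e + c\<close>, which is not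
  constant.\<close>

lemma no_power_parametrization:
  fixes F :: "'k::field_char_0 poly3"
  assumes F: "homogeneous 4 F" "smooth_curve F" and e: "e > 0" and \<delta>: "\<delta> \<noteq> 0"
  shows "eval3 const_ac F ((monom 1 e + [:c:]) * \<delta>) \<delta> r \<noteq> 0"
proof
  define M where "M = monom 1 e + [:c :: 'k alg_closure:]"
  assume "eval3 const_ac F ((monom 1 e + [:c:]) * \<delta>) \<delta> r = 0"
  from no_parametrization(1)[OF F this] have "M * \<delta> * pderiv \<delta> = \<delta> * pderiv (M * \<delta>)" by (simp add: M_def)
  also have "\<dots> = M * \<delta> * pderiv \<delta> + pderiv M * (\<delta> * \<delta>)" by (simp add: pderiv_mult algebra_simps)
  finally have "pderiv M = 0" using \<delta> by simp
  moreover have "pderiv M = monom (of_nat e) (e - 1)" by (simp add: M_def pderiv_add pderiv_monom pderiv_pCons)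
  ultimately show False using e by simp
qed

section \<open>Binary forms\<close>

text \<open>The homogenization is to the prescribed degree \<open>d\<close> and not to the actual
  degree of \<open>p\<close>, so that zeros at \<open>y = 0\<close> are retained.\<close>

definition bform :: "nat \<Rightarrow> 'a::comm_ring_1 poly \<Rightarrow> 'a \<Rightarrow> 'a \<Rightarrow> 'a" where
  "bform d p x y = (\<Sum>i\<le>d. coeff p i * x ^ i * y ^ (d - i))"

lemma bform_dehom:
  fixes p :: "'a::field poly"
  assumes "degree p \<le> d" "y \<noteq> 0"
  shows "bform d p x y = y ^ d * poly p (x / y)"
proof -
  have "poly p (x / y) = (\<Sum>i\<le>d. coeff p i * (x / y) ^ i)"
    unfolding poly_altdef using assms(1) by (intro sum.mono_neutral_left) (auto simp: coeff_eq_0)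
  then show ?thesis
    unfolding bform_def sum_distrib_left \<open>poly p (x / y) = _\<close> 
    using assms(2) by (intro sum.cong) (auto simp: power_diff power_divide field_simps)
qed

lemma bform_at_infinity: "bform d p x 0 = coeff p d * x ^ d"
proof -
  have "bform d p x 0 = (\<Sum>i\<le>d. if i = d then coeff p d * x ^ d else 0)"
    unfolding bform_def by (intro sum.cong) (auto simp: power_0_left)
  then show ?thesis by simp
qed

lemma bform_mult:
  fixes p q :: "'a::field poly"
  assumes "degree p \<le> m" "degree q \<le> n"
  shows "bform (m + n) (p * q) x y = bform m p x y * bform n q x y"
proof (cases "y = 0")
  case True
  then show ?thesis by (simp add: bform_at_infinity coeff_mult_top[OF assms] power_add)
next
  case False
  have "degree (p * q) \<le> m + n" using assms degree_mult_le[of p q] by linarith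
  then show ?thesis using False assms by (simp add: bform_dehom power_add)
qed

lemma bform_add: "bform d (p + q) x y = bform d p x y + bform d q x y"
  by (simp add: bform_def sum.distrib algebra_simps)

lemma bform_diff: "bform d (p - q) x y = bform d p x y - bform d q x y"
  by (simp add: bform_def sum_subtractf algebra_simps)

lemma bform_smult: "bform d (smult c p) x y = c * bform d p x y"
  by (simp add: bform_def sum_distrib_left algebra_simps)

lemma bform_Suc:
  assumes "degree p \<le> d"
  shows "bform (Suc d) p x y = y * bform d p x y"
proof -
  have "bform (Suc d) p x y = (\<Sum>i\<le>d. coeff p i * x ^ i * y ^ (Suc d - i))"
    using assms by (simp add: bform_def coeff_eq_0)
  also have "\<dots> = y * bform d p x y"
    unfolding bform_def sum_distrib_left by (intro sum.cong) (auto simp: Suc_diff_le ac_simps)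
  finally show ?thesis .
qed

lemma bform_pCons_0: "bform (Suc d) (pCons 0 p) x y = x * bform d p x y"
  unfolding bform_def sum.atMost_Suc_shift by (simp add: sum_distrib_left ac_simps)

lemma poly_bform:
  assumes "degree (p :: 'a::field poly) \<le> d"
  shows "bform d p x 1 = poly p x"
  using bform_dehom[OF assms, of 1 x] by simp

text \<open>The coefficient of \<open>Z\<^bsup>4-j\<^esup>\<close> in \<open>F\<close>, dehomogenized by \<open>Y = 1\<close>.\<close>

definition graded :: "'k::field poly3 \<Rightarrow> nat \<Rightarrow> 'k alg_closure poly" where
  "graded F j = (\<Sum>a\<le>j. monom (to_ac (Poly_Mapping.lookup F (a, j - a, 4 - j))) a)"

lemma coeff_graded: "coeff (graded F j) a = (if a \<le> j then to_ac (Poly_Mapping.lookup F (a, j - a, 4 - j)) else 0)"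
  by (simp add: graded_def coeff_sum)

lemma degree_graded: "degree (graded F j) \<le> j"
  by (intro degree_le) (simp add: coeff_graded)

lemma eval_ac_graded:
  assumes "homogeneous 4 F"
  shows "eval_ac F (x, y, z) = (\<Sum>j\<le>4. bform j (graded F j) x y * z ^ (4 - j))"
proof -
  define B where "B = (SIGMA j:{..4::nat}. {..j})"
  define g where "g = (\<lambda>(j, a). (a, j - a, 4 - j :: nat))"
  have "Poly_Mapping.keys F \<subseteq> g ` B"
  proof clarify
    fix a b c assume "(a, b, c) \<in> Poly_Mapping.keys F"
    then have "a + b + c = 4" using assms by (auto simp: homogeneous_def)
    then have "(a, b, c) = g (a + b, a)" "(a + b, a) \<in> B" by (auto simp: g_def B_def)
    then show "(a, b, c) \<in> g ` B" by blast
  qed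
  moreover have "finite (g ` B)" by (simp add: B_def)
  ultimately have "eval_ac F (x, y, z) =
      (\<Sum>(a, b, c) \<in> g ` B. to_ac (Poly_Mapping.lookup F (a, b, c)) * x ^ a * y ^ b * z ^ c)"
    unfolding eval_ac_eq_eval3 by (intro eval3_superset) simp_all
  also have "inj_on g B"
    by (auto simp: inj_on_def g_def B_def)
  then have "(\<Sum>(a, b, c) \<in> g ` B. to_ac (Poly_Mapping.lookup F (a, b, c)) * x ^ a * y ^ b * z ^ c) =
      (\<Sum>(j, a) \<in> B. to_ac (Poly_Mapping.lookup F (a, j - a, 4 - j)) * x ^ a * y ^ (j - a) * z ^ (4 - j))"
    by (simp add: sum.reindex g_def case_prod_unfold)
  also have "\<dots> = (\<Sum>j\<le>4. \<Sum>a\<le>j. to_ac (Poly_Mapping.lookup F (a, j - a, 4 - j)) * x ^ a * y ^ (j - a) * z ^ (4 - j))"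
    unfolding B_def by (subst sum.Sigma) auto
  also have "\<dots> = (\<Sum>j\<le>4. bform j (graded F j) x y * z ^ (4 - j))"
    by (simp add: bform_def coeff_graded sum_distrib_right)
  finally show ?thesis .
qed

section \<open>Quadratic factors\<close>

definition scale_var :: "'a::comm_ring_1 \<Rightarrow> 'a poly poly \<Rightarrow> 'a poly poly" where
  "scale_var \<zeta> Q = map_poly (\<lambda>c. pcompose c [:0, \<zeta>:]) Q"

lemma is_hom_scale_var: "is_hom (scale_var \<zeta>)"
  unfolding scale_var_def by (rule is_hom_map_poly[OF is_hom_pcompose])

lemma coeff_pcompose_scale: "coeff (pcompose p [:0, \<zeta> :: 'a::comm_ring_1:]) n = \<zeta> ^ n * coeff p n"
proof (induction p arbitrary: n)
  case (pCons a p)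
  then show ?case by (cases n) (simp_all add: pcompose_pCons)
qed simp

lemma coeff_scale_var: "coeff (coeff (scale_var \<zeta> Q) i) n = \<zeta> ^ n * coeff (coeff Q i) n"
  by (simp add: scale_var_def coeff_map_poly coeff_pcompose_scale)

lemma scale_var_mult: "scale_var \<zeta> (scale_var \<xi> Q) = scale_var (\<zeta> * \<xi>) Q"
  by (simp add: poly_eq_iff coeff_scale_var power_mult_distrib mult.assoc)

lemma coeff_pcompose_monom:
  fixes c :: "'a::field poly"
  assumes "e > 0"
  shows "coeff (pcompose c (monom 1 e)) n = (if e dvd n then coeff c (n div e) else 0)"
proof -
  have "coeff (pcompose c (monom 1 e)) n = fps_nth (ramify e (fps_of_poly c)) n"
    using fps_of_poly_expand[OF assms, of c] by (metis fps_of_poly_nth)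
  then show ?thesis by simp
qed

lemma coeff_coeff_expand:
  fixes P :: "'a::field poly poly"
  assumes "e > 0"
  shows "coeff (coeff (expand e P) i) n = (if e dvd n then coeff (coeff P i) (n div e) else 0)"
  unfolding coeff_expand by (rule coeff_pcompose_monom[OF assms])

lemma expand_expand:
  fixes P :: "'a::field poly poly"
  assumes "a > 0" "b > 0"
  shows "expand a (expand b P) = expand (a * b) P"
proof -
  have "coeff (coeff (expand a (expand b P)) i) n = coeff (coeff (expand (a * b) P) i) n" for i n
  proof (cases "a dvd n")
    case True
    then obtain m where "n = a * m" by (elim dvdE)
    then show ?thesis using assms by (simp add: coeff_coeff_expand)
  next
    case False
    then have "\<not> a * b dvd n" using dvd_mult_left by blast
    then show ?thesis using False assms by (simp add: coeff_coeff_expand)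
  qed
  then show ?thesis by (simp add: poly_eq_iff)
qed

lemma expand_injective:
  fixes P Q :: "'a::field poly poly"
  assumes "e > 0" "expand e P = expand e Q"
  shows "P = Q"
proof -
  have "coeff (coeff P i) n = coeff (coeff Q i) n" for i n
    using arg_cong[OF assms(2), of "\<lambda>R. coeff (coeff R i) (e * n)"] assms(1) by (simp add: coeff_coeff_expand)
  then show ?thesis by (simp add: poly_eq_iff)
qed

lemma scale_var_expand:
  fixes P :: "'a::field poly poly"
  assumes "e > 0" "\<zeta> ^ e = 1"
  shows "scale_var \<zeta> (expand e P) = expand e P"
proof -
  have "coeff (coeff (scale_var \<zeta> (expand e P)) i) n = coeff (coeff (expand e P) i) n" for i n
  proof (cases "e dvd n")
    case True
    then obtain m where "n = e * m" by (elim dvdE)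
    then have "\<zeta> ^ n = 1" using assms(2) by (simp add: power_mult)
    then show ?thesis by (simp add: coeff_scale_var)
  qed (simp add: coeff_scale_var coeff_coeff_expand[OF assms(1)])
  then show ?thesis by (simp add: poly_eq_iff)
qed

lemma expand_descent:
  fixes Q :: "'a::field poly poly"
  assumes k: "k > 0" and supp: "\<And>i n. coeff (coeff Q i) n \<noteq> 0 \<Longrightarrow> k dvd n"
  shows "\<exists>P. Q = expand k P"
proof -
  define d where "d = (\<lambda>c :: 'a poly. \<Sum>n\<le>degree c. monom (coeff c (k * n)) n)"
  have cd: "coeff (d c) n = coeff c (k * n)" for c n
  proof -
    have "n \<le> k * n" using k by simp
    then have "degree c < n \<Longrightarrow> coeff c (k * n) = 0" by (intro coeff_eq_0) linarith
    then show ?thesis by (auto simp: d_def coeff_sum not_le)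
  qed
  have "d 0 = 0" by (simp add: d_def)
  define P where "P = map_poly d Q"
  have "coeff (coeff Q i) n = coeff (coeff (expand k P) i) n" for i n
    using supp[of i n] k by (auto simp: coeff_coeff_expand P_def coeff_map_poly[of d, OF \<open>d 0 = 0\<close>] cd)
  then have "Q = expand k P" by (simp add: poly_eq_iff)
  then show ?thesis ..
qed

text \<open>The polynomial \<open>Y ^ e - 1\<close> is prime to its derivative and has
  \<open>e\<close> distinct roots. They would all be roots of \<open>Y ^ r - 1\<close> for the
  remainder \<open>r\<close> of \<open>m\<close> modulo \<open>e\<close>, which is too many unless
  \<open>r\<close> is zero.\<close>

lemma roots_of_unity_exponent:
  fixes e m :: nat
  assumes e: "e > 0" and all: "\<And>\<zeta> :: 'a::{alg_closed_field, field_char_0}. \<zeta> ^ e = 1 \<Longrightarrow> \<zeta> ^ m = 1"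
  shows "e dvd m"
proof (rule ccontr)
  assume "\<not> e dvd m"
  define r where "r = m mod e"
  have r: "r > 0" "r < e" using e \<open>\<not> e dvd m\<close> by (auto simp: r_def dvd_eq_mod_eq_0)
  have r_all: "\<zeta> ^ r = 1" if "\<zeta> ^ e = 1" for \<zeta> :: 'a
  proof -
    have "\<zeta> ^ m = (\<zeta> ^ e) ^ (m div e) * \<zeta> ^ r" unfolding r_def by (simp flip: power_mult power_add)
    then show ?thesis using all[OF that] that by simp
  qed
  define p where "p = monom (1 :: 'a) e - 1"
  have cp: "coeff p n = (if n = e then 1 else 0) - (if n = 0 then 1 else 0)" for n
    by (simp add: p_def coeff_1)
  have "degree p = e" using e by (intro antisym degree_le le_degree) (auto simp: cp)
  have "p \<noteq> 0" using \<open>degree p = e\<close> e by auto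
  obtain A where A: "size A = e" "p = (\<Prod>x\<in>#A. [:- x, 1:])"
    using alg_closed_imp_factorization[OF \<open>p \<noteq> 0\<close>] \<open>degree p = e\<close> e by (auto simp: cp)
  have root: "poly p x = 0 \<longleftrightarrow> x ^ e = 1" for x by (simp add: p_def poly_monom)
  have inA: "x ^ e = 1" if "x \<in># A" for x
  proof -
    have "[:- x, 1:] dvd p" unfolding A(2) using that by (intro dvd_prod_mset) auto
    then show ?thesis by (simp add: poly_eq_0_iff_dvd flip: root)
  qed
  have "count A x \<le> 1" for x
  proof (rule ccontr)
    assume "\<not> count A x \<le> 1"
    then have "count A x > 0" by linarith
    then have "x \<in># A" by (simp only: count_greater_zero_iff)
    from multi_member_split[OF this] obtain A' where A': "A = add_mset x A'" by blast
    then have "count A' x > 0" using \<open>\<not> count A x \<le> 1\<close> by simp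
    then have "x \<in># A'" by (simp only: count_greater_zero_iff)
    from multi_member_split[OF this] obtain B where B: "A = add_mset x (add_mset x B)" using A' by blast
    then have "p = [:- x, 1:] * ([:- x, 1:] * (\<Prod>x\<in>#B. [:- x, 1:]))" by (simp add: A(2))
    then have "poly (pderiv p) x = 0" by (simp only: pderiv_mult poly_add poly_mult) simp
    then have "of_nat e * x ^ (e - 1) = 0" by (simp add: p_def pderiv_diff pderiv_monom poly_monom)
    then have "x = 0" using e by simp
    moreover have "x ^ e = 1" using B by (intro inA) simp
    ultimately show False using e by (simp add: power_0_left)
  qed
  then have "count A x = 1" if "x \<in># A" for x
    using that by (metis count_greater_zero_iff le_neq_implies_less less_one not_gr_zero)
  then have "card (set_mset A) = e"
    using A(1) by (simp add: size_multiset_overloaded_eq)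
  define q where "q = monom (1 :: 'a) r - 1"
  have cq: "coeff q n = (if n = r then 1 else 0) - (if n = 0 then 1 else 0)" for n
    by (simp add: q_def coeff_1)
  have dq: "degree q = r" using r by (intro antisym degree_le le_degree) (auto simp: cq)
  then have "q \<noteq> 0" using r by auto
  have "set_mset A \<subseteq> {x. poly q x = 0}" using inA r_all by (auto simp: q_def poly_monom)
  then have "card (set_mset A) \<le> card {x. poly q x = 0}"
    using poly_roots_finite[OF \<open>q \<noteq> 0\<close>] by (rule card_mono[rotated])
  also have "\<dots> \<le> r" using card_poly_roots_bound[OF \<open>q \<noteq> 0\<close>] dq by simp
  finally show False using \<open>card (set_mset A) = e\<close> r by simp
qed

lemma monic_quadratic_irreducible:
  fixes a b :: "'a::field_gcd poly"
  assumes nolin: "\<And>r. \<not> [:r, 1:] dvd [:b, a, 1:]"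
  shows "irreducible [:b, a, 1:]"
proof (rule irreducibleI)
  show "[:b, a, 1:] \<noteq> 0" by simp
  show "\<not> is_unit [:b, a, 1:]"
  proof
    assume "is_unit [:b, a, 1:]"
    then obtain v where v: "1 = [:b, a, 1:] * v" by (elim dvdE)
    then have "v \<noteq> 0" by auto
    then have "degree ([:b, a, 1:] * v) = degree [:b, a, 1:] + degree v" by (intro degree_mult_eq) auto
    moreover have "degree ([:b, a, 1:] * v) = 0" unfolding v[symmetric] by simp
    ultimately show False by simp
  qed
  fix u v assume uv: "[:b, a, 1:] = u * v"
  have nz: "u \<noteq> 0" "v \<noteq> 0" using uv by auto
  have "degree (u * v) = 2" unfolding uv[symmetric] by simp
  then have deg: "degree u + degree v = 2" by (simp only: degree_mult_eq[OF nz])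
  have "lead_coeff u * lead_coeff v = lead_coeff (u * v)" by (rule lead_coeff_mult[symmetric])
  also have "\<dots> = 1" unfolding uv[symmetric] by simp
  finally have lc: "lead_coeff u * lead_coeff v = 1" .
  have const: "is_unit w" if w: "degree w = 0" "lead_coeff w * c = 1" for w and c :: "'a poly"
  proof -
    obtain x where x: "w = [:x:]" using w(1) by (elim degree_eq_zeroE)
    then have "1 = w * [:c:]" using w(2) by (simp add: one_pCons mult.commute)
    then show ?thesis by (rule dvdI)
  qed
  have lin: False if "degree w = 1" "lead_coeff w * c = 1" "w dvd [:b, a, 1:]" for w c
  proof -
    have "smult c w = [:c * coeff w 0, 1:]"
      using that(1,2) by (intro poly_eqI) (auto simp: coeff_pCons mult.commute coeff_eq_0 split: nat.splits)
    moreover have "smult c w dvd [:b, a, 1:]"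
    proof -
      have "smult (lead_coeff w) (smult c w) = w" using that(2) by (metis smult_smult smult_1_left)
      then have "smult c w dvd w" by (metis dvd_refl dvd_smult)
      then show ?thesis using that(3) by (rule dvd_trans)
    qed
    ultimately show False using nolin by metis
  qed
  consider "degree u = 0" | "degree u = 1" | "degree v = 0" using deg by linarith
  then show "is_unit u \<or> is_unit v"
  proof cases
    case 1
    then show ?thesis using const[OF _ lc] by blast
  next
    case 2
    then show ?thesis using lin[OF _ lc] uv by (metis dvd_triv_left)
  next
    case 3
    then show ?thesis using const[of v "lead_coeff u"] lc by (simp add: mult.commute)
  qed
qed

lemma monic_quadratic_exists:
  assumes "lead_coeff H = 1" "degree H = 2"
  obtains c d where "H = [:d, c, 1:]"
proof (rule that)
  show "H = [:coeff H 0, coeff H 1, 1:]"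
  proof (rule poly_eqI)
    fix n :: nat
    consider "n = 0" | "n = 1" | "n = 2" | "n > 2" by linarith
    then show "coeff H n = coeff [:coeff H 0, coeff H 1, 1:] n"
    proof cases
      case 3
      then show ?thesis using assms by (simp add: numeral_2_eq_2)
    next
      case 4
      then obtain m where "n = Suc (Suc (Suc m))" by (metis less_imp_Suc_add numeral_2_eq_2 add_Suc)
      then show ?thesis using assms 4 by (simp add: coeff_eq_0)
    qed simp_all
  qed
qed

text \<open>Without linear factors the divisor is irreducible, hence prime in this factorial ring;
  dividing a monic quadratic, it must equal it.\<close>

lemma monic_quadratic_dvd_product:
  fixes a b c d :: "'a::field_gcd poly"
  assumes nolin: "\<And>r. \<not> [:r, 1:] dvd G * H"
    and G: "G = [:b, a, 1:]" and H: "H = [:d, c, 1:]" and G': "[:b', a', 1:] dvd G * H"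
  shows "[:b', a', 1:] = G \<or> [:b', a', 1:] = H"
proof -
  have "irreducible [:b', a', 1:]"
    by (rule monic_quadratic_irreducible) (use nolin G' dvd_trans in blast)
  then have "prime_elem [:b', a', 1:]" by (rule irreducible_imp_prime_elem)
  then have "[:b', a', 1:] dvd G \<or> [:b', a', 1:] dvd H" using G' by (simp add: prime_elem_dvd_mult_iff)
  moreover have "[:b', a', 1:] = [:y, x, 1:]" if xy: "[:b', a', 1:] dvd [:y, x, 1:]" for x y
  proof -
    obtain k where k: "[:y, x, 1:] = [:b', a', 1:] * k" using xy by (elim dvdE)
    then have "k \<noteq> 0" by auto
    then have "degree ([:b', a', 1:] * k) = degree [:b', a', 1:] + degree k" by (intro degree_mult_eq) auto
    then have "degree k = 0" unfolding k[symmetric] by simp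
    then obtain u where u: "k = [:u:]" by (elim degree_eq_zeroE)
    have "[:y, x, 1:] = smult u [:b', a', 1:]" using k unfolding u by simp
    then have "u = 1" by simp
    then show ?thesis using \<open>[:y, x, 1:] = smult u [:b', a', 1:]\<close> by simp
  qed
  ultimately show ?thesis unfolding G H by blast
qed

lemma scale_var_quadratic:
  "scale_var \<zeta> [:b, a, 1:] = [:pcompose b [:0, \<zeta>:], pcompose a [:0, \<zeta>:], 1:]"
  by (simp add: scale_var_def map_poly_pCons pcompose_1)

text \<open>Scaling by a root of unity either fixes \<open>G\<close> or exchanges it with its cofactor \<open>H\<close>, so scaling by
  the square of a root of unity fixes both.\<close>

lemma scale_var_square:
  fixes P G H :: "'a::field_gcd poly poly"
  assumes e: "e > 0" "\<zeta> ^ e = 1" and nolin: "\<And>r. \<not> [:r, 1:] dvd expand e P"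
    and GH: "expand e P = G * H" and G: "G = [:b, a, 1:]" and H: "H = [:d, c, 1:]"
  shows "scale_var \<zeta> G = G \<or> scale_var \<zeta> G = H" "scale_var (\<zeta> * \<zeta>) G = G" "scale_var (\<zeta> * \<zeta>) H = H"
    "scale_var \<zeta> G = G \<Longrightarrow> scale_var \<zeta> H = H"
proof -
  note h = is_hom_simps[OF is_hom_scale_var[of \<zeta>]]
  have inv: "scale_var \<zeta> G * scale_var \<zeta> H = G * H"
    using scale_var_expand[OF e, of P] by (simp add: GH h)
  have "scale_var \<zeta> G dvd G * H" unfolding inv[symmetric] by simp
  then show or: "scale_var \<zeta> G = G \<or> scale_var \<zeta> G = H"
    using monic_quadratic_dvd_product[OF nolin[unfolded GH] G H] unfolding G scale_var_quadratic by blast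
  have nz: "G \<noteq> 0" "H \<noteq> 0" by (auto simp: G H)
  show fixed: "scale_var \<zeta> G = G \<Longrightarrow> scale_var \<zeta> H = H"
    using inv nz by simp
  have "scale_var \<zeta> G = H \<Longrightarrow> scale_var \<zeta> H = G" using inv nz by (simp add: mult.commute)
  then show "scale_var (\<zeta> * \<zeta>) G = G" "scale_var (\<zeta> * \<zeta>) H = H"
    using or fixed unfolding scale_var_mult[symmetric] by metis+
qed

lemma pcompose_monom_eq_0_iff:
  fixes c :: "'a::field poly"
  assumes "e > 0"
  shows "pcompose c (monom 1 e) = 0 \<longleftrightarrow> c = 0"
  using assms by (simp add: pcompose_eq_0_iff degree_monom_eq)

lemma expand_quadratic:
  fixes Q :: "'a::field poly poly"
  assumes e: "e > 0" and Q: "expand e Q = [:y, x, 1:]"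
  obtains b a where "Q = [:b, a, 1:]"
proof -
  have "Q \<noteq> 0" using Q by (auto simp: expand_def)
  then have "pcompose (lead_coeff Q) (monom 1 e) \<noteq> 0" by (simp add: pcompose_monom_eq_0_iff[OF e])
  then have "degree (expand e Q) = degree Q" unfolding expand_def by (rule map_poly_degree_eq)
  then have d: "degree Q = 2" using Q by simp
  have "pcompose (coeff Q 2) (monom 1 e) = 1"
    using coeff_expand[of e Q 2] Q by (simp add: numeral_2_eq_2)
  then have "pcompose (coeff Q 2 - 1) (monom 1 e) = 0" by (simp add: pcompose_diff pcompose_1)
  then have "lead_coeff Q = 1" by (simp add: pcompose_monom_eq_0_iff[OF e] d)
  then show ?thesis using monic_quadratic_exists d that by blast
qed

text \<open>The squares of the \<open>2 * e\<close>-th roots of unity fix both factors over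
  \<open>expand (2 * e) P\<close>, so only multiples of \<open>e\<close> occur as exponents of
  \<open>Y\<close> and the factorization descends to \<open>expand 2 P\<close>. A further descent
  may fail, since the roots of unity themselves may exchange the factors.\<close>

lemma quadratic_factor_square:
  fixes P :: "'a::{field_gcd, alg_closed_field, field_char_0} poly poly"
  assumes P: "lead_coeff P = 1" "degree P = 4" and nolin: "\<And>e r. e > 0 \<Longrightarrow> \<not> [:r, 1:] dvd expand e P"
    and e: "e > 0" and dvd: "[:b, a, 1:] dvd expand e P"
  obtains a' b' c' d' where "expand 2 P = [:b', a', 1:] * [:d', c', 1:]"
proof -
  define G where "G = expand 2 [:b, a, 1:]"
  have Gq: "\<exists>x y. G = [:y, x, 1:]" by (simp add: G_def expand_def map_poly_pCons pcompose_1)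
  then obtain x y where G: "G = [:y, x, 1:]" by blast
  have ee: "expand (2 * e) P = expand 2 (expand e P)" using e by (simp add: expand_expand)
  have "G dvd expand (2 * e) P"
  proof -
    obtain k where k: "expand e P = [:b, a, 1:] * k" using dvd by (elim dvdE)
    have "expand (2 * e) P = G * expand 2 k"
      unfolding ee k G_def by (rule is_hom_simps(3)[OF is_hom_expand])
    then show ?thesis by (rule dvdI)
  qed
  then obtain H where GH: "expand (2 * e) P = G * H" by (elim dvdE)
  have mon: "lead_coeff (expand (2 * e) P) = 1" "degree (expand (2 * e) P) = 4"
    using monic_expand[OF P(1), of "2 * e"] P(2) by auto
  have "G \<noteq> 0" "H \<noteq> 0" using mon(1) GH by auto
  have "degree G = 2" "lead_coeff G = 1" by (simp_all add: G)
  then have "degree H = 2" "lead_coeff H = 1"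
    using mon degree_mult_eq[OF \<open>G \<noteq> 0\<close> \<open>H \<noteq> 0\<close>] lead_coeff_mult[of G H] unfolding GH by simp_all
  then obtain u v where H: "H = [:v, u, 1:]" using monic_quadratic_exists by blast
  have e2: "2 * e > 0" using e by simp
  note sq = scale_var_square[OF e2 _ nolin[OF e2] GH G H]
  have supp: "e dvd n" if Q: "Q = G \<or> Q = H" and nz: "coeff (coeff Q i) n \<noteq> 0" for Q i n
  proof -
    have "\<zeta> ^ (2 * n) = 1" if "\<zeta> ^ (2 * e) = 1" for \<zeta> :: 'a
    proof -
      have "scale_var (\<zeta> * \<zeta>) Q = Q" using sq(2,3)[OF that] Q by blast
      then have "(\<zeta> * \<zeta>) ^ n * coeff (coeff Q i) n = coeff (coeff Q i) n"
        using coeff_scale_var[of "\<zeta> * \<zeta>" Q i n] by simp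
      then show ?thesis using nz by (simp add: power_mult power2_eq_square)
    qed
    then have "2 * e dvd 2 * n" by (rule roots_of_unity_exponent[OF e2])
    then show ?thesis by simp
  qed
  obtain G1 where G1: "G = expand e G1" using expand_descent[OF e, of G] supp by blast
  obtain H1 where H1: "H = expand e H1" using expand_descent[OF e, of H] supp by blast
  have "expand e (expand 2 P) = expand e (G1 * H1)"
    using GH e by (simp add: expand_expand mult.commute is_hom_simps[OF is_hom_expand] flip: G1 H1)
  then have eq: "expand 2 P = G1 * H1" by (rule expand_injective[OF e])
  obtain a' b' where "G1 = [:b', a', 1:]" using expand_quadratic[OF e, of G1 y x] G1 G by metis
  moreover obtain c' d' where "H1 = [:d', c', 1:]" using expand_quadratic[OF e, of H1 v u] H1 H by metis
  ultimately show ?thesis using that eq by blast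
qed

section \<open>Degrees and normal form of quadratic factors\<close>

lemma degree_le_pred: "degree p \<le> n" if "degree p \<le> Suc n" "coeff p (Suc n) = 0"
  using that by (metis le_SucE leading_coeff_0_iff degree_0 le0)

text \<open>With weight \<open>M + 1\<close> for \<open>a\<close> and \<open>c\<close> and
  \<open>2 * M + 2\<close> for \<open>b\<close> and \<open>d\<close>, the top coefficients satisfy
  that \<open>z ^ 2 + \<alpha> * z + \<beta>\<close> times
  \<open>z ^ 2 + \<gamma> * z + \<delta>\<close> is \<open>z ^ 4\<close>. Hence they all vanish and
  the degree bounds can be lowered.\<close>

lemma quadratic_factors_degree_step:
  fixes a b c d :: "'a::field poly"
  assumes u: "degree (a + c) \<le> 2" "degree (b + d + a * c) \<le> 4" "degree (a * d + b * c) \<le> 6" "degree (b * d) \<le> 8"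
    and M: "M \<ge> 2"
    and ac: "degree a \<le> Suc M" "degree c \<le> Suc M" and bd: "degree b \<le> Suc (Suc (2 * M))" "degree d \<le> Suc (Suc (2 * M))"
  shows "degree a \<le> M \<and> degree c \<le> M \<and> degree b \<le> 2 * M \<and> degree d \<le> 2 * M"
proof -
  define \<alpha> \<gamma> \<beta> \<delta> where "\<alpha> = coeff a (Suc M)" and "\<gamma> = coeff c (Suc M)"
    and "\<beta> = coeff b (Suc (Suc (2 * M)))" and "\<delta> = coeff d (Suc (Suc (2 * M)))"
  have top: "coeff (a * c) (Suc (Suc (2 * M))) = \<alpha> * \<gamma>"
    using coeff_mult_top[OF ac] by (simp add: \<alpha>_def \<gamma>_def mult_2)
  have 1: "\<alpha> + \<gamma> = 0"
    using u(1) M coeff_eq_0[of "a + c" "Suc M"] by (simp add: \<alpha>_def \<gamma>_def)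
  have 2: "\<beta> + \<delta> + \<alpha> * \<gamma> = 0"
    using u(2) M coeff_eq_0[of "b + d + a * c" "Suc (Suc (2 * M))"] top by (simp add: \<beta>_def \<delta>_def)
  have 3: "\<alpha> * \<delta> + \<beta> * \<gamma> = 0"
    using u(3) M coeff_eq_0[of "a * d + b * c" "Suc M + Suc (Suc (2 * M))"]
      coeff_mult_top[OF ac(1) bd(2)] coeff_mult_top[OF bd(1) ac(2)]
    by (simp add: \<alpha>_def \<beta>_def \<gamma>_def \<delta>_def add.commute)
  have 4: "\<beta> * \<delta> = 0"
    using u(4) M coeff_eq_0[of "b * d" "Suc (Suc (2 * M)) + Suc (Suc (2 * M))"] coeff_mult_top[OF bd]
    by (simp add: \<beta>_def \<delta>_def)
  have \<gamma>: "\<gamma> = - \<alpha>" using 1 by (simp add: eq_neg_iff_add_eq_0 add.commute)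
  have "\<alpha> * (\<delta> - \<beta>) = 0" using 3 by (simp add: \<gamma> algebra_simps)
  then have "\<alpha> = 0"
    using 2 4 by (auto simp: \<gamma>)
  then have z: "\<alpha> = 0" "\<gamma> = 0" "\<beta> = 0" "\<delta> = 0"
    using 2 4 by (auto simp: \<gamma>)
  have ac': "degree a \<le> M" "degree c \<le> M" and bd': "degree b \<le> Suc (2 * M)" "degree d \<le> Suc (2 * M)"
    using z ac bd by (auto simp: \<alpha>_def \<beta>_def \<gamma>_def \<delta>_def intro: degree_le_pred)
  have "degree (a * c) < Suc (2 * M)" using ac' degree_mult_le[of a c] by linarith
  \<comment> \<open>The bounds for \<open>b\<close> and \<open>d\<close> must drop by two while
    those for \<open>a\<close> and \<open>c\<close> drop by one, so a second comparison in odd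
    degree is needed; the term \<open>a * c\<close> no longer reaches it.\<close>
  then have "coeff b (Suc (2 * M)) + coeff d (Suc (2 * M)) = 0"
    using u(2) M coeff_eq_0[of "b + d + a * c" "Suc (2 * M)"] by (simp add: coeff_eq_0)
  moreover have "coeff b (Suc (2 * M)) * coeff d (Suc (2 * M)) = 0"
    using u(4) M coeff_eq_0[of "b * d" "Suc (2 * M) + Suc (2 * M)"] coeff_mult_top[OF bd'] by simp
  ultimately have "coeff b (Suc (2 * M)) = 0" "coeff d (Suc (2 * M)) = 0" by auto
  then show ?thesis using ac' bd' by (auto intro: degree_le_pred)
qed

text \<open>Descent from a bound that holds trivially. The conditions record that \<open>Y\<close>
  has weight one half of that of \<open>X\<close> after the substitution of a square.\<close>

lemma quadratic_factors_degree:
  fixes a b c d :: "'a::field poly"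
  assumes u: "degree (a + c) \<le> 2" "degree (b + d + a * c) \<le> 4" "degree (a * d + b * c) \<le> 6" "degree (b * d) \<le> 8"
  shows "degree a \<le> 2 \<and> degree c \<le> 2 \<and> degree b \<le> 4 \<and> degree d \<le> 4"
proof -
  have "degree a \<le> 2 + M \<and> degree c \<le> 2 + M \<and> degree b \<le> 2 * (2 + M) \<and> degree d \<le> 2 * (2 + M) \<Longrightarrow> ?thesis" for M
  proof (induction M)
    case (Suc M)
    then show ?case using quadratic_factors_degree_step[OF u, of "2 + M"] by simp
  qed simp
  moreover have "degree a \<le> 2 + (degree a + degree b + degree c + degree d)
      \<and> degree c \<le> 2 + (degree a + degree b + degree c + degree d)
      \<and> degree b \<le> 2 * (2 + (degree a + degree b + degree c + degree d))
      \<and> degree d \<le> 2 * (2 + (degree a + degree b + degree c + degree d))" by simp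
  ultimately show ?thesis by blast
qed

lemma even_odd_decomposition:
  fixes p :: "'a::field poly"
  obtains u v where "p = pcompose u (monom 1 2) + [:0, 1:] * pcompose v (monom 1 2)"
    "pcompose p [:0, - 1:] = pcompose u (monom 1 2) - [:0, 1:] * pcompose v (monom 1 2)"
    "\<And>n. degree p \<le> 2 * n \<Longrightarrow> degree u \<le> n" "\<And>n. degree p \<le> Suc (Suc (2 * n)) \<Longrightarrow> degree v \<le> n"
proof -
  have m: "pcompose (monom 1 2) [:0, - 1:] = monom (1 :: 'a) 2"
    by (rule poly_eqI) (simp add: coeff_pcompose_scale)
  have sq: "monom (1 :: 'a) 2 = [:0, 1:] * [:0, 1:]"
    by (simp add: numeral_2_eq_2 monom_altdef)
  have "\<exists>u v. p = pcompose u (monom 1 2) + [:0, 1:] * pcompose v (monom 1 2)"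
  proof (induction p)
    case 0
    show ?case by (intro exI[of _ 0]) simp
  next
    case (pCons c p)
    then obtain u v where p: "p = pcompose u (monom 1 2) + [:0, 1:] * pcompose v (monom 1 2)" by blast
    have "pCons c p = [:c:] + [:0, 1:] * p" by simp
    also have "\<dots> = pcompose (pCons c v) (monom 1 2) + [:0, 1:] * pcompose u (monom 1 2)"
      unfolding pcompose_pCons sq by (subst p) (simp add: algebra_simps sq)
    finally show ?case by blast
  qed
  then obtain u v where p: "p = pcompose u (monom 1 2) + [:0, 1:] * pcompose v (monom 1 2)" by blast
  have cu: "coeff u n = coeff p (2 * n)" for n
  proof -
    have "coeff (pCons 0 (pcompose v (monom 1 2))) (2 * n) = 0"
      by (cases n) (simp_all add: coeff_pcompose_monom)
    then show ?thesis using p by (simp add: coeff_pcompose_monom)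
  qed
  have cv: "coeff v n = coeff p (Suc (2 * n))" for n
    using p by (simp add: coeff_pcompose_monom)
  show ?thesis
  proof (rule that[OF p])
    have "pcompose p [:0, - 1:] = pcompose (pcompose u (monom 1 2)) [:0, - 1:]
        + pcompose [:0, 1:] [:0, - 1:] * pcompose (pcompose v (monom 1 2)) [:0, - 1:]"
      by (subst p) (simp only: pcompose_add pcompose_mult)
    also have "\<dots> = pcompose u (monom 1 2) - [:0, 1:] * pcompose v (monom 1 2)"
      by (simp add: pcompose_assoc[symmetric] m pcompose_pCons)
    finally show "pcompose p [:0, - 1:] = pcompose u (monom 1 2) - [:0, 1:] * pcompose v (monom 1 2)" .
    show "degree u \<le> n" if "degree p \<le> 2 * n" for n
      using that by (intro degree_le) (auto simp: cu intro!: coeff_eq_0)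
    show "degree v \<le> n" if "degree p \<le> Suc (Suc (2 * n))" for n
      using that by (intro degree_le) (auto simp: cv intro!: coeff_eq_0)
  qed
qed

lemma bform_has_zero:
  fixes p :: "'a::alg_closed_field poly"
  assumes "degree p \<le> d" "d > 0"
  obtains x y where "(x, y) \<noteq> (0, 0)" "bform d p x y = 0"
proof (cases "degree p = d")
  case True
  then obtain x where "poly p x = 0" using alg_closed_imp_poly_has_root[of p] assms by auto
  then show ?thesis using that[of x 1] assms by (simp add: poly_bform)
next
  case False
  then have "coeff p d = 0" using assms by (simp add: coeff_eq_0)
  then show ?thesis using that[of 1 0] by (simp add: bform_at_infinity)
qed

text \<open>Eliminating \<open>z\<close> leaves the resultant \<open>\<rho>\<close>, a binary form
  of positive degree, which has a nontrivial zero. Above it the linear equation determines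
  \<open>z\<close>, unless its leading coefficient vanishes; then it vanishes identically in
  \<open>z\<close> and any root of the quadratic will do.\<close>

lemma common_zero:
  fixes A B l m :: "'a::alg_closed_field poly"
  assumes deg: "degree A \<le> 1" "degree B \<le> 2" "degree l \<le> \<delta>" "degree m \<le> Suc \<delta>"
  obtains x y z where "(x, y) \<noteq> (0, 0)" "z ^ 2 + bform 1 A x y * z + bform 2 B x y = 0"
    "bform \<delta> l x y * z + bform (Suc \<delta>) m x y = 0"
proof -
  define \<rho> where "\<rho> = m * m - A * (l * m) + B * (l * l)"
  define D where "D = Suc \<delta> + Suc \<delta>"
  have D: "D = 1 + (\<delta> + Suc \<delta>)" "D = 2 + (\<delta> + \<delta>)" by (simp_all add: D_def)
  have le: "degree (p * q) \<le> i + j" if "degree p \<le> i" "degree q \<le> j" for p q :: "'a poly" and i j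
    using that degree_mult_le[of p q] by linarith
  have dlm: "degree (l * m) \<le> \<delta> + Suc \<delta>" "degree (l * l) \<le> \<delta> + \<delta>" using deg le by blast+
  have "degree (m * m) \<le> D" "degree (A * (l * m)) \<le> D" "degree (B * (l * l)) \<le> D"
    unfolding D(1) using le[OF deg(4,4)] le[OF deg(1) dlm(1)] le[OF deg(2) dlm(2)] D by simp_all
  then have "degree \<rho> \<le> D" unfolding \<rho>_def by (intro degree_add_le degree_diff_le)
  moreover have "D > 0" by (simp add: D_def)
  ultimately obtain x y where xy: "(x, y) \<noteq> (0, 0)" "bform D \<rho> x y = 0" by (rule bform_has_zero)
  define A' B' l' m' where "A' = bform 1 A x y" and "B' = bform 2 B x y"
    and "l' = bform \<delta> l x y" and "m' = bform (Suc \<delta>) m x y"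
  have "bform D (m * m) x y = m' * m'" unfolding D_def m'_def by (rule bform_mult[OF deg(4,4)])
  moreover have "bform D (A * (l * m)) x y = A' * (l' * m')"
    unfolding D(1) A'_def l'_def m'_def by (simp only: bform_mult[OF deg(1) dlm(1)] bform_mult[OF deg(3,4)])
  moreover have "bform D (B * (l * l)) x y = B' * (l' * l')"
    unfolding D(2) B'_def l'_def by (simp only: bform_mult[OF deg(2) dlm(2)] bform_mult[OF deg(3,3)])
  ultimately have res: "m' * m' - A' * (l' * m') + B' * (l' * l') = 0"
    using xy(2) by (simp add: \<rho>_def bform_add bform_diff)
  show ?thesis
  proof (cases "l' = 0")
    case True
    then have "m' = 0" using res by simp
    obtain z where "poly [:B', A', 1:] z = 0" using alg_closed_imp_poly_has_root[of "[:B', A', 1:]"] by auto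
    then have "z ^ 2 + A' * z + B' = 0" by (simp add: power2_eq_square algebra_simps)
    then show ?thesis using that[OF xy(1), of z] True \<open>m' = 0\<close> by (simp add: A'_def B'_def l'_def m'_def)
  next
    case False
    define z where "z = - m' / l'"
    have "(l' * l') * (z ^ 2 + A' * z + B') = m' * m' - A' * (l' * m') + B' * (l' * l')"
      using False by (simp add: z_def power2_eq_square field_simps)
    then have "z ^ 2 + A' * z + B' = 0" using res False by simp
    moreover have "l' * z + m' = 0" using False by (simp add: z_def)
    ultimately show ?thesis using that[OF xy(1), of z] by (simp add: A'_def B'_def l'_def m'_def)
  qed
qed


text \<open>The substitution \<open>Y \<mapsto> - Y\<close> either fixes both factors (\<open>split\<close>) or exchanges them (\<open>twist\<close>).\<close>

lemma quadratic_factor_split: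
  fixes g1 g2 g3 g4 :: "'a::{field_gcd, alg_closed_field, field_char_0} poly"
  assumes g: "degree g1 \<le> 1" "degree g2 \<le> 2" "degree g3 \<le> 3" "degree g4 \<le> 4"
    and P: "P = [:g4, g3, g2, g1, 1:]"
    and nolin: "\<forall>e r. e > 0 \<longrightarrow> \<not> [:r, 1:] dvd expand e P"
    and e: "e > 0" and dvd: "[:b0, a0, 1:] dvd expand e P"
  obtains (split) a b c d where "degree a \<le> 1" "degree c \<le> 1" "degree b \<le> 2" "degree d \<le> 2"
      "g1 = a + c" "g2 = b + d + a * c" "g3 = a * d + b * c" "g4 = b * d"
  | (twist) a b l m where "degree a \<le> 1" "degree l \<le> 0" "degree b \<le> 2" "degree m \<le> 1"
      "g1 = 2 * a" "g2 = 2 * b + a * a - [:0, 1:] * (l * l)" "g3 = 2 * (a * b - [:0, 1:] * (l * m))"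
      "g4 = b * b - [:0, 1:] * (m * m)"
proof -
  define E where "E = (\<lambda>p :: 'a poly. pcompose p (monom 1 2))"
  have "is_hom E" unfolding E_def by (rule is_hom_pcompose)
  note E = is_hom_simps[OF this]
  have E_inj: "p = q" if "E p = E q" for p q
    using that pcompose_monom_eq_0_iff[of 2 "p - q"] by (simp add: E_def pcompose_diff)
  have "lead_coeff P = 1" "degree P = 4" by (simp_all add: P)
  from quadratic_factor_square[OF this _ e dvd] obtain b a d c
    where fac: "expand 2 P = [:b, a, 1:] * [:d, c, 1:]" using nolin by metis
  have "expand 2 P = [:E g4, E g3, E g2, E g1, 1:]"
    by (simp add: P expand_def E_def map_poly_pCons pcompose_1)
  moreover have "[:b, a, 1:] * [:d, c, 1:] = [:b * d, a * d + b * c, b + d + a * c, a + c, 1:]"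
    by (simp add: algebra_simps)
  ultimately have eqs: "E g1 = a + c" "E g2 = b + d + a * c" "E g3 = a * d + b * c" "E g4 = b * d"
    using fac by simp_all
  have degE: "degree (E p) = 2 * degree p" for p by (simp add: E_def degree_pcompose degree_monom_eq)
  have deg: "degree a \<le> 2" "degree c \<le> 2" "degree b \<le> 4" "degree d \<le> 4"
    using quadratic_factors_degree[of a c b d] g degE[of g1] degE[of g2] degE[of g3] degE[of g4] unfolding eqs by simp_all
  define T :: "'a poly" where "T = [:0, 1:]"
  have T: "T \<noteq> 0" "T * T = E T"
    by (simp_all add: T_def E_def pcompose_pCons numeral_2_eq_2 monom_altdef)
  obtain a1 a2 where a: "a = E a1 + T * E a2" "pcompose a [:0, - 1:] = E a1 - T * E a2"
      and da: "degree a1 \<le> 1" "degree a2 \<le> 0"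
    using even_odd_decomposition[of a] deg(1) unfolding E_def T_def
    by (metis mult_0_right mult_1_right numeral_2_eq_2)
  obtain b1 b2 where b: "b = E b1 + T * E b2" "pcompose b [:0, - 1:] = E b1 - T * E b2"
      and db: "degree b1 \<le> 2" "degree b2 \<le> 1"
    using even_odd_decomposition[of b] deg(3) unfolding E_def T_def
    by (smt (verit) One_nat_def Suc_1 mult_2 numeral_Bit0 add_Suc_right add_Suc plus_1_eq_Suc)
  obtain c1 c2 where c: "c = E c1 + T * E c2" "pcompose c [:0, - 1:] = E c1 - T * E c2"
      and dc: "degree c1 \<le> 1" "degree c2 \<le> 0"
    using even_odd_decomposition[of c] deg(2) unfolding E_def T_def
    by (metis mult_0_right mult_1_right numeral_2_eq_2)
  obtain d1 d2 where d: "d = E d1 + T * E d2" "pcompose d [:0, - 1:] = E d1 - T * E d2"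
      and dd: "degree d1 \<le> 2" "degree d2 \<le> 1"
    using even_odd_decomposition[of d] deg(4) unfolding E_def T_def
    by (smt (verit) One_nat_def Suc_1 mult_2 numeral_Bit0 add_Suc_right add_Suc plus_1_eq_Suc)
  have root: "(- 1 :: 'a) ^ 2 = 1" by simp
  have nolin2: "\<not> [:r, 1:] dvd expand 2 P" for r using nolin by simp
  note sq = scale_var_square[OF _ root nolin2 fac refl refl, simplified]
  have even: "E u + T * E v = E u" if "E u - T * E v = E u + T * E v" for u v
  proof -
    have "2 * (T * E v) = 0" using that by (simp add: algebra_simps)
    then show ?thesis by simp
  qed
  show ?thesis
  proof (cases "scale_var (- 1) [:b, a, 1:] = [:b, a, 1:]")
    case True
    then have "scale_var (- 1) [:d, c, 1:] = [:d, c, 1:]" using sq(4) by simp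
    then have "a = E a1" "b = E b1" "c = E c1" "d = E d1"
      using True even unfolding scale_var_quadratic a(2) b(2) c(2) d(2)
      by (simp_all add: a(1) b(1) c(1) d(1))
    then have "E g1 = E (a1 + c1)" "E g2 = E (b1 + d1 + a1 * c1)" "E g3 = E (a1 * d1 + b1 * c1)" "E g4 = E (b1 * d1)"
      by (simp_all add: E eqs)
    then show ?thesis using split[OF da(1) dc(1) db(1) dd(1)] E_inj by blast
  next
    case False
    \<comment> \<open>The second factor is the conjugate of the first under the sign change, so the
      product is a norm: a square minus \<open>x\<close> times a square, in terms of even and odd
      parts.\<close>
    then have "scale_var (- 1) [:b, a, 1:] = [:d, c, 1:]" using sq(1) by simp
    then have cd: "c = E a1 - T * E a2" "d = E b1 - T * E b2"
      unfolding scale_var_quadratic a(2) b(2) by simp_all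
    have E2: "E 2 = 2" using E(7)[of 2] by simp
    have "E g1 = E (2 * a1)" by (simp add: eqs cd a(1) E E2)
    moreover have "E g2 = E (2 * b1 + a1 * a1 - T * (a2 * a2))"
      by (simp add: eqs cd a(1) b(1) E E2 T(2)[symmetric] algebra_simps)
    moreover have "E g3 = E (2 * (a1 * b1 - T * (a2 * b2)))"
      by (simp add: eqs cd a(1) b(1) E E2 T(2)[symmetric] algebra_simps)
    moreover have "E g4 = E (b1 * b1 - T * (b2 * b2))"
      by (simp add: eqs cd b(1) E T(2)[symmetric] algebra_simps)
    ultimately show ?thesis using twist[OF da db] E_inj unfolding T_def by blast
  qed
qed

text \<open>For \<open>split\<close>, a product is the square of half the sum minus the square of
  half the difference, giving \<open>\<kappa> = 1\<close>, \<open>\<mu> = 0\<close>,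
  \<open>\<delta> = 1\<close>. For \<open>twist\<close>, the norm carries a factor \<open>x\<close>,
  homogenized to \<open>x * y\<close>, giving \<open>\<kappa> = 0\<close>, \<open>\<mu> = 1\<close>,
  \<open>\<delta> = 0\<close>. A common shape lets one singularity argument cover both.\<close>

lemma quadratic_factor_form:
  fixes g1 g2 g3 g4 :: "'a::{field_gcd, alg_closed_field, field_char_0} poly"
  assumes g: "degree g1 \<le> 1" "degree g2 \<le> 2" "degree g3 \<le> 3" "degree g4 \<le> 4"
    and P: "P = [:g4, g3, g2, g1, 1:]"
    and nolin: "\<forall>e r. e > 0 \<longrightarrow> \<not> [:r, 1:] dvd expand e P"
    and e: "e > 0" and dvd: "[:b0, a0, 1:] dvd expand e P"
  obtains A B l m \<delta> \<kappa> \<mu> where "degree A \<le> 1" "degree B \<le> 2" "degree l \<le> \<delta>" "degree m \<le> Suc \<delta>"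
    "\<And>x y z. z ^ 4 + bform 1 g1 x y * z ^ 3 + bform 2 g2 x y * z ^ 2 + bform 3 g3 x y * z + bform 4 g4 x y =
      (z ^ 2 + bform 1 A x y * z + bform 2 B x y) ^ 2
      - (\<kappa> + \<mu> * x * y) * (bform \<delta> l x y * z + bform (Suc \<delta>) m x y) ^ 2"
proof -
  have le: "degree (p * q) \<le> n" if "degree p \<le> i" "degree q \<le> j" "n = i + j" for p q :: "'a poly" and i j n
    using that degree_mult_le[of p q] by linarith
  have mult: "bform n (p * q) x y = bform i p x y * bform j q x y"
    if "degree p \<le> i" "degree q \<le> j" "n = i + j" for p q :: "'a poly" and i j n x y
    using that bform_mult by blast
  show ?thesis
  proof (cases rule: quadratic_factor_split[OF g P nolin e dvd, consumes 0, case_names split twist])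
    case (split a b c d)
    define A B l m where "A = smult (1/2) (a + c)" and "B = smult (1/2) (b + d)"
      and "l = smult (1/2) (a - c)" and "m = smult (1/2) (b - d)"
    show ?thesis
    proof (rule that[of A B l 1 m 1 0])
      show "degree A \<le> 1" "degree B \<le> 2" "degree l \<le> 1" "degree m \<le> Suc 1"
        using split(1-4) by (auto simp: A_def B_def l_def m_def intro!: degree_add_le degree_diff_le)
      fix x y z
      define a' b' c' d' where "a' = bform 1 a x y" and "b' = bform 2 b x y" and "c' = bform 1 c x y" and "d' = bform 2 d x y"
      have "bform 1 g1 x y = a' + c'" by (simp only: split(5) bform_add a'_def c'_def)
      moreover have "bform 2 g2 x y = b' + d' + a' * c'"
        using mult[OF split(1,2), of 2 x y] by (simp add: split(6) bform_add a'_def b'_def c'_def d'_def)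
      moreover have "bform 3 g3 x y = a' * d' + b' * c'"
        using mult[OF split(1,4), of 3 x y] mult[OF split(3,2), of 3 x y]
        by (simp add: split(7) bform_add a'_def b'_def c'_def d'_def)
      moreover have "bform 4 g4 x y = b' * d'"
        using mult[OF split(3,4), of 4 x y] by (simp add: split(8) b'_def d'_def)
      moreover have "bform 1 A x y = (a' + c') / 2" "bform 2 B x y = (b' + d') / 2"
        "bform 1 l x y = (a' - c') / 2" "bform (Suc 1) m x y = (b' - d') / 2"
        by (simp_all only: A_def B_def l_def m_def bform_smult bform_add bform_diff a'_def b'_def c'_def d'_def) (simp_all add: numeral_2_eq_2)
      ultimately show "z ^ 4 + bform 1 g1 x y * z ^ 3 + bform 2 g2 x y * z ^ 2 + bform 3 g3 x y * z + bform 4 g4 x y =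
        (z ^ 2 + bform 1 A x y * z + bform 2 B x y) ^ 2 - (1 + 0 * x * y) * (bform 1 l x y * z + bform (Suc 1) m x y) ^ 2"
        by (simp only:) (simp add: field_simps power2_eq_square power3_eq_cube power4_eq_xxxx)
    qed
  next
    case (twist a b l m)
    show ?thesis
    proof (rule that[of a b l 0 m 0 1])
      show "degree a \<le> 1" "degree b \<le> 2" "degree l \<le> 0" "degree m \<le> Suc 0" using twist by simp_all
      fix x y z
      define a' b' l' m' where "a' = bform 1 a x y" and "b' = bform 2 b x y" and "l' = bform 0 l x y" and "m' = bform (Suc 0) m x y"
      have two: "bform n (2 * p) x y = 2 * bform n p x y" for n p
        using bform_smult[of n 2 p x y] by (simp add: numeral_poly)
      have shift: "bform (Suc (Suc n)) ([:0, 1:] * p) x y = x * y * bform n p x y" if "degree p \<le> n" for n p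
        using bform_pCons_0[of "Suc n" p x y] bform_Suc[OF that, of x y] by simp
      have m1: "degree m \<le> 1" using twist(4) .
      have "bform 1 g1 x y = 2 * a'" by (simp only: twist(5) two a'_def)
      moreover have "bform 2 g2 x y = 2 * b' + a' * a' - x * y * (l' * l')"
        using mult[OF twist(1,1), of 2 x y] shift[OF le[OF twist(2,2)], of 0] mult[OF twist(2,2), of 0 x y]
        by (simp add: twist(6) bform_add bform_diff two a'_def b'_def l'_def numeral_2_eq_2)
      moreover have "bform 3 g3 x y = 2 * (a' * b' - x * y * (l' * m'))"
      proof -
        have "bform 3 g3 x y = 2 * (bform 3 (a * b) x y - bform 3 ([:0, 1:] * (l * m)) x y)"
          by (simp only: twist(7) two bform_diff)
        then show ?thesis
          using mult[OF twist(1,3), of 3 x y] shift[OF le[OF twist(2,4)], of 1] mult[OF twist(2,4), of 1 x y]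
          by (simp add: a'_def b'_def l'_def m'_def numeral_3_eq_3)
      qed
      moreover have "bform 4 g4 x y = b' * b' - x * y * (m' * m')"
        using mult[OF twist(3,3), of 4 x y] shift[OF le[OF m1 m1], of 2] mult[OF m1 m1, of 2 x y]
        by (simp add: twist(8) bform_diff b'_def m'_def numeral_eq_Suc)
      ultimately show "z ^ 4 + bform 1 g1 x y * z ^ 3 + bform 2 g2 x y * z ^ 2 + bform 3 g3 x y * z + bform 4 g4 x y =
        (z ^ 2 + bform 1 a x y * z + bform 2 b x y) ^ 2 - (0 + 1 * x * y) * (bform 0 l x y * z + bform (Suc 0) m x y) ^ 2"
        unfolding a'_def[symmetric] b'_def[symmetric] l'_def[symmetric] m'_def[symmetric]
        by (simp only:) (simp add: algebra_simps power2_eq_square power3_eq_cube power4_eq_xxxx)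
    qed
  qed
qed

section \<open>Monic models of the curve and exclusion of factors\<close>

instance alg_closure :: (field) field_gcd ..

lemma bform_const: "poly (bform d (map_poly (\<lambda>c. [:c:]) p) q r) s = bform d p (poly q s) (poly r s)"
  by (simp add: bform_def coeff_map_poly is_hom_sum[OF is_hom_poly] mult.assoc)

lemma poly_poly_const: "poly (poly Q q) s = poly (poly Q [:poly q s:]) s"
  by (induction Q) simp_all

lemma bform_shift:
  fixes p :: "'a::field poly"
  assumes "degree p \<le> d"
  shows "bform d (pcompose p [:c, 1:]) x y = bform d p (x + c * y) y"
proof (cases "y = 0")
  case True
  have "coeff (pcompose p [:c, 1:]) d = coeff p d"
    using coeff_pcompose_shift[OF assms] by blast
  then show ?thesis using True by (simp add: bform_at_infinity)
next
  case False
  moreover have "(x + c * y) / y = c + x / y" using False by (simp add: field_simps)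
  ultimately show ?thesis using assms by (simp add: bform_dehom degree_pcompose poly_pcompose mult.commute)
qed

lemma bform_scale_left:
  fixes p :: "'a::field poly"
  assumes "degree p \<le> d"
  shows "bform d p (x * y) y = y ^ d * poly p x"
proof (cases "y = 0")
  case True
  then show ?thesis by (cases d) (use assms in \<open>auto simp: bform_at_infinity elim: degree_eq_zeroE\<close>)
qed (use assms in \<open>simp add: bform_dehom\<close>)

text \<open>At a common zero of the two forms that are squared, the right-hand side vanishes to
  second order, so this zero is a singular point.\<close>

lemma smooth_not_square_form:
  fixes F :: "'k::field_char_0 poly3"
  assumes F: "homogeneous 4 F" "smooth_curve F"
    and deg: "degree A \<le> 1" "degree B \<le> 2" "degree l \<le> \<delta>" "degree m \<le> Suc \<delta>"
    and form: "\<And>x y z. eval_ac F (x + c * y, y, z) = f *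
      ((z ^ 2 + bform 1 A x y * z + bform 2 B x y) ^ 2
      - (\<kappa> + \<mu> * x * y) * (bform \<delta> l x y * z + bform (Suc \<delta>) m x y) ^ 2)"
  shows False
proof -
  obtain x0 y0 z0 where ne: "(x0, y0) \<noteq> (0, 0)" and zero: "z0 ^ 2 + bform 1 A x0 y0 * z0 + bform 2 B x0 y0 = 0"
    "bform \<delta> l x0 y0 * z0 + bform (Suc \<delta>) m x0 y0 = 0"
    using common_zero[OF deg] .
  define v where "v = (x0 + c * y0, y0, z0)"
  have "v \<noteq> (0, 0, 0)" using ne by (auto simp: v_def)
  \<comment> \<open>Restricting to the line through the common zero in direction \<open>dx\<close>,
    \<open>dy\<close>, \<open>dz\<close> turns the statement into the vanishing of one ordinary
    derivative at 0.\<close>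
  have dir: "(dx + c * dy) * eval_ac (pderivX F) v + dy * eval_ac (pderivY F) v + dz * eval_ac (pderivZ F) v = 0"
    for dx dy dz
  proof -
    define p q r where "p = [:x0, dx:]" and "q = [:y0, dy:]" and "r = [:z0, dz:]"
    define K where "K = (\<lambda>p. map_poly (\<lambda>a. [:a :: 'k alg_closure:]) p)"
    define U where "U = r ^ 2 + bform 1 (K A) p q * r + bform 2 (K B) p q"
    define V where "V = bform \<delta> (K l) p q * r + bform (Suc \<delta>) (K m) p q"
    define W where "W = [:\<kappa>:] + [:\<mu>:] * p * q"
    have "poly (eval3 const_ac F (p + [:c:] * q) q r) s = poly ([:f:] * (U ^ 2 - W * V ^ 2)) s" for s
      using form[of "poly p s" "poly q s" "poly r s"]
      by (simp add: poly_eval3 U_def V_def W_def K_def bform_const)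
    then have "eval3 const_ac F (p + [:c:] * q) q r = [:f:] * (U ^ 2 - W * V ^ 2)"
      by (simp add: poly_eq_poly_eq_iff[symmetric] fun_eq_iff)
    then have "poly (pderiv (eval3 const_ac F (p + [:c:] * q) q r)) 0 = poly (pderiv ([:f:] * (U ^ 2 - W * V ^ 2))) 0"
      by simp
    moreover have "poly U 0 = 0" "poly V 0 = 0"
      using zero by (simp_all add: U_def V_def K_def bform_const p_def q_def r_def mult.commute)
    then have "poly (pderiv ([:f:] * (U ^ 2 - W * V ^ 2))) 0 = 0"
      by (simp add: pderiv_mult pderiv_diff pderiv_smult power2_eq_square pderiv_pCons)
    moreover have "poly (p + [:c:] * q) 0 = x0 + c * y0" "poly q 0 = y0" "poly r 0 = z0"
      "poly (pderiv (p + [:c:] * q)) 0 = dx + c * dy" "poly (pderiv q) 0 = dy" "poly (pderiv r) 0 = dz"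
      by (simp_all add: p_def q_def r_def pderiv_add pderiv_mult pderiv_pCons)
    ultimately show ?thesis
      unfolding pderiv_eval3 by (simp add: poly_eval3 v_def mult.commute)
  qed
  have X: "eval_ac (pderivX F) v = 0" using dir[of 1 0 0] by simp
  then have "eval_ac (pderivY F) v = 0" "eval_ac (pderivZ F) v = 0" using dir[of 0 1 0] dir[of 0 0 1] by simp_all
  moreover have "eval_ac F v = 0" unfolding v_def form zero by simp
  ultimately show False using smooth_curveD[OF F(2)] \<open>v \<noteq> (0, 0, 0)\<close> X by (metis prod.exhaust)
qed

text \<open>If both vanish, every monomial has degree at least two in \<open>X\<close> and
  \<open>Y\<close> together, and \<open>(0, 0, 1)\<close> is singular.\<close>

lemma smooth_graded_nonzero:
  fixes F :: "'k::field_char_0 poly3"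
  assumes F: "homogeneous 4 F" "smooth_curve F"
  shows "graded F 0 \<noteq> 0 \<or> graded F 1 \<noteq> 0"
proof (rule ccontr)
  assume zero: "\<not> (graded F 0 \<noteq> 0 \<or> graded F 1 \<noteq> 0)"
  have to_ac0: "to_ac u = 0 \<longleftrightarrow> u = 0" for u :: 'k by simp
  have l: "Poly_Mapping.lookup F (0, 0, 4) = 0" "Poly_Mapping.lookup F (1, 0, 3) = 0" "Poly_Mapping.lookup F (0, 1, 3) = 0"
    using zero coeff_graded[of F 0 0] coeff_graded[of F 1 1] coeff_graded[of F 1 0] by (auto simp: to_ac0)
  have keys: "a + b \<ge> 2" if "(a, b, c) \<in> Poly_Mapping.keys F" for a b c
  proof (rule ccontr)
    assume "\<not> a + b \<ge> 2"
    moreover have "a + b + c = 4" using F(1) that by (auto simp: homogeneous_def)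
    ultimately have "(a, b, c) = (0, 0, 4) \<or> (a, b, c) = (1, 0, 3) \<or> (a, b, c) = (0, 1, 3)" by auto
    then show False using l that by (auto simp: in_keys_iff)
  qed
  have pow: "(0 :: 'k alg_closure) ^ i * 0 ^ j = 0" if "i + j > 0" for i j :: nat using that by (cases i) auto
  have "eval_ac F (0, 0, 1) = 0" unfolding eval_ac_eq_eval3 eval3_def
    using keys pow by (intro sum.neutral) (force simp: mult.assoc)
  moreover have "eval_ac (pderivX F) (0, 0, 1) = 0" "eval_ac (pderivY F) (0, 0, 1) = 0" "eval_ac (pderivZ F) (0, 0, 1) = 0"
    unfolding eval_ac_eq_eval3 eval3_pderiv[OF is_hom_to_ac]
    using keys pow by (intro sum.neutral; force simp: mult.assoc)+
  ultimately show False using smooth_curveD[OF F(2), of "(0, 0, 1)"] by simp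
qed


text \<open>A linear factor has the root \<open>- r\<close>, a polynomial in \<open>Y\<close>;
  inserting it in the model parametrizes the curve with abscissa \<open>Y ^ e + c\<close>.\<close>

lemma no_linear_model_factor:
  fixes F :: "'k::field_char_0 poly3"
  assumes F: "homogeneous 4 F" "smooth_curve F" and N: "N \<noteq> 0" and e: "e > 0"
    and model: "\<And>x z. eval_ac F ((x + c) * poly N x, poly N x, z) = poly u x * poly (poly P [:z:]) x"
  shows "\<not> [:r, 1:] dvd expand e P"
proof
  assume "[:r, 1:] dvd expand e P"
  then have root: "poly (expand e P) (- r) = 0" using poly_eq_0_iff_dvd[of "expand e P" "- r"] by simp
  define \<delta> where "\<delta> = pcompose N (monom 1 e)"
  have "poly (eval3 const_ac F ((monom 1 e + [:c:]) * \<delta>) \<delta> (- r)) s = 0" for s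
  proof -
    have "poly (poly P [:poly (- r) s:]) (s ^ e) = poly (poly (expand e P) (- r)) s"
      unfolding poly_poly_const[of "expand e P"] poly_expand ..
    then show ?thesis using model[of "s ^ e" "poly (- r) s"] root
      by (simp add: poly_eval3 \<delta>_def poly_pcompose poly_monom)
  qed
  then have "eval3 const_ac F ((monom 1 e + [:c:]) * \<delta>) \<delta> (- r) = 0" by (intro poly_all_0_iff_0[THEN iffD1]) blast
  moreover have "\<delta> \<noteq> 0" using N pcompose_monom_eq_0_iff[OF e, of N] by (simp add: \<delta>_def)
  ultimately show False using no_power_parametrization[OF F e] by blast
qed

text \<open>The complement of a quadratic factor in a cubic is linear, so in the cubic model
  quadratic factors reduce to linear ones.\<close>

lemma cubic_linear_factor:
  fixes Q :: "'a::idom poly"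
  assumes "lead_coeff Q = 1" "degree Q = 3" "[:b, a, 1:] dvd Q"
  obtains r where "[:r, 1:] dvd Q"
proof -
  obtain k where k: "Q = [:b, a, 1:] * k" using assms(3) by (elim dvdE)
  have "k \<noteq> 0" using k assms(1) by auto
  then have "degree Q = 2 + degree k" unfolding k by (subst degree_mult_eq) auto
  then have "degree k = 1" using assms(2) by simp
  moreover have "lead_coeff k = 1" using assms(1) unfolding k lead_coeff_mult by simp
  ultimately have "k = [:coeff k 0, 1:]"
    by (intro poly_eqI) (auto simp: coeff_pCons coeff_eq_0 split: nat.splits)
  then show ?thesis using k that[of "coeff k 0"] by (metis dvd_triv_right)
qed

lemma sum_atMost_4: "(\<Sum>j\<le>4. f j) = f 0 + f 1 + f 2 + f 3 + f (4 :: nat)" for f :: "nat \<Rightarrow> 'a::comm_monoid_add"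
  by (simp add: eval_nat_numeral atMost_Suc ac_simps)

lemma poly_graded_rational: "poly (graded F j) (to_ac x) \<in> range to_ac"
proof -
  have "poly (graded F j) (to_ac x) = to_ac (\<Sum>a\<le>j. Poly_Mapping.lookup F (a, j - a, 4 - j) * x ^ a)"
    by (simp add: graded_def poly_sum poly_monom to_ac_sum)
  then show ?thesis by simp
qed

text \<open>
  If \<open>(0 : 0 : 1)\<close> is not on the curve, take \<open>N = 1\<close> and divide by the leading coefficient in \<open>Z\<close>. Otherwise
  the equation is a cubic in \<open>Z\<close> with leading coefficient \<open>N\<close>, and \<open>Z \<mapsto> Z / N\<close> makes it monic.
\<close>

lemma model_polynomial:
  fixes F :: "'k::field_char_0 poly3"
  assumes F: "homogeneous 4 F" "smooth_curve F"
  obtains N u P where "N \<noteq> 0" "\<And>x. poly N (to_ac x) \<in> range to_ac" "\<And>x. poly N x \<noteq> 0 \<Longrightarrow> poly u x \<noteq> 0" "lead_coeff P = 1"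
    "\<And>x z. eval_ac F ((x + to_ac c) * poly N x, poly N x, z) = poly u x * poly (poly P [:z:]) x"
    "\<And>e a. e > 0 \<Longrightarrow> \<not> [:a, 1:] dvd expand e P"
    "\<And>e a b. e > 0 \<Longrightarrow> \<not> [:b, a, 1:] dvd expand e P"
proof -
  \<comment> \<open>The coefficients with respect to \<open>Z\<close> after moving the centre of
    expansion from \<open>c\<close> to 0.\<close>
  define h where "h = (\<lambda>j. pcompose (graded F j) [:to_ac c, 1:])"
  have dh: "degree (h j) \<le> j" for j using degree_graded[of F j] by (simp add: h_def degree_pcompose)
  have shift: "eval_ac F (x + to_ac c * y, y, z) = (\<Sum>j\<le>4. bform j (h j) x y * z ^ (4 - j))" for x y z
    unfolding eval_ac_graded[OF F(1)] h_def bform_shift[OF degree_graded] ..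
  have model: "eval_ac F ((x + to_ac c) * y, y, z) = (\<Sum>j\<le>4. y ^ j * poly (h j) x * z ^ (4 - j))" for x y z
    using shift[of "x * y" y z] by (simp add: bform_scale_left[OF dh] algebra_simps)
  obtain f where f: "graded F 0 = [:f:]" using degree_graded[of F 0] by (metis degree_eq_zeroE le_zero_eq)
  then have h0: "h 0 = [:f:]" by (simp add: h_def)
  show ?thesis
  proof (cases "f = 0")
    case False
    define g where "g = (\<lambda>j. smult (1 / f) (h j))"
    have fg: "f * poly (g j) x = poly (h j) x" for j x using False by (simp add: g_def)
    have fg': "f * bform d (g j) x y = bform d (h j) x y" for d j x y using False by (simp add: g_def bform_smult)
    define P where "P = [:g 4, g 3, g 2, g 1, 1:]"
    have P: "eval_ac F ((x + to_ac c) * poly 1 x, poly 1 x, z) = poly [:f:] x * poly (poly P [:z:]) x" for x z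
    proof -
      have "f * poly (poly P [:z:]) x = f * z ^ 4 + (f * poly (g 1) x) * z ^ 3 + (f * poly (g 2) x) * z ^ 2
          + (f * poly (g 3) x) * z + f * poly (g 4) x"
        by (simp add: P_def algebra_simps power2_eq_square power3_eq_cube power4_eq_xxxx)
      then show ?thesis unfolding model fg by (simp add: sum_atMost_4 h0)
    qed
    have nolin: "\<forall>e r. e > 0 \<longrightarrow> \<not> [:r, 1:] dvd expand e P"
      using no_linear_model_factor[OF F _ _ P] by simp
    have dg: "degree (g j) \<le> j" for j using dh[of j] by (simp add: g_def degree_smult_le order.trans[OF degree_smult_le])
    have noquad: False if ab: "e > 0" "[:b, a, 1:] dvd expand e P" for e a b
    proof (rule quadratic_factor_form[OF dg[of 1] dg[of 2] dg[of 3] dg[of 4] P_def nolin ab])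
      fix A B l m \<delta> \<kappa> \<mu>
      assume deg: "degree A \<le> 1" "degree B \<le> 2" "degree l \<le> \<delta>" "degree m \<le> Suc \<delta>"
        and form: "\<And>x y z. z ^ 4 + bform 1 (g 1) x y * z ^ 3 + bform 2 (g 2) x y * z ^ 2 + bform 3 (g 3) x y * z + bform 4 (g 4) x y =
          (z ^ 2 + bform 1 A x y * z + bform 2 B x y) ^ 2
          - (\<kappa> + \<mu> * x * y) * (bform \<delta> l x y * z + bform (Suc \<delta>) m x y) ^ 2"
      have "eval_ac F (x + to_ac c * y, y, z) =
          f * (z ^ 4 + bform 1 (g 1) x y * z ^ 3 + bform 2 (g 2) x y * z ^ 2 + bform 3 (g 3) x y * z + bform 4 (g 4) x y)" for x y z
      proof -
        have "eval_ac F (x + to_ac c * y, y, z) = f * z ^ 4 + bform 1 (h 1) x y * z ^ 3 + bform 2 (h 2) x y * z ^ 2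
            + bform 3 (h 3) x y * z + bform 4 (h 4) x y"
          unfolding shift by (simp add: sum_atMost_4 h0 bform_def[of 0])
        then show ?thesis unfolding distrib_left mult.assoc[symmetric] fg' .
      qed
      then show False by (intro smooth_not_square_form[OF F deg, of "to_ac c" f]) (simp only: form)
    qed
    show ?thesis
      by (rule that[OF _ _ _ _ P]) (use False nolin noquad in \<open>auto simp: P_def intro: range_eqI[of _ _ 1]\<close>)
  next
    case True
    \<comment> \<open>Taking \<open>h 1\<close> itself as second coordinate, every term of the cubic
      equation acquires the factor \<open>h 1 ^ 2\<close>, which becomes \<open>u\<close>, and the
      rest is monic in \<open>Z\<close>.\<close>
    define P where "P = [:h 1 ^ 2 * h 4, h 1 * h 3, h 2, 1:]"
    have "graded F 1 \<noteq> 0" using smooth_graded_nonzero[OF F] True f by simp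
    then have h1: "h 1 \<noteq> 0" by (simp add: h_def pcompose_eq_0_iff)
    have N: "poly (h 1) (to_ac x) \<in> range to_ac" for x
      using poly_graded_rational[of F 1 "c + x"] by (simp add: h_def poly_pcompose)
    have P: "eval_ac F ((x + to_ac c) * poly (h 1) x, poly (h 1) x, z) = poly (h 1 ^ 2) x * poly (poly P [:z:]) x" for x z
      unfolding model P_def using True
      by (simp add: h0 sum_atMost_4 algebra_simps power2_eq_square power3_eq_cube power4_eq_xxxx)
    have nolin: "\<not> [:r, 1:] dvd expand e P" if "e > 0" for e r
      using no_linear_model_factor[OF F h1 that P] .
    have P1: "lead_coeff P = 1" "degree P = 3" by (simp_all add: P_def)
    have noquad: "\<not> [:b, a, 1:] dvd expand e P" if "e > 0" for e a b
    proof
      assume "[:b, a, 1:] dvd expand e P"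
      moreover have "lead_coeff (expand e P) = 1" "degree (expand e P) = 3"
        using monic_expand[OF P1(1), of e] P1(2) by simp_all
      ultimately obtain r where "[:r, 1:] dvd expand e P" using cubic_linear_factor by blast
      then show False using nolin[OF that] by blast
    qed
    show ?thesis
      by (rule that[OF h1 N _ P1(1) P nolin noquad]) auto
  qed
qed

section \<open>Number fields and quadratic points\<close>

text \<open>The powers of \<open>w\<close> with exponents up to \<open>card J\<close> lie in a span
  of \<open>card J\<close> elements, so they are linearly dependent.\<close>

lemma finite_span_root:
  fixes w :: "'a::field_char_0" and v :: "'j \<Rightarrow> 'a"
  assumes J: "finite J" and span: "\<And>i. \<exists>r. w ^ i = (\<Sum>j\<in>J. of_rat (r j) * v j)"
  obtains q :: "rat poly" where "q \<noteq> 0" "degree q \<le> card J" "poly (map_poly of_rat q) w = 0"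
proof -
  obtain r where r: "\<And>i. w ^ i = (\<Sum>j\<in>J. of_rat (r i j) * v j)" using span by metis
  have card: "card J < card {..card J}" by simp
  obtain c where c: "\<And>i. i \<notin> {..card J} \<Longrightarrow> c i = 0" "\<exists>i\<in>{..card J}. c i \<noteq> 0"
    "\<And>j. j \<in> J \<Longrightarrow> (\<Sum>i\<le>card J. c i * r i j) = 0"
    using nontrivial_linear_relation[OF J _ card, of r] by auto
  define q where "q = (\<Sum>i\<le>card J. monom (c i) i)"
  have cq: "coeff q i = c i" for i using c(1)[of i] by (auto simp: q_def coeff_sum)
  have "map_poly of_rat q = (\<Sum>i\<le>card J. monom (of_rat (c i) :: 'a) i)"
    by (rule poly_eqI) (use c(1) in \<open>auto simp: coeff_map_poly cq coeff_sum\<close>)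
  then have "poly (map_poly of_rat q) w = (\<Sum>i\<le>card J. of_rat (c i) * w ^ i)"
    by (simp add: poly_sum poly_monom)
  also have "\<dots> = (\<Sum>i\<le>card J. \<Sum>j\<in>J. of_rat (c i * r i j) * v j)"
    by (simp add: r sum_distrib_left of_rat_mult mult.assoc)
  also have "\<dots> = (\<Sum>j\<in>J. of_rat (\<Sum>i\<le>card J. c i * r i j) * v j)"
    by (subst sum.swap) (simp add: of_rat_sum sum_distrib_right)
  also have "\<dots> = 0" by (simp add: c(3))
  finally have "poly (map_poly of_rat q) w = 0" .
  moreover have "degree q \<le> card J" using c(1) by (intro degree_le) (simp add: cq)
  moreover have "q \<noteq> 0" using c(2) cq by (metis coeff_0)
  ultimately show ?thesis using that by blast
qed

lemma number_field_span:
  assumes "number_field TYPE('k::field_char_0)"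
  obtains B :: "'k::field_char_0 set" where "finite B" "\<And>x. \<exists>r. x = (\<Sum>b\<in>B. of_rat (r b) * b)"
proof -
  obtain B :: "'k set" where "finite_dimensional_vector_space (\<lambda>q (x::'k). of_rat q * x) B"
    using assms unfolding number_field_def by blast
  then interpret V: finite_dimensional_vector_space "\<lambda>q (x::'k). of_rat q * x" B .
  have "\<exists>r. x = (\<Sum>b\<in>B. of_rat (r b) * b)" for x
  proof -
    have "x \<in> range (\<lambda>r. \<Sum>b\<in>B. of_rat (r b) * b)"
      unfolding V.span_finite[OF V.finite_Basis, symmetric] V.span_Basis by simp
    then show ?thesis by blast
  qed
  then show ?thesis using that V.finite_Basis by blast
qed

lemma to_ac_of_rat: "to_ac (of_rat q :: 'k::field_char_0) = of_rat q"
  by (cases q) (simp only: of_rat_rat to_ac_divide is_hom_simps(9)[OF is_hom_to_ac])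

lemma degree_bounded_range_to_ac:
  assumes "number_field TYPE('k::field_char_0)"
  obtains n where "degree_bounded n (range (to_ac :: 'k::field_char_0 \<Rightarrow> _))"
proof -
  obtain B :: "'k set" where B: "finite B" "\<And>x. \<exists>r. x = (\<Sum>b\<in>B. of_rat (r b) * b)"
    using number_field_span[OF assms] by blast
  have "\<exists>q :: rat poly. q \<noteq> 0 \<and> degree q \<le> card B \<and> poly (map_poly of_rat q) (to_ac x) = 0" for x :: 'k
  proof -
    obtain q :: "rat poly" where q: "q \<noteq> 0" "degree q \<le> card B" "poly (map_poly of_rat q) x = 0"
      using finite_span_root[of B x "\<lambda>b. b"] B by blast
    have "map_poly to_ac (map_poly of_rat q) = map_poly (of_rat :: rat \<Rightarrow> 'k alg_closure) q"
      by (rule poly_eqI) (simp add: coeff_map_poly to_ac_of_rat)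
    then have "poly (map_poly of_rat q) (to_ac x) = 0"
      using poly_map_poly_hom[OF is_hom_to_ac, of "map_poly of_rat q" x] q(3) by simp
    then show ?thesis using q by blast
  qed
  moreover have "is_subring (range (to_ac :: 'k \<Rightarrow> _))"
    unfolding is_subring_def
    by (auto simp: is_hom_simps[OF is_hom_to_ac] intro: range_eqI[of _ _ "_ - _"] range_eqI[of _ _ "_ * _"] range_eqI[of _ _ 1])
  ultimately show ?thesis using that[of "card B"] by (auto simp: degree_bounded_def)
qed

text \<open>Reduction modulo an equation over \<open>k\<close> puts all powers of \<open>x\<close>
  into the rational span of finitely many products of a spanning element of \<open>k\<close> with a
  low power of \<open>x\<close>.\<close>

lemma alg_closure_algebraic_over_rationals:
  assumes "number_field TYPE('k::field_char_0)"
  shows "algebraic (x :: 'k::field_char_0 alg_closure)"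
proof -
  obtain B :: "'k set" where B: "finite B" "\<And>x. \<exists>r. x = (\<Sum>b\<in>B. of_rat (r b) * b)"
    using number_field_span[OF assms] by blast
  obtain p :: "'k poly" where p: "p \<noteq> 0" "poly (map_poly to_ac p) x = 0"
    using alg_closure_algebraic[of x] by metis
  have "is_hom (\<lambda>q. poly (map_poly to_ac q) x)"
    using is_hom_comp[OF is_hom_poly is_hom_map_poly[OF is_hom_to_ac]] .
  note h = is_hom_simps[OF this]
  define d where "d = degree p"
  have d: "degree (monom 1 i mod p) < d" for i
  proof -
    have "degree p \<noteq> 0"
    proof
      assume "degree p = 0"
      then obtain a where "p = [:a:]" by (elim degree_eq_zeroE)
      then show False using p by (simp add: map_poly_pCons)
    qed
    then show ?thesis using degree_mod_less[OF p(1), of "monom 1 i"] by (auto simp: d_def)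
  qed
  define r where "r = (\<lambda>u. SOME r. u = (\<Sum>b\<in>B. of_rat (r b) * b))"
  have r: "u = (\<Sum>b\<in>B. of_rat (r u b) * b)" for u
    unfolding r_def by (rule someI_ex[OF B(2)])
  have "\<exists>s. x ^ i = (\<Sum>j\<in>{..<d} \<times> B. of_rat (s j) * (to_ac (snd j) * x ^ fst j))" for i
  proof -
    define m where "m = monom 1 i mod p"
    have "x ^ i = poly (map_poly to_ac (monom 1 i)) x"
      by (simp add: map_poly_monom poly_monom)
    also have "monom 1 i = monom 1 i div p * p + m" by (simp add: m_def)
    also have "poly (map_poly to_ac \<dots>) x = poly (map_poly to_ac m) x" by (simp add: h p(2))
    also have "\<dots> = (\<Sum>j<d. to_ac (coeff m j) * x ^ j)"
    proof -
      have "degree (map_poly to_ac m) = degree m" by (cases "m = 0") (auto intro: map_poly_degree_eq)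
      then show ?thesis unfolding poly_altdef using d[of i]
        by (intro sum.mono_neutral_cong_left) (auto simp: m_def coeff_map_poly intro: le_degree)
    qed
    also have "\<dots> = (\<Sum>j<d. \<Sum>b\<in>B. of_rat (r (coeff m j) b) * (to_ac b * x ^ j))"
    proof (intro sum.cong refl)
      fix j
      have "to_ac (coeff m j) = (\<Sum>b\<in>B. of_rat (r (coeff m j) b) * to_ac b)"
        using arg_cong[OF r[of "coeff m j"], of to_ac] by (simp only: to_ac_sum to_ac_mult to_ac_of_rat)
      then show "to_ac (coeff m j) * x ^ j = (\<Sum>b\<in>B. of_rat (r (coeff m j) b) * (to_ac b * x ^ j))"
        by (simp add: sum_distrib_right mult.assoc)
    qed
    also have "\<dots> = (\<Sum>j\<in>{..<d} \<times> B. of_rat (r (coeff m (fst j)) (snd j)) * (to_ac (snd j) * x ^ fst j))"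
      by (simp add: sum.cartesian_product case_prod_unfold)
    finally show ?thesis by (intro exI[of _ "\<lambda>j. r (coeff m (fst j)) (snd j)"])
  qed
  then obtain q :: "rat poly" where q: "q \<noteq> 0" "poly (map_poly of_rat q) x = 0"
    using finite_span_root[of "{..<d} \<times> B" x "\<lambda>j. to_ac (snd j) * x ^ fst j"] B(1) by blast
  have "map_poly (of_rat :: rat \<Rightarrow> 'k alg_closure) q \<noteq> 0"
    using q(1) by (auto simp: poly_eq_iff coeff_map_poly)
  then show ?thesis using q(2) by (auto simp: algebraic_altdef coeff_map_poly intro!: exI[of _ "map_poly of_rat q"])
qed

text \<open>The three monomials of degree two in \<open>u\<close> and \<open>v\<close> lie in a
  space of dimension two. Using them instead of powers of \<open>v / u\<close> requires only closure
  of \<open>L\<close> under products.\<close>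

lemma quadratic_extension_relation:
  assumes L: "quadratic_extension L" and uv: "u \<in> L" "v \<in> L" and u: "u \<noteq> 0"
  obtains p where "p \<noteq> 0" "degree p \<le> 2" "poly (map_poly to_ac p) (v / u) = 0"
proof -
  interpret V: vector_space ac_scale by (rule vector_space_ac_scale)
  have "subring L ring_of_type_algebra" and dim: "V.dim L = 2"
    using L by (auto simp: quadratic_extension_def subfield_def subcring_def subdomain_def)
  then have mult: "a * b \<in> L" if "a \<in> L" "b \<in> L" for a b
    using subringE(6)[of L ring_of_type_algebra a b] that by (simp add: ring_of_type_algebra_def)
  obtain B where B: "B \<subseteq> L" "L \<subseteq> V.span B" "card B = 2" using V.basis_exists[of L] dim by metis
  have "finite B" using B(3) by (intro card_ge_0_finite) simp
  have span: "\<exists>r. a = (\<Sum>b\<in>B. to_ac (r b) * b)" if "a \<in> L" for a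
  proof -
    have "a \<in> range (\<lambda>r. \<Sum>b\<in>B. ac_scale (r b) b)"
      using V.span_finite[OF \<open>finite B\<close>] B(2) that by blast
    then show ?thesis by (auto simp: ac_scale_def)
  qed
  define w where "w = (\<lambda>i::nat. v ^ i * u ^ (2 - i))"
  have "w 0 \<in> L" "w 1 \<in> L" "w 2 \<in> L" using uv mult by (simp_all add: w_def power2_eq_square)
  have "\<exists>r. w i = (\<Sum>b\<in>B. to_ac (r b) * b)" if i: "i \<le> 2" for i
  proof -
    consider "i = 0" | "i = 1" | "i = 2" using i by linarith
    then show ?thesis by cases (use \<open>w 0 \<in> L\<close> \<open>w 1 \<in> L\<close> \<open>w 2 \<in> L\<close> span in simp_all)
  qed
  then obtain r where r: "\<And>i. i \<le> 2 \<Longrightarrow> w i = (\<Sum>b\<in>B. to_ac (r i b) * b)" by metis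
  have card: "card B < card {..2::nat}" by (simp add: B(3))
  obtain c where c: "\<And>i. i \<notin> {..2} \<Longrightarrow> c i = 0" "\<exists>i\<in>{..2}. c i \<noteq> 0" "\<And>b. b \<in> B \<Longrightarrow> (\<Sum>i\<le>2. c i * r i b) = 0"
    using nontrivial_linear_relation[OF \<open>finite B\<close> _ card, of r] by auto
  define p where "p = (\<Sum>i\<le>2. monom (c i) i)"
  have cp: "coeff p i = c i" for i using c(1)[of i] by (auto simp: p_def coeff_sum)
  have "poly (map_poly to_ac p) (v / u) = (\<Sum>i\<le>2. to_ac (c i) * (v / u) ^ i)"
    unfolding p_def is_hom_sum[OF is_hom_map_poly[OF is_hom_to_ac]] by (simp add: map_poly_monom poly_sum poly_monom)
  then have "u ^ 2 * poly (map_poly to_ac p) (v / u) = (\<Sum>i\<le>2. to_ac (c i) * w i)"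
    using u by (simp add: sum_distrib_left w_def power_diff power_divide field_simps)
  also have "\<dots> = (\<Sum>i\<le>2. \<Sum>b\<in>B. to_ac (c i * r i b) * b)"
    by (intro sum.cong refl) (simp add: r sum_distrib_left mult.assoc)
  also have "\<dots> = (\<Sum>b\<in>B. to_ac (\<Sum>i\<le>2. c i * r i b) * b)"
    by (subst sum.swap) (simp add: to_ac_sum sum_distrib_right)
  also have "\<dots> = 0" by (simp add: c(3))
  finally have "poly (map_poly to_ac p) (v / u) = 0" using u by simp
  moreover have "degree p \<le> 2" using c(1) by (intro degree_le) (simp add: cp)
  moreover have "p \<noteq> 0" using c(2) cp by (metis coeff_0)
  ultimately show ?thesis using that by blast
qed


text \<open>Outside \<open>k\<close> the monic multiple \<open>M\<close> of \<open>p\<close> is the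
  minimal polynomial of \<open>z\<close>; it divides \<open>G\<close>, so its second root is a root
  of \<open>G\<close> too. If \<open>z\<close> lies in \<open>k\<close>, then \<open>z\<close>
  itself serves as its own conjugate.\<close>

lemma quadratic_root_conjugate:
  fixes G p :: "'k::field poly"
  assumes p: "p \<noteq> 0" "degree p \<le> 2" "poly (map_poly to_ac p) z = 0" and G: "poly (map_poly to_ac G) z = 0"
  obtains z' where "poly (map_poly to_ac G) z' = 0" "z + z' \<in> range to_ac" "z * z' \<in> range to_ac"
proof (cases "z \<in> range to_ac")
  case True
  then obtain a where "z = to_ac a" by blast
  then have "z + z = to_ac (a + a)" "z * z = to_ac (a * a)" by simp_all
  then show ?thesis using that[of z] G by blast
next
  case False
  have linear: "q = 0" if q: "degree q \<le> 1" "poly (map_poly to_ac q) z = 0" for q :: "'k poly"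
  proof -
    have "q = [:coeff q 0, coeff q 1:]"
      using q(1) by (intro poly_eqI) (auto simp: coeff_pCons coeff_eq_0 split: nat.splits)
    then obtain a b where ab: "q = [:a, b:]" by blast
    then have "to_ac a + to_ac b * z = 0" using q(2) by (simp add: map_poly_pCons mult.commute)
    moreover have "b = 0"
    proof (rule ccontr)
      assume "b \<noteq> 0"
      then have "z = to_ac (- a / b)" using calculation by (simp add: field_simps add_eq_0_iff)
      then show False using False by blast
    qed
    ultimately show ?thesis by (simp add: ab)
  qed
  have "degree p = 2" using linear[of p] p by force
  define s n where "s = - coeff p 1 / coeff p 2" and "n = coeff p 0 / coeff p 2"
  define M where "M = [:n, - s, 1:]"
  have p2: "coeff p 2 \<noteq> 0" using \<open>degree p = 2\<close> p(1) by (metis leading_coeff_0_iff)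
  have pM: "p = smult (coeff p 2) M"
  proof (rule poly_eqI)
    fix i :: nat
    consider "i = 0" | "i = 1" | "i = 2" | "i > 2" by linarith
    then show "coeff p i = coeff (smult (coeff p 2) M) i"
      using p2 \<open>degree p = 2\<close> by cases (auto simp: M_def s_def n_def coeff_pCons numeral_2_eq_2 coeff_eq_0 split: nat.splits)
  qed
  have h_mult: "poly (map_poly to_ac (a * b)) x = poly (map_poly to_ac a) x * poly (map_poly to_ac b) x" for a b and x :: "'k alg_closure"
    by (simp only: is_hom_simps(3)[OF is_hom_map_poly[OF is_hom_to_ac]] poly_mult)
  have h_diff: "poly (map_poly to_ac (a - b)) x = poly (map_poly to_ac a) x - poly (map_poly to_ac b) x" for a b and x :: "'k alg_closure"
    by (simp only: is_hom_simps(6)[OF is_hom_map_poly[OF is_hom_to_ac]] poly_diff)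
  have "poly (map_poly to_ac ([:coeff p 2:] * M)) z = 0" using p(3) pM by simp
  then have "to_ac (coeff p 2) * poly (map_poly to_ac M) z = 0"
    unfolding h_mult by (simp add: map_poly_pCons)
  then have Mz: "poly (map_poly to_ac M) z = 0" using p2 by simp
  have M: "poly (map_poly to_ac M) x = to_ac n - to_ac s * x + x * x" for x
    by (simp add: M_def map_poly_pCons algebra_simps)
  define z' where "z' = to_ac s - z"
  have "z * z' = to_ac n" using Mz by (simp add: M z'_def algebra_simps)
  have Mz': "poly (map_poly to_ac M) z' = 0"
  proof -
    have "poly (map_poly to_ac M) z' = poly (map_poly to_ac M) z" by (simp add: M z'_def algebra_simps)
    then show ?thesis by (simp add: Mz)
  qed
  have "poly (map_poly to_ac (G mod M)) z = 0"
    using G Mz by (simp add: minus_div_mult_eq_mod[symmetric] h_diff h_mult)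
  moreover have "degree (G mod M) \<le> 1"
    using degree_mod_less[of M G] by (auto simp: M_def)
  ultimately have "G mod M = 0" by (intro linear)
  then have "G = M * (G div M)" by (metis dvd_mult_div_cancel dvd_eq_mod_eq_0)
  then have "poly (map_poly to_ac G) z' = 0" using h_mult[of M "G div M" z'] Mz' by simp
  then show ?thesis using that[of z'] \<open>z * z' = to_ac n\<close> by (simp add: z'_def)
qed

lemma hpoint_coordinates:
  assumes "v \<in> (x : 1 : z)\<^sub>P"
  obtains u where "u \<noteq> 0" "v = (u * x, u, u * z)"
  using assms by (auto simp: hpoint_def proportional_def)

lemma quadratic_point_conjugate:
  fixes F :: "'k::field_char_0 poly3"
  assumes F: "homogeneous 4 F" and P: "(to_ac x : 1 : z)\<^sub>P \<in> quadratic_points F"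
  obtains z' where "eval_ac F (to_ac x, 1, z) = 0" "eval_ac F (to_ac x, 1, z') = 0"
    "z + z' \<in> range to_ac" "z * z' \<in> range to_ac"
proof -
  obtain L v w where L: "quadratic_extension L" and v: "v \<in> (to_ac x : 1 : z)\<^sub>P" "v \<in> L \<times> L \<times> L"
    and w: "w \<in> (to_ac x : 1 : z)\<^sub>P" "eval_ac F w = 0"
    using P by (auto simp: quadratic_points_def rational_points_def curve_def)
  obtain a where a: "a \<noteq> 0" "w = (a * to_ac x, a * 1, a * z)" using hpoint_coordinates[OF w(1)] by (metis mult_1_right)
  have root: "eval_ac F (to_ac x, 1, z) = 0"
    using w(2) a(1) unfolding a(2) eval_ac_scale[OF F] by simp
  obtain u where u: "u \<noteq> 0" "v = (u * to_ac x, u, u * z)" using hpoint_coordinates[OF v(1)] by blast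
  then have "u \<in> L" "u * z \<in> L" using v(2) by auto
  from quadratic_extension_relation[OF L this u(1)] obtain p
    where p: "p \<noteq> 0" "degree p \<le> 2" "poly (map_poly to_ac p) z = 0" using u(1) by auto
  \<comment> \<open>The equation of the fibre over \<open>x\<close>. Its coefficients are in
    \<open>k\<close>, which is why the conjugate ordinate satisfies it as well.\<close>
  define G where "G = eval3 (\<lambda>c. [:c:]) F [:x:] 1 [:0, 1:]"
  have hom: "is_hom (\<lambda>q. poly (map_poly to_ac q) y)" for y :: "'k alg_closure"
    using is_hom_comp[OF is_hom_poly is_hom_map_poly[OF is_hom_to_ac]] .
  have G: "poly (map_poly to_ac G) y = eval_ac F (to_ac x, 1, y)" for y
    unfolding G_def eval_ac_eq_eval3 using eval3_hom[OF hom[of y], of "\<lambda>c. [:c:]" F] by (simp add: map_poly_pCons)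
  show ?thesis
    by (rule quadratic_root_conjugate[OF p, of G]) (use that root in \<open>auto simp: G\<close>)
qed

text \<open>An infinite fibre would mean that the curve contains the line of points
  \<open>(x, 1, z)\<close>, a nonconstant polynomial parametrization.\<close>

lemma finite_fibre:
  fixes F :: "'k::field_char_0 poly3"
  assumes F: "homogeneous 4 F" "smooth_curve F"
  shows "finite {z. eval_ac F (x, 1, z) = 0}"
proof -
  define G where "G = eval3 const_ac F [:x:] 1 [:0, 1:]"
  have "G \<noteq> 0"
  proof
    assume "G = 0"
    then have "1 * pderiv [:0, 1 :: 'k alg_closure:] = [:0, 1:] * pderiv 1"
      unfolding G_def by (rule no_parametrization(2)[OF F])
    then show False by (simp add: pderiv_pCons)
  qed
  moreover have "poly G z = eval_ac F (x, 1, z)" for z by (simp add: G_def poly_eval3)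
  ultimately show ?thesis using poly_roots_finite[of G] by simp
qed

section \<open>Progressions\<close>

lemma no_infinite_power_sequence:
  fixes F :: "'k::field_char_0 poly3"
  assumes k: "number_field TYPE('k)" and F: "homogeneous 4 F" "smooth_curve F"
    and t: "inj (\<lambda>i::nat. t ^ i)" "t \<noteq> 0" and t': "t' \<noteq> 0"
    and points: "\<And>i::nat. i \<ge> 1 \<Longrightarrow> \<exists>z. (to_ac (c + t' * t ^ i) : 1 : z)\<^sub>P \<in> quadratic_points F"
  shows False
proof -
  obtain n where n: "degree_bounded n (range (to_ac :: 'k \<Rightarrow> _))" using degree_bounded_range_to_ac[OF k] by blast
  have "\<exists>z z'. eval_ac F (to_ac (c + t' * t ^ i), 1, z) = 0 \<and> eval_ac F (to_ac (c + t' * t ^ i), 1, z') = 0 \<and>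
      z + z' \<in> range to_ac \<and> z * z' \<in> range to_ac" if i: "i \<ge> 1" for i :: nat
  proof -
    obtain z where z: "(to_ac (c + t' * t ^ i) : 1 : z)\<^sub>P \<in> quadratic_points F" using points[OF i] by blast
    show ?thesis using quadratic_point_conjugate[OF F(1) z] by metis
  qed
  then obtain z z' where z: "\<And>i. i \<ge> 1 \<Longrightarrow> eval_ac F (to_ac (c + t' * t ^ i), 1, z i) = 0"
    "\<And>i. i \<ge> 1 \<Longrightarrow> eval_ac F (to_ac (c + t' * t ^ i), 1, z' i) = 0"
    "\<And>i. i \<ge> 1 \<Longrightarrow> z i + z' i \<in> range to_ac" "\<And>i. i \<ge> 1 \<Longrightarrow> z i * z' i \<in> range to_ac" by metis
  show False
  proof (rule model_polynomial[OF F, of c])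
    fix N u P assume N: "N \<noteq> 0" "\<And>x. poly N (to_ac x) \<in> range to_ac" and u: "\<And>x. poly N x \<noteq> 0 \<Longrightarrow> poly u x \<noteq> 0"
      and P: "lead_coeff P = 1"
      and model: "\<And>x z. eval_ac F ((x + to_ac c) * poly N x, poly N x, z) = poly u x * poly (poly P [:z:]) x"
      and nofactor: "\<And>e a. e > 0 \<Longrightarrow> \<not> [:a, 1:] dvd expand e P" "\<And>e a b. e > 0 \<Longrightarrow> \<not> [:b, a, 1:] dvd expand e P"
    define \<xi> where "\<xi> = (\<lambda>i. to_ac (t' * t ^ i))"
    have "inj \<xi>" using t(1) t' by (auto simp: inj_on_def \<xi>_def simp del: to_ac_mult to_ac_power)
    have "finite {i. poly N (\<xi> i) = 0}"
      using finite_vimageI[OF poly_roots_finite[OF N(1)] \<open>inj \<xi>\<close>] by (simp add: vimage_def)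
    then obtain m where m: "\<And>i. poly N (\<xi> i) = 0 \<Longrightarrow> i < m"
      by (metis (mono_tags, lifting) finite_nat_set_iff_bounded mem_Collect_eq)
    \<comment> \<open>The sequence is restarted beyond the finitely many zeros of \<open>N\<close>;
      the successor also ensures that all indices are at least 1, where points are given.\<close>
    define m' where "m' = Suc m"
    have N0: "poly N (\<xi> (m' + i)) \<noteq> 0" for i using m[of "m' + i"] by (auto simp: m'_def)
    have root: "poly (poly P [:poly N (\<xi> i) * w:]) (\<xi> i) = 0"
      if "poly N (\<xi> i) \<noteq> 0" "eval_ac F (to_ac (c + t' * t ^ i), 1, w) = 0" for i w
    proof -
      have "poly u (\<xi> i) * poly (poly P [:poly N (\<xi> i) * w:]) (\<xi> i) =
          eval_ac F (poly N (\<xi> i) * (\<xi> i + to_ac c), poly N (\<xi> i) * 1, poly N (\<xi> i) * w)"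
        using model[of "\<xi> i" "poly N (\<xi> i) * w"] by (simp add: mult.commute)
      also have "\<dots> = 0"
        unfolding eval_ac_scale[OF F(1)] using that(2) by (simp add: \<xi>_def add.commute)
      finally show ?thesis using u[OF that(1)] by simp
    qed
    \<comment> \<open>Multiplication by values of \<open>N\<close>, which lie in \<open>k\<close>,
      carries the ordinates to the monic model while keeping their sums and products in
      \<open>k\<close>.\<close>
    define y y' where "y = (\<lambda>i. poly N (\<xi> (m' + i)) * z (m' + i))" and "y' = (\<lambda>i. poly N (\<xi> (m' + i)) * z' (m' + i))"
    have \<xi>: "\<xi> (m' + i) = to_ac (t' * t ^ m' * t ^ i)" for i by (simp add: \<xi>_def power_add mult.assoc)
    have ge: "m' + i \<ge> 1" for i by (simp add: m'_def)
    have range: "r * s \<in> range to_ac" if rs: "r \<in> range to_ac" "s \<in> range to_ac" for r s :: "'k alg_closure"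
    proof -
      obtain a b where "r = to_ac a" "s = to_ac b" using rs by blast
      then have "r * s = to_ac (a * b)" by simp
      then show ?thesis by blast
    qed
    have NX: "poly N (\<xi> i) \<in> range to_ac" for i unfolding \<xi>_def by (rule N(2))
    have "y i + y' i \<in> range to_ac" for i
      using range[OF NX[of "m' + i"] z(3)[OF ge[of i]]] by (simp add: y_def y'_def algebra_simps)
    moreover have "y i * y' i \<in> range to_ac" for i
      using range[OF range[OF NX[of "m' + i"] NX[of "m' + i"]] z(4)[OF ge[of i]]] by (simp add: y_def y'_def ac_simps)
    moreover have "poly (poly P [:y i:]) (to_ac (t' * t ^ m' * t ^ i)) = 0" "poly (poly P [:y' i:]) (to_ac (t' * t ^ m' * t ^ i)) = 0" for i
      unfolding y_def y'_def \<xi>[symmetric] using root[OF N0 z(1)[OF ge]] root[OF N0 z(2)[OF ge]] by blast+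
    moreover have "t' * t ^ m' \<noteq> 0" using t' t(2) by simp
    ultimately have "\<exists>e>0. (\<exists>a. [:a, 1:] dvd expand e P) \<or> (\<exists>a b. [:b, a, 1:] dvd expand e P)"
      by (intro algebraic_factor[OF alg_closure_algebraic_over_rationals[OF k] is_hom_to_ac n t _ P])
    then show False using nofactor by blast
  qed
qed

theorem theorem4p5:
  fixes F :: "'k::field_char_0 poly3"
  assumes "number_field TYPE('k)"
    and "homogeneous 4 F"
    and "smooth_curve F"
  shows "(\<forall>N P. quadratic_geometric_progression F N P \<longrightarrow> finite_length N P) \<and>
         (\<forall>N P. quadratic_arithmetic_progression F N P \<longrightarrow> finite_length N P)"
proof (intro conjI allI impI)
  fix N P assume prog: "quadratic_geometric_progression F N P"
  show "finite_length N P"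
  proof
    assume inf: "infinite_progression N P"
    then have indices: "i \<in> seq_indices N \<longleftrightarrow> i \<ge> 1" for i
      by (auto simp: infinite_progression_def seq_indices_def)
    obtain x z where xz: "\<forall>i\<in>seq_indices N. P i = (to_ac (x i) : 1 : z i)\<^sub>P \<and> P i \<in> quadratic_points F"
      and "\<exists>t t'. t \<noteq> 0 \<and> t' \<noteq> 0 \<and> (\<forall>i\<in>seq_indices N. x i = t' * t ^ i)"
      using prog unfolding quadratic_geometric_progression_def by (elim exE, elim conjE) rule
    then obtain t t' where t: "t \<noteq> 0" "t' \<noteq> 0" "\<And>i. i \<ge> 1 \<Longrightarrow> x i = t' * t ^ i"
      using indices by blast
    have xz: "P i = (to_ac (x i) : 1 : z i)\<^sub>P" "P i \<in> quadratic_points F" if "i \<ge> 1" for i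
      using xz indices that by blast+
    show False
    proof (cases "inj (\<lambda>i::nat. t ^ i)")
      case True
      have "\<exists>z. (to_ac (0 + t' * t ^ i) : 1 : z)\<^sub>P \<in> quadratic_points F" if "i \<ge> 1" for i
        using xz[OF that] t(3)[OF that] by (metis add_0)
      then show False
        using no_infinite_power_sequence[OF assms True t(1,2), of 0] by blast
    next
      case False
      then obtain a b :: nat where "t ^ a = t ^ b" "a < b" by (metis injI linorder_neqE_nat)
      moreover from \<open>a < b\<close> have "t ^ a * t ^ (b - a) = t ^ b" by (simp flip: power_add)
      ultimately have "t ^ a * t ^ (b - a) = t ^ a * 1" by simp
      then have unity: "t ^ (b - a) = 1" using t(1) by simp
      have "t ^ i \<in> (\<lambda>j. t ^ j) ` {..<b - a}" for i
      proof -
        have "t ^ i = t ^ (i mod (b - a))"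
          by (metis div_mult_mod_eq mult.left_neutral power_add power_mult power_one mult.commute unity)
        then show ?thesis using \<open>a < b\<close> by force
      qed
      then have fin: "finite (range (\<lambda>i. t ^ i))" by (meson finite_imageI finite_lessThan finite_subset image_subsetI)
      define S where "S = (SIGMA s:range (\<lambda>i. t ^ i). {w. eval_ac F (to_ac (t' * s), 1, w) = 0})"
      have "finite S" unfolding S_def using fin finite_fibre[OF assms(2,3)] by blast
      have "P i \<in> (\<lambda>(s, w). (to_ac (t' * s) : 1 : w)\<^sub>P) ` S" if i: "i \<ge> 1" for i
      proof -
        have eq: "P i = (to_ac (t' * t ^ i) : 1 : z i)\<^sub>P" using xz[OF i] t(3)[OF i] by simp
        have "(to_ac (t' * t ^ i) : 1 : z i)\<^sub>P \<in> quadratic_points F" using xz[OF i] eq by simp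
        then have "eval_ac F (to_ac (t' * t ^ i), 1, z i) = 0" using quadratic_point_conjugate[OF assms(2)] by blast
        then have "(t ^ i, z i) \<in> S" by (simp add: S_def)
        then show ?thesis using eq by force
      qed
      then have "P ` seq_indices N \<subseteq> (\<lambda>(s, w). (to_ac (t' * s) : 1 : w)\<^sub>P) ` S" using indices by blast
      then have "finite (P ` seq_indices N)" using \<open>finite S\<close> by (meson finite_imageI finite_subset)
      then show False using inf by (simp add: infinite_progression_def)
    qed
  qed
next
  fix N P assume prog: "quadratic_arithmetic_progression F N P"
  show "finite_length N P"
  proof
    assume inf: "infinite_progression N P"
    then have indices: "i \<in> seq_indices N \<longleftrightarrow> i \<ge> 1" for i
      by (auto simp: infinite_progression_def seq_indices_def)
    obtain x z where xz: "\<forall>i\<in>seq_indices N. P i = (to_ac (x i) : 1 : z i)\<^sub>P \<and> P i \<in> quadratic_points F"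
      and "\<exists>t t'. t \<noteq> 0 \<and> t' \<noteq> 0 \<and> (\<forall>i\<in>seq_indices N. x i = t' + of_nat i * t)"
      using prog unfolding quadratic_arithmetic_progression_def by (elim exE, elim conjE) rule
    then obtain t t' where t: "t \<noteq> 0" "t' \<noteq> 0" "\<And>i. i \<ge> 1 \<Longrightarrow> x i = t' + of_nat i * t"
      using indices by blast
    have xz: "P i = (to_ac (x i) : 1 : z i)\<^sub>P" "P i \<in> quadratic_points F" if "i \<ge> 1" for i
      using xz indices that by blast+
    have "\<exists>z. (to_ac (t' + t * 2 ^ i) : 1 : z)\<^sub>P \<in> quadratic_points F" for i :: nat
    proof -
      have "(2 :: nat) ^ i \<ge> 1" by simp
      from xz[OF this] t(3)[OF this] show ?thesis by (metis mult.commute of_nat_numeral of_nat_power)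
    qed
    moreover have "inj (\<lambda>i::nat. (2 :: 'k) ^ i)"
    proof (rule injI)
      fix i j :: nat assume "(2 :: 'k) ^ i = 2 ^ j"
      then have "(of_nat (2 ^ i) :: 'k) = of_nat (2 ^ j)" by simp
      then show "i = j" unfolding of_nat_eq_iff by simp
    qed
    ultimately show False
      using no_infinite_power_sequence[OF assms, of 2 t t'] t(1) by simp
  qed
qed

end
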